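(* Let $X$ be the $m$-symmetric Hunt process on $S$ described in the context (regular Dirichlet form, absolute continuity condition (AC), extended transition density $p$). Let $k\in\mathbb{N}$, and for each $i\in\{1,2,\ldots,k\}$ let $A^{(i)}=(A^{(i)}_t)_{t\ge0}$ be a PCAF in the strict sense of $X$ and let $\mu_i$ be the Revuz measure of $A^{(i)}$. Then, for any $t\in(0,\infty]$, $x\in S$, and Borel measurable function $f\colon S_\Delta\to[0,\infty]$, $$\begin{aligned}E_x\Biggl[f(X_t)\prod_{i=1}^kA^{(i)}_t\Biggr]=\sum_{\pi\in\mathfrak{S}_k}&\int_0^tdt_1\int_{t_1}^tdt_2\cdots\int_{t_{k-1}}^tdt_k\int_S\mu_{\pi_1}(dy_1)\int_S\mu_{\pi_2}(dy_2)\cdots\int_S\mu_{\pi_k}(dy_k)\int_{S_\Delta}m_\Delta(dz)\\&\;p_{t_1}(x,y_1)\,p_{t_2-t_1}(y_1,y_2)\cdots p_{t_k-t_{k-1}}(y_{k-1},y_k)\,p_{t-t_k}(y_k,z)\,f(z),\end{aligned}$$ where $\mathfrak{S}_k$ denotes the set of all bijections $\pi=(\pi_i)_{i=1}^k$ from $\{1,2,\ldots,k\}$ to itself.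
   Context: Setting. $S$ is a locally compact separable metrizable topological space, and $S_\Delta=S\cup\{\Delta\}$ is its one-point compactification ($\Delta$ is added as an isolated point if $S$ is compact). $\mathbb{N}$ is the set of positive integers. $\mathcal{B}(E)$ denotes the Borel $\sigma$-algebra of a topological space $E$, and $1_E$ an indicator function. $m$ is a Radon measure on $S$ with full support, $(\mathcal{E},\mathcal{F})$ is a regular symmetric Dirichlet form on $L^2(S,m)$, and $X=(\Omega,\mathscr{M},(X_t)_{t\in[0,\infty]},(P_x)_{x\in S_\Delta},(\theta_t)_{t\in[0,\infty]})$ is an $m$-symmetric Hunt process on $S$ with cemetery $\Delta$ (and $X_\infty=\Delta$) whose Dirichlet form is $(\mathcal{E},\mathcal{F})$. Here $\theta_t\colon\Omega\to\Omega$ is the shift operator, satisfying $X_s\circ\theta_t=X_{s+t}$ for all $s\in[0,\infty]$. $E_x$ is expectation under $P_x$. The life time $\zeta\colon\Omega\to[0,\infty]$ satisfies $\{X_t=\Delta\}=\{\zeta\le t\}$ for each $t\in[0,\infty]$. $\mathscr{F}_*=(\mathscr{F}_t)_{t\in[0,\infty]}$ is the minimum augmented admissible filtration of $X$: with $\mathscr{F}^0_t:=\sigma(X_s: s\le t)$, for each probability measure $\nu$ on $S_\Delta$ let $\mathscr{F}^\nu_\infty$ be the $P_\nu$-completion of $\mathscr{F}^0_\infty$ and $\mathscr{F}^\nu_t$ the $\sigma$-algebra generated by $\mathscr{F}^0_t$ and the $P_\nu$-null sets of $\mathscr{F}^\nu_\infty$; then $\mathscr{F}_t:=\bigcap_\nu\mathscr{F}^\nu_t$.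 Absolute continuity condition (AC) (assumed): for all $x\in S$ and $t\in(0,\infty)$, the Borel measure $P_x(X_t\in dy)$ on $S$ is absolutely continuous with respect to $m(dy)$. Transition density. Under these assumptions there is a unique Borel measurable $p\colon(0,\infty)\times S\times S\to[0,\infty]$ such that, for all $s,t\in(0,\infty)$ and $x,y\in S$, $P_x(X_t\in dz)=p_t(x,z)\,m(dz)$ on $S$, $p_t(x,y)=p_t(y,x)$ and $p_{t+s}(x,y)=\int_S p_t(x,z)p_s(z,y)\,m(dz)$. It is extended to $(0,\infty]\times S\times S_\Delta$ by $p_t(x,\Delta):=1-\int_Sp_t(x,y)\,m(dy)=P_x(X_t=\Delta)$ for $t\in(0,\infty)$, $x\in S$, and $p_\infty(x,y):=1_{\{\Delta\}}(y)$ for $x\in S$, $y\in S_\Delta$. The measure $m$ is extended to the Borel measure $m_\Delta:=m(\cdot\cap S)+\delta_\Delta$ on $S_\Delta$, with $\delta_\Delta$ the unit point mass at $\Delta$. PCAF in the strict sense. An $\mathscr{F}_*$-adapted $[0,\infty]$-valued process $A=(A_t)_{t\ge0}$ on $\Omega$ is a positive continuous additive functional (PCAF) in the strict sense of $X$ if there is a set $\Lambda\in\mathscr{F}_\infty$ (a defining set of $A$) such that $P_x(\Lambda)=1$ for all $x\in S$, $\theta_t(\Lambda)\subseteq\Lambda$ for all $t\in[0,\infty)$, and for every $\omega\in\Lambda$ the map $[0,\infty)\ni t\mapsto A_t(\omega)\in[0,\infty]$ is continuous with $A_0(\omega)=0$ and, for all $s,t\in[0,\infty)$, $A_t(\omega)<\infty$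 if $t<\zeta(\omega)$, $A_t(\omega)=A_{\zeta(\omega)}(\omega)$ if $t\ge\zeta(\omega)$, and $A_{t+s}(\omega)=A_t(\omega)+A_s(\theta_t(\omega))$. Set $A_\infty:=\sup_{t\in[0,\infty)\cap\mathbb{Q}}A_t$. Standing convention: every PCAF in the strict sense with defining set $\Lambda$ satisfies $A_t(\omega)=0$ for all $t\in[0,\infty)$, $\omega\in\Omega\setminus\Lambda$, and $\{\zeta=0\}\subseteq\Lambda$. Revuz measure. The Revuz measure of $A$ is the Borel measure $\mu$ on $S$ given, for $E\in\mathcal{B}(S)$, by $$\mu(E):=\sup_{t\in(0,\infty)}\frac1t\int_S E_x\Bigl[\int_0^t1_E(X_s)\,dA_s\Bigr]m(dx)=\lim_{t\downarrow0}\frac1t\int_S E_x\Bigl[\int_0^t1_E(X_s)\,dA_s\Bigr]m(dx),$$ where $\int_0^t\cdots dA_s$ is a Lebesgue--Stieltjes integral (the measure $dA_s$ has no atoms and is carried by $(0,\zeta)$). *)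

theory Defs
  imports "HOL-Probability.Probability"
begin

text \<open>
  The state space is a type \<open>'s\<close> of class \<open>{metric_space, second_countable_topology}\<close>, assumed locally
  compact where it matters; nothing below depends on the metric, only on its topology. The point
  at infinity of the one-point compactification is \<open>None\<close>. Times in $[0,\infty]$ have type
  \<^typ>\<open>ennreal\<close>.
\<close>

abbreviation (input) compactified :: "'s::topological_space option topology"
  where "compactified \<equiv> Alexandroff_compactification euclidean"

definition borel_cpt :: "'s::topological_space option measure"
  where "borel_cpt = sigma UNIV {U. openin compactified U}"

text \<open>On a locally compact separable metrizable space, finiteness on compact sets already
  implies the regularity properties of a Radon measure.\<close>

definition radon_full_support :: "'s::topological_space measure \<Rightarrow> bool"
  where "radon_full_support m \<longleftrightarrow>
    sets m = sets borel \<and>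
    (\<forall>K. compact K \<longrightarrow> emeasure m K < \<infinity>) \<and>
    (\<forall>U. open U \<and> U \<noteq> {} \<longrightarrow> emeasure m U > 0)"


section \<open>Regular symmetric Dirichlet forms\<close>

text \<open>Elements of $L^2(S,m)$ are represented by Borel functions; a form is accordingly required to
  respect equality almost everywhere.\<close>

definition L2 :: "'s::topological_space measure \<Rightarrow> ('s \<Rightarrow> real) set"
  where "L2 m = {u \<in> borel_measurable m. integrable m (\<lambda>x. (u x)\<^sup>2)}"

definition L2_inner :: "'s::topological_space measure \<Rightarrow> ('s \<Rightarrow> real) \<Rightarrow> ('s \<Rightarrow> real) \<Rightarrow> real"
  where "L2_inner m u v = (\<integral>x. u x * v x \<partial>m)"

text \<open>The quadratic form of $\mathcal{E}_1 = \mathcal{E} + \langle\cdot,\cdot\rangle_{L^2}$.\<close>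

definition form1 ::
    "'s::topological_space measure \<Rightarrow> (('s \<Rightarrow> real) \<Rightarrow> ('s \<Rightarrow> real) \<Rightarrow> real) \<Rightarrow> ('s \<Rightarrow> real) \<Rightarrow> real"
  where "form1 m \<E> u = \<E> u u + L2_inner m u u"

definition symmetric_dirichlet_form ::
    "'s::topological_space measure \<Rightarrow> (('s \<Rightarrow> real) \<Rightarrow> ('s \<Rightarrow> real) \<Rightarrow> real) \<Rightarrow> ('s \<Rightarrow> real) set \<Rightarrow> bool"
  where "symmetric_dirichlet_form m \<E> \<F> \<longleftrightarrow>
    \<comment> \<open>a dense linear subspace of $L^2(S,m)$\<close>
    \<F> \<subseteq> L2 m \<and> (\<lambda>x. 0) \<in> \<F> \<and>
    (\<forall>u\<in>\<F>. \<forall>v\<in>\<F>. (\<lambda>x. u x + v x) \<in> \<F>) \<and>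
    (\<forall>c. \<forall>u\<in>\<F>. (\<lambda>x. c * u x) \<in> \<F>) \<and>
    (\<forall>u\<in>\<F>. \<forall>v\<in>borel_measurable m. (AE x in m. u x = v x) \<longrightarrow> v \<in> \<F>) \<and>
    (\<forall>u\<in>L2 m. \<forall>\<epsilon>>0. \<exists>v\<in>\<F>. L2_inner m (\<lambda>x. u x - v x) (\<lambda>x. u x - v x) < \<epsilon>) \<and>
    \<comment> \<open>a nonnegative definite symmetric bilinear form\<close>
    (\<forall>u\<in>\<F>. \<forall>v\<in>\<F>. \<E> u v = \<E> v u) \<and>
    (\<forall>u\<in>\<F>. \<forall>v\<in>\<F>. \<forall>w\<in>\<F>. \<E> (\<lambda>x. u x + v x) w = \<E> u w + \<E> v w) \<and>
    (\<forall>c. \<forall>u\<in>\<F>. \<forall>v\<in>\<F>. \<E> (\<lambda>x. c * u x) v = c * \<E> u v) \<and>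
    (\<forall>u\<in>\<F>. \<E> u u \<ge> 0) \<and>
    (\<forall>u\<in>\<F>. \<forall>v\<in>\<F>. \<forall>w\<in>\<F>. (AE x in m. u x = v x) \<longrightarrow> \<E> u w = \<E> v w) \<and>
    \<comment> \<open>closed\<close>
    (\<forall>u::nat \<Rightarrow> 's \<Rightarrow> real. (\<forall>n. u n \<in> \<F>) \<and>
        (\<forall>\<epsilon>>0. \<exists>N. \<forall>i\<ge>N. \<forall>j\<ge>N. form1 m \<E> (\<lambda>x. u i x - u j x) < \<epsilon>) \<longrightarrow>
        (\<exists>v\<in>\<F>. (\<lambda>n. form1 m \<E> (\<lambda>x. u n x - v x)) \<longlonglongrightarrow> 0)) \<and>
    \<comment> \<open>Markovian\<close>
    (\<forall>u\<in>\<F>. (\<lambda>x. min (max (u x) 0) 1) \<in> \<F> \<and>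
        \<E> (\<lambda>x. min (max (u x) 0) 1) (\<lambda>x. min (max (u x) 0) 1) \<le> \<E> u u)"

definition Cc :: "('s::topological_space \<Rightarrow> real) set"
  where "Cc = {g. continuous_on UNIV g \<and> compact (closure {x. g x \<noteq> 0})}"

definition regular_form ::
    "'s::topological_space measure \<Rightarrow> (('s \<Rightarrow> real) \<Rightarrow> ('s \<Rightarrow> real) \<Rightarrow> real) \<Rightarrow> ('s \<Rightarrow> real) set \<Rightarrow> bool"
  where "regular_form m \<E> \<F> \<longleftrightarrow>
    (\<forall>u\<in>\<F>. \<forall>\<epsilon>>0. \<exists>v\<in>\<F> \<inter> Cc. form1 m \<E> (\<lambda>x. u x - v x) < \<epsilon>) \<and>
    (\<forall>g\<in>Cc. \<forall>\<epsilon>>0. \<exists>v\<in>\<F> \<inter> Cc. \<forall>x. \<bar>g x - v x\<bar> < \<epsilon>)"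


section \<open>Hunt processes\<close>

text \<open>\<open>Events\<close> is $(\Omega,\mathscr{M})$ (only its space and its $\sigma$-algebra are used), \<open>Law x\<close> is $P_x$.\<close>

record ('w, 's) process =
  Events :: "'w measure"
  State :: "ennreal \<Rightarrow> 'w \<Rightarrow> 's option"
  Law :: "'s option \<Rightarrow> 'w measure"
  Shift :: "ennreal \<Rightarrow> 'w \<Rightarrow> 'w"

abbreviation Omega :: "('w, 's) process \<Rightarrow> 'w set"
  where "Omega X \<equiv> space (Events X)"

definition life_time :: "('w, 's) process \<Rightarrow> 'w \<Rightarrow> ennreal"
  where "life_time X \<omega> = Inf {t. State X t \<omega> = None}"

text \<open>$\mathscr{F}^0_t$\<close>

definition natural_filtration :: "('w, 's::topological_space) process \<Rightarrow> ennreal \<Rightarrow> 'w measure"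
  where "natural_filtration X t =
    sigma (Omega X) {State X s -` B \<inter> Omega X | s B. s \<le> t \<and> B \<in> sets borel_cpt}"

definition initial_dists :: "'s::topological_space option measure set"
  where "initial_dists = {\<nu>. prob_space \<nu> \<and> sets \<nu> = sets borel_cpt}"

text \<open>The $P_\nu$-completion of $\mathscr{F}^0_\infty$, with the measure $P_\nu = \int P_x\,\nu(dx)$ on it.\<close>

definition law_from :: "('w, 's::topological_space) process \<Rightarrow> 's option measure \<Rightarrow> 'w measure"
  where "law_from X \<nu> = completion (measure_of (Omega X) (sets (natural_filtration X \<infinity>))
    (\<lambda>\<Gamma>. \<integral>\<^sup>+x. emeasure (Law X x) \<Gamma> \<partial>\<nu>))"

text \<open>The case $\nu = \delta_x$ of the above: $P_x$ on the $P_x$-completion of $\mathscr{F}^0_\infty$.\<close>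

definition law_at :: "('w, 's::topological_space) process \<Rightarrow> 's option \<Rightarrow> 'w measure"
  where "law_at X x = completion (restr_to_subalg (Law X x) (natural_filtration X \<infinity>))"

text \<open>$\mathscr{F}^\nu_t$ and $\mathscr{F}_t$\<close>

definition filtration_from ::
    "('w, 's::topological_space) process \<Rightarrow> 's option measure \<Rightarrow> ennreal \<Rightarrow> 'w measure"
  where "filtration_from X \<nu> t =
    sigma (Omega X) (sets (natural_filtration X t) \<union> null_sets (law_from X \<nu>))"

definition augmented_filtration :: "('w, 's::topological_space) process \<Rightarrow> ennreal \<Rightarrow> 'w measure"
  where "augmented_filtration X t =
    sigma (Omega X) (\<Inter>\<nu>\<in>initial_dists. sets (filtration_from X \<nu> t))"

text \<open>
  The strong Markov property states that $P_{X_\sigma}(X_s \in B)$ is a version of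
  $P_\nu(X_{\sigma+s} \in B \mid \mathscr{F}_\sigma)$; constant stopping times give the simple Markov property.
  The convention $X_\infty = \Delta$ and the fact that $\Delta$ is a trap follow from the condition
  on the life time.
\<close>

definition hunt_process :: "('w, 's::topological_space) process \<Rightarrow> bool"
  where "hunt_process X \<longleftrightarrow>
    (\<forall>x. prob_space (Law X x) \<and> space (Law X x) = Omega X \<and> sets (Law X x) = sets (Events X)) \<and>
    (\<forall>t. State X t \<in> Events X \<rightarrow>\<^sub>M borel_cpt) \<and>
    (\<forall>t. \<forall>B\<in>sets borel_cpt.
        (\<lambda>x. emeasure (Law X x) {\<omega>\<in>Omega X. State X t \<omega> \<in> B}) \<in> borel_measurable borel_cpt) \<and>
    \<comment> \<open>normality\<close>
    (\<forall>x. emeasure (Law X x) {\<omega>\<in>Omega X. State X 0 \<omega> = x} = 1) \<and>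
    \<comment> \<open>life time and shifts\<close>
    (\<forall>t. \<forall>\<omega>\<in>Omega X. State X t \<omega> = None \<longleftrightarrow> life_time X \<omega> \<le> t) \<and>
    (\<forall>t. Shift X t \<in> Omega X \<rightarrow> Omega X) \<and>
    (\<forall>s t. \<forall>\<omega>\<in>Omega X. State X s (Shift X t \<omega>) = State X (s + t) \<omega>) \<and>
    \<comment> \<open>right-continuous paths with left limits\<close>
    (\<forall>\<omega>\<in>Omega X. \<forall>t<\<infinity>.
        limitin compactified (\<lambda>s. State X s \<omega>) (State X t \<omega>) (at_right t)) \<and>
    (\<forall>\<omega>\<in>Omega X. \<forall>t. 0 < t \<and> t < \<infinity> \<longrightarrow>
        (\<exists>l. limitin compactified (\<lambda>s. State X s \<omega>) l (at_left t))) \<and>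
    \<comment> \<open>right-continuous filtration\<close>
    (\<forall>t<\<infinity>. sets (augmented_filtration X t) = (\<Inter>s\<in>{t<..}. sets (augmented_filtration X s))) \<and>
    \<comment> \<open>strong Markov property\<close>
    (\<forall>\<nu>\<in>initial_dists. \<forall>\<sigma>. stopping_time (augmented_filtration X) \<sigma> \<longrightarrow>
        (\<forall>s<\<infinity>. \<forall>B\<in>sets borel_cpt.
          \<forall>\<Gamma>\<in>sets (filtration.pre_sigma (Omega X) (augmented_filtration X) \<sigma>).
            emeasure (law_from X \<nu>) {\<omega>\<in>\<Gamma>. State X (\<sigma> \<omega> + s) \<omega> \<in> B} =
            (\<integral>\<^sup>+\<omega>\<in>\<Gamma>. emeasure (Law X (State X (\<sigma> \<omega>) \<omega>)) {\<omega>'\<in>Omega X. State X s \<omega>' \<in> B}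
              \<partial>law_from X \<nu>))) \<and>
    \<comment> \<open>quasi-left-continuity\<close>
    (\<forall>\<nu>\<in>initial_dists. \<forall>\<sigma>s \<sigma>.
        (\<forall>n::nat. stopping_time (augmented_filtration X) (\<sigma>s n)) \<and>
        (\<forall>\<omega>\<in>Omega X. incseq (\<lambda>n. \<sigma>s n \<omega>) \<and> \<sigma> \<omega> = (SUP n. \<sigma>s n \<omega>)) \<longrightarrow>
        (AE \<omega> in law_from X \<nu>. \<sigma> \<omega> < \<infinity> \<longrightarrow>
          limitin compactified (\<lambda>n. State X (\<sigma>s n \<omega>) \<omega>) (State X (\<sigma> \<omega>) \<omega>) sequentially))"

text \<open>The Borel measure $P_x(X_t \in dy)$ on $S$.\<close>

definition transition_measure ::
    "('w, 's::topological_space) process \<Rightarrow> ennreal \<Rightarrow> 's \<Rightarrow> 's measure"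
  where "transition_measure X t x =
    distr (restrict_space (Law X (Some x)) {\<omega>. State X t \<omega> \<noteq> None}) borel (\<lambda>\<omega>. the (State X t \<omega>))"

definition symmetric_process ::
    "'s::topological_space measure \<Rightarrow> ('w, 's) process \<Rightarrow> bool"
  where "symmetric_process m X \<longleftrightarrow>
    (\<forall>t. 0 < t \<and> t < \<infinity> \<longrightarrow>
      (\<forall>f\<in>borel_measurable borel. \<forall>g\<in>borel_measurable borel.
        (\<integral>\<^sup>+x. (\<integral>\<^sup>+y. f y \<partial>transition_measure X t x) * g x \<partial>m) =
        (\<integral>\<^sup>+x. (f x :: ennreal) * (\<integral>\<^sup>+y. g y \<partial>transition_measure X t x) \<partial>m)))"

text \<open>$\frac1t\langle u - T_t u, v\rangle_{L^2}$, where $(T_t)$ is the transition semigroup on $L^2(S,m)$. For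
  $u \in L^2(S,m)$ the integral defining $T_t u(x)$ exists for $m$-almost every $x$.\<close>

definition approximating_form ::
    "'s::topological_space measure \<Rightarrow> ('w, 's) process \<Rightarrow> real \<Rightarrow> ('s \<Rightarrow> real) \<Rightarrow> ('s \<Rightarrow> real) \<Rightarrow> real"
  where "approximating_form m X t u v =
    L2_inner m (\<lambda>x. u x - (\<integral>y. u y \<partial>transition_measure X (ennreal t) x)) v / t"

definition dirichlet_form_of ::
    "'s::topological_space measure \<Rightarrow> ('w, 's) process \<Rightarrow>
      (('s \<Rightarrow> real) \<Rightarrow> ('s \<Rightarrow> real) \<Rightarrow> real) \<Rightarrow> ('s \<Rightarrow> real) set \<Rightarrow> bool"
  where "dirichlet_form_of m X \<E> \<F> \<longleftrightarrow>
    \<F> = {u \<in> L2 m. \<exists>l. ((\<lambda>t. approximating_form m X t u u) \<longlongrightarrow> l) (at_right 0)} \<and>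
    (\<forall>u\<in>\<F>. \<forall>v\<in>\<F>. ((\<lambda>t. approximating_form m X t u v) \<longlongrightarrow> \<E> u v) (at_right 0))"

definition absolute_continuity ::
    "'s::topological_space measure \<Rightarrow> ('w, 's) process \<Rightarrow> bool"
  where "absolute_continuity m X \<longleftrightarrow>
    (\<forall>x t. 0 < t \<and> t < \<infinity> \<longrightarrow> absolutely_continuous m (transition_measure X t x))"


section \<open>Transition density\<close>

definition transition_density ::
    "'s::topological_space measure \<Rightarrow> ('w, 's) process \<Rightarrow> (ennreal \<Rightarrow> 's \<Rightarrow> 's \<Rightarrow> ennreal) \<Rightarrow> bool"
  where "transition_density m X p \<longleftrightarrow>
    (\<lambda>(t, x, y). p t x y) \<in> borel_measurable (restrict_space borel ({0<..<\<infinity>} \<times> UNIV \<times> UNIV)) \<and>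
    (\<forall>t x. 0 < t \<and> t < \<infinity> \<longrightarrow> transition_measure X t x = density m (p t x)) \<and>
    (\<forall>t x y. 0 < t \<and> t < \<infinity> \<longrightarrow> p t x y = p t y x) \<and>
    (\<forall>s t x y. 0 < s \<and> s < \<infinity> \<and> 0 < t \<and> t < \<infinity> \<longrightarrow>
      p (t + s) x y = (\<integral>\<^sup>+z. p t x z * p s z y \<partial>m))"

text \<open>The extension of $p$ to $(0,\infty] \times S \times S_\Delta$.\<close>

definition extended_density ::
    "'s measure \<Rightarrow> (ennreal \<Rightarrow> 's \<Rightarrow> 's \<Rightarrow> ennreal) \<Rightarrow> ennreal \<Rightarrow> 's \<Rightarrow> 's option \<Rightarrow> ennreal"
  where "extended_density m p t x y =
    (if t = \<infinity> then indicator {None} y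
     else case y of Some y' \<Rightarrow> p t x y' | None \<Rightarrow> 1 - (\<integral>\<^sup>+z. p t x z \<partial>m))"

definition extended_measure :: "'s::topological_space measure \<Rightarrow> 's option measure"
  where "extended_measure m =
    measure_of UNIV (sets borel_cpt) (\<lambda>B. emeasure m (Some -` B) + indicator B None)"


section \<open>Positive continuous additive functionals\<close>

text \<open>PCAFs in the strict sense, including the convention that $A$ vanishes off the defining set
  \<open>\<Lambda>\<close> and that \<open>\<Lambda>\<close> contains $\{\zeta = 0\}$. Only the values \<open>A t\<close> with \<open>t < \<infinity>\<close> matter.\<close>

definition PCAF_strict ::
    "('w, 's::topological_space) process \<Rightarrow> (ennreal \<Rightarrow> 'w \<Rightarrow> ennreal) \<Rightarrow> bool"
  where "PCAF_strict X A \<longleftrightarrow>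
    (\<forall>t<\<infinity>. A t \<in> borel_measurable (augmented_filtration X t)) \<and>
    (\<exists>\<Lambda>\<in>sets (augmented_filtration X \<infinity>).
      (\<forall>x. emeasure (law_at X (Some x)) \<Lambda> = 1) \<and>
      (\<forall>t<\<infinity>. Shift X t ` \<Lambda> \<subseteq> \<Lambda>) \<and>
      (\<forall>\<omega>\<in>\<Lambda>.
        continuous_on {..<\<infinity>} (\<lambda>t. A t \<omega>) \<and>
        A 0 \<omega> = 0 \<and>
        (\<forall>t<\<infinity>. t < life_time X \<omega> \<longrightarrow> A t \<omega> < \<infinity>) \<and>
        (\<forall>t<\<infinity>. life_time X \<omega> \<le> t \<longrightarrow> A t \<omega> = A (life_time X \<omega>) \<omega>) \<and>
        (\<forall>s<\<infinity>. \<forall>t<\<infinity>. A (t + s) \<omega> = A t \<omega> + A s (Shift X t \<omega>))) \<and>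
      (\<forall>\<omega>\<in>Omega X - \<Lambda>. \<forall>t<\<infinity>. A t \<omega> = 0) \<and>
      {\<omega>\<in>Omega X. life_time X \<omega> = 0} \<subseteq> \<Lambda>)"

definition extend_to_infinity :: "(ennreal \<Rightarrow> 'w \<Rightarrow> ennreal) \<Rightarrow> ennreal \<Rightarrow> 'w \<Rightarrow> ennreal"
  where "extend_to_infinity A t \<omega> =
    (if t = \<infinity> then (SUP q\<in>{q\<in>\<rat>. 0 \<le> q}. A (ennreal q) \<omega>) else A t \<omega>)"

text \<open>
  The Lebesgue--Stieltjes measure $da$ on $(0,\zeta)$ of a continuous nondecreasing function $a$ on
  $[0,\infty)$ with $a_0 = 0$ that is finite on $[0,\zeta)$. As $a_\zeta$ may be infinite, it is
  built as the increasing limit of the measures of the finite functions $s \mapsto a_{s \wedge r}$,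
  $r < \zeta$. Note that \<open>ennreal s = 0\<close> for \<open>s < 0\<close>.
\<close>

definition stieltjes_measure :: "ennreal \<Rightarrow> (ennreal \<Rightarrow> ennreal) \<Rightarrow> real measure"
  where "stieltjes_measure \<zeta> a = measure_of UNIV (sets borel)
    (\<lambda>B. SUP r\<in>{r. 0 \<le> r \<and> ennreal r < \<zeta>}.
      emeasure (interval_measure (\<lambda>s. enn2real (a (ennreal (min s r))))) B)"

text \<open>$\int_0^t 1_E(X_s)\,dA_s$\<close>

definition occupation_integral ::
    "('w, 's) process \<Rightarrow> (ennreal \<Rightarrow> 'w \<Rightarrow> ennreal) \<Rightarrow> 's set \<Rightarrow> ennreal \<Rightarrow> 'w \<Rightarrow> ennreal"
  where "occupation_integral X A E t \<omega> =
    (\<integral>\<^sup>+s\<in>{s. 0 < s \<and> ennreal s \<le> t}. indicator (Some ` E) (State X (ennreal s) \<omega>)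
      \<partial>stieltjes_measure (life_time X \<omega>) (\<lambda>s. A s \<omega>))"

text \<open>As $A$ is only measurable for completed $\sigma$-algebras, the $m(dx)$-integrand is in general
  not Borel but only universally measurable, whence \<^const>\<open>completion\<close>.\<close>

definition revuz_measure ::
    "'s::topological_space measure \<Rightarrow> ('w, 's) process \<Rightarrow> (ennreal \<Rightarrow> 'w \<Rightarrow> ennreal) \<Rightarrow> 's measure \<Rightarrow> bool"
  where "revuz_measure m X A \<mu> \<longleftrightarrow>
    sets \<mu> = sets borel \<and>
    (\<forall>E\<in>sets borel. emeasure \<mu> E =
      (SUP t\<in>{0<..<\<infinity>}.
        (\<integral>\<^sup>+x. (\<integral>\<^sup>+\<omega>. occupation_integral X A E t \<omega> \<partial>law_at X (Some x)) \<partial>completion m) / t))"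


section \<open>Iterated integrals\<close>

text \<open>$\int_a^t dt_1\int_{t_1}^t dt_2 \cdots \int_{t_{k-1}}^t dt_k\, G(t_1,\dots,t_k)$\<close>

primrec time_integral :: "nat \<Rightarrow> ennreal \<Rightarrow> ennreal \<Rightarrow> (ennreal list \<Rightarrow> ennreal) \<Rightarrow> ennreal"
  where
    "time_integral 0 a t G = G []"
  | "time_integral (Suc k) a t G =
      (\<integral>\<^sup>+s\<in>{s. a < ennreal s \<and> ennreal s < t}.
        time_integral k (ennreal s) t (\<lambda>ts. G (ennreal s # ts)) \<partial>lborel)"

text \<open>$\int \mu_1(dy_1) \int \mu_2(dy_2) \cdots \int \mu_k(dy_k)\, G(y_1,\dots,y_k)$\<close>

primrec space_integral :: "'s measure list \<Rightarrow> ('s list \<Rightarrow> ennreal) \<Rightarrow> ennreal"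
  where
    "space_integral [] G = G []"
  | "space_integral (\<mu> # \<mu>s) G = (\<integral>\<^sup>+y. space_integral \<mu>s (\<lambda>ys. G (y # ys)) \<partial>\<mu>)"

text \<open>$q_{t_1-t_0}(y_0,y_1)\cdots q_{t_k-t_{k-1}}(y_{k-1},y_k)\,q_{t-t_k}(y_k,z)$ for
  \<open>ts = [t\<^sub>0,\<dots>,t\<^sub>k]\<close> and \<open>ys = [y\<^sub>0,\<dots>,y\<^sub>k]\<close>.\<close>

definition path_density ::
    "(ennreal \<Rightarrow> 's \<Rightarrow> 's option \<Rightarrow> ennreal) \<Rightarrow> ennreal list \<Rightarrow> 's list \<Rightarrow> ennreal \<Rightarrow> 's option \<Rightarrow> ennreal"
  where "path_density q ts ys t z =
    (\<Prod>i<length ts - 1. q (ts ! Suc i - ts ! i) (ys ! i) (Some (ys ! Suc i))) *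
    q (t - last ts) (last ys) z"

end

theory Submission
  imports Defs
begin

text \<open>
  For a single functional with \<open>f = 1\<close> the theorem says that $E_x[\int \varphi(s,X_s)\,dA_s]$ equals
  $\int ds \int \mu(dy)\, p_s(x,y)\, \varphi(s,y)$: the density of the law of $X_s$ turns
  the Revuz measure, which is defined through the initial law \<open>m\<close>, into the law of \<open>A\<close> under $P_x$.
  The general case follows by iteration. By the product rule, $\prod_i A^{(i)}_t$ is the sum over
  \<open>i\<close> of $\int_0^t \prod_{l \ne i} (A^{(l)}_t - A^{(l)}_s)\, dA^{(i)}_s$, and given the path up to
  time \<open>s\<close>, the remaining product is the same kind of functional started from $X_s$. Each step
  splits off one factor, one time and one transition density; the order in which the factors are
  split off is the permutation in the statement (\<open>prod_inc\<close>, \<open>clock_integral_density\<close>,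
  \<open>moment_recursion\<close>).

  The case of one functional rests on the symmetry of \<open>X\<close>. A functional
  $B = \int_0^T w(X_s)\,dA_s$ is invariant under time reversal in the sense that
  $\int g(x)\, E_x[h(X_T) B]\, m(dx)$ is symmetric in \<open>g\<close> and \<open>h\<close>. To see this, cut $[0,T]$ into \<open>n\<close>
  equal cells of length $\delta$. The expectation becomes a sum over the cells \<open>j\<close> of integrals of
  $T_{j\delta} g \cdot T_{T-j\delta} h \cdot E_\cdot[B_\delta]$, up to an error, and this sum is
  symmetric up to its boundary terms. The error comes from moving
  the martingale $T_{T-t}h(X_t)$ from the right to the left end of each cell. It is controlled by
  the quadratic variation of the martingale, which is bounded, and by that of \<open>B\<close>, which tends to
  zero as \<open>B\<close> is continuous (\<open>riemann_sum_error\<close>, \<open>reversal_le\<close>). Boundedness of potentials is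
  needed for this, so \<open>w\<close> is the indicator of a member of an increasing sequence of Borel
  sets, which exhausts the state space (\<open>nest_potential\<close>, \<open>nest_UN\<close>).

  With \<open>h = 1\<close> and a short time $T$, the symmetry relates the law of the points of increase of
  \<open>A\<close> started from $g \cdot m$ to the occupation of the functional in $[0,T]$ started from \<open>m\<close>,
  which is the quantity that defines the Revuz measure. Averaging over shifts of the short
  interval identifies the former law as $T_s g(y)\, ds\, \mu(dy)$ (\<open>duality\<close>). Taking
  $g = p_a(x,\cdot)$ and $a \downarrow 0$ gives the formula for the starting point \<open>x\<close>
  (\<open>NN_density\<close>).

  A large part of the text is measurability. The hypothesis on \<open>X\<close> is the strong Markov property for
  one-dimensional marginals, while additive functionals are only measurable for the augmented
  filtration, so the strong Markov property is extended to functionals of the whole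
  path that are measurable for the universal completion, at the random times at
  which \<open>A\<close> exceeds a given level. Integrals against \<open>dA\<close> are Lebesgue integrals over these levels.
\<close>

text \<open>Paths are denoted by \<open>V\<close>, and \<open>LI x. f wrt M\<close> is the Lebesgue integral of a nonnegative
  function.\<close>

abbreviation (input) BM :: "'a measure => ('a => 'b::topological_space) set"
  where "BM M \<equiv> borel_measurable M"

abbreviation (input) ind :: "'a set => 'a => 'b::zero_neq_one"
  where "ind \<equiv> indicator"

syntax
  "_LI" :: "pttrn => ennreal => 'a measure => ennreal"  ("(2LI _./ _/ wrt _)" [60, 61] 110)
translations
  "LI x. f wrt M" => "CONST nn_integral M (\<lambda>x. f)"


section \<open>The one-point compactification as a measurable space\<close>

lemma space_borel_cpt [simp]: "space borel_cpt = UNIV"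
 unfolding borel_cpt_def by simp

lemma openin_vimage_Some:
 fixes U :: "'s::t2_space option set"
 assumes "openin compactified U"
 shows "open (Some -` U)"
proof -
 consider (a) Vo where "open Vo" "U = Some ` Vo"
  | (b) C where "closed C" "U = insert None (Some ` (UNIV - C))"
  using assms by (auto simp: openin_Alexandroff_compactification)
 then show ?thesis
 proof cases
  case a
  then have "Some -` U = Vo" by auto
  with a show ?thesis by simp
 next
  case b
  then have "Some -` U = - C" by auto
  with b show ?thesis by (simp add: open_Compl)
 qed
qed

lemma measurable_Some: "Some \<in> (borel :: 's::t2_space measure) \<rightarrow>\<^sub>M borel_cpt"
 unfolding borel_cpt_def
 by (rule measurable_measure_of) (auto intro!: borel_open openin_vimage_Some)

lemma sets_borel_cpt_image:
 fixes E :: "'s::t2_space set"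
 assumes "E \<in> sets borel"
 shows "Some ` E \<in> sets borel_cpt"
proof -
 have rng: "range (Some :: 's => _) \<in> sets borel_cpt"
  unfolding borel_cpt_def by (rule sets_measure_of[THEN equalityD2, THEN subsetD, OF _ sigma_sets.Basic]) auto
 have "E \<in> sigma_sets UNIV {S. open S}"
  using assms by (simp add: borel_def)
 then show ?thesis
 proof induction
  case (Basic a)
  then show ?case unfolding borel_cpt_def by (auto intro!: sigma_sets.Basic)
 next
  case Empty then show ?case by simp
 next
  case (Compl a)
  have "Some ` (UNIV - a) = range Some - Some ` a" by auto
  with Compl rng show ?case by auto
 next
  case (Union a)
  then show ?case by (auto simp: image_UN)
 qed
qed

lemma sets_borel_cpt_None: "{None :: 's::t2_space option} \<in> sets borel_cpt"
proof -
 have "- range (Some :: 's => _) = {None}" by (auto simp: notin_range_Some)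
 then show ?thesis
  using sets.compl_sets[OF sets_borel_cpt_image[of "UNIV :: 's set"]]
  by (simp add: Compl_eq_Diff_UNIV)
qed

lemma sets_borel_cpt_iff:
 fixes B :: "'s::t2_space option set"
 shows "B \<in> sets borel_cpt \<longleftrightarrow> Some -` B \<in> sets borel"
proof
 assume "B \<in> sets borel_cpt"
 then show "Some -` B \<in> sets borel"
  using measurable_sets[OF measurable_Some, of B] by simp
next
 assume "Some -` B \<in> sets borel"
 then have "Some ` (Some -` B) \<in> sets borel_cpt" by (rule sets_borel_cpt_image)
 moreover have "B \<inter> {None} \<in> sets borel_cpt"
  using sets_borel_cpt_None by (cases "None \<in> B") auto
 moreover have "B = Some ` (Some -` B) \<union> (B \<inter> {None})"
  by (auto intro: imageI)
 ultimately show "B \<in> sets borel_cpt" by (metis sets.Un)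
qed

lemma measurable_from_borel_cpt:
 fixes f :: "'s::t2_space option => 'b"
 assumes "(\<lambda>x. f (Some x)) \<in> borel \<rightarrow>\<^sub>M N" "f None \<in> space N"
 shows "f \<in> borel_cpt \<rightarrow>\<^sub>M N"
proof (rule measurableI)
 show "f x \<in> space N" for x
  using assms(2) measurable_space[OF assms(1)] by (cases x) auto
 fix A assume "A \<in> sets N"
 from measurable_sets[OF assms(1) this] show "f -` A \<inter> space borel_cpt \<in> sets borel_cpt"
  by (simp add: sets_borel_cpt_iff vimage_def)
qed

lemma sets_borel_cpt_singleton: "{x :: 's::t2_space option} \<in> sets borel_cpt"
proof -
 have "Some -` {x} = (case x of None => {} | Some y => {y})" by (auto split: option.split)
 then show ?thesis by (auto simp: sets_borel_cpt_iff split: option.split)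
qed

text \<open>Pointwise limits in the compactification are measurable: membership of the limit in an open
 subset \<open>U\<close> of the state space is decided by the countably many basic open sets whose compact
 closures lie in \<open>U\<close>.\<close>

lemma measurable_limitin_compactified:
 fixes Z :: "nat => 'w => 's::{metric_space, second_countable_topology} option"
 assumes lc: "locally_compact_space (euclidean :: 's topology)"
  and Z: "\<And>n. Z n \<in> M \<rightarrow>\<^sub>M borel_cpt"
  and lim: "\<And>V. V \<in> space M ==> limitin compactified (\<lambda>n. Z n V) (Y V) sequentially"
 shows "Y \<in> M \<rightarrow>\<^sub>M borel_cpt"
proof -
 obtain \<B> :: "'s set set" where \<B>: "countable \<B>" "topological_basis \<B>"
  using ex_countable_basis by auto
 have key: "{V \<in> space M. Y V \<in> Some ` U} \<in> sets M" if U: "open U" for U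
 proof -
  define \<C> where "\<C> = {B \<in> \<B>. compact (closure B) \<and> closure B \<subseteq> U}"
  have cnt: "countable \<C>" using \<B>(1) by (simp add: \<C>_def)
  have eq: "Y V \<in> Some ` U \<longleftrightarrow> (\<exists>B\<in>\<C>. \<exists>N. \<forall>n\<ge>N. Z n V \<in> Some ` B)"
   if w: "V \<in> space M" for V
  proof
   assume "Y V \<in> Some ` U"
   then obtain y where y: "y \<in> U" "Y V = Some y" by auto
   obtain Vo K where VK: "open Vo" "compact K" "y \<in> Vo" "Vo \<subseteq> K"
    using lc unfolding locally_compact_space_def by (metis UNIV_I compactin_euclidean_iff open_openin topspace_euclidean)
   obtain e where e: "e > 0" "cball y e \<subseteq> U \<inter> Vo"
    using open_contains_cball[of "U \<inter> Vo"] U VK y by (meson IntI open_Int)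
   obtain B where B: "B \<in> \<B>" "y \<in> B" "B \<subseteq> ball y e"
    using topological_basisE[OF \<B>(2), of "ball y e" y] e by auto
   have "closure B \<subseteq> cball y e"
    using B(3) by (meson ball_subset_cball closed_cball closure_minimal order_trans)
   moreover have "compact (closure B)"
   proof -
    have "closure B \<subseteq> K" using calculation e(2) VK(4) by blast
    then have "K \<inter> closure B = closure B" by blast
    then show ?thesis using compact_Int_closed[OF VK(2) closed_closure, of B] by simp
   qed
   ultimately have "B \<in> \<C>" using B e by (auto simp: \<C>_def)
   moreover have "open B" using B \<B> topological_basis_open by blast
   then have "eventually (\<lambda>n. Z n V \<in> Some ` B) sequentially"
    using limitinD[OF lim[OF w], of "Some ` B"] y B by auto
   ultimately show "\<exists>B\<in>\<C>. \<exists>N. \<forall>n\<ge>N. Z n V \<in> Some ` B"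
    unfolding eventually_sequentially by blast
  next
   assume "\<exists>B\<in>\<C>. \<exists>N. \<forall>n\<ge>N. Z n V \<in> Some ` B"
   then obtain B N where B: "B \<in> \<C>" "\<forall>n\<ge>N. Z n V \<in> Some ` B" by auto
   have cl: "closedin compactified (Some ` closure B)"
    using B by (auto simp: \<C>_def closedin_Alexandroff_compactification_image_Some)
   have "Y V \<in> Some ` closure B"
   proof (rule ccontr)
    assume neg: "Y V \<notin> Some ` closure B"
    have "openin compactified (topspace compactified - Some ` closure B)"
     using cl by (simp only: closedin_def)
    moreover have "Y V \<in> topspace compactified"
     using limitin_topspace[OF lim[OF w]] .
    ultimately have "eventually (\<lambda>n. Z n V \<in> topspace compactified - Some ` closure B) sequentially"
     using limitinD[OF lim[OF w]] neg by blast
    then obtain N' where N': "\<And>n. n \<ge> N' ==> Z n V \<notin> Some ` closure B"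
     unfolding eventually_sequentially by blast
    have "Z (max N N') V \<in> Some ` B" using B(2) by simp
    moreover have "Some ` B \<subseteq> Some ` closure B" using closure_subset by blast
    ultimately show False using N'[of "max N N'"] by auto
   qed
   then show "Y V \<in> Some ` U" using B by (auto simp: \<C>_def)
  qed
  have "{V \<in> space M. Y V \<in> Some ` U} = (\<Union>B\<in>\<C>. \<Union>N. \<Inter>n\<in>{N..}. Z n -` (Some ` B) \<inter> space M)" (is "?L = ?R")
  proof (rule set_eqI)
   fix V
   have conv: "(\<forall>n\<in>{N..}. P n) \<longleftrightarrow> (\<forall>n\<ge>N. P n)" for N :: nat and P by auto
   show "V \<in> ?L \<longleftrightarrow> V \<in> ?R"
   proof (cases "V \<in> space M")
    case True
    with eq[OF True] show ?thesis by (simp only: mem_Collect_eq UN_iff INT_iff Int_iff vimage_eq conv bex_UNIV simp_thms)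
   qed auto
  qed
  also have "... \<in> sets M"
  proof (rule sets.countable_UN''[OF cnt])
   fix B assume "B \<in> \<C>"
   then have "open B" using \<B>(2) topological_basis_open by (auto simp: \<C>_def)
   then have "Z n -` Some ` B \<inter> space M \<in> sets M" for n
    by (intro measurable_sets[OF Z] sets_borel_cpt_image borel_open)
   then have "(\<Inter>n\<in>{N..}. Z n -` Some ` B \<inter> space M) \<in> sets M" for N
    by (intro sets.countable_INT') auto
   then show "(\<Union>N. \<Inter>n\<in>{N..}. Z n -` Some ` B \<inter> space M) \<in> sets M"
    by (intro sets.countable_UN) auto
  qed
  finally show ?thesis .
 qed
 show ?thesis
  unfolding borel_cpt_def
 proof (rule measurable_measure_of)
  fix W :: "'s option set" assume "W \<in> {U. openin compactified U}"
  then have op: "open (Some -` W)" by (simp add: openin_vimage_Some)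
  have U: "{V \<in> space M. Y V \<in> Some ` (UNIV :: 's set)} \<in> sets M" by (rule key) simp
  have N: "{V \<in> space M. Y V = None} \<in> sets M"
  proof -
   have "{V \<in> space M. Y V = None} = space M - {V \<in> space M. Y V \<in> Some ` (UNIV :: 's set)}"
    by (auto simp: notin_range_Some)
   then show ?thesis using U by simp
  qed
  have "Y -` W \<inter> space M = {V \<in> space M. Y V \<in> Some ` (Some -` W)} \<union>
    (if None \<in> W then {V \<in> space M. Y V = None} else {})"
  proof (rule set_eqI)
   fix V
   show "V \<in> Y -` W \<inter> space M \<longleftrightarrow> V \<in> {V \<in> space M. Y V \<in> Some ` (Some -` W)} \<union>
     (if None \<in> W then {V \<in> space M. Y V = None} else {})"
    by (cases "Y V") auto
  qed
  then show "Y -` W \<inter> space M \<in> sets M" using key[OF op] N by auto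
 qed auto
qed

text \<open>A right-continuous process evaluated at a random time bounded by \<open>c\<close> only involves its
 values at times up to \<open>c\<close>: approximate the random time from the right by times with countably
 many values, cut off at \<open>c\<close>.\<close>

lemma measurable_at_random_time:
 fixes Z :: "ennreal => 'w => 's::{metric_space, second_countable_topology} option"
 assumes lc: "locally_compact_space (euclidean :: 's topology)"
  and \<sigma>: "\<sigma> \<in> BM M" "\<And>V. V \<in> space M ==> \<sigma> V <= c"
  and Z: "\<And>q. q <= c ==> Z q \<in> M \<rightarrow>\<^sub>M borel_cpt"
  and lim: "\<And>V t. V \<in> space M ==> t < \<infinity> ==>
   limitin compactified (\<lambda>s. Z s V) (Z t V) (at_right t)"
 shows "(\<lambda>V. Z (\<sigma> V) V) \<in> M \<rightarrow>\<^sub>M borel_cpt"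
proof -
 define ix :: "nat => 'w => int option"
  where "ix n V = (if \<sigma> V = \<infinity> then None else Some \<lfloor>real (Suc n) * enn2real (\<sigma> V)\<rfloor>)" for n V
 define vl :: "nat => int option => ennreal"
  where "vl n i = min c (case i of None => \<infinity> | Some k => ennreal ((of_int k + 1) / real (Suc n)))" for n i
 note \<sigma>(1)[measurable]
 have ix: "ix n \<in> M \<rightarrow>\<^sub>M count_space UNIV" for n
  unfolding ix_def by measurable
 have 1: "(\<lambda>V. Z (vl n (ix n V)) V) \<in> M \<rightarrow>\<^sub>M borel_cpt" for n
  by (rule measurable_compose_countable[OF _ ix]) (auto intro!: Z simp: vl_def)
 show ?thesis
 proof (rule measurable_limitin_compactified[OF lc 1])
  fix V assume w: "V \<in> space M"
  show "limitin compactified (\<lambda>n. Z (vl n (ix n V)) V) (Z (\<sigma> V) V) sequentially"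
  proof (cases "\<sigma> V < c")
   case False
   with \<sigma>(2)[OF w] have c: "\<sigma> V = c" by auto
   have "vl n (ix n V) = c" for n
   proof (cases c)
    case (real r)
    have "r <= (of_int \<lfloor>real (Suc n) * r\<rfloor> + 1) / real (Suc n)"
     by (simp add: field_simps) linarith
    with real show ?thesis by (auto simp: vl_def ix_def c min_def intro!: antisym ennreal_leI)
   qed (simp add: vl_def ix_def c)
   then show ?thesis by (cases "Z c V") (simp_all add: c)
  next
   case True
   then have fin: "\<sigma> V < \<infinity>" by (auto simp: less_top[symmetric])
   then obtain r where r: "\<sigma> V = ennreal r" "r \<ge> 0" by (cases "\<sigma> V") auto
   define v where "v n = (of_int \<lfloor>real (Suc n) * r\<rfloor> + 1) / real (Suc n)" for n
   have vl: "vl n (ix n V) = min c (ennreal (v n))" for n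
    using r by (simp add: vl_def ix_def v_def)
   have v1: "r < v n" for n
    by (simp add: v_def field_simps) linarith
   have v2: "v n <= r + 1 / real (Suc n)" for n
   proof -
    have "v n <= (real (Suc n) * r + 1) / real (Suc n)"
     unfolding v_def by (intro divide_right_mono add_right_mono of_int_floor_le) simp
    also have "... = r + 1 / real (Suc n)" by (simp add: add_divide_distrib)
    finally show ?thesis .
   qed
   have "v \<longlonglongrightarrow> r"
   proof (rule tendsto_sandwich)
    show "\<forall>\<^sub>F n in sequentially. r <= v n" using v1 by (simp add: less_imp_le)
    show "\<forall>\<^sub>F n in sequentially. v n <= r + 1 / real (Suc n)" using v2 by simp
    show "(\<lambda>n. r + 1 / real (Suc n)) \<longlonglongrightarrow> r"
     using tendsto_add[OF tendsto_const[of r] LIMSEQ_inverse_real_of_nat] by (simp add: inverse_eq_divide)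
   qed simp
   then have "(\<lambda>n. ennreal (v n)) \<longlonglongrightarrow> ennreal r" by (rule tendsto_ennrealI)
   then have "(\<lambda>n. min c (ennreal (v n))) \<longlonglongrightarrow> min c (ennreal r)"
    by (intro tendsto_min tendsto_const)
   moreover have "min c (ennreal r) = \<sigma> V" using True r by (auto simp: min_def)
   ultimately have l: "(\<lambda>n. min c (ennreal (v n))) \<longlonglongrightarrow> \<sigma> V" by simp
   have lt: "\<sigma> V < min c (ennreal (v n))" for n
    using True r v1[of n] by (simp add: ennreal_lessI)
   have ev: "\<forall>n. min c (ennreal (v n)) \<in> {\<sigma> V<..} \<and> min c (ennreal (v n)) ~= \<sigma> V"
    by (intro allI conjI greaterThan_iff[THEN iffD2, OF lt] less_imp_neq[OF lt, symmetric])
   have "filterlim (\<lambda>n. vl n (ix n V)) (at_right (\<sigma> V)) sequentially"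
    unfolding vl filterlim_at by (rule conjI[OF always_eventually[OF ev] l])
   with lim[OF w fin] show ?thesis
    unfolding limitin_def by (auto simp: filterlim_iff)
  qed
 qed
qed

section \<open>The strong Markov property for path functionals\<close>

lemma nn_integral_return_any:
 assumes "{x} \<in> sets M" "x \<in> space M"
 shows "(LI y. g y wrt return M x) = g x"
proof -
 have m: "Measurable.pred M (\<lambda>y. y = x)"
  using assms(1) by (simp add: pred_def Int_absorb1 sets.sets_into_space) (metis assms Collect_conj_eq Int_insert_left_if1 Int_commute inf_bot_left singleton_conv Int_absorb1 sets.sets_into_space Collect_mem_eq)
 have "AE y in return M x. y = x"
  using assms(2) by (subst AE_return[OF _ m]) auto
 then have "(LI y. g y wrt return M x) = (LI y. g x wrt return M x)"
  by (intro nn_integral_cong_AE) auto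
 also have "... = g x" using assms by (simp add: emeasure_return)
 finally show ?thesis .
qed

lemma measurable_completion_cong_AE:
 assumes g: "g \<in> M \<rightarrow>\<^sub>M N" and ae: "AE x in M. f x = g x" and sp: "f \<in> space M \<rightarrow> space N"
 shows "f \<in> completion M \<rightarrow>\<^sub>M N"
proof (rule measurableI)
 fix A assume A: "A \<in> sets N"
 show "f -` A \<inter> space (completion M) \<in> sets (completion M)"
 proof (rule completion.in_sets_AE)
  show "AE x in completion M. (x \<in> g -` A \<inter> space M) = (x \<in> f -` A \<inter> space (completion M))"
   using ae by (auto intro!: AE_completion simp del: AE_completion_iff)
  show "g -` A \<inter> space M \<in> sets (completion M)"
   using g A by (auto intro: measurable_sets)
 qed auto
qed (use sp in auto)

lemma measurable_coarser:
 "f \<in> M \<rightarrow>\<^sub>M N ==> sets M \<subseteq> sets M' ==> space M = space M' ==> f \<in> M' \<rightarrow>\<^sub>M N"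
 unfolding measurable_def by auto

locale hunt =
 fixes X :: "('w, 's::{metric_space, second_countable_topology}) process"
 assumes lc: "locally_compact_space (euclidean :: 's topology)"
  and hunt: "hunt_process X"
begin

abbreviation \<Omega> where "\<Omega> \<equiv> Omega X"
abbreviation F0 where "F0 \<equiv> natural_filtration X top"
abbreviation Fil where "Fil \<equiv> augmented_filtration X"
abbreviation Fu where "Fu \<equiv> augmented_filtration X top"
abbreviation TF :: "('a::topological_space \<times> 'w) measure" where "TF \<equiv> borel  \<Otimes>\<^sub>M Fu"

lemmas hunt_conj = hunt[unfolded hunt_process_def infinity_ennreal_def]

lemma Law_prob: "prob_space (Law X x)" and Law_space: "space (Law X x) = \<Omega>"
  and Law_sets: "sets (Law X x) = sets (Events X)"
 using hunt_conj[THEN conjunct1] by simp_all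

lemmas State_Events = hunt_conj[THEN conjunct2, THEN conjunct1, rule_format]
lemmas Law_State_measurable = hunt_conj[THEN conjunct2, THEN conjunct2, THEN conjunct1, rule_format]
lemmas hunt_conj3 = hunt_conj[THEN conjunct2, THEN conjunct2, THEN conjunct2]
lemmas Law_normal = hunt_conj3[THEN conjunct1, rule_format]
lemmas State_None_iff = hunt_conj3[THEN conjunct2, THEN conjunct1, rule_format]
lemmas hunt_conj5 = hunt_conj3[THEN conjunct2, THEN conjunct2]
lemmas Shift_range = hunt_conj5[THEN conjunct1, rule_format]
lemmas State_Shift = hunt_conj5[THEN conjunct2, THEN conjunct1, rule_format]
lemmas right_cont = hunt_conj5[THEN conjunct2, THEN conjunct2, THEN conjunct1, rule_format]
lemmas hunt_conj9 = hunt_conj5[THEN conjunct2, THEN conjunct2, THEN conjunct2, THEN conjunct2]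
lemmas Fil_right_cont = hunt_conj9[THEN conjunct1, rule_format]
lemmas strong_markov_hyp = hunt_conj9[THEN conjunct2, THEN conjunct1, rule_format]

lemma Shift_in: "V \<in> \<Omega> ==> Shift X t V \<in> \<Omega>"
 using Shift_range by (auto simp: Pi_iff)

lemma space_natural [simp]: "space (natural_filtration X t) = \<Omega>"
 unfolding natural_filtration_def by (simp add: space_measure_of_conv)

lemma natural_gen_Pow: "{State X s -` B \<inter> \<Omega> | s B. s <= t \<and> B \<in> sets borel_cpt} \<subseteq> Pow \<Omega>"
 by auto

lemma sets_natural: "sets (natural_filtration X t) =
  sigma_sets \<Omega> {State X s -` B \<inter> \<Omega> | s B. s <= t \<and> B \<in> sets borel_cpt}"
 unfolding natural_filtration_def by (rule sets_measure_of[OF natural_gen_Pow])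

lemma State_natural: "s <= t ==> State X s \<in> natural_filtration X t \<rightarrow>\<^sub>M borel_cpt"
 by (rule measurableI) (auto simp: sets_natural intro!: sigma_sets.Basic)

lemma sets_natural_mono: "s <= t ==> sets (natural_filtration X s) \<subseteq> sets (natural_filtration X t)"
 unfolding sets_natural by (rule sigma_sets_mono') (auto intro: order_trans)

lemma sets_F0_Events: "sets F0 \<subseteq> sets (Events X)"
 unfolding sets_natural
 by (rule sets.sigma_sets_subset) (auto intro: measurable_sets[OF State_Events])

text \<open>\<open>R x\<close> is the uncompleted law $P_x$ on $\mathscr{F}^0_\infty$.\<close>

definition R :: "'s option => 'w measure" where "R x = restr_to_subalg (Law X x) F0"

lemma subalg_F0: "subalgebra (Law X x) F0"
 using sets_F0_Events by (simp add: subalgebra_def Law_space Law_sets)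

lemma sets_R: "sets (R x) = sets F0" and space_R [simp]: "space (R x) = \<Omega>"
 and emeasure_R: "A \<in> sets F0 ==> emeasure (R x) A = emeasure (Law X x) A"
 unfolding R_def using subalg_F0
 by (simp_all add: sets_restr_to_subalg space_restr_to_subalg Law_space emeasure_restr_to_subalg)

lemma prob_R: "prob_space (R x)"
 unfolding R_def by (intro prob_space_restr_to_subalg subalg_F0 Law_prob)

lemma law_at_eq: "law_at X x = completion (R x)"
 by (simp add: law_at_def R_def)

lemma prob_space_completion: "prob_space M ==> prob_space (completion M)"
 by (intro prob_spaceI) (simp add: prob_space.emeasure_space_1)

lemma return_initial: "return borel_cpt x \<in> initial_dists"
 by (simp add: initial_dists_def prob_space_return)

lemma law_from_return: "law_from X (return borel_cpt x) = law_at X x"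
proof -
 have "measure_of \<Omega> (sets F0) (\<lambda>\<Gamma>. LI y. emeasure (Law X y) \<Gamma> wrt return borel_cpt x) = R x"
  unfolding R_def restr_to_subalg_def Law_space
  by (rule measure_of_eq)
   (use sets.space_closed[of F0] in \<open>auto simp: nn_integral_return_any sets_borel_cpt_singleton\<close>)
 then show ?thesis by (simp add: law_from_def law_at_eq)
qed

lemma space_law_from [simp]: "space (law_from X \<nu>) = \<Omega>"
 unfolding law_from_def by (simp add: space_measure_of_conv)

lemma sets_F0_law_from: "sets F0 \<subseteq> sets (law_from X \<nu>)"
proof -
 have "sets (measure_of \<Omega> (sets F0) g) = sets F0" for g
  by (metis sets.sets_measure_of_eq space_natural)
 then show ?thesis unfolding law_from_def by (auto intro!: sets_completionI_sets)
qed

lemma complete_law_from: "complete_measure (law_from X \<nu>)"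
 unfolding law_from_def ..

subsection \<open>The augmented filtration\<close>

lemma filtration_from_sets: "sets (filtration_from X \<nu> t) =
  sigma_sets \<Omega> (sets (natural_filtration X t) \<union> null_sets (law_from X \<nu>))"
 unfolding filtration_from_def
 by (rule sets_measure_of)
  (use sets.space_closed[of "natural_filtration X t"] sets.space_closed[of "law_from X \<nu>"] in \<open>auto dest: null_setsD2\<close>)

lemma filtration_from_sub: "sets (filtration_from X \<nu> t) \<subseteq> sets (law_from X \<nu>)"
proof -
 have "sigma_sets (space (law_from X \<nu>)) (sets (natural_filtration X t) \<union> null_sets (law_from X \<nu>)) \<subseteq> sets (law_from X \<nu>)"
  using sets_natural_mono[of t top] sets_F0_law_from[of \<nu>]
  by (intro sets.sigma_sets_subset) auto
 then show ?thesis by (simp add: filtration_from_sets)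
qed

lemma space_Fil [simp]: "space (Fil t) = \<Omega>"
 unfolding augmented_filtration_def by (simp add: space_measure_of_conv)

lemma sets_Fil: "sets (Fil t) = (\<Inter>\<nu>\<in>initial_dists. sets (filtration_from X \<nu> t))"
proof -
 let ?I = "\<Inter>\<nu>\<in>initial_dists. sets (filtration_from X \<nu> t)"
 have sp: "space (filtration_from X \<nu> t) = \<Omega>" for \<nu>
  unfolding filtration_from_def by (simp add: space_measure_of_conv)
 have P: "?I \<subseteq> Pow \<Omega>"
  using sets.sets_into_space[of _ "filtration_from X (return borel_cpt None) t"] return_initial sp by blast
 have "sigma_sets \<Omega> ?I \<subseteq> sets (filtration_from X \<nu> t)" if "\<nu> \<in> initial_dists" for \<nu>
  using that sp[of \<nu>] by (metis INT_lower sets.sigma_sets_subset)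
 then have "sigma_sets \<Omega> ?I = ?I" by (auto intro: sigma_sets.Basic)
 then show ?thesis unfolding augmented_filtration_def using P by (simp add: sets_measure_of)
qed

lemma sets_Fil_mono: "s <= t ==> sets (Fil s) \<subseteq> sets (Fil t)"
 unfolding sets_Fil filtration_from_sets using sets_natural_mono[of s t]
 by (intro INF_mono' sigma_sets_mono') auto

lemma natural_Fil: "sets (natural_filtration X t) \<subseteq> sets (Fil t)"
 unfolding sets_Fil filtration_from_sets by (auto intro: sigma_sets.Basic)

lemma State_Fil: "s <= t ==> State X s \<in> Fil t \<rightarrow>\<^sub>M borel_cpt"
 by (rule measurable_coarser[OF State_natural]) (auto intro: natural_Fil[THEN subsetD])

lemma Fil_law_from: "\<nu> \<in> initial_dists ==> sets (Fil t) \<subseteq> sets (law_from X \<nu>)"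
 using filtration_from_sub by (auto simp: sets_Fil)

lemma sets_law_from_Fil: "sets (filtration_from X \<nu> top) = sets (law_from X \<nu>)"
proof (intro antisym filtration_from_sub subsetI)
 fix A assume A: "A \<in> sets (law_from X \<nu>)"
 define P where "P = measure_of \<Omega> (sets F0) (\<lambda>\<Gamma>. LI x. emeasure (Law X x) \<Gamma> wrt \<nu>)"
 have lf: "law_from X \<nu> = completion P" by (simp add: law_from_def P_def)
 have sP: "sets P = sets F0" unfolding P_def by (metis sets.sets_measure_of_eq space_natural)
 from A obtain S N N' where "A = S \<union> N" "N \<subseteq> N'" "N' \<in> null_sets P" "S \<in> sets P"
  unfolding lf by (rule sets_completionE)
 then have "N \<in> null_sets (law_from X \<nu>)" "S \<in> sets F0"
  unfolding lf using sP null_sets_completion_iff2[of N P] by auto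
 then show "A \<in> sets (filtration_from X \<nu> top)"
  unfolding filtration_from_sets \<open>A = S \<union> N\<close>
  by (intro sigma_sets_Un sigma_sets.Basic) auto
qed

lemma sets_Fu: "sets Fu = (\<Inter>\<nu>\<in>initial_dists. sets (law_from X \<nu>))"
 by (simp add: sets_Fil sets_law_from_Fil)

sublocale fil: filtration \<Omega> Fil
 by standard (auto simp: sets_Fil_mono)

lemma stopping_measurable_Fu: "stopping_time Fil \<sigma> ==> \<sigma> \<in> BM Fu"
 by (rule measurable_stopping_time[where F=Fil]) (auto intro: sets_Fil_mono[THEN subsetD])

lemma measurable_law_from: "\<nu> \<in> initial_dists ==> f \<in> Fu \<rightarrow>\<^sub>M N ==> f \<in> law_from X \<nu> \<rightarrow>\<^sub>M N"
 by (erule measurable_coarser) (auto simp: sets_Fu)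

lemma measurable_Fil_mono: "s <= t ==> f \<in> Fil s \<rightarrow>\<^sub>M N ==> f \<in> Fil t \<rightarrow>\<^sub>M N"
 by (erule measurable_coarser) (auto intro: sets_Fil_mono[THEN subsetD])

lemma measurable_State_at:
 assumes "\<sigma> \<in> BM (Fil c)" "\<And>V. V \<in> \<Omega> ==> \<sigma> V <= c"
 shows "(\<lambda>V. State X (\<sigma> V) V) \<in> Fil c \<rightarrow>\<^sub>M borel_cpt"
 by (rule measurable_at_random_time[OF lc, where c=c]) (use assms State_Fil right_cont in auto)

lemma measurable_State_Fu:
 "\<sigma> \<in> BM Fu ==> (\<lambda>V. State X (\<sigma> V) V) \<in> Fu \<rightarrow>\<^sub>M borel_cpt"
 by (rule measurable_State_at) auto

lemma State_joint: "(\<lambda>(t, V). State X t V) \<in> borel \<Otimes>\<^sub>M F0 \<rightarrow>\<^sub>M borel_cpt"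
proof -
 have "(\<lambda>z. State X (fst z) (snd z)) \<in> borel \<Otimes>\<^sub>M F0 \<rightarrow>\<^sub>M borel_cpt"
  by (rule measurable_at_random_time[OF lc, where c=top and Z="\<lambda>q z. State X q (snd z)"])
   (auto intro!: measurable_compose[OF measurable_snd State_natural] right_cont simp: space_pair_measure)
 then show ?thesis by (simp add: split_beta')
qed

lemma stopping_time_add:
 assumes "stopping_time Fil \<sigma>"
 shows "stopping_time Fil (\<lambda>V. \<sigma> V + r)"
proof
 fix t
 show "Measurable.pred (Fil t) (\<lambda>V. \<sigma> V + r <= t)"
 proof (cases "r <= t")
  case False
  then have "\<not> \<sigma> V + r <= t" for V
   using order_trans[of r "\<sigma> V + r" t] by auto
  then show ?thesis by simp
 next
  case True
  show ?thesis
  proof (cases "r = top")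
   case r: True
   with True have "t = top" by (simp add: top_unique)
   then show ?thesis by simp
  next
   case False
   have "\<sigma> V + r <= t \<longleftrightarrow> \<sigma> V <= t - r" for V
   proof
    assume "\<sigma> V + r <= t"
    from ennreal_minus_mono[OF this order_refl[of r]] False show "\<sigma> V <= t - r"
     by (simp add: ennreal_add_diff_cancel_right)
   next
    assume "\<sigma> V <= t - r"
    then have "\<sigma> V + r <= t - r + r" by (rule add_right_mono)
    with True show "\<sigma> V + r <= t" by (simp add: diff_add_cancel_ennreal)
   qed
   moreover have "Measurable.pred (Fil t) (\<lambda>V. \<sigma> V <= t - r)"
    by (rule fil.stopping_time_le_const[OF assms]) (simp add: diff_le_self_ennreal)
   ultimately show ?thesis by simp
  qed
 qed
qed

lemma stopping_min_measurable:
 assumes "stopping_time Fil \<sigma>"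
 shows "(\<lambda>V. min (\<sigma> V) t) \<in> BM (Fil t)"
proof (rule borel_measurableI_le)
 fix s
 show "{V \<in> space (Fil t). min (\<sigma> V) t <= s} \<in> sets (Fil t)"
 proof (cases "t <= s")
  case True
  then have "{V \<in> space (Fil t). min (\<sigma> V) t <= s} = space (Fil t)" by (auto simp: min_le_iff_disj)
  then show ?thesis by (metis sets.top)
 next
  case False
  then have "{V \<in> space (Fil t). min (\<sigma> V) t <= s} = {V \<in> space (Fil t). \<sigma> V <= s}"
   by (auto simp: min_le_iff_disj)
  then show ?thesis using fil.stopping_time_le_const[OF assms, of s t] False
   by (simp add: pred_def)
 qed
qed

lemma State_pre_sigma:
 assumes "stopping_time Fil \<sigma>" "B \<in> sets borel_cpt" "\<Gamma> \<in> sets (fil.pre_sigma \<sigma>)"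
 shows "{V \<in> \<Gamma>. State X (\<sigma> V) V \<in> B} \<in> sets (fil.pre_sigma \<sigma>)"
proof (rule fil.sets_pre_sigmaI[OF assms(1)])
 fix t
 have "(\<lambda>V. State X (min (\<sigma> V) t) V) \<in> Fil t \<rightarrow>\<^sub>M borel_cpt"
  by (rule measurable_State_at) (use stopping_min_measurable[OF assms(1)] in auto)
 from measurable_sets[OF this assms(2)] have
  1: "(\<lambda>V. State X (min (\<sigma> V) t) V) -` B \<inter> \<Omega> \<in> sets (Fil t)" by simp
 have 2: "{V\<in>\<Gamma>. \<sigma> V <= t} \<in> sets (Fil t)"
  by (rule fil.sets_pre_sigmaD[OF assms(1,3)])
 have "\<Gamma> \<subseteq> \<Omega>" using sets.sets_into_space[OF assms(3)] by (simp add: fil.space_pre_sigma)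
 then have "{V \<in> {V \<in> \<Gamma>. State X (\<sigma> V) V \<in> B}. \<sigma> V <= t} =
   {V\<in>\<Gamma>. \<sigma> V <= t} \<inter> ((\<lambda>V. State X (min (\<sigma> V) t) V) -` B \<inter> \<Omega>)"
  by (auto simp: min_def)
 with 1 2 show "{V \<in> {V \<in> \<Gamma>. State X (\<sigma> V) V \<in> B}. \<sigma> V <= t} \<in> sets (Fil t)" by simp
qed

lemma pre_sigma_add:
 assumes "stopping_time Fil \<sigma>" "\<Gamma> \<in> sets (fil.pre_sigma \<sigma>)"
 shows "\<Gamma> \<in> sets (fil.pre_sigma (\<lambda>V. \<sigma> V + r))"
 using fil.mono_pre_sigma[OF assms(1) stopping_time_add[OF assms(1), of r]] assms(2) by auto

lemma pre_sigma_Fu: "stopping_time Fil \<sigma> ==> \<Gamma> \<in> sets (fil.pre_sigma \<sigma>) ==> \<Gamma> \<in> sets Fu"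
 using fil.sets_pre_sigmaD[of \<sigma> \<Gamma> top] by simp

lemma pre_sigma_const: "\<Gamma> \<in> sets (Fil t) ==> \<Gamma> \<in> sets (fil.pre_sigma (\<lambda>_. t))"
proof (rule fil.sets_pre_sigmaI[OF stopping_time_const])
 fix s assume "\<Gamma> \<in> sets (Fil t)"
 then show "{V\<in>\<Gamma>. t <= s} \<in> sets (Fil s)" using sets_Fil_mono[of t s] by (cases "t <= s") auto
qed

subsection \<open>Cylinder functionals\<close>

definition Q :: "ennreal => 's option => 's option measure"
 where "Q s y = distr (Law X y) borel_cpt (State X s)"

lemma State_Law: "State X s \<in> Law X y \<rightarrow>\<^sub>M borel_cpt"
 using State_Events[of s] measurable_cong_sets[OF Law_sets[of y] refl] by blast

lemma Q_kernel: "Q s \<in> borel_cpt \<rightarrow>\<^sub>M prob_algebra borel_cpt"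
proof (rule measurable_prob_algebra_generated[where \<Omega>=UNIV and G="sets borel_cpt"])
 show "sets (borel_cpt :: 's option measure) = sigma_sets UNIV (sets borel_cpt)"
  using sets.sigma_sets_eq[of "borel_cpt :: 's option measure"] by simp
 show "Int_stable (sets (borel_cpt :: 's option measure))" by (auto simp: Int_stable_def)
 show "prob_space (Q s a)" for a
  unfolding Q_def by (rule prob_space.prob_space_distr[OF Law_prob State_Law])
 fix A :: "'s option set" assume A: "A \<in> sets borel_cpt"
 have "emeasure (Q s a) A = emeasure (Law X a) {V\<in>\<Omega>. State X s V \<in> A}" for a
  unfolding Q_def using A State_Law
  by (subst emeasure_distr) (auto simp: Law_space intro!: arg_cong2[where f=emeasure])
 then show "(\<lambda>a. emeasure (Q s a) A) \<in> BM borel_cpt"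
  using Law_State_measurable[OF A] by simp
qed (auto simp: Q_def)

lemma nn_integral_Q_measurable:
 "g \<in> BM borel_cpt ==> (\<lambda>y. LI z. g z wrt Q s y) \<in> BM borel_cpt"
 by (rule nn_integral_measurable_subprob_algebra2[OF _ measurable_prob_algebraD[OF Q_kernel]])
  (simp add: split_beta' measurable_compose[OF measurable_snd])

lemma measurable_State_law_from:
 assumes "\<nu> \<in> initial_dists" "\<sigma> \<in> BM Fu"
 shows "(\<lambda>V. State X (\<sigma> V) V) \<in> law_from X \<nu> \<rightarrow>\<^sub>M borel_cpt"
 by (rule measurable_law_from[OF assms(1) measurable_State_Fu[OF assms(2)]])

text \<open>The ind of an event at time $\sigma + s$ is the hypothesis on \<open>X\<close>; general \<open>g\<close> follow by
 monotone approximation.\<close>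

lemma strong_markov_fun:
 assumes \<nu>: "\<nu> \<in> initial_dists" and \<sigma>: "stopping_time Fil \<sigma>" and s: "s < top"
  and \<Gamma>: "\<Gamma> \<in> sets (fil.pre_sigma \<sigma>)" and g: "g \<in> BM borel_cpt"
 shows "(LI V. ind \<Gamma> V * g (State X (\<sigma> V + s) V) wrt law_from X \<nu>) =
  (LI V. ind \<Gamma> V * (LI z. g z wrt Q s (State X (\<sigma> V) V)) wrt law_from X \<nu>)"
proof -
 have \<sigma>m: "\<sigma> \<in> BM Fu" by (rule stopping_measurable_Fu[OF \<sigma>])
 have S1[measurable]: "(\<lambda>V. State X (\<sigma> V + s) V) \<in> law_from X \<nu> \<rightarrow>\<^sub>M borel_cpt"
  by (rule measurable_State_law_from[OF \<nu>]) (use \<sigma>m in simp)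
 have S0[measurable]: "(\<lambda>V. State X (\<sigma> V) V) \<in> law_from X \<nu> \<rightarrow>\<^sub>M borel_cpt"
  by (rule measurable_State_law_from[OF \<nu> \<sigma>m])
 have G[measurable]: "\<Gamma> \<in> sets (law_from X \<nu>)"
  using pre_sigma_Fu[OF \<sigma> \<Gamma>] Fil_law_from[OF \<nu>] by auto
 have GO: "\<Gamma> \<subseteq> \<Omega>" using sets.sets_into_space[OF G] by simp
 have Qm[measurable]: "h \<in> BM borel_cpt ==>
   (\<lambda>V. LI z. h z wrt Q s (State X (\<sigma> V) V)) \<in> BM (law_from X \<nu>)" for h :: "'s option => ennreal"
  by (rule measurable_compose[OF S0 nn_integral_Q_measurable])
 have Qs[measurable_cong, simp]: "sets (Q s y) = sets borel_cpt" for y by (simp add: Q_def)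
 have Qspace: "space (Q s y) = UNIV" for y by (simp add: Q_def)
 show ?thesis using g
 proof (induction rule: borel_measurable_induct)
  case (cong f g)
  then show ?case by (simp add: Qspace)
 next
  case (set A)
  have "(LI V. ind \<Gamma> V * ind A (State X (\<sigma> V + s) V) wrt law_from X \<nu>) =
    (LI V. ind {V\<in>\<Gamma>. State X (\<sigma> V + s) V \<in> A} V wrt law_from X \<nu>)"
   by (intro nn_integral_cong) (simp add: indicator_def)
  also have "... = emeasure (law_from X \<nu>) {V\<in>\<Gamma>. State X (\<sigma> V + s) V \<in> A}"
  proof (rule nn_integral_indicator)
   have "{V\<in>\<Gamma>. State X (\<sigma> V + s) V \<in> A} = \<Gamma> \<inter> ((\<lambda>V. State X (\<sigma> V + s) V) -` A \<inter> space (law_from X \<nu>))"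
    using GO by auto
   then show "{V\<in>\<Gamma>. State X (\<sigma> V + s) V \<in> A} \<in> sets (law_from X \<nu>)"
    using measurable_sets[OF S1 set(1)] by simp
  qed
  also have "... = (\<integral>\<^sup>+V\<in>\<Gamma>. emeasure (Law X (State X (\<sigma> V) V)) {V'\<in>\<Omega>. State X s V' \<in> A} \<partial>law_from X \<nu>)"
   by (rule strong_markov_hyp[OF \<nu> \<sigma> s set(1) \<Gamma>])
  also have "... = (LI V. ind \<Gamma> V * (LI z. ind A z wrt Q s (State X (\<sigma> V) V)) wrt law_from X \<nu>)"
  proof (intro nn_integral_cong)
   fix V
   have "(LI z. ind A z wrt Q s y) = emeasure (Law X y) {V'\<in>\<Omega>. State X s V' \<in> A}" for y
    using set(1) unfolding Q_def
    by (simp add: emeasure_distr State_Law Law_space vimage_def Int_def conj_commute)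
   then show "emeasure (Law X (State X (\<sigma> V) V)) {V'\<in>\<Omega>. State X s V' \<in> A} * ind \<Gamma> V =
     ind \<Gamma> V * (LI z. ind A z wrt Q s (State X (\<sigma> V) V))" by (simp add: mult.commute)
  qed
  finally show ?case .
 next
  case (mult u c)
  have 1: "(LI z. c * u z wrt Q s y) = c * (LI z. u z wrt Q s y)" for y
   using mult(2) by (intro nn_integral_cmult) simp
  show ?case
   unfolding 1 using mult by (simp add: mult.left_commute[of _ c] nn_integral_cmult)
 next
  case (add u v)
  have 1: "(LI z. v z + u z wrt Q s y) = (LI z. v z wrt Q s y) + (LI z. u z wrt Q s y)" for y
   using add(1,3) by (intro nn_integral_add) auto
  show ?case
   unfolding 1 using add by (simp add: distrib_left nn_integral_add)
 next
  case (seq U)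
  note [measurable] = seq(1)
  have 1: "(LI z. (SUP i. U i) z wrt Q s y) = (SUP i. LI z. U i z wrt Q s y)" for y
   unfolding SUP_apply using seq(1,3) by (intro nn_integral_monotone_convergence_SUP) auto
  have inc1: "incseq (\<lambda>i V. ind \<Gamma> V * U i (State X (\<sigma> V + s) V))"
   using seq(3) by (auto simp: incseq_def le_fun_def intro!: mult_left_mono)
  have inc2: "incseq (\<lambda>i V. ind \<Gamma> V * (LI z. U i z wrt Q s (State X (\<sigma> V) V)))"
   using seq(3) by (auto simp: incseq_def le_fun_def intro!: mult_left_mono nn_integral_mono)
  show ?case
   unfolding 1 unfolding SUP_apply
   by (simp add: SUP_mult_left_ennreal nn_integral_monotone_convergence_SUP inc1 inc2 seq.IH)
 qed
qed

end

context hunt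
begin

text \<open>\<open>gcyl L y\<close> is the probability, under $P_y$, that a path meets the constraints in \<open>L\<close>, a list of
 time increments and sets; \<open>cyl L s\<close> is the corresponding event for the path after time \<open>s\<close>.\<close>

primrec gcyl :: "(ennreal \<times> 's option set) list => 's option => ennreal"
 where "gcyl [] y = 1"
 | "gcyl (rB # L) y = (LI z. ind (snd rB) z * gcyl L z wrt Q (fst rB) y)"

primrec cyl :: "(ennreal \<times> 's option set) list => ennreal => 'w => bool"
 where "cyl [] s V = True"
 | "cyl (rB # L) s V = (State X (s + fst rB) V \<in> snd rB \<and> cyl L (s + fst rB) V)"

abbreviation valid_cyl :: "(ennreal \<times> 's option set) list => bool"
 where "valid_cyl L \<equiv> \<forall>(r, B)\<in>set L. r < top \<and> B \<in> sets borel_cpt"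

lemma gcyl_measurable: "valid_cyl L ==> gcyl L \<in> BM borel_cpt"
proof (induction L)
 case (Cons rB L)
 then have [measurable]: "gcyl L \<in> BM borel_cpt" "snd rB \<in> sets borel_cpt" by auto
 have "(\<lambda>y. LI z. ind (snd rB) z * gcyl L z wrt Q (fst rB) y) \<in> BM borel_cpt"
  by (rule nn_integral_Q_measurable) measurable
 then show ?case by (simp add: fun_eq_iff[symmetric] cong: measurable_cong)
qed (simp add: fun_eq_iff[symmetric] cong: measurable_cong)

text \<open>After the first constraint has been met at $\sigma' = \sigma + r$, which is again a stopping time, the
 other constraints concern the path after $\sigma'$, and the constraint at $\sigma'$ becomes part
 of the event known at that time.\<close>

lemma strong_markov_cyl:
 assumes \<nu>: "\<nu> \<in> initial_dists"
 shows "valid_cyl L ==> stopping_time Fil \<sigma> ==> \<Gamma> \<in> sets (fil.pre_sigma \<sigma>) ==>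
  (LI V. ind \<Gamma> V * ind {V. cyl L (\<sigma> V) V} V wrt law_from X \<nu>) =
  (LI V. ind \<Gamma> V * gcyl L (State X (\<sigma> V) V) wrt law_from X \<nu>)"
proof (induction L arbitrary: \<sigma> \<Gamma>)
 case Nil
 then show ?case by simp
next
 case (Cons rB L)
 obtain r B where rB: "rB = (r, B)" by (cases rB)
 with Cons.prems have v: "r < top" "B \<in> sets borel_cpt" "valid_cyl L" by auto
 define \<sigma>' where "\<sigma>' V = \<sigma> V + r" for V
 define \<Gamma>' where "\<Gamma>' = {V\<in>\<Gamma>. State X (\<sigma>' V) V \<in> B}"
 have \<sigma>': "stopping_time Fil \<sigma>'" unfolding \<sigma>'_def by (rule stopping_time_add[OF Cons.prems(2)])
 have "\<Gamma> \<in> sets (fil.pre_sigma \<sigma>')" unfolding \<sigma>'_def by (rule pre_sigma_add[OF Cons.prems(2,3)])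
 then have \<Gamma>': "\<Gamma>' \<in> sets (fil.pre_sigma \<sigma>')" unfolding \<Gamma>'_def by (rule State_pre_sigma[OF \<sigma>' v(2)])
 have "(LI V. ind \<Gamma> V * ind {V. cyl (rB # L) (\<sigma> V) V} V wrt law_from X \<nu>) =
   (LI V. ind \<Gamma>' V * ind {V. cyl L (\<sigma>' V) V} V wrt law_from X \<nu>)"
  by (intro nn_integral_cong) (auto simp: indicator_def \<Gamma>'_def \<sigma>'_def rB)
 also have "... = (LI V. ind \<Gamma>' V * gcyl L (State X (\<sigma>' V) V) wrt law_from X \<nu>)"
  by (rule Cons.IH[OF v(3) \<sigma>' \<Gamma>'])
 also have "... = (LI V. ind \<Gamma> V * (ind B (State X (\<sigma> V + r) V) * gcyl L (State X (\<sigma> V + r) V)) wrt law_from X \<nu>)"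
  by (intro nn_integral_cong) (auto simp: indicator_def \<Gamma>'_def \<sigma>'_def)
 also have "... = (LI V. ind \<Gamma> V * (LI z. ind B z * gcyl L z wrt Q r (State X (\<sigma> V) V)) wrt law_from X \<nu>)"
  by (rule strong_markov_fun[OF \<nu> Cons.prems(2) v(1) Cons.prems(3)])
   (use gcyl_measurable[OF v(3)] v(2) in measurable)
 finally show ?case by (simp add: rB)
qed

definition cyl_sets :: "'w set set"
 where "cyl_sets = {{V\<in>\<Omega>. \<forall>(s, B)\<in>T. State X s V \<in> B} | T. finite T \<and> (\<forall>(s, B)\<in>T. s < top \<and> B \<in> sets borel_cpt)}"

lemma sorted_cyl:
 "sorted (map fst l) ==> (\<forall>(s, B)\<in>set l. c <= s \<and> s < top \<and> B \<in> sets borel_cpt) ==>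
 \<exists>L. valid_cyl L \<and> (\<forall>V. cyl L c V \<longleftrightarrow> (\<forall>(s, B)\<in>set l. State X s V \<in> B))"
proof (induction l arbitrary: c)
 case Nil
 show ?case by (rule exI[of _ "[]"]) simp
next
 case (Cons sB l)
 obtain s B where sB: "sB = (s, B)" by (cases sB)
 with Cons.prems have p: "c <= s" "s < top" "B \<in> sets borel_cpt" "sorted (map fst l)"
  "\<forall>(s', B)\<in>set l. s <= s' \<and> s' < top \<and> B \<in> sets borel_cpt" by auto
 from Cons.IH[OF p(4,5)] obtain L where L: "valid_cyl L"
  "\<forall>V. cyl L s V \<longleftrightarrow> (\<forall>(s, B)\<in>set l. State X s V \<in> B)" by blast
 have cs: "c + (s - c) = s" using p(1) by (simp add: add_diff_inverse_ennreal)
 show ?case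
 proof (rule exI[of _ "(s - c, B) # L"], intro conjI allI)
  show "valid_cyl ((s - c, B) # L)" using L p by (auto simp: le_less_trans[OF diff_le_self_ennreal])
  show "cyl ((s - c, B) # L) c V \<longleftrightarrow> (\<forall>(s, B)\<in>set (sB # l). State X s V \<in> B)" for V
   using L(2) by (simp add: cs sB)
 qed
qed

lemma cyl_sets_cyl:
 assumes "A \<in> cyl_sets"
 obtains L where "valid_cyl L" "A = {V\<in>\<Omega>. cyl L 0 V}"
  "\<And>V t. V \<in> \<Omega> ==> Shift X t V \<in> A \<longleftrightarrow> cyl L t V"
proof -
 from assms obtain T where T: "finite T" "\<forall>(s, B)\<in>T. s < top \<and> B \<in> sets borel_cpt"
  "A = {V\<in>\<Omega>. \<forall>(s, B)\<in>T. State X s V \<in> B}" unfolding cyl_sets_def by blast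
 obtain l0 where l0: "set l0 = T" using finite_list[OF T(1)] by blast
 define l where "l = sort_key fst l0"
 have l: "set l = T" "sorted (map fst l)" by (simp_all add: l_def l0)
 have "\<exists>L. valid_cyl L \<and> (\<forall>V. cyl L 0 V \<longleftrightarrow> (\<forall>(s, B)\<in>set l. State X s V \<in> B))"
  by (rule sorted_cyl) (use l T in auto)
 then obtain L where L: "valid_cyl L" "\<And>V. cyl L 0 V \<longleftrightarrow> (\<forall>(s, B)\<in>T. State X s V \<in> B)"
  using l by auto
 have sh: "cyl L c (Shift X t V) \<longleftrightarrow> cyl L (t + c) V" if "V \<in> \<Omega>" for V t c L
  by (induction L arbitrary: c) (simp_all add: State_Shift[OF that] add.assoc add.left_commute add.commute[of _ t])
 show ?thesis
 proof (rule that[OF L(1)])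
  show A: "A = {V\<in>\<Omega>. cyl L 0 V}" using T(3) L(2) by simp
  show "Shift X t V \<in> A \<longleftrightarrow> cyl L t V" if "V \<in> \<Omega>" for V t
   using sh[OF that, of L 0 t] Shift_in[OF that] by (simp add: A)
 qed
qed

lemma cyl_sets_Int: "Int_stable cyl_sets"
proof (rule Int_stableI)
 fix a b assume "a \<in> cyl_sets" "b \<in> cyl_sets"
 then obtain S T where "finite S" "\<forall>(s, B)\<in>S. s < top \<and> B \<in> sets borel_cpt"
  "a = {V\<in>\<Omega>. \<forall>(s, B)\<in>S. State X s V \<in> B}"
  "finite T" "\<forall>(s, B)\<in>T. s < top \<and> B \<in> sets borel_cpt"
  "b = {V\<in>\<Omega>. \<forall>(s, B)\<in>T. State X s V \<in> B}" unfolding cyl_sets_def by blast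
 then show "a \<inter> b \<in> cyl_sets"
  unfolding cyl_sets_def by (intro CollectI exI[of _ "S \<union> T"]) auto
qed

lemma cyl_sets_Pow: "cyl_sets \<subseteq> Pow \<Omega>" unfolding cyl_sets_def by auto

lemma space_in_cyl_sets: "\<Omega> \<in> cyl_sets"
 unfolding cyl_sets_def by (intro CollectI exI[of _ "{}"]) auto

lemma State_top: "V \<in> \<Omega> ==> State X top V = None"
 using State_None_iff[of V top] by simp

lemma sets_F0_cyl: "sets F0 = sigma_sets \<Omega> cyl_sets"
proof (intro antisym)
 show "sets F0 \<subseteq> sigma_sets \<Omega> cyl_sets"
  unfolding sets_natural
 proof (rule sigma_sets_mono, safe)
  fix s :: ennreal and B :: "'s option set" assume B: "B \<in> sets borel_cpt"
  show "State X s -` B \<inter> \<Omega> \<in> sigma_sets \<Omega> cyl_sets"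
  proof (cases "s = top")
   case True
   then have "State X s -` B \<inter> \<Omega> = (if None \<in> B then \<Omega> else {})" using State_top by auto
   then show ?thesis using sigma_sets.Empty sigma_sets_top by auto
  next
   case False
   then have "State X s -` B \<inter> \<Omega> \<in> cyl_sets"
    unfolding cyl_sets_def using B by (intro CollectI exI[of _ "{(s, B)}"]) (auto simp: less_top)
   then show ?thesis by (rule sigma_sets.Basic)
  qed
 qed
 have "sigma_sets (space F0) cyl_sets \<subseteq> sets F0"
 proof (rule sets.sigma_sets_subset, safe)
  fix A assume "A \<in> cyl_sets"
  then obtain T where T: "finite T" "\<forall>(s, B)\<in>T. s < top \<and> B \<in> sets borel_cpt"
   "A = {V\<in>\<Omega>. \<forall>(s, B)\<in>T. State X s V \<in> B}" unfolding cyl_sets_def by blast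
  have "A = {V\<in>space F0. \<forall>sB\<in>T. State X (fst sB) V \<in> snd sB}" using T(3) by (auto simp: split_beta)
  also have "... \<in> sets F0"
  proof (rule sets.sets_Collect_finite_All[OF _ T(1)])
   fix sB assume "sB \<in> T"
   then have "snd sB \<in> sets borel_cpt" using T(2) by auto
   from measurable_sets[OF State_natural[of "fst sB" top] this]
   show "{V\<in>space F0. State X (fst sB) V \<in> snd sB} \<in> sets F0"
    by (simp add: vimage_def Int_def conj_commute)
  qed
  finally show "A \<in> sets F0" .
 qed
 then show "sigma_sets \<Omega> cyl_sets \<subseteq> sets F0" by simp
qed

lemma AE_start: "AE V in law_at X x. State X 0 V = x"
proof -
 have A: "{V\<in>\<Omega>. State X 0 V = x} \<in> sets F0"
  using measurable_sets[OF State_natural[of 0 top] sets_borel_cpt_singleton[of x]]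
  by (simp add: vimage_def Int_def conj_commute)
 interpret prob_space "R x" by (rule prob_R)
 have "emeasure (R x) {V\<in>space (R x). State X 0 V = x} = 1"
  using A by (simp add: emeasure_R Law_normal)
 then have "AE V in R x. State X 0 V = x"
  using A sets_R by (subst AE_iff_emeasure_eq_1) (auto simp: pred_def)
 then show ?thesis unfolding law_at_eq by (rule AE_completion)
qed

lemma Law_cyl:
 assumes "valid_cyl L" "{V\<in>\<Omega>. cyl L 0 V} \<in> sets F0"
 shows "emeasure (R y) {V\<in>\<Omega>. cyl L 0 V} = gcyl L y"
proof -
 interpret prob_space "law_at X y" unfolding law_at_eq by (rule prob_space_completion[OF prob_R])
 have sp: "space (law_at X y) = \<Omega>" by (simp add: law_at_eq)
 have "emeasure (R y) {V\<in>\<Omega>. cyl L 0 V} = emeasure (law_at X y) {V\<in>\<Omega>. cyl L 0 V}"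
  using assms sets_R by (simp add: law_at_eq)
 also have "... = (LI V. ind {V\<in>\<Omega>. cyl L 0 V} V wrt law_at X y)"
  using assms sets_R by (subst nn_integral_indicator) (auto simp: law_at_eq)
 also have "... = (LI V. ind \<Omega> V * ind {V. cyl L 0 V} V wrt law_at X y)"
  by (intro nn_integral_cong) (auto simp: indicator_def)
 also have "... = (LI V. ind \<Omega> V * gcyl L (State X 0 V) wrt law_at X y)"
  using strong_markov_cyl[OF return_initial assms(1) stopping_time_const[of Fil 0] pre_sigma_const[of \<Omega> 0], of y]
   sets.top[of "Fil 0"]
  by (simp add: law_from_return)
 also have "... = (LI V. gcyl L y wrt law_at X y)"
  using AE_start[of y] AE_space[of "law_at X y"] by (intro nn_integral_cong_AE) (auto simp: sp)
 also have "... = gcyl L y" using emeasure_space_1 by simp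
 finally show ?thesis .
qed

text \<open>On cylinder events, which generate $\mathscr{F}^0_\infty$, $P_x$ is an iterated integral of
 transition probabilities.\<close>

lemma R_kernel: "R \<in> borel_cpt \<rightarrow>\<^sub>M prob_algebra F0"
proof (rule measurable_prob_algebra_generated[OF sets_F0_cyl cyl_sets_Int cyl_sets_Pow prob_R sets_R])
 fix A assume A: "A \<in> cyl_sets"
 then obtain L where L: "valid_cyl L" "A = {V\<in>\<Omega>. cyl L 0 V}" by (rule cyl_sets_cyl)
 have "A \<in> sets F0" using A by (auto simp: sets_F0_cyl intro: sigma_sets.Basic)
 then show "(\<lambda>a. emeasure (R a) A) \<in> BM borel_cpt"
  using Law_cyl[OF L(1)] gcyl_measurable[OF L(1)] L(2) by simp
qed

lemma R_kernel_sub: "R \<in> borel_cpt \<rightarrow>\<^sub>M subprob_algebra F0"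
 by (rule measurable_prob_algebraD[OF R_kernel])

definition Pbase :: "'s option measure => 'w measure" where "Pbase \<nu> = \<nu> \<bind> R"

lemma initial_space: "\<nu> \<in> initial_dists ==> \<nu> \<in> space (prob_algebra borel_cpt)"
 by (simp add: initial_dists_def space_prob_algebra)

lemma sets_Pbase: "\<nu> \<in> initial_dists ==> sets (Pbase \<nu>) = sets F0"
 unfolding Pbase_def by (rule sets_bind'[OF initial_space R_kernel])

lemma space_Pbase: "\<nu> \<in> initial_dists ==> space (Pbase \<nu>) = \<Omega>"
 using sets_eq_imp_space_eq[OF sets_Pbase] by simp

lemma prob_Pbase: "\<nu> \<in> initial_dists ==> prob_space (Pbase \<nu>)"
 unfolding Pbase_def by (rule prob_space_bind'[OF initial_space R_kernel])

lemma emeasure_Pbase: "\<nu> \<in> initial_dists ==> A \<in> sets F0 ==> emeasure (Pbase \<nu>) A = (LI y. emeasure (R y) A wrt \<nu>)"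
 unfolding Pbase_def by (rule emeasure_bind_prob_algebra[OF initial_space R_kernel])

lemma law_from_eq:
 assumes "\<nu> \<in> initial_dists"
 shows "law_from X \<nu> = completion (Pbase \<nu>)"
proof -
 have "measure_of \<Omega> (sets F0) (\<lambda>\<Gamma>. LI x. emeasure (Law X x) \<Gamma> wrt \<nu>) =
   measure_of \<Omega> (sets F0) (emeasure (Pbase \<nu>))"
  using sets.space_closed[of F0] sets.sigma_sets_eq[of F0]
  by (intro measure_of_eq) (auto simp: emeasure_Pbase[OF assms] emeasure_R)
 also have "... = Pbase \<nu>"
  using measure_of_of_measure[of "Pbase \<nu>"] by (simp add: sets_Pbase space_Pbase assms)
 finally show ?thesis by (simp add: law_from_def)
qed

lemma prob_law_from: "\<nu> \<in> initial_dists ==> prob_space (law_from X \<nu>)"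
 by (simp add: law_from_eq prob_Pbase prob_space_completion)

subsection \<open>From cylinders to completed path functionals\<close>

lemma State_distr_initial:
 assumes "\<nu> \<in> initial_dists" "\<sigma> \<in> BM Fu"
 shows "distr (law_from X \<nu>) borel_cpt (\<lambda>V. State X (\<sigma> V) V) \<in> initial_dists"
 using prob_space.prob_space_distr[OF prob_law_from[OF assms(1)] measurable_State_law_from[OF assms]]
 by (simp add: initial_dists_def)

lemma measurable_Shift_F0:
 assumes "\<sigma> \<in> BM Fu"
 shows "(\<lambda>V. Shift X (\<sigma> V) V) \<in> Fu \<rightarrow>\<^sub>M F0"
 unfolding natural_filtration_def
proof (rule measurable_measure_of[OF natural_gen_Pow])
 show "(\<lambda>V. Shift X (\<sigma> V) V) \<in> space Fu \<rightarrow> \<Omega>" by (auto intro: Shift_in)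
 fix A assume "A \<in> {State X s -` B \<inter> \<Omega> |s B. s <= top \<and> B \<in> sets borel_cpt}"
 then obtain s B where A: "A = State X s -` B \<inter> \<Omega>" "B \<in> sets borel_cpt" by auto
 have "(\<lambda>V. State X (s + \<sigma> V) V) \<in> Fu \<rightarrow>\<^sub>M borel_cpt"
  by (rule measurable_State_Fu) (use assms in simp)
 from measurable_sets[OF this A(2)]
 show "(\<lambda>V. Shift X (\<sigma> V) V) -` A \<inter> space Fu \<in> sets Fu"
  by (rule back_subst[of "\<lambda>A. A \<in> sets Fu"]) (auto simp: A State_Shift Shift_in)
qed

lemma
 assumes \<nu>: "\<nu> \<in> initial_dists" and \<sigma>: "stopping_time Fil \<sigma>"
  and \<Gamma>: "\<Gamma> \<in> sets (fil.pre_sigma \<sigma>)"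
 shows strong_markov_F0: "distr (density (law_from X \<nu>) (ind \<Gamma>)) F0 (\<lambda>V. Shift X (\<sigma> V) V) =
  distr (density (law_from X \<nu>) (ind \<Gamma>)) borel_cpt (\<lambda>V. State X (\<sigma> V) V) \<bind> R" (is "?N1 = ?D \<bind> R")
  and strong_markov_F0_nn: "A \<in> sets F0 ==>
   (LI V. ind \<Gamma> V * ind A (Shift X (\<sigma> V) V) wrt law_from X \<nu>) =
   (LI V. ind \<Gamma> V * emeasure (R (State X (\<sigma> V) V)) A wrt law_from X \<nu>)"
proof -
 have \<sigma>m: "\<sigma> \<in> BM Fu" by (rule stopping_measurable_Fu[OF \<sigma>])
 have S0[measurable]: "(\<lambda>V. State X (\<sigma> V) V) \<in> law_from X \<nu> \<rightarrow>\<^sub>M borel_cpt"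
  by (rule measurable_State_law_from[OF \<nu> \<sigma>m])
 have T[measurable]: "(\<lambda>V. Shift X (\<sigma> V) V) \<in> law_from X \<nu> \<rightarrow>\<^sub>M F0"
  by (rule measurable_law_from[OF \<nu> measurable_Shift_F0[OF \<sigma>m]])
 have G[measurable]: "\<Gamma> \<in> sets (law_from X \<nu>)"
  using pre_sigma_Fu[OF \<sigma> \<Gamma>] Fil_law_from[OF \<nu>] by auto
 interpret prob_space "law_from X \<nu>" by (rule prob_law_from[OF \<nu>])
 have e1: "emeasure ?N1 A = (LI V. ind \<Gamma> V * ind A (Shift X (\<sigma> V) V) wrt law_from X \<nu>)"
  if A: "A \<in> sets F0" for A
 proof -
  have "emeasure ?N1 A = (LI V. ind A V wrt ?N1)" using A by simp
  also have "... = (LI V. ind A (Shift X (\<sigma> V) V) wrt density (law_from X \<nu>) (ind \<Gamma>))"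
   using A by (intro nn_integral_distr) auto
  also have "... = (LI V. ind \<Gamma> V * ind A (Shift X (\<sigma> V) V) wrt law_from X \<nu>)"
   using A T by (intro nn_integral_density) (auto intro!: measurable_compose[OF T])
  finally show ?thesis .
 qed
 have e2: "emeasure (?D \<bind> R) A = (LI V. ind \<Gamma> V * emeasure (R (State X (\<sigma> V) V)) A wrt law_from X \<nu>)"
  if A: "A \<in> sets F0" for A
 proof -
  have m: "(\<lambda>y. emeasure (R y) A) \<in> BM borel_cpt"
   using measurable_compose[OF R_kernel_sub measurable_emeasure_subprob_algebra[OF A]] .
  have "emeasure (?D \<bind> R) A = (LI y. emeasure (R y) A wrt ?D)"
   by (rule emeasure_bind[OF _ _ A]) (use R_kernel_sub in \<open>auto cong: measurable_cong_sets\<close>)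
  also have "... = (LI V. emeasure (R (State X (\<sigma> V) V)) A wrt density (law_from X \<nu>) (ind \<Gamma>))"
   using m by (intro nn_integral_distr) auto
  also have "... = (LI V. ind \<Gamma> V * emeasure (R (State X (\<sigma> V) V)) A wrt law_from X \<nu>)"
   by (intro nn_integral_density) (auto intro!: measurable_compose[OF S0 m])
  finally show ?thesis .
 qed
 show eq: "?N1 = ?D \<bind> R"
 proof (rule measure_eqI_generator_eq[OF cyl_sets_Int cyl_sets_Pow, where A="\<lambda>_. \<Omega>"])
  fix A assume A: "A \<in> cyl_sets"
  then have AF: "A \<in> sets F0" by (auto simp: sets_F0_cyl intro: sigma_sets.Basic)
  obtain L where L: "valid_cyl L" "A = {V\<in>\<Omega>. cyl L 0 V}" "\<And>V t. V \<in> \<Omega> ==> Shift X t V \<in> A \<longleftrightarrow> cyl L t V"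
   using cyl_sets_cyl[OF A] by blast
  have "emeasure ?N1 A = (LI V. ind \<Gamma> V * ind {V. cyl L (\<sigma> V) V} V wrt law_from X \<nu>)"
   unfolding e1[OF AF] using L(3) by (intro nn_integral_cong) (auto simp: indicator_def)
  also have "... = (LI V. ind \<Gamma> V * gcyl L (State X (\<sigma> V) V) wrt law_from X \<nu>)"
   by (rule strong_markov_cyl[OF \<nu> L(1) \<sigma> \<Gamma>])
  also have "... = emeasure (?D \<bind> R) A"
   unfolding e2[OF AF] using Law_cyl[OF L(1)] AF L(2) by simp
  finally show "emeasure ?N1 A = emeasure (?D \<bind> R) A" .
 next
  show "sets ?N1 = sigma_sets \<Omega> cyl_sets" by (simp add: sets_F0_cyl)
  show "sets (?D \<bind> R) = sigma_sets \<Omega> cyl_sets"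
   using sets_bind[of ?D R F0] by (simp add: sets_F0_cyl sets_R)
  show "emeasure ?N1 \<Omega> ~= \<infinity>"
  proof -
   have "emeasure ?N1 \<Omega> <= (LI V. 1 wrt law_from X \<nu>)"
    unfolding e1[OF sets.top[of F0, unfolded space_natural]]
    by (intro nn_integral_mono) (simp add: indicator_def)
   then show ?thesis using emeasure_space_1 by (auto simp: top_unique)
  qed
 qed (auto simp: space_in_cyl_sets)
 show "A \<in> sets F0 ==>
   (LI V. ind \<Gamma> V * ind A (Shift X (\<sigma> V) V) wrt law_from X \<nu>) =
   (LI V. ind \<Gamma> V * emeasure (R (State X (\<sigma> V) V)) A wrt law_from X \<nu>)"
  using e1[of A] e2[of A] eq by simp
qed

lemma distr_Shift:
 assumes \<nu>: "\<nu> \<in> initial_dists" and \<sigma>: "stopping_time Fil \<sigma>"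
 shows "distr (law_from X \<nu>) F0 (\<lambda>V. Shift X (\<sigma> V) V) =
  Pbase (distr (law_from X \<nu>) borel_cpt (\<lambda>V. State X (\<sigma> V) V))"
proof -
 have "density (law_from X \<nu>) (ind \<Omega>) = law_from X \<nu>"
  using sets.top[of "law_from X \<nu>"]
  by (intro trans[OF density_cong density_1]) (auto intro!: AE_I2)
 moreover have "\<Omega> \<in> sets (fil.pre_sigma \<sigma>)"
  using sets.top[of "fil.pre_sigma \<sigma>"] by (simp add: fil.space_pre_sigma)
 ultimately show ?thesis using strong_markov_F0[OF assms, of \<Omega>] by (simp add: Pbase_def)
qed

end

context hunt
begin

text \<open>The universally measurable sets. Expectations of functionals that are only measurable for the
 completed \<open>\<sigma>\<close>-algebras are measurable functions of the starting point in this sense.\<close>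

definition UB :: "'s option measure"
 where "UB = sigma UNIV (\<Inter>\<nu>\<in>initial_dists. sets (completion \<nu>))"

lemma space_initial: "\<nu> \<in> initial_dists ==> space \<nu> = UNIV"
 using sets_eq_imp_space_eq[of \<nu> borel_cpt] by (auto simp: initial_dists_def)

lemma sets_initial: "\<nu> \<in> initial_dists ==> sets \<nu> = sets borel_cpt"
 by (auto simp: initial_dists_def)

lemma space_UB [simp]: "space UB = UNIV" by (simp add: UB_def)

lemma sets_UB: "sets UB = (\<Inter>\<nu>\<in>initial_dists. sets (completion \<nu>))"
proof -
 let ?I = "\<Inter>\<nu>\<in>initial_dists. sets (completion \<nu>) :: 's option set set"
 have "sigma_sets UNIV ?I \<subseteq> sets (completion \<nu>)" if "\<nu> \<in> initial_dists" for \<nu> :: "'s option measure"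
  using sets.sigma_sets_subset[of ?I "completion \<nu>"] that space_initial[OF that] by auto
 then have "sigma_sets UNIV ?I = ?I" by (auto intro: sigma_sets.Basic)
 then show ?thesis unfolding UB_def by (simp add: sets_measure_of)
qed

lemma borel_cpt_UB: "sets borel_cpt \<subseteq> sets UB"
 by (auto simp: sets_UB sets_initial intro!: sets_completionI_sets)

lemma measurable_UB_borel: "f \<in> borel_cpt \<rightarrow>\<^sub>M N ==> f \<in> UB \<rightarrow>\<^sub>M N"
 by (erule measurable_coarser) (auto intro: borel_cpt_UB[THEN subsetD])

lemma measurable_UB_I:
 assumes "\<And>\<nu>. \<nu> \<in> initial_dists ==> f \<in> completion \<nu> \<rightarrow>\<^sub>M N"
 shows "f \<in> UB \<rightarrow>\<^sub>M N"
proof (rule measurableI)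
 show "f x \<in> space N" for x
  using measurable_space[OF assms[OF return_initial[of x]], of x] by simp
 fix A assume A: "A \<in> sets N"
 show "f -` A \<inter> space UB \<in> sets UB"
  unfolding sets_UB
 proof
  fix \<nu> :: "'s option measure" assume "\<nu> \<in> initial_dists"
  from measurable_sets[OF assms[OF this] A] space_initial[OF this]
  show "f -` A \<inter> space UB \<in> sets (completion \<nu>)" by simp
 qed
qed

lemma measurable_State_UB:
 assumes "\<sigma> \<in> BM Fu"
 shows "(\<lambda>V. State X (\<sigma> V) V) \<in> Fu \<rightarrow>\<^sub>M UB"
proof (rule measurableI)
 fix A assume A: "A \<in> sets UB"
 show "(\<lambda>V. State X (\<sigma> V) V) -` A \<inter> space Fu \<in> sets Fu"
  unfolding sets_Fu
 proof
  fix \<nu> :: "'s option measure" assume \<nu>: "\<nu> \<in> initial_dists"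
  define \<nu>' where "\<nu>' = distr (law_from X \<nu>) borel_cpt (\<lambda>V. State X (\<sigma> V) V)"
  have i: "\<nu>' \<in> initial_dists" unfolding \<nu>'_def by (rule State_distr_initial[OF \<nu> assms])
  have S: "(\<lambda>V. State X (\<sigma> V) V) \<in> law_from X \<nu> \<rightarrow>\<^sub>M \<nu>'"
   using measurable_State_law_from[OF \<nu> assms] by (simp add: \<nu>'_def)
  have "distr (law_from X \<nu>) \<nu>' (\<lambda>V. State X (\<sigma> V) V) = \<nu>'"
   unfolding \<nu>'_def by (intro distr_cong) auto
  then have m: "(\<lambda>V. State X (\<sigma> V) V) \<in> law_from X \<nu> \<rightarrow>\<^sub>M completion \<nu>'"
   by (intro complete_measure.measurable_completion2[OF complete_law_from S]) simp
  have "A \<in> sets (completion \<nu>')" using A i by (auto simp: sets_UB)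
  from measurable_sets[OF m this] show "(\<lambda>V. State X (\<sigma> V) V) -` A \<inter> space Fu \<in> sets (law_from X \<nu>)"
by simp
 qed
qed simp

text \<open>The law $P_x$ on the universally completed $\sigma$-algebra.\<close>

definition Pu :: "'s option => 'w measure" where "Pu x = restr_to_subalg (law_at X x) Fu"

lemma space_law_at [simp]: "space (law_at X x) = \<Omega>" by (simp add: law_at_eq)

lemma subalg_Fu: "subalgebra (law_at X x) Fu"
 unfolding subalgebra_def using Fil_law_from[OF return_initial] by (simp add: law_from_return)

lemma sets_Pu [measurable_cong, simp]: "sets (Pu x) = sets Fu"
 unfolding Pu_def by (rule sets_restr_to_subalg[OF subalg_Fu])

lemma space_Pu [simp]: "space (Pu x) = \<Omega>"
 unfolding Pu_def by (simp add: space_restr_to_subalg)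

lemma emeasure_Pu: "A \<in> sets Fu ==> emeasure (Pu x) A = emeasure (law_at X x) A"
 unfolding Pu_def by (rule emeasure_restr_to_subalg[OF subalg_Fu])

lemma prob_Pu: "prob_space (Pu x)"
 unfolding Pu_def law_at_eq[symmetric]
 by (rule prob_space_restr_to_subalg[OF subalg_Fu]) (simp add: law_at_eq prob_space_completion prob_R)

lemma nn_integral_Pu: "f \<in> BM Fu ==> (LI V. f V wrt law_at X x) = (LI V. f V wrt Pu x)"
 unfolding Pu_def by (rule nn_integral_subalgebra2[OF subalg_Fu, symmetric])

lemma F0_Fu: "sets F0 \<subseteq> sets Fu" by (rule natural_Fil)

lemma measurable_F0_Fu: "f \<in> F0 \<rightarrow>\<^sub>M N ==> f \<in> Fu \<rightarrow>\<^sub>M N"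
 by (erule measurable_coarser) (use F0_Fu in auto)

lemma nn_integral_Pu_R:
 assumes "f \<in> BM F0"
 shows "(LI V. f V wrt Pu x) = (LI V. f V wrt R x)"
proof -
 have "(LI V. f V wrt Pu x) = (LI V. f V wrt law_at X x)"
  by (rule nn_integral_Pu[symmetric, OF measurable_F0_Fu[OF assms]])
 then show ?thesis by (simp add: law_at_eq nn_integral_completion)
qed

text \<open>An event of the augmented \<open>\<sigma>\<close>-algebra agrees, for a given initial law, with an event of
 $\mathscr{F}^0_\infty$ up to a null set, and then it has the same probability under $P_y$ for almost
 every starting point \<open>y\<close>.\<close>

lemma Fu_representative:
 assumes D: "D \<in> sets Fu" and \<nu>: "\<nu> \<in> initial_dists"
 obtains D1 where "D1 \<in> sets F0" "AE V in Pbase \<nu>. V \<in> D1 \<longleftrightarrow> V \<in> D"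
  "AE y in \<nu>. emeasure (law_at X y) D = emeasure (R y) D1"
proof -
 have D': "D \<in> sets (completion (Pbase \<nu>))" using D \<nu> by (auto simp: sets_Fu law_from_eq)
 define D1 where "D1 = main_part (Pbase \<nu>) D"
 have D1: "D1 \<in> sets F0" using main_part_sets[OF D'] by (simp add: D1_def sets_Pbase[OF \<nu>])
 have ae: "AE V in Pbase \<nu>. V \<in> D1 \<longleftrightarrow> V \<in> D" unfolding D1_def using D' by (rule AE_in_main_part)
 then obtain N where N: "{V\<in>space (Pbase \<nu>). \<not> (V \<in> D1 \<longleftrightarrow> V \<in> D)} \<subseteq> N" "N \<in> null_sets (Pbase \<nu>)"
  unfolding eventually_ae_filter by blast
 then have NF: "N \<in> sets F0" using sets_Pbase[OF \<nu>] by auto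
 have "(LI y. emeasure (R y) N wrt \<nu>) = 0"
  using emeasure_Pbase[OF \<nu> NF] N(2) by auto
 moreover have "(\<lambda>y. emeasure (R y) N) \<in> BM \<nu>"
  using measurable_compose[OF R_kernel_sub measurable_emeasure_subprob_algebra[OF NF]]
  by (simp cong: measurable_cong_sets add: sets_initial[OF \<nu>])
 ultimately have "AE y in \<nu>. emeasure (R y) N = 0" by (simp add: nn_integral_0_iff_AE)
 then have "AE y in \<nu>. emeasure (law_at X y) D = emeasure (R y) D1"
 proof (rule AE_mp, intro AE_I2 impI)
  fix y assume "emeasure (R y) N = 0"
  then have "N \<in> null_sets (R y)" using NF sets_R by auto
  then have "AE V in R y. V \<notin> N" by (rule AE_not_in)
  then have "AE V in R y. V \<in> D \<longleftrightarrow> V \<in> D1"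
   using AE_space by eventually_elim (use N(1) space_Pbase[OF \<nu>] in auto)
  then have "AE V in law_at X y. V \<in> D \<longleftrightarrow> V \<in> D1" unfolding law_at_eq by (rule AE_completion)
  then have "emeasure (law_at X y) D = emeasure (law_at X y) D1"
   using D D1 F0_Fu subalg_Fu[of y] by (intro emeasure_eq_AE) (auto simp: subalgebra_def)
  also have "... = emeasure (R y) D1" using D1 sets_R by (simp add: law_at_eq)
  finally show "emeasure (law_at X y) D = emeasure (R y) D1" .
 qed
 then show ?thesis using that D1 ae by blast
qed

lemma Pu_kernel: "Pu \<in> UB \<rightarrow>\<^sub>M prob_algebra Fu"
proof (rule measurable_prob_algebra_generated[where G="sets Fu" and \<Omega>="space Fu", OF sets.sigma_sets_eq[symmetric]])
 show "Int_stable (sets Fu)" by (auto simp: Int_stable_def)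
 fix A assume A: "A \<in> sets Fu"
 show "(\<lambda>a. emeasure (Pu a) A) \<in> BM UB"
 proof (rule measurable_UB_I)
  fix \<nu> :: "'s option measure" assume \<nu>: "\<nu> \<in> initial_dists"
  obtain D1 where D1: "D1 \<in> sets F0" "AE y in \<nu>. emeasure (law_at X y) A = emeasure (R y) D1"
   using Fu_representative[OF A \<nu>] by blast
  have "(\<lambda>y. emeasure (R y) D1) \<in> BM \<nu>"
   using measurable_compose[OF R_kernel_sub measurable_emeasure_subprob_algebra[OF D1(1)]]
   by (simp cong: measurable_cong_sets add: sets_initial[OF \<nu>])
  then show "(\<lambda>a. emeasure (Pu a) A) \<in> BM (completion \<nu>)"
   by (rule measurable_completion_cong_AE) (use D1 in \<open>simp_all add: emeasure_Pu[OF A]\<close>)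
 qed
qed (use sets.space_closed[of Fu] in \<open>auto simp: prob_Pu\<close>)

lemma Pu_kernel_sub: "Pu \<in> UB \<rightarrow>\<^sub>M subprob_algebra Fu"
 by (rule measurable_prob_algebraD[OF Pu_kernel])

text \<open>The path after $\sigma$ has the law of a path whose initial law is that of $X_\sigma$. So null
 sets of the latter law pull back to null sets, and completed events to completed events.\<close>

lemma measurable_Shift_Fu:
 assumes \<sigma>: "stopping_time Fil \<sigma>"
 shows "(\<lambda>V. Shift X (\<sigma> V) V) \<in> Fu \<rightarrow>\<^sub>M Fu"
proof (rule measurableI)
 note \<sigma>m = stopping_measurable_Fu[OF \<sigma>]
 fix A assume A: "A \<in> sets Fu"
 show "(\<lambda>V. Shift X (\<sigma> V) V) -` A \<inter> space Fu \<in> sets Fu"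
  unfolding sets_Fu
 proof
  fix \<nu> :: "'s option measure" assume \<nu>: "\<nu> \<in> initial_dists"
  define \<nu>' where "\<nu>' = distr (law_from X \<nu>) borel_cpt (\<lambda>V. State X (\<sigma> V) V)"
  have i: "\<nu>' \<in> initial_dists" unfolding \<nu>'_def by (rule State_distr_initial[OF \<nu> \<sigma>m])
  have S: "(\<lambda>V. Shift X (\<sigma> V) V) \<in> law_from X \<nu> \<rightarrow>\<^sub>M Pbase \<nu>'"
   using measurable_law_from[OF \<nu> measurable_Shift_F0[OF \<sigma>m]]
   by (simp cong: measurable_cong_sets add: sets_Pbase[OF i])
  have "distr (law_from X \<nu>) (Pbase \<nu>') (\<lambda>V. Shift X (\<sigma> V) V) = distr (law_from X \<nu>) F0 (\<lambda>V. Shift X (\<sigma> V) V)"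
   by (intro distr_cong) (simp_all add: sets_Pbase[OF i])
  also have "... = Pbase \<nu>'" unfolding \<nu>'_def by (rule distr_Shift[OF \<nu> \<sigma>])
  finally have m: "(\<lambda>V. Shift X (\<sigma> V) V) \<in> law_from X \<nu> \<rightarrow>\<^sub>M completion (Pbase \<nu>')"
   by (intro complete_measure.measurable_completion2[OF complete_law_from S]) simp
  have "A \<in> sets (completion (Pbase \<nu>'))" using A i by (auto simp: sets_Fu law_from_eq)
  from measurable_sets[OF m this] show "(\<lambda>V. Shift X (\<sigma> V) V) -` A \<inter> space Fu \<in> sets (law_from X \<nu>)"
by simp
 qed
qed (auto intro: Shift_in)

lemma strong_markov_sets:
 assumes \<sigma>: "stopping_time Fil \<sigma>" and \<Gamma>: "\<Gamma> \<in> sets (fil.pre_sigma \<sigma>)" and D: "D \<in> sets Fu"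
 shows "(LI V. ind \<Gamma> V * ind D (Shift X (\<sigma> V) V) wrt Pu x) =
  (LI V. ind \<Gamma> V * emeasure (Pu (State X (\<sigma> V) V)) D wrt Pu x)"
proof -
 note \<sigma>m = stopping_measurable_Fu[OF \<sigma>]
 note \<nu> = return_initial[of x]
 let ?P = "law_at X x"
 have P: "law_from X (return borel_cpt x) = ?P" by (rule law_from_return)
 define \<nu>' where "\<nu>' = distr ?P borel_cpt (\<lambda>V. State X (\<sigma> V) V)"
 have i: "\<nu>' \<in> initial_dists"
  using State_distr_initial[OF \<nu> \<sigma>m] by (simp add: \<nu>'_def P)
 obtain D1 where D1: "D1 \<in> sets F0" "AE V in Pbase \<nu>'. V \<in> D1 \<longleftrightarrow> V \<in> D"
  "AE y in \<nu>'. emeasure (law_at X y) D = emeasure (R y) D1"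
  using Fu_representative[OF D i] by blast
 have S: "(\<lambda>V. State X (\<sigma> V) V) \<in> ?P \<rightarrow>\<^sub>M borel_cpt"
  using measurable_State_law_from[OF \<nu> \<sigma>m] by (simp add: P)
 have T: "(\<lambda>V. Shift X (\<sigma> V) V) \<in> ?P \<rightarrow>\<^sub>M F0"
  using measurable_law_from[OF \<nu> measurable_Shift_F0[OF \<sigma>m]] by (simp add: P)
 have pe: "Pbase \<nu>' = distr ?P F0 (\<lambda>V. Shift X (\<sigma> V) V)"
  using distr_Shift[OF \<nu> \<sigma>] by (simp add: \<nu>'_def P)
 have ae1: "AE V in ?P. Shift X (\<sigma> V) V \<in> D1 \<longleftrightarrow> Shift X (\<sigma> V) V \<in> D"
  by (rule AE_distrD[OF T D1(2)[unfolded pe]])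
 have ae2: "AE V in ?P. emeasure (law_at X (State X (\<sigma> V) V)) D = emeasure (R (State X (\<sigma> V) V)) D1"
  using D1(3) unfolding \<nu>'_def by (rule AE_distrD[OF S])
 have G: "\<Gamma> \<in> sets Fu" by (rule pre_sigma_Fu[OF \<sigma> \<Gamma>])
 have "(LI V. ind \<Gamma> V * ind D (Shift X (\<sigma> V) V) wrt Pu x) =
   (LI V. ind \<Gamma> V * ind D (Shift X (\<sigma> V) V) wrt ?P)"
  using G D by (intro nn_integral_Pu[symmetric] borel_measurable_times_ennreal borel_measurable_indicator
    measurable_compose[OF measurable_Shift_Fu[OF \<sigma>]])
 also have "... = (LI V. ind \<Gamma> V * ind D1 (Shift X (\<sigma> V) V) wrt ?P)"
  using ae1 by (intro nn_integral_cong_AE) (auto simp: indicator_def)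
 also have "... = (LI V. ind \<Gamma> V * emeasure (R (State X (\<sigma> V) V)) D1 wrt ?P)"
  using strong_markov_F0_nn[OF \<nu> \<sigma> \<Gamma> D1(1)] by (simp add: P)
 also have "... = (LI V. ind \<Gamma> V * emeasure (Pu (State X (\<sigma> V) V)) D wrt ?P)"
  using ae2 by (intro nn_integral_cong_AE) (auto simp: emeasure_Pu[OF D])
 also have "... = (LI V. ind \<Gamma> V * emeasure (Pu (State X (\<sigma> V) V)) D wrt Pu x)"
  using G by (intro nn_integral_Pu borel_measurable_times_ennreal borel_measurable_indicator
    measurable_compose[OF measurable_State_UB[OF \<sigma>m]]
    measurable_compose[OF Pu_kernel_sub measurable_emeasure_subprob_algebra[OF D]])
 finally show ?thesis .
qed

text \<open>The two sides define measures on pairs of a time and a path, which agree on rectangles by the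
 property for events.\<close>

theorem strong_markov:
 assumes \<sigma>: "stopping_time Fil \<sigma>" and H: "H \<in> BM (TF)"
 shows "(LI V. H (\<sigma> V, Shift X (\<sigma> V) V) wrt Pu x) =
  (LI V. (LI V'. H (\<sigma> V, V') wrt Pu (State X (\<sigma> V) V)) wrt Pu x)"
proof -
 note \<sigma>m[measurable] = stopping_measurable_Fu[OF \<sigma>]
 note T[measurable] = measurable_Shift_Fu[OF \<sigma>]
 interpret prob_space "Pu x" by (rule prob_Pu)
 let ?B = "borel \<Otimes>\<^sub>M Fu :: (ennreal \<times> 'w) measure"
 define K where "K V = distr (Pu (State X (\<sigma> V) V)) ?B (Pair (\<sigma> V))" for V
 have Km: "K \<in> Fu \<rightarrow>\<^sub>M prob_algebra ?B"
  unfolding K_def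
  by (rule measurable_distr_prob_space2[OF measurable_compose[OF measurable_State_UB[OF \<sigma>m] Pu_kernel]]) simp
 have KP: "K \<in> Pu x \<rightarrow>\<^sub>M subprob_algebra ?B"
  using measurable_prob_algebraD[OF Km] by (simp cong: measurable_cong_sets)
 have K_nn: "(LI z. g z wrt K V) = (LI V'. g (\<sigma> V, V') wrt Pu (State X (\<sigma> V) V))"
  if "g \<in> BM ?B" for g V
  unfolding K_def by (rule nn_integral_distr) (use that in auto)
 let ?N1 = "distr (Pu x) ?B (\<lambda>V. (\<sigma> V, Shift X (\<sigma> V) V))"
 let ?N2 = "Pu x \<bind> K"
 have "?N1 = ?N2"
 proof (rule measure_eqI_generator_eq[OF Int_stable_pair_measure_generator[of borel Fu], where A="\<lambda>_. UNIV \<times> \<Omega>"])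
  fix A :: "(ennreal \<times> 'w) set" assume "A \<in> {a \<times> b |a b. a \<in> sets borel \<and> b \<in> sets Fu}"
  then obtain C D where A: "A = C \<times> D" "C \<in> sets borel" "D \<in> sets Fu" by auto
  define \<Gamma> where "\<Gamma> = \<sigma> -` C \<inter> \<Omega>"
  have \<Gamma>: "\<Gamma> \<in> sets (fil.pre_sigma \<sigma>)"
   using measurable_sets[OF fil.measurable_stopping_time_pre_sigma[OF \<sigma>] A(2)]
   by (simp add: \<Gamma>_def fil.space_pre_sigma)
  have AB: "A \<in> sets ?B" using A by auto
  have "emeasure ?N1 A = (LI V. ind A (\<sigma> V, Shift X (\<sigma> V) V) wrt Pu x)"
   using AB by (subst nn_integral_indicator[symmetric], simp) (rule nn_integral_distr, auto)
  also have "... = (LI V. ind \<Gamma> V * ind D (Shift X (\<sigma> V) V) wrt Pu x)"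
   by (intro nn_integral_cong) (auto simp: A \<Gamma>_def indicator_def)
  also have "... = (LI V. ind \<Gamma> V * emeasure (Pu (State X (\<sigma> V) V)) D wrt Pu x)"
   by (rule strong_markov_sets[OF \<sigma> \<Gamma> A(3)])
  also have "... = (LI V. emeasure (K V) A wrt Pu x)"
  proof (intro nn_integral_cong)
   fix V assume w: "V \<in> space (Pu x)"
   have "emeasure (K V) A = (LI z. ind A z wrt K V)"
    using AB by (subst nn_integral_indicator) (auto simp: K_def)
   also have "... = (LI V'. ind \<Gamma> V * ind D V' wrt Pu (State X (\<sigma> V) V))"
    unfolding K_nn[OF borel_measurable_indicator[OF AB]]
    using w by (intro nn_integral_cong) (auto simp: A \<Gamma>_def indicator_def)
   also have "... = ind \<Gamma> V * emeasure (Pu (State X (\<sigma> V) V)) D"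
    using A(3) by (simp add: nn_integral_cmult_indicator)
   finally show "ind \<Gamma> V * emeasure (Pu (State X (\<sigma> V) V)) D = emeasure (K V) A" by simp
  qed
  also have "... = emeasure ?N2 A"
   by (rule emeasure_bind[OF _ KP AB, symmetric]) (use not_empty in auto)
  finally show "emeasure ?N1 A = emeasure ?N2 A" .
 next
  show "sets ?N1 = sigma_sets (space borel \<times> space Fu) {a \<times> b |a b. a \<in> sets borel \<and> b \<in> sets Fu}"
   by (simp only: sets_distr sets_pair_measure)
  show "sets ?N2 = sigma_sets (space borel \<times> space Fu) {a \<times> b |a b. a \<in> sets borel \<and> b \<in> sets Fu}"
   using sets_bind[of "Pu x" K ?B] not_empty unfolding sets_pair_measure[symmetric] by (auto simp: K_def)
  show "emeasure ?N1 (UNIV \<times> \<Omega>) ~= \<infinity>"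
  proof -
   interpret N1: prob_space ?N1 by (rule prob_space_distr) simp
   show ?thesis by simp
  qed
  show "range (\<lambda>_. UNIV \<times> \<Omega>) \<subseteq> {a \<times> b |a b. a \<in> sets (borel :: ennreal measure) \<and> b \<in> sets Fu}"
   using sets.top[of Fu] by (intro image_subsetI CollectI exI[of _ UNIV] exI[of _ \<Omega>]) auto
 qed (use sets.space_closed[of Fu] in auto)
 then have "(LI z. H z wrt ?N1) = (LI z. H z wrt ?N2)" by simp
 moreover have "(LI z. H z wrt ?N1) = (LI V. H (\<sigma> V, Shift X (\<sigma> V) V) wrt Pu x)"
  using H by (intro nn_integral_distr) auto
 moreover have "(LI z. H z wrt ?N2) = (LI V. (LI z. H z wrt K V) wrt Pu x)"
  by (rule nn_integral_bind[OF H KP])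
 ultimately show ?thesis using K_nn[OF H] by simp
qed

theorem markov:
 assumes Z: "Z \<in> BM (Fil t)" and Y: "Y \<in> BM Fu"
 shows "(LI V. Z V * Y (Shift X t V) wrt Pu x) =
  (LI V. Z V * (LI V'. Y V' wrt Pu (State X t V)) wrt Pu x)"
proof -
 interpret prob_space "Pu x" by (rule prob_Pu)
 have T: "(\<lambda>V. Shift X t V) \<in> Fu \<rightarrow>\<^sub>M Fu" by (rule measurable_Shift_Fu[OF stopping_time_const])
 have S: "(\<lambda>V. State X t V) \<in> Fu \<rightarrow>\<^sub>M UB" by (rule measurable_State_UB) simp
 have Zu: "f \<in> BM Fu" if "f \<in> BM (Fil t)" for f :: "'w => ennreal"
  using measurable_Fil_mono[of t top, OF _ that] by simp
 have YT[measurable]: "(\<lambda>V. Y (Shift X t V)) \<in> BM Fu" by (rule measurable_compose[OF T Y])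
 have YS[measurable]: "(\<lambda>V. LI V'. Y V' wrt Pu (State X t V)) \<in> BM Fu"
  by (rule measurable_compose[OF S]) (rule measurable_compose[OF Pu_kernel_sub nn_integral_measurable_subprob_algebra[OF Y]])
 show ?thesis using Z
 proof (induction rule: borel_measurable_induct)
  case (cong f g)
  then show ?case by (simp cong: nn_integral_cong_simp)
 next
  case (set \<Gamma>)
  have G: "\<Gamma> \<in> sets Fu" using set sets_Fil_mono[of t top] by auto
  let ?D = "density (Pu x) (ind \<Gamma>)"
  have "distr ?D Fu (\<lambda>V. Shift X t V) = distr ?D UB (\<lambda>V. State X t V) \<bind> Pu" (is "?N1 = ?N2")
  proof (rule measure_eqI)
   show "sets ?N1 = sets ?N2" using sets_bind[of "distr ?D UB (\<lambda>V. State X t V)" Pu Fu] by simp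
   fix D assume "D \<in> sets ?N1"
   then have D: "D \<in> sets Fu" by simp
   have mD: "(\<lambda>y. emeasure (Pu y) D) \<in> BM UB"
    by (rule measurable_compose[OF Pu_kernel_sub measurable_emeasure_subprob_algebra[OF D]])
   have "emeasure ?N1 D = (LI V. ind D V wrt ?N1)" using D by simp
   also have "... = (LI V. ind D (Shift X t V) wrt ?D)"
    using D T by (intro nn_integral_distr) (auto cong: measurable_cong_sets)
   also have "... = (LI V. ind \<Gamma> V * ind D (Shift X t V) wrt Pu x)"
    using G D T by (intro nn_integral_density) (auto intro!: measurable_compose[OF T] cong: measurable_cong_sets)
   also have "... = (LI V. ind \<Gamma> V * emeasure (Pu (State X t V)) D wrt Pu x)"
    by (rule strong_markov_sets[OF stopping_time_const pre_sigma_const[OF set] D])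
   also have "... = (LI V. emeasure (Pu (State X t V)) D wrt ?D)"
    using G S by (intro nn_integral_density[symmetric]) (auto intro!: measurable_compose[OF S mD] cong: measurable_cong_sets)
   also have "... = (LI y. emeasure (Pu y) D wrt distr ?D UB (\<lambda>V. State X t V))"
    using S mD by (intro nn_integral_distr[symmetric]) (auto cong: measurable_cong_sets)
   also have "... = emeasure ?N2 D"
    by (rule emeasure_bind[OF _ _ D, symmetric]) (use Pu_kernel_sub in \<open>auto cong: measurable_cong_sets\<close>)
   finally show "emeasure ?N1 D = emeasure ?N2 D" .
  qed
  then have "(LI V. Y V wrt ?N1) = (LI V. Y V wrt ?N2)" by simp
  moreover have "(LI V. Y V wrt ?N1) = (LI V. Y (Shift X t V) wrt ?D)"
   using T Y by (intro nn_integral_distr) (auto cong: measurable_cong_sets)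
  moreover have "... = (LI V. ind \<Gamma> V * Y (Shift X t V) wrt Pu x)"
   using G by (intro nn_integral_density) auto
  moreover have "(LI V. Y V wrt ?N2) = (LI y. (LI V. Y V wrt Pu y) wrt distr ?D UB (\<lambda>V. State X t V))"
   by (rule nn_integral_bind[OF Y]) (use Pu_kernel_sub in \<open>auto cong: measurable_cong_sets\<close>)
  moreover have "... = (LI V. (LI V'. Y V' wrt Pu (State X t V)) wrt ?D)"
   using S measurable_compose[OF Pu_kernel_sub nn_integral_measurable_subprob_algebra[OF Y]]
   by (intro nn_integral_distr) (auto cong: measurable_cong_sets)
  moreover have "... = (LI V. ind \<Gamma> V * (LI V'. Y V' wrt Pu (State X t V)) wrt Pu x)"
   using G by (intro nn_integral_density) auto
  ultimately show ?case by simp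
 next
  case (mult u c)
  then show ?case using Zu[OF mult(2)] by (simp add: mult.assoc nn_integral_cmult)
 next
  case (add u v)
  then show ?case using Zu[OF add(1)] Zu[OF add(3)] by (simp add: distrib_right nn_integral_add)
 next
  case (seq U)
  have inc: "incseq (\<lambda>i V. U i V * g V)" for g :: "'w => ennreal"
   using seq(3) by (auto simp: incseq_def le_fun_def intro!: mult_right_mono)
  show ?case
   unfolding SUP_apply using Zu[OF seq(1)]
   by (simp add: SUP_mult_right_ennreal nn_integral_monotone_convergence_SUP inc seq.IH)
 qed
qed

end

context hunt
begin

lemma AE_Pu_start: "AE V in Pu x. State X 0 V = x"
proof -
 have A: "{V\<in>\<Omega>. State X 0 V = x} \<in> sets F0"
  using measurable_sets[OF State_natural[of 0 top] sets_borel_cpt_singleton[of x]]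
  by (simp add: vimage_def Int_def conj_commute)
 interpret prob_space "Pu x" by (rule prob_Pu)
 have "emeasure (Pu x) {V\<in>space (Pu x). State X 0 V = x} = 1"
  using A F0_Fu sets_R by (auto simp: emeasure_Pu law_at_eq emeasure_R Law_normal)
 then show ?thesis
  using A F0_Fu by (subst AE_iff_emeasure_eq_1) (auto simp: pred_def)
qed

lemma AE_Pu_None: "AE V in Pu None. \<forall>t. State X t V = None"
 using AE_Pu_start[of None] AE_space
proof eventually_elim
 case (elim V)
 then have w: "V \<in> \<Omega>" by simp
 have "life_time X V <= t" for t using elim State_None_iff[OF w, of 0] order_trans[of _ 0 t] by simp
 then show ?case using State_None_iff[OF w] by simp
qed

text \<open>The transition operators, acting on functions on the compactification.\<close>

definition TT :: "ennreal => ('s option => ennreal) => 's option => ennreal"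
 where "TT s h y = (LI V. h (State X s V) wrt Pu y)"

lemma State_UB: "State X s \<in> Fu \<rightarrow>\<^sub>M UB"
 using measurable_State_UB[of "\<lambda>_. s"] by simp

lemma TT_UB: "h \<in> BM UB ==> TT s h \<in> BM UB"
 unfolding TT_def
 by (rule measurable_compose[OF Pu_kernel_sub nn_integral_measurable_subprob_algebra[OF measurable_compose[OF State_UB]]])

lemma TT_joint:
 assumes "(\<lambda>(s, y). h s y) \<in> BM (borel \<Otimes>\<^sub>M borel_cpt)"
 shows "(\<lambda>(s, y). TT s (h s) y) \<in> BM (borel \<Otimes>\<^sub>M borel_cpt)"
proof -
 have J: "(\<lambda>z. State X (fst z) (snd z)) \<in> borel \<Otimes>\<^sub>M F0 \<rightarrow>\<^sub>M borel_cpt"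
  using State_joint by (simp add: split_beta')
 have eq: "TT s (h s) y = (LI V. h s (State X s V) wrt R y)" for s y
 proof -
  have "Pair s \<in> borel_cpt \<rightarrow>\<^sub>M borel \<Otimes>\<^sub>M borel_cpt" by simp
  from measurable_compose[OF this assms] have "h s \<in> BM borel_cpt" by simp
  then show ?thesis unfolding TT_def
   by (intro nn_integral_Pu_R measurable_compose[OF State_natural]) auto
 qed
 have R': "(\<lambda>z. R (snd z)) \<in> borel \<Otimes>\<^sub>M borel_cpt \<rightarrow>\<^sub>M subprob_algebra F0"
  by (rule measurable_compose[OF measurable_snd R_kernel_sub])
 have "(\<lambda>z. LI V. h (fst z) (State X (fst z) V) wrt R (snd z)) \<in> BM (borel \<Otimes>\<^sub>M borel_cpt)"
 proof (rule nn_integral_measurable_subprob_algebra2[OF _ R'])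
  have m: "(\<lambda>w. (fst (fst w), State X (fst (fst w)) (snd w))) \<in> (borel \<Otimes>\<^sub>M borel_cpt) \<Otimes>\<^sub>M F0 \<rightarrow>\<^sub>M borel \<Otimes>\<^sub>M borel_cpt"
  proof (rule measurable_Pair)
   have "(\<lambda>w. (fst (fst w), snd w)) \<in> (borel \<Otimes>\<^sub>M borel_cpt) \<Otimes>\<^sub>M F0 \<rightarrow>\<^sub>M borel \<Otimes>\<^sub>M F0" by measurable
   from measurable_compose[OF this J]
   show "(\<lambda>w. State X (fst (fst w)) (snd w)) \<in> (borel \<Otimes>\<^sub>M borel_cpt) \<Otimes>\<^sub>M F0 \<rightarrow>\<^sub>M borel_cpt" by simp
  qed measurable
  from measurable_compose[OF this assms]
  show "(\<lambda>(z, V). h (fst z) (State X (fst z) V)) \<in> BM ((borel \<Otimes>\<^sub>M borel_cpt) \<Otimes>\<^sub>M F0)"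
   by (simp add: split_beta')
 qed
 then show ?thesis by (simp add: eq split_beta')
qed

lemma TT_joint' [measurable (raw)]:
 assumes f: "f \<in> BM N" and h: "h \<in> BM borel_cpt" and g: "g \<in> N \<rightarrow>\<^sub>M borel_cpt"
 shows "(\<lambda>z. TT (f z) h (g z)) \<in> BM N"
proof -
 have 1: "(\<lambda>(s :: ennreal, y). TT s h y) \<in> BM (borel \<Otimes>\<^sub>M borel_cpt)"
  by (rule TT_joint) (use h in \<open>simp add: split_beta'\<close>)
 have 2: "(\<lambda>z. (f z, g z)) \<in> N \<rightarrow>\<^sub>M borel \<Otimes>\<^sub>M borel_cpt" using f g by (rule measurable_Pair)
 from measurable_compose[OF 2 1] show ?thesis by simp
qed

lemma State_fun_Pu:
 "h \<in> BM borel_cpt ==> (\<lambda>V. h (State X s V)) \<in> BM (Pu x)"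
 using measurable_compose[OF State_Fil[OF top_greatest]] by (simp cong: measurable_cong_sets)

lemma TT_borel:
 assumes "h \<in> BM borel_cpt"
 shows "TT s h \<in> BM borel_cpt"
proof -
 have "(\<lambda>(s :: ennreal, y). h y) \<in> BM (borel \<Otimes>\<^sub>M borel_cpt)"
  using measurable_compose[OF measurable_snd assms] by (simp add: split_beta')
 note J = TT_joint[OF this]
 have "Pair s \<in> borel_cpt \<rightarrow>\<^sub>M borel \<Otimes>\<^sub>M borel_cpt" by simp
 from measurable_compose[OF this J] show ?thesis by simp
qed

lemma TT_0: "TT 0 h y = h y"
proof -
 interpret prob_space "Pu y" by (rule prob_Pu)
 have "TT 0 h y = (LI V. h y wrt Pu y)"
  unfolding TT_def using AE_Pu_start[of y] by (intro nn_integral_cong_AE) auto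
 then show ?thesis using emeasure_space_1 by simp
qed

lemma TT_None: "TT s h None = h None"
proof -
 interpret prob_space "Pu None" by (rule prob_Pu)
 have "TT s h None = (LI V. h None wrt Pu None)"
  unfolding TT_def using AE_Pu_None by (intro nn_integral_cong_AE) auto
 then show ?thesis using emeasure_space_1 by simp
qed

lemma TT_mono: "(\<And>y. h y <= k y) ==> TT s h y <= TT s k y"
 unfolding TT_def by (intro nn_integral_mono) auto

lemma TT_const: "TT s (\<lambda>_. c) y = c"
 unfolding TT_def using prob_space.emeasure_space_1[OF prob_Pu[of y]] by simp

lemma TT_le: "(\<And>y. h y <= c) ==> TT s h y <= c"
 using TT_mono[of h "\<lambda>_. c" s y] by (simp add: TT_const)

lemma nn_integral_Shift:
 assumes "Y \<in> BM Fu"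
 shows "(LI V. Y (Shift X t V) wrt Pu x) = TT t (\<lambda>y. LI V. Y V wrt Pu y) x"
 using markov[of "\<lambda>_. 1" t Y x] assms by (simp add: TT_def)

lemma TT_add:
 assumes "h \<in> BM UB"
 shows "TT s (TT r h) y = TT (s + r) h y"
proof -
 have "TT s (TT r h) y = (LI V. h (State X r (Shift X s V)) wrt Pu y)"
  using nn_integral_Shift[where Y="\<lambda>V. h (State X r V)" and t=s and x=y] measurable_compose[OF State_UB assms]
  by (simp add: TT_def)
 also have "... = TT (s + r) h y"
  unfolding TT_def by (intro nn_integral_cong) (simp add: State_Shift add.commute)
 finally show ?thesis .
qed

end

locale hunt_setting = hunt X
 for X :: "('w, 's::{metric_space, second_countable_topology}) process" +
 fixes m :: "'s measure" and p :: "ennreal => 's => 's => ennreal"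
 assumes radon: "radon_full_support m" and dens: "transition_density m X p"
begin

lemma sets_m [measurable_cong, simp]: "sets m = sets borel"
 using radon by (simp add: radon_full_support_def)

lemma space_m [simp]: "space m = UNIV"
 using sets_eq_imp_space_eq[OF sets_m] by simp

lemma sigma_finite_m_cover:
 "\<exists>A. countable A \<and> A \<subseteq> sets m \<and> \<Union>A = UNIV \<and> (\<forall>a\<in>A. emeasure m a ~= \<infinity>)"
proof -
 obtain \<B> :: "'s set set" where \<B>: "countable \<B>" "topological_basis \<B>"
  using ex_countable_basis by auto
 define A where "A = {B \<in> \<B>. emeasure m B < \<infinity>}"
 have "\<exists>B\<in>A. y \<in> B" for y
 proof -
  obtain Vo K where VK: "open Vo" "compact K" "y \<in> Vo" "Vo \<subseteq> K"
   using lc unfolding locally_compact_space_def by (metis UNIV_I compactin_euclidean_iff open_openin topspace_euclidean)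
  obtain B where B: "B \<in> \<B>" "y \<in> B" "B \<subseteq> Vo"
   using topological_basisE[OF \<B>(2) VK(1,3)] by auto
  have "emeasure m B <= emeasure m K"
   using B VK by (intro emeasure_mono) (auto simp: compact_imp_closed)
  also have "... < \<infinity>" using radon VK(2) by (simp add: radon_full_support_def)
  finally show ?thesis using B by (auto simp: A_def)
 qed
 then have "\<Union>A = UNIV" by blast
 moreover have "countable A" using \<B>(1) by (simp add: A_def)
 moreover have "A \<subseteq> sets m" using topological_basis_open[OF \<B>(2)] by (auto simp: A_def)
 moreover have "\<forall>a\<in>A. emeasure m a ~= \<infinity>" by (auto simp: A_def)
 ultimately show ?thesis by blast
qed

lemma sigma_finite_m: "sigma_finite_measure m"
 using sigma_finite_m_cover by unfold_locales auto

text \<open>All integrals over the state space are taken against the completion of \<open>m\<close>, because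
 expectations of completed path functionals are only universally measurable.\<close>

abbreviation M where "M \<equiv> completion m"

sublocale M: sigma_finite_measure M
proof
 obtain A where "countable A" "A \<subseteq> sets m" "\<Union>A = UNIV" "\<forall>a\<in>A. emeasure m a ~= \<infinity>"
  using sigma_finite_m_cover by blast
 moreover from this have "emeasure M a = emeasure m a" if "a \<in> A" for a
  using that by (subst emeasure_completion) auto
 ultimately show "\<exists>A. countable A \<and> A \<subseteq> sets M \<and> \<Union>A = space M \<and> (\<forall>a\<in>A. emeasure M a ~= \<infinity>)"
  by (intro exI[of _ A]) auto
qed

lemma positive_integrable:
 obtains h where "h \<in> BM borel" "\<And>x. 0 < h x" "\<And>x. h x <= 1" "(LI x. h x wrt m) < \<infinity>"
  "(LI x. h x wrt m) > 0"
proof -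
 obtain h where h: "h \<in> BM m" "integral\<^sup>N m h ~= \<infinity>" "\<And>x. 0 < h x"
  using sigma_finite_measure.Ex_finite_integrable_function[OF sigma_finite_m] by auto
 have hm: "h \<in> BM borel" using h(1) by (simp cong: measurable_cong_sets)
 have fin: "(LI x. min 1 (h x) wrt m) < \<infinity>"
  using h(2) nn_integral_mono[of m "\<lambda>x. min 1 (h x)" h] by (auto simp: less_top[symmetric] top_unique)
 have "(LI x. min 1 (h x) wrt m) ~= 0"
 proof
  assume "(LI x. min 1 (h x) wrt m) = 0"
  then have "AE x in m. min 1 (h x) = 0" using h(1) by (subst (asm) nn_integral_0_iff_AE) auto
  moreover have "min 1 (h x) ~= 0" for x using h(3)[of x] by (auto simp: min_def)
  ultimately have "AE x in m. False" by simp
  then have "emeasure m UNIV = 0"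
   using AE_iff_null[of m "\<lambda>_. False"] by (simp add: null_sets_def)
  moreover have "emeasure m UNIV > 0" using radon by (simp add: radon_full_support_def)
  ultimately show False by simp
 qed
 then show ?thesis
  using hm h(3) fin by (intro that[of "\<lambda>x. min 1 (h x)"]) (auto simp: zero_less_iff_neq_zero min_def)
qed

text \<open>A probability measure equivalent to \<open>m\<close> is among the initial laws with respect to whose
 completion \<open>g\<close> is measurable.\<close>

lemma UB_representative:
 fixes g :: "'s option => ennreal"
 assumes g: "g \<in> BM UB"
 obtains g' where "g' \<in> BM borel_cpt" "g' None = g None" "AE y in m. g (Some y) = g' (Some y)"
proof -
 obtain h where h: "h \<in> BM borel" "\<And>x. 0 < h x" "\<And>x. h x <= 1" "(LI x. h x wrt m) < \<infinity>"
  "(LI x. h x wrt m) > 0" using positive_integrable by blast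
 define c where "c = (LI x. h x wrt m)"
 define N where "N = density m (\<lambda>x. h x / c)"
 have hm[measurable]: "h \<in> BM m" using h(1) by (simp cong: measurable_cong_sets)
 have pN: "prob_space N"
 proof (rule prob_spaceI)
  have "emeasure N (space N) = (LI x. h x / c wrt m)"
   unfolding N_def by (subst emeasure_density) (auto intro!: nn_integral_cong)
  also have "... = c / c" unfolding c_def by (simp add: nn_integral_divide)
  also have "... = 1" using h(4,5) by (simp add: c_def ennreal_divide_self)
  finally show "emeasure N (space N) = 1" .
 qed
 have So: "Some \<in> N \<rightarrow>\<^sub>M borel_cpt" using measurable_Some by (simp add: N_def cong: measurable_cong_sets)
 define \<nu> where "\<nu> = distr N borel_cpt Some"
 have \<nu>: "\<nu> \<in> initial_dists"
  using prob_space.prob_space_distr[OF pN So] by (simp add: \<nu>_def initial_dists_def)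
 have "g \<in> BM (completion \<nu>)"
  by (rule measurable_coarser[OF g]) (use \<nu> space_initial[OF \<nu>] in \<open>auto simp: sets_UB\<close>)
 then obtain g1 where g1: "g1 \<in> BM \<nu>" "AE y in \<nu>. g y = g1 y"
  using completion_ex_borel_measurable by blast
 have "AE y in N. g (Some y) = g1 (Some y)"
  using g1(2) unfolding \<nu>_def by (rule AE_distrD[OF So])
 then have "AE y in m. 0 < h y / c \<longrightarrow> g (Some y) = g1 (Some y)"
  unfolding N_def by (subst (asm) AE_density) auto
 moreover have "0 < h y / c" for y
  using h(2)[of y] h(4) by (simp add: c_def zero_less_iff_neq_zero less_top)
 ultimately have ae: "AE y in m. g (Some y) = g1 (Some y)" by simp
 show ?thesis
 proof (rule that[of "\<lambda>y. case y of None => g None | Some z => g1 (Some z)"])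
  have "g1 \<in> BM borel_cpt" using g1(1) sets_initial[OF \<nu>] by (simp cong: measurable_cong_sets)
  then show "(\<lambda>y. case y of None => g None | Some z => g1 (Some z)) \<in> BM borel_cpt"
   by (intro measurable_from_borel_cpt) (auto intro: measurable_compose[OF measurable_Some])
 qed (use ae in auto)
qed

lemma UB_Some_measurable:
 fixes g :: "'s option => ennreal"
 assumes "g \<in> BM UB"
 shows "(\<lambda>y. g (Some y)) \<in> BM M"
proof -
 obtain g' where g': "g' \<in> BM borel_cpt" "AE y in m. g (Some y) = g' (Some y)"
  using UB_representative[OF assms] by blast
 have "(\<lambda>y. g' (Some y)) \<in> BM m"
  using measurable_compose[OF measurable_Some g'(1)] by (simp cong: measurable_cong_sets)
 then show ?thesis by (rule measurable_completion_cong_AE) (use g' in auto)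
qed

subsection \<open>The transition density\<close>

text \<open>The density, set to zero at the times $0$ and $\infty$ to have a function that is
 measurable everywhere.\<close>

definition pd :: "ennreal => 's => 's => ennreal"
 where "pd t x y = (if 0 < t \<and> t < top then p t x y else 0)"

lemma pd_measurable: "(\<lambda>(t, x, y). pd t x y) \<in> BM (borel \<Otimes>\<^sub>M borel \<Otimes>\<^sub>M borel)"
proof -
 let ?S = "{0<..<top} \<times> UNIV \<times> UNIV :: (ennreal \<times> 's \<times> 's) set"
 have "(\<lambda>(t, x, y). p t x y) \<in> BM (restrict_space borel ?S)"
  using dens by (simp add: transition_density_def)
 moreover have "open ?S" by (intro open_Times) auto
 ultimately have "(\<lambda>z. if z \<in> ?S then (\<lambda>(t, x, y). p t x y) z else 0) \<in> BM borel"
  by (subst measurable_restrict_space_iff[symmetric]) auto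
 moreover have "(\<lambda>z. if z \<in> ?S then (\<lambda>(t, x, y). p t x y) z else 0) = (\<lambda>(t, x, y). pd t x y)"
  by (auto simp: pd_def fun_eq_iff)
 ultimately show ?thesis by (simp add: borel_prod)
qed

lemma pd_measurable' [measurable (raw)]:
 assumes "f \<in> BM N" "g \<in> N \<rightarrow>\<^sub>M borel" "h \<in> N \<rightarrow>\<^sub>M borel"
 shows "(\<lambda>z. pd (f z) (g z) (h z)) \<in> BM N"
 using measurable_compose[OF measurable_Pair[OF assms(1) measurable_Pair[OF assms(2,3)]] pd_measurable] by simp

lemma pd_sym: "pd t x y = pd t y x"
 using dens by (simp add: pd_def transition_density_def)

lemma pd_add: "0 < s ==> s < top ==> 0 < t ==> t < top ==> pd (s + t) x y = (LI z. pd s x z * pd t z y wrt m)"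
 using dens by (simp add: pd_def transition_density_def add_pos_pos)

lemma transition_borel:
 assumes t: "0 < t" "t < top" and g: "g \<in> BM borel_cpt"
 shows "TT t g (Some x) = (LI y. pd t x y * g (Some y) wrt m) + (1 - (LI y. pd t x y wrt m)) * g None"
proof -
 let ?L = "Law X (Some x)"
 define S where "S = {V. State X t V ~= None}"
 have St: "State X t \<in> ?L \<rightarrow>\<^sub>M borel_cpt" by (rule State_Law)
 have S1: "S \<inter> space ?L \<in> sets ?L"
  using measurable_sets[OF St, of "- {None}"] sets_borel_cpt_singleton[of None]
  by (simp add: S_def vimage_def Int_def sets_borel_cpt_iff conj_commute)
 have the: "the \<in> borel_cpt \<rightarrow>\<^sub>M (borel :: 's measure)"
  by (rule measurable_from_borel_cpt) auto
 have tm: "transition_measure X t x = density m (p t x)"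
  using dens t by (simp add: transition_density_def)
 have on_S: "(\<integral>\<^sup>+V\<in>S. k (State X t V) \<partial>?L) = (LI y. pd t x y * k (Some y) wrt m)"
  if k: "k \<in> BM borel_cpt" for k
 proof -
  have kS: "(\<lambda>y. k (Some y)) \<in> BM borel" by (rule measurable_compose[OF measurable_Some k])
  have "(LI y. pd t x y * k (Some y) wrt m) = (LI y. k (Some y) wrt density m (pd t x))"
   by (rule nn_integral_density[symmetric]) (use kS in \<open>auto cong: measurable_cong_sets\<close>)
  also have "... = (LI y. k (Some y) wrt transition_measure X t x)"
   using t by (simp add: tm pd_def[abs_def])
  also have "... = (LI V. k (Some (the (State X t V))) wrt restrict_space ?L S)"
   unfolding transition_measure_def S_def
   by (rule nn_integral_distr) (use kS in \<open>auto intro!: measurable_restrict_space1 measurable_compose[OF St the]\<close>)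
  also have "... = (\<integral>\<^sup>+V\<in>S. k (Some (the (State X t V))) \<partial>?L)"
   by (rule nn_integral_restrict_space[OF S1])
  also have "... = (\<integral>\<^sup>+V\<in>S. k (State X t V) \<partial>?L)"
   by (intro nn_integral_cong) (auto simp: S_def indicator_def)
  finally show ?thesis by simp
 qed
 interpret L: prob_space ?L by (rule Law_prob)
 have PS: "emeasure ?L (S \<inter> space ?L) = (LI y. pd t x y wrt m)"
 proof -
  have "emeasure ?L (S \<inter> space ?L) = (LI V. ind (S \<inter> space ?L) V wrt ?L)" using S1 by simp
  also have "... = (\<integral>\<^sup>+V\<in>S. 1 \<partial>?L)" by (intro nn_integral_cong) (auto simp: indicator_def)
  also have "... = (LI y. pd t x y wrt m)" using on_S[of "\<lambda>_. 1"] by simp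
  finally show ?thesis .
 qed
 have PN: "emeasure ?L (space ?L - S \<inter> space ?L) = 1 - (LI y. pd t x y wrt m)"
  using emeasure_compl[OF S1] L.emeasure_space_1 PS L.emeasure_finite[of "S \<inter> space ?L"] by auto
 have "TT t g (Some x) = (LI V. g (State X t V) wrt R (Some x))"
  unfolding TT_def by (intro nn_integral_Pu_R measurable_compose[OF State_natural g]) simp
 also have "... = (LI V. g (State X t V) wrt ?L)"
  unfolding R_def by (intro nn_integral_subalgebra2[OF subalg_F0] measurable_compose[OF State_natural g]) simp
 also have "... = (LI V. g (State X t V) * ind S V + g None * ind (space ?L - S \<inter> space ?L) V wrt ?L)"
  by (intro nn_integral_cong) (auto simp: S_def indicator_def)
 also have "... = (LI V. g (State X t V) * ind S V wrt ?L) + (LI V. g None * ind (space ?L - S \<inter> space ?L) V wrt ?L)"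
 proof (rule nn_integral_add)
  have "(\<lambda>V. g (State X t V) * ind (S \<inter> space ?L) V) \<in> BM ?L"
   using S1 by (intro borel_measurable_times_ennreal measurable_compose[OF St g] borel_measurable_indicator)
  then show "(\<lambda>V. g (State X t V) * ind S V) \<in> BM ?L"
   by (rule measurable_cong[THEN iffD1, rotated]) (auto simp: indicator_def)
  show "(\<lambda>V. g None * ind (space ?L - S \<inter> space ?L) V) \<in> BM ?L" using S1 by auto
 qed
 also have "... = (LI y. pd t x y * g (Some y) wrt m) + (1 - (LI y. pd t x y wrt m)) * g None"
  using S1 PN on_S[OF g] by (subst nn_integral_cmult_indicator) (auto simp: mult.commute)
 finally show ?thesis .
qed

text \<open>A universally measurable function may be replaced by a Borel representative, because the
 set where they differ is \<open>m\<close>-null and hence is not charged by the law of $X_t$.\<close>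

lemma TT_density:
 assumes t: "0 < t" "t < top" and g: "g \<in> BM UB" "g None = 0"
 shows "TT t g (Some x) = (LI y. pd t x y * g (Some y) wrt M)"
proof -
 obtain g' where g': "g' \<in> BM borel_cpt" "g' None = g None" "AE y in m. g (Some y) = g' (Some y)"
  using UB_representative[OF g(1)] by blast
 define N where "N y = (if y = None then 0 else if g y = g' y then 0 else 1 :: ennreal)" for y
 obtain C where C: "{y \<in> space m. \<not> g (Some y) = g' (Some y)} \<subseteq> C" "C \<in> null_sets m"
  using g'(3) unfolding eventually_ae_filter by blast
 have Cm: "ind (Some ` C) \<in> BM (borel_cpt :: 's option measure)"
  using C(2) by (intro borel_measurable_indicator sets_borel_cpt_image) auto
 have "TT t (ind (Some ` C)) (Some x) = (LI y. pd t x y * ind (Some ` C) (Some y) wrt m)"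
  using transition_borel[OF t Cm] by simp
 also have "... = (LI y. pd t x y * ind C y wrt m)"
  by (intro nn_integral_cong) (auto simp: indicator_def)
 also have "... = 0"
  using C(2) by (intro nn_integral_null_set) auto
 finally have "(LI V. ind (Some ` C) (State X t V) wrt Pu (Some x)) = (0::ennreal)" by (simp add: TT_def)
 then have "AE V in Pu (Some x). ind (Some ` C) (State X t V) = (0::ennreal)"
  using measurable_compose[OF State_UB measurable_UB_borel[OF Cm]]
  by (subst (asm) nn_integral_0_iff_AE) (auto cong: measurable_cong_sets)
 then have ae: "AE V in Pu (Some x). g (State X t V) = g' (State X t V)"
 proof eventually_elim
  case (elim V)
  then show ?case using C(1) g(2) g'(2) by (cases "State X t V") (auto simp: indicator_def split: if_splits)
 qed
 have "TT t g (Some x) = TT t g' (Some x)"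
  unfolding TT_def using ae by (rule nn_integral_cong_AE)
 also have "... = (LI y. pd t x y * g' (Some y) wrt m)"
  using transition_borel[OF t g'(1)] g g' by simp
 also have "... = (LI y. pd t x y * g (Some y) wrt m)"
  using g'(3) by (intro nn_integral_cong_AE) auto
 finally show ?thesis by (simp add: nn_integral_completion)
qed

text \<open>The transition density is symmetric on the state space only, so the functions vanish at the cemetery.\<close>

lemma TT_symmetric:
 assumes t: "t < top" and g: "g \<in> BM UB" "g None = 0" and h: "h \<in> BM UB" "h None = 0"
 shows "(LI x. g (Some x) * TT t h (Some x) wrt M) = (LI x. TT t g (Some x) * h (Some x) wrt M)"
proof (cases "t = 0")
 case True
 then show ?thesis by (simp add: TT_0)
next
 case False
 then have t0: "0 < t" by (simp add: zero_less_iff_neq_zero)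
 obtain g' where g': "g' \<in> BM borel_cpt" "g' None = g None" "AE y in m. g (Some y) = g' (Some y)"
  using UB_representative[OF g(1)] by blast
 obtain h' where h': "h' \<in> BM borel_cpt" "h' None = h None" "AE y in m. h (Some y) = h' (Some y)"
  using UB_representative[OF h(1)] by blast
 have [measurable]: "(\<lambda>y. g' (Some y)) \<in> BM borel" "(\<lambda>y. h' (Some y)) \<in> BM borel"
  by (auto intro: measurable_compose[OF measurable_Some] g'(1) h'(1))
 have rep: "TT t k (Some x) = (LI y. pd t x y * k' (Some y) wrt m)"
  if "k \<in> BM UB" "k None = 0" "AE y in m. k (Some y) = k' (Some y)" for k k' x
  unfolding TT_density[OF t0 t that(1,2)] nn_integral_completion
  using that(3) by (intro nn_integral_cong_AE) auto
 interpret pair_sigma_finite m m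
  by (rule pair_sigma_finite.intro[OF sigma_finite_m sigma_finite_m])
 have "(LI x. g (Some x) * TT t h (Some x) wrt M) = (LI x. g' (Some x) * (LI y. pd t x y * h' (Some y) wrt m) wrt m)"
  unfolding nn_integral_completion rep[OF h h'(3)] using g'(3) by (intro nn_integral_cong_AE) auto
 also have "... = (LI x. (LI y. g' (Some x) * (pd t x y * h' (Some y)) wrt m) wrt m)"
  by (intro nn_integral_cong nn_integral_cmult[symmetric]) simp
 also have "... = (LI y. (LI x. g' (Some x) * (pd t x y * h' (Some y)) wrt m) wrt m)"
  by (rule Fubini[symmetric, of "\<lambda>(x, y). g' (Some x) * (pd t x y * h' (Some y))", simplified]) measurable
 also have "... = (LI y. (LI x. pd t y x * g' (Some x) wrt m) * h' (Some y) wrt m)"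
  by (subst nn_integral_multc[symmetric]) (auto intro!: nn_integral_cong simp: pd_sym[of t] mult_ac)
 also have "... = (LI x. TT t g (Some x) * h (Some x) wrt M)"
  unfolding nn_integral_completion rep[OF g g'(3)] using h'(3) by (intro nn_integral_cong_AE) auto
 finally show ?thesis .
qed

abbreviation alive :: "'s option => ennreal" where "alive \<equiv> ind (range Some)"

lemma alive_borel [measurable]: "alive \<in> BM borel_cpt"
 by (intro borel_measurable_indicator sets_borel_cpt_image) simp

lemma TT_integral_le:
 assumes "t < top" "g \<in> BM UB" "g None = 0"
 shows "(LI x. TT t g (Some x) wrt M) <= (LI x. g (Some x) wrt M)"
proof -
 have "(LI x. TT t g (Some x) wrt M) = (LI x. TT t g (Some x) * alive (Some x) wrt M)" by simp
 also have "... = (LI x. g (Some x) * TT t alive (Some x) wrt M)"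
  by (rule TT_symmetric[symmetric]) (use assms measurable_UB_borel[OF alive_borel] in auto)
 also have "... <= (LI x. g (Some x) * 1 wrt M)"
  by (intro nn_integral_mono mult_left_mono TT_le) (auto simp: indicator_def)
 finally show ?thesis by simp
qed

end

section \<open>Integration against a continuous increasing function\<close>

lemma emeasure_lborel_Ici_0: "emeasure lborel {0::real..} = top"
proof -
 have "of_nat n <= emeasure lborel {0::real..}" for n :: nat
  using emeasure_mono[of "{0..real n}" "{0..}" lborel] by (simp add: ennreal_of_nat_eq_real_of_nat)
 then have "(SUP n. of_nat n :: ennreal) <= emeasure lborel {0::real..}" by (intro SUP_least)
 then show ?thesis by (simp add: ennreal_SUP_of_nat_eq_top top_unique)
qed

text \<open>A continuous additive functional, followed along one path, is such a function on
 $[0,\infty]$; it may reach the value $\infty$.\<close>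

definition clock :: "(ennreal => ennreal) => bool"
 where "clock a \<longleftrightarrow> mono a \<and> continuous_on UNIV a \<and> a 0 = 0"

text \<open>The right-continuous inverse of \<open>a\<close>.\<close>

definition hit :: "(ennreal => ennreal) => real => ennreal"
 where "hit a u = Inf {s. ennreal u < a s}"

text \<open>The measure \<open>da\<close> is the image of Lebesgue measure under the inverse of \<open>a\<close>; in this form
 integrals against \<open>da\<close> are Lebesgue integrals over the level \<open>u\<close>, so that Fubini's theorem
 applies when \<open>a\<close> is random.\<close>

definition dclock :: "(ennreal => ennreal) => ennreal measure"
 where "dclock a = distr (density lborel (\<lambda>u. ind {0..} u * ind {..<top} (hit a u))) borel (hit a)"

lemma sets_dclock [measurable_cong, simp]: "sets (dclock a) = sets borel"
 and space_dclock [simp]: "space (dclock a) = UNIV"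
 by (simp_all add: dclock_def)

context
 fixes a :: "ennreal => ennreal"
 assumes a: "clock a"
begin

lemma clock_mono: "s <= t ==> a s <= a t"
 using a by (auto simp: clock_def mono_def)

lemma clock_open_less: "open {s. c < a s}" and clock_open_greater: "open {s. a s < c}"
 using a by (auto simp: clock_def intro!: open_Collect_less continuous_on_const)

lemma hit_less_iff: "hit a u < t \<longleftrightarrow> ennreal u < a t"
proof
 assume "hit a u < t"
 then obtain s where "ennreal u < a s" "s < t" by (auto simp: hit_def Inf_less_iff)
 then show "ennreal u < a t" using clock_mono[of s t] by (intro less_le_trans[of "ennreal u" "a s" "a t"]) auto
next
 assume u: "ennreal u < a t"
 have "0 < t" using u a by (cases "t = 0") (auto simp: clock_def zero_less_iff_neq_zero)
 from open_left[OF clock_open_less _ this, of "ennreal u"] u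
 obtain b where b: "b < t" "{b<..t} \<subseteq> {s. ennreal u < a s}" by auto
 obtain r where "b < r" "r < t" using dense[OF b(1)] by auto
 then show "hit a u < t" using b(2) unfolding hit_def Inf_less_iff by force
qed

lemma hit_measurable [measurable]: "hit a \<in> BM borel"
proof (rule borel_measurableI_less)
 fix t
 have "{u \<in> space borel. ennreal u < a t} \<in> sets borel" by measurable
 then show "{u \<in> space borel. hit a u < t} \<in> sets borel" by (simp add: hit_less_iff)
qed

lemma clock_hit:
 assumes "hit a u < top"
 shows "a (hit a u) = ennreal u"
proof (rule antisym)
 show "a (hit a u) <= ennreal u"
  using hit_less_iff[of u "hit a u"] by (simp add: not_less)
 show "ennreal u <= a (hit a u)"
 proof (rule ccontr)
  assume "\<not> ennreal u <= a (hit a u)"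
  then have "hit a u \<in> {s. a s < ennreal u}" by simp
  from open_right[OF clock_open_greater this assms]
  obtain b where b: "b > hit a u" "{hit a u..<b} \<subseteq> {s. a s < ennreal u}" by auto
  obtain r where r: "hit a u < r" "r < b" using dense[OF b(1)] by auto
  then have "r \<in> {hit a u..<b}" by simp
  then have "a r < ennreal u" using b(2) by blast
  moreover have "ennreal u < a r" using r(1) by (simp add: hit_less_iff)
  ultimately show False by simp
 qed
qed

lemma nn_integral_dclock:
 assumes "\<phi> \<in> BM borel"
 shows "(LI s. \<phi> s wrt dclock a) =
  (LI u. ind {0..} u * ind {..<top} (hit a u) * \<phi> (hit a u) wrt lborel)"
 unfolding dclock_def using assms
 by (subst nn_integral_distr, simp, simp, subst nn_integral_density) auto

lemma emeasure_dclock_less: "emeasure (dclock a) {..<t} = a t"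
proof -
 have "emeasure (dclock a) {..<t} = (LI s. ind {..<t} s wrt dclock a)" by simp
 also have "... = (LI u. ind {u. 0 <= u \<and> ennreal u < a t} u wrt lborel)"
  by (subst nn_integral_dclock, simp)
   (intro nn_integral_cong, auto simp: indicator_def hit_less_iff[symmetric] top.not_eq_extremum
    dest: less_le_trans[OF _ top_greatest])
 also have "... = emeasure lborel {u. 0 <= u \<and> ennreal u < a t}" by (intro nn_integral_indicator) measurable
 also have "... = a t"
 proof (cases "a t")
  case (real r)
  then have "{u. 0 <= u \<and> ennreal u < a t} = {0..<r}"
   by (auto simp: ennreal_less_iff)
  then show ?thesis using real by simp
 next
  case top
  then have "{u. 0 <= u \<and> ennreal u < a t} = {0..}" by auto
  then show ?thesis using top by (simp add: emeasure_lborel_Ici_0)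
 qed
 finally show ?thesis .
qed

lemma AE_dclock_less_top: "AE s in dclock a. s < top"
proof -
 have "emeasure (dclock a) {top} = (LI s. ind {top} s wrt dclock a)" by simp
 also have "... = (LI u. 0 wrt (lborel :: real measure))"
  by (subst nn_integral_dclock, simp) (intro nn_integral_cong, auto simp: indicator_def)
 finally have "{top} \<in> null_sets (dclock a)" by auto
 then have "AE s in dclock a. s \<notin> {top}" by (rule AE_not_in)
 then show ?thesis by eventually_elim (auto simp: less_top)
qed

lemma AE_dclock_neq: "AE s in dclock a. s ~= t"
proof -
 have "emeasure (dclock a) {t} = (LI s. ind {t} s wrt dclock a)" by simp
 also have "... <= (LI u. ind {enn2real (a t)} u wrt lborel)"
  by (subst nn_integral_dclock, simp)
   (intro nn_integral_mono, auto simp: indicator_def dest: clock_hit)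
 also have "... = 0" by simp
 finally have "{t} \<in> null_sets (dclock a)" by auto
 then have "AE s in dclock a. s \<notin> {t}" by (rule AE_not_in)
 then show ?thesis by simp
qed

lemma sigma_finite_dclock: "sigma_finite_measure (dclock a)"
proof
 have [measurable]: "a \<in> BM borel"
  using a by (auto simp: clock_def intro: borel_measurable_continuous_onI)
 define C where "C = insert {s. a s = top} (range (\<lambda>n::nat. {s. a s <= of_nat n}))"
 have 1: "emeasure (dclock a) {s. a s = top} = 0"
 proof -
  have "emeasure (dclock a) {s. a s = top} = (LI s. ind {s. a s = top} s wrt dclock a)" by simp
  also have "... = (LI u. 0 wrt (lborel :: real measure))"
   by (subst nn_integral_dclock, simp) (intro nn_integral_cong, auto simp: indicator_def dest: clock_hit)
  finally show ?thesis by simp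
 qed
 have 2: "emeasure (dclock a) {s. a s <= of_nat n} ~= \<infinity>" for n
 proof -
  have "emeasure (dclock a) {s. a s <= of_nat n} = (LI s. ind {s. a s <= of_nat n} s wrt dclock a)" by simp
  also have "... <= (LI u. ind {0..real n} u wrt lborel)"
   by (subst nn_integral_dclock, simp)
    (intro nn_integral_mono, auto simp: indicator_def ennreal_of_nat_eq_real_of_nat dest: clock_hit)
  also have "... < \<infinity>" by simp
  finally show ?thesis by simp
 qed
 have "s \<in> \<Union>C" for s
 proof (cases "a s")
  case (real r)
  then have "a s <= of_nat (nat \<lceil>r\<rceil>)" by (auto simp: ennreal_of_nat_eq_real_of_nat intro!: ennreal_leI)
  then show ?thesis unfolding C_def by auto
 qed (auto simp: C_def)
 then show "\<exists>A. countable A \<and> A \<subseteq> sets (dclock a) \<and> \<Union>A = space (dclock a) \<and> (\<forall>a'\<in>A. emeasure (dclock a) a' ~= \<infinity>)"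
  using 1 2 by (intro exI[of _ C]) (auto simp: C_def)
qed

end

text \<open>Past the level \<open>a t\<close>, the inverse of \<open>a\<close> is \<open>t\<close> plus the inverse of \<open>b\<close>. If \<open>a t\<close> is infinite, no
 level lies beyond it.\<close>

lemma dclock_shift:
 assumes a: "clock a" and b: "clock b" and t: "t < top"
  and add: "\<And>s. a (t + s) = a t + b s" and inf: "a t = top ==> b = (\<lambda>_. 0)"
  and \<phi>: "\<phi> \<in> BM borel"
 shows "(LI s. ind {t..} s * \<phi> s wrt dclock a) = (LI s. \<phi> (t + s) wrt dclock b)"
proof -
 note ha[measurable] = hit_measurable[OF a] and hb[measurable] = hit_measurable[OF b] and \<phi>[measurable]
 have L: "(LI s. ind {t..} s * \<phi> s wrt dclock a) =
  (LI u. ind {0..} u * ind {..<top} (hit a u) * (ind {t..} (hit a u) * \<phi> (hit a u)) wrt lborel)"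
  by (rule nn_integral_dclock[OF a]) measurable
 have R: "(LI s. \<phi> (t + s) wrt dclock b) =
  (LI u. ind {0..} u * ind {..<top} (hit b u) * \<phi> (t + hit b u) wrt lborel)"
  by (rule nn_integral_dclock[OF b]) measurable
 show ?thesis
 proof (cases "a t")
  case top
  have "\<not> t <= hit a u" for u using hit_less_iff[OF a, of u t] top by (simp add: not_le)
  moreover have "hit b u = top" for u by (simp add: hit_def inf[OF top])
  ultimately show ?thesis unfolding L R by (simp add: indicator_def)
 next
  case (real c)
  have ge: "t <= hit a u \<longleftrightarrow> c <= u" if "0 <= u" for u
   using hit_less_iff[OF a, of u t] real that by (simp add: not_less[symmetric] ennreal_less_iff)
  have sh: "hit a (c + v) = t + hit b v" if v: "0 <= v" for v
  proof -
   have "hit a (c + v) < r \<longleftrightarrow> t + hit b v < r" for r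
   proof (cases "r <= t")
    case True
    have "\<not> hit a (c + v) < r"
    proof -
     have "a r <= ennreal c" using clock_mono[OF a True] real by simp
     also have "... <= ennreal (c + v)" using v by (intro ennreal_leI) simp
     finally show ?thesis unfolding hit_less_iff[OF a] by (simp add: not_less)
    qed
    moreover have "\<not> t + hit b v < r" using True by (auto simp: not_less intro: order_trans add_increasing2)
    ultimately show ?thesis by simp
   next
    case False
    then have r: "r = t + (r - t)" by (simp add: add_diff_inverse_ennreal)
    have "hit a (c + v) < r \<longleftrightarrow> ennreal c + ennreal v < ennreal c + b (r - t)"
     unfolding hit_less_iff[OF a] by (subst r, subst add) (simp add: real v)
    also have "... \<longleftrightarrow> hit b v < r - t"
     unfolding hit_less_iff[OF b] by (simp add: ennreal_add_left_cancel_less)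
    also have "... \<longleftrightarrow> t + hit b v < t + (r - t)"
     using t by (auto simp: ennreal_add_left_cancel_less)
    finally show ?thesis using r by simp
   qed
   from this[of "t + hit b v"] this[of "hit a (c + v)"] show ?thesis by (simp add: not_less)
  qed
  have "(LI u. ind {0..} u * ind {..<top} (hit a u) * (ind {t..} (hit a u) * \<phi> (hit a u)) wrt lborel) =
   (LI v. ind {0..} (c + v) * ind {..<top} (hit a (c + v)) * (ind {t..} (hit a (c + v)) * \<phi> (hit a (c + v))) wrt lborel)"
   using nn_integral_real_affine[of "\<lambda>u. ind {0..} u * ind {..<top} (hit a u) * (ind {t..} (hit a u) * \<phi> (hit a u))" 1 c]
   by simp
  also have "... = (LI u. ind {0..} u * ind {..<top} (hit b u) * \<phi> (t + hit b u) wrt lborel)"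
  proof (intro nn_integral_cong)
   fix v :: real
   show "ind {0..} (c + v) * ind {..<top} (hit a (c + v)) * (ind {t..} (hit a (c + v)) * \<phi> (hit a (c + v))) =
     ind {0..} v * ind {..<top} (hit b v) * \<phi> (t + hit b v)"
   proof (cases "0 <= v")
    case True
    have "t + hit b v < top \<longleftrightarrow> hit b v < top" using t by (cases t; cases "hit b v") auto
    with True real show ?thesis by (simp add: sh indicator_def)
   next
    case False
    then show ?thesis using ge[of "c + v"] by (auto simp: indicator_def)
   qed
  qed
  finally show ?thesis unfolding L R .
 qed
qed

subsection \<open>The product rule\<close>

definition inc :: "(ennreal => ennreal) => ennreal => ennreal => ennreal"
 where "inc a r t = emeasure (dclock a) {r..<t}"

lemma inc_0: "clock a ==> inc a 0 t = a t"
 by (simp add: inc_def emeasure_dclock_less[symmetric] atLeastLessThan_def atLeast_def)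

lemma inc_nn: "inc a r t = (LI s. ind {r..<t} s wrt dclock a)"
 by (simp add: inc_def)

lemma inc_measurable [measurable]: "clock a ==> (\<lambda>r. inc a r t) \<in> BM borel"
proof -
 assume "clock a"
 then interpret sigma_finite_measure "dclock a" by (rule sigma_finite_dclock)
 have "(\<lambda>r. LI s. (if r <= s \<and> s < t then 1 else 0) wrt dclock a) \<in> BM borel"
  by measurable
 then show ?thesis by (simp add: inc_nn indicator_def if_distrib of_bool_def cong: if_cong)
qed

lemma inc_add: "clock a ==> r <= s ==> s <= t ==> inc a r t = inc a r s + inc a s t"
 unfolding inc_def by (subst plus_emeasure) (auto intro!: arg_cong2[where f=emeasure])

text \<open>Integration by parts for finitely many continuous increasing functions: sort the
 factors by which of them is \<open>used first\<close>.\<close>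

lemma prod_inc:
 assumes "finite I" "I ~= {}" "\<And>i. i \<in> I ==> clock (a i)"
 shows "(\<Prod>i\<in>I. inc (a i) r t) =
  (\<Sum>i\<in>I. LI s. ind {r..<t} s * (\<Prod>l\<in>I - {i}. inc (a l) s t) wrt dclock (a i))"
 using assms
proof (induction I arbitrary: r rule: finite_ne_induct)
 case (singleton i)
 then show ?case by (simp add: inc_nn)
next
 case (insert j I)
 have cj: "clock (a j)" and ci: "\<And>i. i \<in> I ==> clock (a i)" using insert.prems by auto
 define G where "G i s = (\<Prod>l\<in>I - {i}. inc (a l) s t)" for i s
 have [measurable]: "G i \<in> BM borel" if "i \<in> I" for i
  unfolding G_def[abs_def] using ci by (intro borel_measurable_prod_ennreal) (auto intro: inc_measurable)
 have IH: "(\<Prod>i\<in>I. inc (a i) v t) = (\<Sum>i\<in>I. LI s. ind {v..<t} s * G i s wrt dclock (a i))" for v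
  using insert.IH[OF ci] by (simp add: G_def)
 have split: "inc (a j) r t * (LI s. ind {r..<t} s * G i s wrt dclock (a i)) =
   (LI s. ind {r..<t} s * (inc (a j) s t * G i s) wrt dclock (a i)) +
   (LI v. ind {r..<t} v * (LI s. ind {v..<t} s * G i s wrt dclock (a i)) wrt dclock (a j))"
  if i: "i \<in> I" for i
 proof -
  note [measurable] = inc_measurable[OF cj]
  interpret ij: pair_sigma_finite "dclock (a i)" "dclock (a j)"
   by (rule pair_sigma_finite.intro[OF sigma_finite_dclock[OF ci[OF i]] sigma_finite_dclock[OF cj]])
  have "inc (a j) r t * (LI s. ind {r..<t} s * G i s wrt dclock (a i)) =
    (LI s. inc (a j) r t * (ind {r..<t} s * G i s) wrt dclock (a i))"
   using i by (intro nn_integral_cmult[symmetric]) measurable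
  also have "... = (LI s. ind {r..<t} s * (inc (a j) s t * G i s) + ind {r..<t} s * (inc (a j) r s * G i s) wrt dclock (a i))"
   by (intro nn_integral_cong) (auto simp: indicator_def inc_add[OF cj, of r _ t] distrib_right add.commute)
  also have "... = (LI s. ind {r..<t} s * (inc (a j) s t * G i s) wrt dclock (a i)) +
    (LI s. ind {r..<t} s * (inc (a j) r s * G i s) wrt dclock (a i))"
  proof (rule nn_integral_add)
   have "(\<lambda>s. LI v. (if r <= v \<and> v < s then 1 else 0) wrt dclock (a j)) \<in> BM borel" by measurable
   then have [measurable]: "(\<lambda>s. inc (a j) r s) \<in> BM borel"
    by (simp add: inc_nn indicator_def if_distrib of_bool_def cong: if_cong)
   show "(\<lambda>s. ind {r..<t} s * (inc (a j) r s * G i s)) \<in> BM (dclock (a i))"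
    using i by measurable
  qed (use i in measurable)
  also have "(LI s. ind {r..<t} s * (inc (a j) r s * G i s) wrt dclock (a i)) =
    (LI s. (LI v. (if r <= v \<and> v < s \<and> s < t then G i s else 0) wrt dclock (a j)) wrt dclock (a i))"
  proof (intro nn_integral_cong)
   fix s
   have "ind {r..<t} s * (inc (a j) r s * G i s) = (LI v. ind {r..<t} s * G i s * ind {r..<s} v wrt dclock (a j))"
    by (subst nn_integral_cmult) (simp_all add: inc_nn mult_ac)
   also have "... = (LI v. (if r <= v \<and> v < s \<and> s < t then G i s else 0) wrt dclock (a j))"
    by (intro nn_integral_cong) (auto simp: indicator_def)
   finally show "ind {r..<t} s * (inc (a j) r s * G i s) = ..." .
  qed
  also have "... = (LI v. (LI s. (if r <= v \<and> v < s \<and> s < t then G i s else 0) wrt dclock (a i)) wrt dclock (a j))"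
   using i by (intro ij.Fubini'[symmetric]) measurable
  also have "... = (LI v. ind {r..<t} v * (LI s. ind {v..<t} s * G i s wrt dclock (a i)) wrt dclock (a j))"
  proof (intro nn_integral_cong)
   fix v
   have "(LI s. (if r <= v \<and> v < s \<and> s < t then G i s else 0) wrt dclock (a i)) =
     (LI s. ind {r..<t} v * (ind {v..<t} s * G i s) wrt dclock (a i))"
    using AE_dclock_neq[OF ci[OF i], of v] by (intro nn_integral_cong_AE) (auto simp: indicator_def)
   also have "... = ind {r..<t} v * (LI s. ind {v..<t} s * G i s wrt dclock (a i))"
    using i by (intro nn_integral_cmult) measurable
   finally show "(LI s. (if r <= v \<and> v < s \<and> s < t then G i s else 0) wrt dclock (a i)) = ..." .
  qed
  finally show ?thesis .
 qed
 have "(\<Prod>i\<in>insert j I. inc (a i) r t) = (\<Sum>i\<in>I. inc (a j) r t * (LI s. ind {r..<t} s * G i s wrt dclock (a i)))"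
  using insert.hyps by (simp add: IH sum_distrib_left)
 also have "... = (\<Sum>i\<in>I. LI s. ind {r..<t} s * (inc (a j) s t * G i s) wrt dclock (a i)) +
   (\<Sum>i\<in>I. LI v. ind {r..<t} v * (LI s. ind {v..<t} s * G i s wrt dclock (a i)) wrt dclock (a j))"
  by (simp add: split sum.distrib cong: sum.cong)
 also have "(\<Sum>i\<in>I. LI v. ind {r..<t} v * (LI s. ind {v..<t} s * G i s wrt dclock (a i)) wrt dclock (a j)) =
   (LI v. ind {r..<t} v * (\<Prod>i\<in>I. inc (a i) v t) wrt dclock (a j))"
 proof -
  have "(\<lambda>v. LI s. ind {v..<t} s * G i s wrt dclock (a i)) \<in> BM borel" if i: "i \<in> I" for i
  proof -
   interpret sigma_finite_measure "dclock (a i)" by (rule sigma_finite_dclock[OF ci[OF i]])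
   have "(\<lambda>v. LI s. (if v <= s \<and> s < t then G i s else 0) wrt dclock (a i)) \<in> BM borel"
    using i by measurable
   moreover have "(if v <= s \<and> s < t then G i s else 0) = ind {v..<t} s * G i s" for v s
    by (simp add: indicator_def)
   ultimately show ?thesis by simp
  qed
  then show ?thesis
   unfolding IH by (simp add: sum_distrib_left nn_integral_sum)
 qed
 also have "(\<Sum>i\<in>I. LI s. ind {r..<t} s * (inc (a j) s t * G i s) wrt dclock (a i)) =
   (\<Sum>i\<in>I. LI s. ind {r..<t} s * (\<Prod>l\<in>insert j I - {i}. inc (a l) s t) wrt dclock (a i))"
 proof (rule sum.cong[OF refl])
  fix i assume i: "i \<in> I"
  then have "insert j I - {i} = insert j (I - {i})" using insert.hyps by auto
  moreover have "j \<notin> I - {i}" "finite (I - {i})" using insert.hyps by auto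
  ultimately show "(LI s. ind {r..<t} s * (inc (a j) s t * G i s) wrt dclock (a i)) =
    (LI s. ind {r..<t} s * (\<Prod>l\<in>insert j I - {i}. inc (a l) s t) wrt dclock (a i))"
   by (simp add: G_def)
 qed
 finally show ?case using insert.hyps by (simp add: add.commute)
qed

subsection \<open>Comparison with the Lebesgue--Stieltjes measure\<close>

lemma enn2real_vimage: "B \<in> sets borel ==> enn2real -` B \<in> sets (borel :: ennreal measure)"
 using measurable_sets[of enn2real borel borel B] by simp

text \<open>Both measures give $a(y \wedge r) - a(x \wedge r)$ to an interval \<open>(x, y]\<close>, and this determines a
 Borel measure.\<close>

lemma interval_measure_dclock:
 assumes a: "clock a" and fin: "a (ennreal r) < top" and r: "0 <= r"
 shows "interval_measure (\<lambda>s. enn2real (a (ennreal (min s r)))) =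
  distr (density (dclock a) (ind {..<ennreal r})) borel enn2real" (is "interval_measure ?F = ?N")
proof -
 have le: "a (ennreal (min s r)) <= a (ennreal r)" for s
  by (intro clock_mono[OF a] ennreal_leI) simp
 then have fin': "a (ennreal (min s r)) < top" for s using fin by (rule le_less_trans)
 have mono: "?F x <= ?F y" if "x <= y" for x y
  using that fin' by (intro enn2real_mono clock_mono[OF a] ennreal_leI) auto
 have rc: "continuous (at_right x) ?F" for x
 proof -
  have "continuous_on UNIV (\<lambda>s. a (ennreal (min s r)))"
   by (rule continuous_on_compose2[of UNIV a])
    (use a in \<open>auto simp: clock_def intro!: continuous_intros continuous_on_ennreal\<close>)
  then have "((\<lambda>s. a (ennreal (min s r))) \<longlongrightarrow> a (ennreal (min x r))) (at_right x)"
   by (auto simp: continuous_on_eq_continuous_at isCont_def intro: tendsto_within_subset)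
  then have "((\<lambda>s. enn2real (a (ennreal (min s r)))) \<longlongrightarrow> enn2real (a (ennreal (min x r)))) (at_right x)"
   using fin'[of x] by (intro tendsto_enn2real) (auto simp: ennreal_enn2real_if)
  then show ?thesis by (simp add: continuous_within)
 qed
 have e: "emeasure ?N B = emeasure (dclock a) {s. s < ennreal r \<and> enn2real s \<in> B}" if "B \<in> sets borel" for B
 proof -
  have "emeasure ?N B = emeasure (density (dclock a) (ind {..<ennreal r})) (enn2real -` B)"
   using that by (subst emeasure_distr) auto
  also have "... = (LI s. ind {..<ennreal r} s * ind (enn2real -` B) s wrt dclock a)"
   using that enn2real_vimage[OF that] by (subst emeasure_density) auto
  also have "... = (LI s. ind {s. s < ennreal r \<and> enn2real s \<in> B} s wrt dclock a)"
   by (intro nn_integral_cong) (auto simp: indicator_def)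
  also have "... = emeasure (dclock a) {s. s < ennreal r \<and> enn2real s \<in> B}"
  proof (rule nn_integral_indicator)
   have "{s. s < ennreal r \<and> enn2real s \<in> B} = {..<ennreal r} \<inter> enn2real -` B" by auto
   then show "{s. s < ennreal r \<and> enn2real s \<in> B} \<in> sets (dclock a)"
    using enn2real_vimage[OF that] by simp
  qed
  finally show ?thesis .
 qed
 have G: "emeasure (dclock a) {s. s < ennreal r \<and> enn2real s <= y} = a (ennreal (min y r))" for y
 proof (cases "0 <= y")
  case True
  have "emeasure (dclock a) {s. s < ennreal r \<and> enn2real s <= y} = emeasure (dclock a) {..<ennreal (min y r)}"
  proof (rule emeasure_eq_AE)
   show "AE s in dclock a. s \<in> {s. s < ennreal r \<and> enn2real s <= y} \<longleftrightarrow> s \<in> {..<ennreal (min y r)}"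
    using AE_dclock_neq[OF a, of "ennreal y"]
   proof eventually_elim
    case (elim s)
    show ?case
    proof (cases s)
     case (real s')
     with elim True r show ?thesis
      by (auto simp: ennreal_less_iff min_def split: if_splits)
    next
     case top then show ?thesis by (auto simp: top_unique)
    qed
   qed
  qed auto
  then show ?thesis by (simp add: emeasure_dclock_less[OF a])
 next
  case False
  then have "{s. s < ennreal r \<and> enn2real s <= y} = {}"
   by (auto dest: order_trans[OF enn2real_nonneg])
  then have "emeasure (dclock a) {s. s < ennreal r \<and> enn2real s <= y} = 0" by (simp only: emeasure_empty)
  moreover have "ennreal (min y r) = 0" using False by (simp add: ennreal_neg)
  ultimately show ?thesis using a by (simp add: clock_def)
 qed
 have fin_n: "emeasure (interval_measure ?F) {- real n<..real n} ~= \<infinity>" for n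
  using mono rc by (subst emeasure_interval_measure_Ioc) auto
 show ?thesis
 proof (rule measure_eqI_generator_eq[where E="range (\<lambda>(x, y). {x<..y})" and \<Omega>=UNIV and A="\<lambda>n. {- real n<..real n}"])
  show "Int_stable (range (\<lambda>(x, y). {x<..y::real}))"
   by (auto simp: Int_stable_def image_def) (metis Int_greaterThanAtMost)
  fix B :: "real set" assume "B \<in> range (\<lambda>(x, y). {x<..y})"
  then obtain x y where B: "B = {x<..y}" by auto
  show "emeasure (interval_measure ?F) B = emeasure ?N B"
  proof (cases "x <= y")
   case True
   have "emeasure (interval_measure ?F) B = ?F y - ?F x"
    unfolding B using True mono rc by (intro emeasure_interval_measure_Ioc) auto
   also have "... = a (ennreal (min y r)) - a (ennreal (min x r))"
    using fin' by (simp add: ennreal_minus[symmetric] less_top)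
   also have "... = emeasure (dclock a) {s. s < ennreal r \<and> enn2real s <= y} - emeasure (dclock a) {s. s < ennreal r \<and> enn2real s <= x}"
    by (simp add: G)
   also have "... = emeasure (dclock a) ({s. s < ennreal r \<and> enn2real s <= y} - {s. s < ennreal r \<and> enn2real s <= x})"
   proof (rule emeasure_Diff[symmetric])
    show "emeasure (dclock a) {s. s < ennreal r \<and> enn2real s <= x} ~= \<infinity>"
     using fin'[of x] by (simp add: G)
   qed (use True in auto)
   also have "{s. s < ennreal r \<and> enn2real s <= y} - {s. s < ennreal r \<and> enn2real s <= x} = {s. s < ennreal r \<and> enn2real s \<in> B}"
    by (auto simp: B)
   finally show ?thesis using e[of B] by (simp add: B)
  next
   case False
   then have "B = {}" by (simp add: B)
   then show ?thesis by simp
  qed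
 next
  show "(\<Union>n. {- real n<..real n}) = UNIV"
  proof -
   have "\<exists>n. - real n < x \<and> x <= real n" for x
    using reals_Archimedean2[of "\<bar>x\<bar>"] by (auto intro: less_imp_le simp: abs_less_iff)
     (metis less_eq_real_def minus_less_iff)
   then show ?thesis by auto
  qed
 qed (use fin_n in \<open>auto simp: borel_sigma_sets_Ioc\<close>)
qed

lemma stieltjes_measure_dclock:
 assumes a: "clock a" and fin: "\<And>s. s < \<zeta> ==> a s < top" and a0: "\<And>s. s < top ==> a0 s = a s"
 shows "stieltjes_measure \<zeta> a0 = distr (density (dclock a) (ind {..<\<zeta>})) borel enn2real" (is "_ = ?N")
proof -
 have e: "emeasure (distr (density (dclock a) (ind {..<c})) borel enn2real) B =
   emeasure (dclock a) ({..<c} \<inter> enn2real -` B)" if B: "B \<in> sets borel" for B c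
 proof -
  have m: "enn2real -` B \<in> sets borel" by (rule enn2real_vimage[OF B])
  have "emeasure (distr (density (dclock a) (ind {..<c})) borel enn2real) B =
    emeasure (density (dclock a) (ind {..<c})) (enn2real -` B)"
   using B by (subst emeasure_distr) auto
  also have "... = (LI s. ind ({..<c} \<inter> enn2real -` B) s wrt dclock a)"
  proof -
   have "emeasure (density (dclock a) (ind {..<c})) (enn2real -` B) =
     (LI s. ind {..<c} s * ind (enn2real -` B) s wrt dclock a)"
    by (rule emeasure_density) (use m in auto)
   also have "... = (LI s. ind ({..<c} \<inter> enn2real -` B) s wrt dclock a)"
    by (intro nn_integral_cong) (simp add: indicator_def)
   finally show ?thesis .
  qed
  finally show ?thesis using m by simp
 qed
 have main: "(SUP r\<in>{r. 0 <= r \<and> ennreal r < \<zeta>}. emeasure (interval_measure (\<lambda>s. enn2real (a0 (ennreal (min s r))))) B) =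
   emeasure ?N B" if B: "B \<in> sets borel" for B
 proof -
  have m: "enn2real -` B \<in> sets borel" by (rule enn2real_vimage[OF B])
  have eq: "emeasure (interval_measure (\<lambda>s. enn2real (a0 (ennreal (min s r))))) B = emeasure (dclock a) ({..<ennreal r} \<inter> enn2real -` B)"
   if "0 <= r" "ennreal r < \<zeta>" for r
   using interval_measure_dclock[OF a fin[OF that(2)] that(1)] e[OF B] by (simp add: a0)
  have "(SUP r\<in>{r. 0 <= r \<and> ennreal r < \<zeta>}. emeasure (interval_measure (\<lambda>s. enn2real (a0 (ennreal (min s r))))) B) =
   (SUP r\<in>{r. 0 <= r \<and> ennreal r < \<zeta>}. emeasure (dclock a) ({..<ennreal r} \<inter> enn2real -` B))"
   by (intro SUP_cong) (auto simp: eq)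
  also have "... = emeasure (dclock a) ({..<\<zeta>} \<inter> enn2real -` B)"
  proof (rule antisym)
   show "(SUP r\<in>{r. 0 <= r \<and> ennreal r < \<zeta>}. emeasure (dclock a) ({..<ennreal r} \<inter> enn2real -` B)) <=
     emeasure (dclock a) ({..<\<zeta>} \<inter> enn2real -` B)"
    using m by (intro SUP_least emeasure_mono) auto
   show "emeasure (dclock a) ({..<\<zeta>} \<inter> enn2real -` B) <=
     (SUP r\<in>{r. 0 <= r \<and> ennreal r < \<zeta>}. emeasure (dclock a) ({..<ennreal r} \<inter> enn2real -` B))"
   proof (cases "\<zeta> = 0")
    case False
    then have "0 < \<zeta>" by (simp add: zero_less_iff_neq_zero)
    from approx_from_below_dense_linorder[OF this]
    obtain u where u: "\<And>n. u n < \<zeta>" "u \<longlonglongrightarrow> \<zeta>" by auto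
    define v where "v n = (MAX i\<in>{..n}. u i)" for n
    have v1: "v n < \<zeta>" for n unfolding v_def by (subst Max_less_iff) (use u in auto)
    have v2: "incseq v" unfolding v_def incseq_def by (intro allI impI Max_mono image_mono) auto
    have un: "u n <= v n" for n unfolding v_def by (intro Max_ge) auto
    have "emeasure (dclock a) ({..<\<zeta>} \<inter> enn2real -` B) = emeasure (dclock a) (\<Union>n. {..<v n} \<inter> enn2real -` B)"
    proof (rule arg_cong2[where f=emeasure, OF refl])
     have "\<exists>n. s < v n" if "s < \<zeta>" for s
      using order_tendstoD(1)[OF u(2) that] un unfolding eventually_sequentially
      by (meson less_le_trans order_refl)
     then show "{..<\<zeta>} \<inter> enn2real -` B = (\<Union>n. {..<v n} \<inter> enn2real -` B)"
      using v1 by (auto intro: less_trans)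
    qed
    also have "... = (SUP n. emeasure (dclock a) ({..<v n} \<inter> enn2real -` B))"
     using m v2 by (intro SUP_emeasure_incseq[symmetric]) (auto simp: incseq_def intro: less_le_trans)
    also have "... <= (SUP r\<in>{r. 0 <= r \<and> ennreal r < \<zeta>}. emeasure (dclock a) ({..<ennreal r} \<inter> enn2real -` B))"
    proof (rule SUP_least)
     fix n
     have "v n < top" using v1[of n] by (rule less_le_trans) simp
     then have v: "ennreal (enn2real (v n)) = v n" by simp
     have "emeasure (dclock a) ({..<ennreal (enn2real (v n))} \<inter> enn2real -` B) <=
       (SUP r\<in>{r. 0 <= r \<and> ennreal r < \<zeta>}. emeasure (dclock a) ({..<ennreal r} \<inter> enn2real -` B))"
      by (rule SUP_upper) (use v v1 in auto)
     then show "emeasure (dclock a) ({..<v n} \<inter> enn2real -` B) <=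
       (SUP r\<in>{r. 0 <= r \<and> ennreal r < \<zeta>}. emeasure (dclock a) ({..<ennreal r} \<inter> enn2real -` B))" by (simp add: v)
    qed
    finally show ?thesis .
   next
    case True
    then have "{..<\<zeta>} \<inter> enn2real -` B = {}" by auto
    then have "emeasure (dclock a) ({..<\<zeta>} \<inter> enn2real -` B) = 0" by (simp only: emeasure_empty)
    then show ?thesis by simp
   qed
  qed
  finally show ?thesis using e[OF B] by simp
 qed
 have "stieltjes_measure \<zeta> a0 = measure_of UNIV (sets borel) (emeasure ?N)"
  unfolding stieltjes_measure_def
  using sets.sigma_sets_eq[of "borel :: real measure"] by (intro measure_of_eq) (auto simp: main)
 also have "... = ?N" using measure_of_of_measure[of ?N] by simp
 finally show ?thesis .
qed

lemma occupation_dclock: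
 assumes a: "clock a" and fin: "\<And>s. s < \<zeta> ==> a s < top" and a0: "\<And>s. s < top ==> a0 s = a s"
  and g: "g \<in> BM borel" "\<And>s. \<zeta> <= s ==> g s = 0" and t: "t < top"
 shows "(\<integral>\<^sup>+s\<in>{s. 0 < s \<and> ennreal s <= t}. g (ennreal s) \<partial>stieltjes_measure \<zeta> a0) =
  (LI s. ind {..<t} s * g s wrt dclock a)"
proof -
 note g(1)[measurable]
 have st: "stieltjes_measure \<zeta> a0 = distr (density (dclock a) (ind {..<\<zeta>})) borel enn2real"
  by (rule stieltjes_measure_dclock[OF a]) (use fin a0 in auto)
 have "(\<integral>\<^sup>+s\<in>{s. 0 < s \<and> ennreal s <= t}. g (ennreal s) \<partial>stieltjes_measure \<zeta> a0) =
   (LI s. g (ennreal (enn2real s)) * ind {s. 0 < s \<and> ennreal s <= t} (enn2real s)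
    wrt density (dclock a) (ind {..<\<zeta>}))"
  unfolding st by (rule nn_integral_distr) (auto, measurable)
 also have "... = (LI s. ind {..<\<zeta>} s * (g (ennreal (enn2real s)) * ind {s. 0 < s \<and> ennreal s <= t} (enn2real s))
    wrt dclock a)"
  by (rule nn_integral_density) measurable
 also have "... = (LI s. ind {..<t} s * g s wrt dclock a)"
 proof (rule nn_integral_cong_AE)
  show "AE s in dclock a. ind {..<\<zeta>} s * (g (ennreal (enn2real s)) * ind {s. 0 < s \<and> ennreal s <= t} (enn2real s)) =
    ind {..<t} s * g s"
   using AE_dclock_neq[OF a, of 0] AE_dclock_neq[OF a, of t] AE_dclock_less_top[OF a]
  proof eventually_elim
  case (elim s)
  then have s: "ennreal (enn2real s) = s" "0 < enn2real s"
   by (auto simp: enn2real_positive_iff zero_less_iff_neq_zero)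
  show ?case
  proof (cases "s < \<zeta>")
   case True
   with s elim(2) show ?thesis by (auto simp: indicator_def)
  next
   case False
   then show ?thesis using g(2)[of s] by (simp add: not_less)
  qed
  qed
 qed
 finally show ?thesis .
qed

section \<open>Positive continuous additive functionals\<close>

locale pcaf = hunt X for X :: "('w, 's::{metric_space, second_countable_topology}) process" +
 fixes A :: "ennreal => 'w => ennreal"
 assumes PCAF: "PCAF_strict X A"
begin

lemma A_adapted: "t < top ==> A t \<in> BM (Fil t)"
 using PCAF by (simp add: PCAF_strict_def)

definition is_defining :: "'w set => bool"
 where "is_defining \<Lambda> \<longleftrightarrow> \<Lambda> \<in> sets Fu \<and> (\<forall>x. emeasure (law_at X (Some x)) \<Lambda> = 1) \<and>
   (\<forall>t<top. Shift X t ` \<Lambda> \<subseteq> \<Lambda>) \<and>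
   (\<forall>V\<in>\<Lambda>.
    continuous_on {..<top} (\<lambda>t. A t V) \<and>
    A 0 V = 0 \<and>
    (\<forall>t<top. t < life_time X V \<longrightarrow> A t V < top) \<and>
    (\<forall>t<top. life_time X V <= t \<longrightarrow> A t V = A (life_time X V) V) \<and>
    (\<forall>s<top. \<forall>t<top. A (t + s) V = A t V + A s (Shift X t V))) \<and>
   (\<forall>V\<in>\<Omega> - \<Lambda>. \<forall>t<top. A t V = 0) \<and>
   {V\<in>\<Omega>. life_time X V = 0} \<subseteq> \<Lambda>"

definition Lam :: "'w set" where "Lam = (SOME \<Lambda>. is_defining \<Lambda>)"

lemma is_defining_Lam: "is_defining Lam"
proof -
 have "\<exists>\<Lambda>. is_defining \<Lambda>"
  using PCAF unfolding PCAF_strict_def is_defining_def infinity_ennreal_def by blast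
 then show ?thesis unfolding Lam_def by (rule someI_ex)
qed

lemmas Lam_props = is_defining_Lam[unfolded is_defining_def]
lemmas Lam_sets = Lam_props[THEN conjunct1]
lemmas Lam_prob = Lam_props[THEN conjunct2, THEN conjunct1, rule_format]
lemmas Lam_props3 = Lam_props[THEN conjunct2, THEN conjunct2]
lemmas Lam_path = Lam_props3[THEN conjunct2, THEN conjunct1, THEN bspec]
lemmas A_cont = Lam_path[THEN conjunct1]
lemmas A_0 = Lam_path[THEN conjunct2, THEN conjunct1]
lemmas Lam_path3 = Lam_path[THEN conjunct2, THEN conjunct2]
lemmas A_finite = Lam_path3[THEN conjunct1, rule_format]
lemmas A_dead = Lam_path3[THEN conjunct2, THEN conjunct1, rule_format]
lemmas A_add = Lam_path3[THEN conjunct2, THEN conjunct2, rule_format]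
lemmas Lam_props5 = Lam_props3[THEN conjunct2, THEN conjunct2]

lemma Lam_shift: "t < top ==> V \<in> Lam ==> Shift X t V \<in> Lam"
 using Lam_props3[THEN conjunct1] by blast

lemma A_off: "V \<in> \<Omega> ==> V \<notin> Lam ==> t < top ==> A t V = 0"
 using Lam_props5[THEN conjunct1] by blast

lemma Lam_dead: "V \<in> \<Omega> ==> life_time X V = 0 ==> V \<in> Lam"
 using Lam_props5[THEN conjunct2] by blast

lemma Lam_Omega: "Lam \<subseteq> \<Omega>" using sets.sets_into_space[OF Lam_sets] by simp

lemma AE_Lam: "AE V in Pu x. V \<in> Lam"
proof (cases x)
 case None
 show ?thesis
  unfolding None using AE_Pu_None AE_space
 proof eventually_elim
  case (elim V)
  then have w: "V \<in> \<Omega>" by simp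
  have "life_time X V <= 0" using elim State_None_iff[OF w, of 0] by simp
  then show ?case using Lam_dead[OF w] by simp
 qed
next
 case (Some y)
 interpret prob_space "Pu x" by (rule prob_Pu)
 have "emeasure (Pu x) Lam = 1" using Lam_prob by (simp add: emeasure_Pu[OF Lam_sets] Some)
 then show ?thesis using Lam_sets AE_in_set_eq_1[of Lam] by (simp add: emeasure_eq_measure)
qed

text \<open>The path of the functional, extended continuously to time $\infty$.\<close>

definition AA :: "'w => ennreal => ennreal" where "AA V t = extend_to_infinity A t V"

abbreviation dA :: "'w => ennreal measure" where "dA V \<equiv> dclock  (AA V)"

lemma AA_less_top: "t < top ==> AA V t = A t V"
 by (auto simp: AA_def extend_to_infinity_def)

lemma AA_top: "AA V top = (SUP q\<in>{q\<in>\<rat>. 0 <= q}. A (ennreal q) V)"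
 by (simp add: AA_def extend_to_infinity_def)

lemma AA_off:
 assumes "V \<in> \<Omega>" "V \<notin> Lam"
 shows "AA V t = 0"
proof (cases "t = top")
 case True
 have "(SUP q\<in>{q\<in>\<rat>. 0 <= q}. A (ennreal q) V) <= 0"
  using A_off[OF assms] by (intro SUP_least) simp
 then show ?thesis by (simp add: True AA_top)
qed (use A_off[OF assms] in \<open>auto simp: AA_less_top less_top\<close>)

lemma A_mono: "V \<in> Lam ==> s <= t ==> t < top ==> A s V <= A t V"
proof -
 assume w: "V \<in> Lam" and st: "s <= t" "t < top"
 then have "s < top" by auto
 have "t - s < top" using st by (meson diff_le_self_ennreal le_less_trans)
 from A_add[OF w this \<open>s < top\<close>] st have "A t V = A s V + A (t - s) (Shift X s V)"
  by (simp add: add_diff_inverse_ennreal)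
 then show ?thesis by simp
qed

lemma AA_mono: "V \<in> Lam ==> mono (AA V)"
proof (rule monoI)
 fix s t :: ennreal assume w: "V \<in> Lam" and st: "s <= t"
 show "AA V s <= AA V t"
 proof (cases "t = top")
  case False
  with st have "s < top" "t < top" by (auto simp: less_top)
  then show ?thesis using A_mono[OF w st] by (simp add: AA_less_top)
 next
  case t: True
  show ?thesis
  proof (cases s)
   case (real r)
   obtain q where q: "q \<in> \<rat>" "r < q" using Rats_dense_in_real[of r "r + 1"] by auto
   have "A s V <= A (ennreal q) V"
    using real q by (intro A_mono[OF w]) (auto intro: ennreal_leI)
   also have "... <= (SUP q\<in>{q\<in>\<rat>. 0 <= q}. A (ennreal q) V)"
    using q real by (intro SUP_upper) auto
   finally show ?thesis using real by (simp add: t AA_top AA_less_top)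
  next
   case top then show ?thesis by (simp add: t)
  qed
 qed
qed

text \<open>Continuity at the time $\infty$ is built into the extension as a supremum over rational times; outside
 the defining set the path is zero.\<close>

lemma clock_AA:
 assumes "V \<in> \<Omega>"
 shows "clock (AA V)"
proof (cases "V \<in> Lam")
 case False
 then have "AA V = (\<lambda>_. 0)" using AA_off[OF assms] by auto
 then show ?thesis by (simp add: clock_def mono_def)
next
 case w: True
 have "isCont (AA V) t" for t
 proof (cases "t = top")
  case False
  have "continuous_on {..<top} (AA V)"
   using A_cont[OF w] by (rule continuous_on_cong[THEN iffD2, rotated -1]) (auto simp: AA_less_top)
  then show ?thesis using False by (simp add: continuous_on_eq_continuous_at less_top)
 next
  case True
  have "(AA V \<longlongrightarrow> AA V top) (at top)"
  proof (rule order_tendstoI)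
   fix c assume "c < AA V top"
   then obtain q where q: "q \<in> \<rat>" "0 <= q" "c < A (ennreal q) V" unfolding AA_top less_SUP_iff by auto
   have "c < AA V s" if "s \<in> {ennreal q<..}" for s
    using q(3) AA_mono[OF w, THEN monoD, of "ennreal q" s] that
    by (intro less_le_trans[OF q(3)]) (auto simp: AA_less_top)
   then show "\<forall>\<^sub>F s in at top. c < AA V s"
    unfolding eventually_at_topological by (intro exI[of _ "{ennreal q<..}"]) auto
  next
   fix c assume "AA V top < c"
   then have "AA V s < c" for s
    using AA_mono[OF w, THEN monoD, of s top] by (rule le_less_trans[rotated]) simp
   then show "\<forall>\<^sub>F s in at top. AA V s < c" by simp
  qed
  then show ?thesis by (simp add: True isCont_def)
 qed
 then have "continuous_on UNIV (AA V)" by (simp add: continuous_on_eq_continuous_at)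
 then show ?thesis using AA_mono[OF w] A_0[OF w] by (simp add: clock_def AA_less_top)
qed

lemma AA_finite: "V \<in> \<Omega> ==> t < life_time X V ==> AA V t < top"
proof (cases "V \<in> Lam")
 case True
 assume "t < life_time X V"
 moreover from this have "t < top" by (rule less_le_trans) simp
 ultimately show ?thesis using A_finite[OF True] by (simp add: AA_less_top)
qed (simp add: AA_off)

lemma AA_add:
 assumes w: "V \<in> Lam" and t: "t < top"
 shows "AA V (t + s) = AA V t + AA (Shift X t V) s"
proof (cases "s = top")
 case False
 then have "s < top" "t + s < top" using t by (auto simp: less_top)
 then show ?thesis using A_add[OF w _ t] t by (simp add: AA_less_top)
next
 case True
 have wO: "V \<in> \<Omega>" and w': "Shift X t V \<in> Lam" "Shift X t V \<in> \<Omega>"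
  using w Lam_Omega Lam_shift[OF t w] by auto
 have c: "(AA V' \<longlongrightarrow> AA V' top) (at top)" if "V' \<in> \<Omega>" for V'
  using clock_AA[OF that] by (auto simp: clock_def continuous_on_eq_continuous_at isCont_def)
 have lim0: "filterlim (\<lambda>n. of_nat n :: ennreal) (at top) sequentially"
  unfolding filterlim_at using of_nat_tendsto_top_ennreal by auto
 have lim1: "filterlim (\<lambda>n. t + of_nat n :: ennreal) (at top) sequentially"
  unfolding filterlim_at
 proof (intro conjI)
  show "(\<lambda>n. t + of_nat n) \<longlonglongrightarrow> top"
   using tendsto_add[OF tendsto_const[of t] of_nat_tendsto_top_ennreal] by simp
 qed (use t in auto)
 have "(\<lambda>n. AA V (t + of_nat n)) \<longlonglongrightarrow> AA V top" by (rule filterlim_compose[OF c[OF wO] lim1])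
 moreover have "AA V (t + of_nat n) = AA V t + AA (Shift X t V) (of_nat n)" for n
 proof -
  have n: "of_nat n < (top :: ennreal)" by (simp add: ennreal_of_nat_eq_real_of_nat)
  moreover from this have "t + of_nat n < top" using t by simp
  ultimately show ?thesis using A_add[OF w n t] t by (simp add: AA_less_top)
 qed
 moreover have "(\<lambda>n. AA V t + AA (Shift X t V) (of_nat n)) \<longlonglongrightarrow> AA V t + AA (Shift X t V) top"
  by (intro tendsto_add tendsto_const filterlim_compose[OF c[OF w'(2)] lim0])
 ultimately show ?thesis using True by (simp add: LIMSEQ_unique)
qed

lemma AA_shift_dead:
 assumes w: "V \<in> Lam" and t: "t < top" and inf: "AA V t = top"
 shows "AA (Shift X t V) = (\<lambda>_. 0)"
proof -
 have wO: "V \<in> \<Omega>" using w Lam_Omega by auto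
 have w': "Shift X t V \<in> Lam" "Shift X t V \<in> \<Omega>" using Lam_Omega Lam_shift[OF t w] by auto
 have "\<not> t < life_time X V" using AA_finite[OF wO, of t] inf by auto
 then have "State X t V = None" using State_None_iff[OF wO] by (simp add: not_less)
 then have "State X 0 (Shift X t V) = None" using State_Shift[OF wO, of 0 t] by simp
 then have l: "life_time X (Shift X t V) = 0" using State_None_iff[OF w'(2), of 0] by simp
 have z: "A s (Shift X t V) = 0" if "s < top" for s
  using A_dead[OF w'(1) that] A_0[OF w'(1)] by (simp add: l)
 have "(SUP q\<in>{q\<in>\<rat>. 0 <= q}. A (ennreal q) (Shift X t V)) <= 0" using z by (intro SUP_least) simp
 then have "AA (Shift X t V) top = 0" by (simp add: AA_top)
 then have "AA (Shift X t V) x = 0" for x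
  using z by (cases "x = top") (auto simp: AA_less_top less_top)
 then show ?thesis by auto
qed

lemma dclock_AA_shift:
 assumes w: "V \<in> Lam" and t: "t < top" and \<phi>: "\<phi> \<in> BM borel"
 shows "(LI s. ind {t..} s * \<phi> s wrt dA V) = (LI s. \<phi> (t + s) wrt dclock (AA (Shift X t V)))"
proof (rule dclock_shift)
 have "V \<in> \<Omega>" "Shift X t V \<in> \<Omega>" using w Lam_Omega Shift_in by auto
 then show "clock (AA V)" "clock (AA (Shift X t V))" by (auto intro: clock_AA)
qed (use AA_add[OF w t] AA_shift_dead[OF w t] t \<phi> in auto)

abbreviation \<tau> :: "real => 'w => ennreal" where "\<tau> u V \<equiv> hit (AA V) u"

text \<open>The functional is constant after the life time, so it does not cross a level there.\<close>

lemma hit_alive: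
 assumes w: "V \<in> \<Omega>" and h: "\<tau> u V < top"
 shows "State X (\<tau> u V) V ~= None"
proof
 assume "State X (\<tau> u V) V = None"
 then have z: "life_time X V <= \<tau> u V" using State_None_iff[OF w] by simp
 note c = clock_AA[OF w]
 have L: "V \<in> Lam"
 proof (rule ccontr)
  assume "V \<notin> Lam"
  then have "AA V = (\<lambda>_. 0)" using AA_off[OF w] by auto
  then have "\<tau> u V = top" by (simp add: hit_def)
  with h show False by simp
 qed
 obtain r where r: "\<tau> u V < r" "r < top" using dense[OF h] by auto
 have "ennreal u < AA V r" using r(1) hit_less_iff[OF c] by simp
 also have "AA V r = AA V (life_time X V)"
  using A_dead[OF L r(2)] z r h by (simp add: AA_less_top le_less_trans)
 finally have "\<tau> u V < life_time X V" using hit_less_iff[OF c] by simp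
 with z show False by simp
qed

lemma AA_measurable: "(\<lambda>V. AA V t) \<in> BM (Fil t)"
proof (cases "t = top")
 case False
 then have "t < top" by (simp add: less_top)
 from A_adapted[OF this] show ?thesis
  by (rule measurable_cong[THEN iffD1, rotated]) (simp add: AA_less_top \<open>t < top\<close>)
next
 case True
 have "A (ennreal q) \<in> BM Fu" for q
  using measurable_Fil_mono[OF _ A_adapted[of "ennreal q"], of top] by simp
 moreover have "countable {q\<in>\<rat>. (0::real) <= q}" by (rule countable_subset[OF _ countable_rat]) auto
 ultimately have "(\<lambda>V. SUP q\<in>{q\<in>\<rat>. 0 <= q}. A (ennreal q) V) \<in> BM Fu"
  by (intro borel_measurable_SUP) auto
 then show ?thesis by (simp add: True AA_top)
qed

lemma AA_measurable_mono: "s <= t ==> (\<lambda>V. AA V s) \<in> BM (Fil t)"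
 by (rule measurable_Fil_mono[OF _ AA_measurable])

lemma hit_min_measurable:
 "(\<lambda>z. min (\<tau> (fst z) (snd z)) t) \<in> BM (borel \<Otimes>\<^sub>M Fil t)"
proof (rule borel_measurableI_less)
 fix r
 show "{z \<in> space (borel \<Otimes>\<^sub>M Fil t). min (\<tau> (fst z) (snd z)) t < r} \<in> sets (borel \<Otimes>\<^sub>M Fil t)"
 proof (cases "t < r")
  case True
  then have "{z \<in> space (borel \<Otimes>\<^sub>M Fil t). min (\<tau> (fst z) (snd z)) t < r} = space (borel \<Otimes>\<^sub>M Fil t)"
   by (auto simp: min_less_iff_disj)
  then show ?thesis by (metis sets.top)
 next
  case False
  then have "(\<lambda>z. AA (snd z) r) \<in> BM (borel \<Otimes>\<^sub>M Fil t)"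
   by (intro measurable_compose[OF measurable_snd AA_measurable_mono]) simp
  then have "{z \<in> space (borel \<Otimes>\<^sub>M Fil t). ennreal (fst z) < AA (snd z) r} \<in> sets (borel \<Otimes>\<^sub>M Fil t)"
   by measurable
  moreover have "{z \<in> space (borel \<Otimes>\<^sub>M Fil t). ennreal (fst z) < AA (snd z) r} =
    {z \<in> space (borel \<Otimes>\<^sub>M Fil t). min (\<tau> (fst z) (snd z)) t < r}"
   using False by (auto simp: space_pair_measure min_less_iff_disj hit_less_iff[OF clock_AA])
  ultimately show ?thesis by simp
 qed
qed

lemma hit_joint: "(\<lambda>z. \<tau> (fst z) (snd z)) \<in> BM (TF)"
 using hit_min_measurable[of top] by simp

lemma hit_joint' [measurable (raw)]:
 assumes "f \<in> BM N" "g \<in> N \<rightarrow>\<^sub>M Fu"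
 shows "(\<lambda>z. \<tau> (f z) (g z)) \<in> BM N"
 using measurable_compose[OF measurable_Pair[OF assms] hit_joint] by simp

lemma State_joint_Fu [measurable (raw)]:
 assumes "f \<in> BM N" "g \<in> N \<rightarrow>\<^sub>M Fu"
 shows "(\<lambda>z. State X (f z) (g z)) \<in> N \<rightarrow>\<^sub>M borel_cpt"
proof -
 have "g \<in> N \<rightarrow>\<^sub>M F0" using assms(2) F0_Fu unfolding measurable_def by auto
 from measurable_compose[OF measurable_Pair[OF assms(1) this] State_joint] show ?thesis by simp
qed

text \<open>Since \<open>\<tau> u < t\<close> means $A_t > u$, this uses the right-continuity of the filtration.\<close>

lemma stopping_time_hit: "stopping_time Fil (\<tau> u)"
proof
 fix t
 show "Measurable.pred (Fil t) (\<lambda>V. \<tau> u V <= t)"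
 proof (cases "t = top")
  case False
  then have t: "t < top" by (simp add: less_top)
  have "{V\<in>\<Omega>. \<tau> u V <= t} \<in> sets (Fil s)" if s: "t < s" for s
  proof -
   obtain f where f: "\<And>n. t < f n" "f \<longlonglongrightarrow> t"
    using approx_from_above_dense_linorder[OF t] by auto
   have eq: "\<tau> u V <= t \<longleftrightarrow> (\<forall>n. ennreal u < AA V (min (f n) s))" if w: "V \<in> \<Omega>" for V
   proof -
    have "\<tau> u V <= t \<longleftrightarrow> (\<forall>n. \<tau> u V < min (f n) s)"
    proof
     assume "\<forall>n. \<tau> u V < min (f n) s"
     then show "\<tau> u V <= t" by (intro LIMSEQ_le_const[OF f(2)]) (auto intro: less_imp_le)
    qed (use f(1) s in \<open>auto intro: le_less_trans\<close>)
    then show ?thesis by (simp only: hit_less_iff[OF clock_AA[OF w]])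
   qed
   have "{V\<in>\<Omega>. \<tau> u V <= t} = {V\<in>space (Fil s). \<forall>n. ennreal u < AA V (min (f n) s)}" using eq by auto
   also have "... \<in> sets (Fil s)"
   proof -
    have [measurable]: "(\<lambda>V. AA V (min (f n) s)) \<in> BM (Fil s)" for n
     by (rule AA_measurable_mono) simp
    show ?thesis by measurable
   qed
   finally show ?thesis .
  qed
  then have "{V\<in>\<Omega>. \<tau> u V <= t} \<in> sets (Fil t)" using Fil_right_cont[OF t] by auto
  then show ?thesis by (simp add: pred_def)
 qed simp
qed

lemma nn_integral_AA:
 assumes "V \<in> \<Omega>" "\<phi> \<in> BM borel"
 shows "(LI s. \<phi> s wrt dA V) =
  (LI u. ind {0..} u * ind {..<top} (\<tau> u V) * \<phi> (\<tau> u V) wrt lborel)"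
 by (rule nn_integral_dclock[OF clock_AA[OF assms(1)] assms(2)])

lemma AE_dclock_alive: "V \<in> \<Omega> ==> AE s in dA V. State X s V ~= None"
proof -
 assume w: "V \<in> \<Omega>"
 have eq: "{s. State X s V = None} = {life_time X V..}" using State_None_iff[OF w] by auto
 have "emeasure (dA V) {life_time X V..} = (LI s. ind {life_time X V..} s wrt dA V)"
  by simp
 also have "... = (LI u. 0 wrt (lborel :: real measure))"
 proof (subst nn_integral_AA[OF w], simp, rule nn_integral_cong)
  fix u
  have "\<not> life_time X V <= \<tau> u V" if "\<tau> u V < top"
   using hit_alive[OF w that] State_None_iff[OF w, of "\<tau> u V"] by simp
  then show "ind {0..} u * ind {..<top} (\<tau> u V) * ind {life_time X V..} (\<tau> u V) = (0::ennreal)"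
   by (auto simp: indicator_def)
 qed
 finally have "{s. State X s V = None} \<in> null_sets (dA V)" unfolding eq by auto
 then have "AE s in dA V. s \<notin> {s. State X s V = None}" by (rule AE_not_in)
 then show ?thesis by simp
qed

lemma nn_integral_AA_measurable:
 assumes f: "(\<lambda>(s, z). f s z) \<in> BM (borel \<Otimes>\<^sub>M N)" and g: "g \<in> N \<rightarrow>\<^sub>M Fu"
 shows "(\<lambda>z. LI s. f s z wrt dclock (AA (g z))) \<in> BM N"
proof -
 note g[measurable]
 have F: "(\<lambda>w. f (\<tau> (snd w) (g (fst w))) (fst w)) \<in> BM (N \<Otimes>\<^sub>M lborel)"
 proof -
  have "(\<lambda>w. (\<tau> (snd w) (g (fst w)), fst w)) \<in> N \<Otimes>\<^sub>M lborel \<rightarrow>\<^sub>M borel \<Otimes>\<^sub>M N" by measurable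
  from measurable_compose[OF this f] show ?thesis by simp
 qed
 have "(\<lambda>z. LI u. ind {0..} u * ind {..<top} (\<tau> u (g z)) * f (\<tau> u (g z)) z wrt lborel) \<in> BM N"
  using F by (intro lborel.borel_measurable_nn_integral) (simp add: split_beta')
 then show ?thesis
 proof (rule measurable_cong[THEN iffD1, rotated])
  fix z assume z: "z \<in> space N"
  then have "g z \<in> \<Omega>" using measurable_space[OF g] by simp
  moreover have "(\<lambda>s. (s, z)) \<in> borel \<rightarrow>\<^sub>M borel \<Otimes>\<^sub>M N" using z by simp
  from measurable_compose[OF this f] have "(\<lambda>s. f s z) \<in> BM borel" by simp
  ultimately show "(LI u. ind {0..} u * ind {..<top} (\<tau> u (g z)) * f (\<tau> u (g z)) z wrt lborel) =
   (LI s. f s z wrt dclock (AA (g z)))" by (rule nn_integral_AA[symmetric])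
 qed
qed

lemma AA_joint: "(\<lambda>z. AA (snd z) (fst z)) \<in> BM (TF)"
proof -
 have "(\<lambda>z. LI s. ind {..<fst z} s wrt dclock (AA (snd z))) \<in> BM (TF)"
 proof (rule nn_integral_AA_measurable)
  have "(\<lambda>w :: ennreal \<times> ennreal \<times> 'w. if fst (snd w) <= fst w then 0 else 1 :: ennreal) \<in> BM (borel \<Otimes>\<^sub>M TF)"
   by measurable
  moreover have "(if fst (snd w) <= fst w then 0 else 1 :: ennreal) = ind {..<fst (snd w)} (fst w)" for w :: "ennreal \<times> ennreal \<times> 'w"
   by (auto simp: indicator_def)
  ultimately show "(\<lambda>(s :: ennreal, z). ind {..<fst z} s :: ennreal) \<in> BM (borel \<Otimes>\<^sub>M TF)"
   by (simp add: split_beta')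
 qed measurable
 then show ?thesis
  by (rule measurable_cong[THEN iffD1, rotated])
   (auto simp: space_pair_measure emeasure_dclock_less[OF clock_AA])
qed

lemma inc_joint [measurable (raw)]:
 assumes [measurable]: "f \<in> BM N" "g \<in> BM N" "h \<in> N \<rightarrow>\<^sub>M Fu"
 shows "(\<lambda>z. inc (AA (h z)) (f z) (g z)) \<in> BM N"
proof -
 have "(\<lambda>z. LI s. ind {f z..<g z} s wrt dclock (AA (h z))) \<in> BM N"
 proof (rule nn_integral_AA_measurable)
  have "(\<lambda>w. if f (snd w) <= fst w \<and> fst w < g (snd w) then 1 else 0 :: ennreal) \<in> BM (borel \<Otimes>\<^sub>M N)"
   by measurable
  then show "(\<lambda>(s :: ennreal, z). ind {f z..<g z} s :: ennreal) \<in> BM (borel \<Otimes>\<^sub>M N)"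
   by (simp add: split_beta' indicator_def of_bool_def)
 qed measurable
 then show ?thesis by (simp add: inc_nn)
qed

lemma AA_joint' [measurable (raw)]:
 assumes "f \<in> BM N" "g \<in> N \<rightarrow>\<^sub>M Fu"
 shows "(\<lambda>z. AA (g z) (f z)) \<in> BM N"
 using measurable_compose[OF measurable_Pair[OF assms] AA_joint] by simp

lemma inc_shift:
 assumes "V \<in> Lam" "s < top" "s <= t"
 shows "inc (AA V) s t = AA (Shift X s V) (t - s)"
proof -
 have w: "Shift X s V \<in> \<Omega>" using assms Lam_Omega Shift_in by auto
 have "inc (AA V) s t = (LI r. ind {s..} r * ind {..<t} r wrt dA V)"
  unfolding inc_nn by (intro nn_integral_cong) (auto simp: indicator_def)
 also have "... = (LI r. ind {..<t} (s + r) wrt dclock (AA (Shift X s V)))"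
  by (rule dclock_AA_shift[OF assms(1,2)]) simp
 also have "... = (LI r. ind {..<t - s} r wrt dclock (AA (Shift X s V)))"
 proof (intro nn_integral_cong)
  fix r
  have "s + r < t \<longleftrightarrow> r < t - s"
   using ennreal_add_left_cancel_less[of s r "t - s"] assms by (auto simp: add_diff_inverse_ennreal)
  then show "ind {..<t} (s + r) = (ind {..<t - s} r :: ennreal)" by (simp add: indicator_def)
 qed
 also have "... = AA (Shift X s V) (t - s)"
  by (simp add: emeasure_dclock_less[OF clock_AA[OF w]])
 finally show ?thesis .
qed

text \<open>The strong Markov property at all the times \<open>\<tau> u\<close> at once.\<close>

lemma nn_integral_AA_swap:
 assumes f: "(\<lambda>(s, V). f s V) \<in> BM (TF)"
 shows "(LI V. (LI s. f s V wrt dA V) wrt Pu x) =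
   (LI u. ind {0..} u * (LI V. ind {..<top} (\<tau> u V) * f (\<tau> u V) V wrt Pu x) wrt lborel)"
proof -
 interpret P: prob_space "Pu x" by (rule prob_Pu)
 interpret pair_sigma_finite lborel "Pu x" by unfold_locales
 have "(\<lambda>w. (\<tau> (fst w) (snd w), snd w)) \<in> lborel \<Otimes>\<^sub>M Pu x \<rightarrow>\<^sub>M borel \<Otimes>\<^sub>M Fu" by measurable
 from measurable_compose[OF this f]
 have F[measurable]: "(\<lambda>w. f (\<tau> (fst w) (snd w)) (snd w)) \<in> BM (lborel \<Otimes>\<^sub>M Pu x)" by simp
 have Fu[measurable]: "(\<lambda>V. f (\<tau> u V) V) \<in> BM (Pu x)" for u
  using measurable_compose[OF _ F, of "\<lambda>V. (u, V)" "Pu x"] by simp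
 have sec: "(\<lambda>s. f s V) \<in> BM borel" if "V \<in> \<Omega>" for V
 proof -
  have "(\<lambda>s. (s, V)) \<in> borel \<rightarrow>\<^sub>M borel \<Otimes>\<^sub>M Fu" using that by simp
  from measurable_compose[OF this f] show ?thesis by simp
 qed
 have "(LI V. (LI s. f s V wrt dA V) wrt Pu x) =
   (LI V. (LI u. ind {0..} u * ind {..<top} (\<tau> u V) * f (\<tau> u V) V wrt lborel) wrt Pu x)"
  by (intro nn_integral_cong nn_integral_AA) (use sec in auto)
 also have "... = (LI u. (LI V. ind {0..} u * ind {..<top} (\<tau> u V) * f (\<tau> u V) V wrt Pu x) wrt lborel)"
  by (rule Fubini') (simp add: split_beta')
 also have "... = (LI u. ind {0..} u * (LI V. ind {..<top} (\<tau> u V) * f (\<tau> u V) V wrt Pu x) wrt lborel)"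
  by (intro nn_integral_cong) (simp add: nn_integral_cmult[symmetric] mult.assoc)
 finally show ?thesis .
qed

lemma strong_markov_hit:
 assumes H: "(\<lambda>(s, V). H s V) \<in> BM (TF)"
 shows "(LI V. ind {..<top} (\<tau> u V) * H (\<tau> u V) (Shift X (\<tau> u V) V) wrt Pu x) =
  (LI V. ind {..<top} (\<tau> u V) * (LI V'. H (\<tau> u V) V' wrt Pu (State X (\<tau> u V) V)) wrt Pu x)"
proof -
 have "(\<lambda>z. ind {..<top} (fst z) * H (fst z) (snd z)) \<in> BM (TF)"
  using H by (simp add: split_beta')
 from strong_markov[OF stopping_time_hit[of u] this, where x=x]
 have "(LI V. ind {..<top} (\<tau> u V) * H (\<tau> u V) (Shift X (\<tau> u V) V) wrt Pu x) =
  (LI V. (LI V'. ind {..<top} (\<tau> u V) * H (\<tau> u V) V' wrt Pu (State X (\<tau> u V) V)) wrt Pu x)"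
  by simp
 also have "... = (LI V. ind {..<top} (\<tau> u V) * (LI V'. H (\<tau> u V) V' wrt Pu (State X (\<tau> u V) V)) wrt Pu x)"
  by (intro nn_integral_cong) (simp add: indicator_def)
 finally show ?thesis .
qed

lemma State_section_joint:
 assumes \<Psi>: "(\<lambda>(s, y). \<Psi> s y) \<in> BM (borel \<Otimes>\<^sub>M borel_cpt)"
 shows "(\<lambda>(s, V). \<Psi> s (State X s V)) \<in> BM (TF)"
proof -
 have "(\<lambda>w. (fst w, State X (fst w) (snd w))) \<in> TF \<rightarrow>\<^sub>M borel \<Otimes>\<^sub>M borel_cpt" by measurable
 from measurable_compose[OF this \<Psi>] show ?thesis by (simp add: split_beta')
qed

lemma strong_markov_AA_le:
 assumes G: "(\<lambda>(s, V). G s V) \<in> BM (TF)"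
  and H: "(\<lambda>(s, V). H s V) \<in> BM (TF)"
  and GH: "\<And>s V. V \<in> Lam ==> s < top ==> State X s V ~= None ==> G s V <= H s (Shift X s V)"
  and \<Psi>: "(\<lambda>(s, y). \<Psi> s y) \<in> BM (borel \<Otimes>\<^sub>M borel_cpt)"
  and H\<Psi>: "\<And>s y. s < top ==> (LI V. H s V wrt Pu (Some y)) <= \<Psi> s (Some y)"
 shows "(LI V. (LI s. G s V wrt dA V) wrt Pu x) <=
  (LI V. (LI s. \<Psi> s (State X s V) wrt dA V) wrt Pu x)"
proof -
 have le: "(LI V. ind {..<top} (\<tau> u V) * G (\<tau> u V) V wrt Pu x) <=
   (LI V. ind {..<top} (\<tau> u V) * \<Psi> (\<tau> u V) (State X (\<tau> u V) V) wrt Pu x)" for u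
 proof -
  have "(LI V. ind {..<top} (\<tau> u V) * G (\<tau> u V) V wrt Pu x) <=
    (LI V. ind {..<top} (\<tau> u V) * H (\<tau> u V) (Shift X (\<tau> u V) V) wrt Pu x)"
  proof (rule nn_integral_mono_AE)
   show "AE V in Pu x. ind {..<top} (\<tau> u V) * G (\<tau> u V) V <=
     ind {..<top} (\<tau> u V) * H (\<tau> u V) (Shift X (\<tau> u V) V)"
    using AE_Lam AE_space
    by eventually_elim (use GH hit_alive in \<open>auto simp: indicator_def\<close>)
  qed
  also have "... = (LI V. ind {..<top} (\<tau> u V) * (LI V'. H (\<tau> u V) V' wrt Pu (State X (\<tau> u V) V)) wrt Pu x)"
   by (rule strong_markov_hit[OF H])
  also have "... <= (LI V. ind {..<top} (\<tau> u V) * \<Psi> (\<tau> u V) (State X (\<tau> u V) V) wrt Pu x)"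
  proof (intro nn_integral_mono)
   fix V assume "V \<in> space (Pu x)"
   then have w: "V \<in> \<Omega>" by simp
   show "ind {..<top} (\<tau> u V) * (LI V'. H (\<tau> u V) V' wrt Pu (State X (\<tau> u V) V)) <=
     ind {..<top} (\<tau> u V) * \<Psi> (\<tau> u V) (State X (\<tau> u V) V)"
   proof (cases "\<tau> u V < top")
    case True
    then obtain y where "State X (\<tau> u V) V = Some y" using hit_alive[OF w True] by auto
    then show ?thesis using True H\<Psi>[OF True, of y] by simp
   qed simp
  qed
  finally show ?thesis .
 qed
 show ?thesis
  unfolding nn_integral_AA_swap[OF G] nn_integral_AA_swap[OF State_section_joint[OF \<Psi>]]
  by (rule nn_integral_mono, rule mult_left_mono[OF le]) simp
qed

text \<open>The functional \<open>G\<close>, evaluated at a point of increase \<open>s\<close>, depends on the path after \<open>s\<close> only, in the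
 form \<open>H\<close>. Its expectation given $X_s$ may be put in its place, because the points of increase
 are exhausted by the stopping times \<open>\<tau> u\<close>. The set \<open>L\<close> of full measure carries the regularity of all
 functionals that enter \<open>G\<close>.\<close>

theorem strong_markov_AA:
 assumes L: "AE V in Pu x. V \<in> L"
  and G: "(\<lambda>(s, V). G s V) \<in> BM (TF)"
  and H: "(\<lambda>(s, V). H s V) \<in> BM (TF)"
  and GH: "\<And>s V. V \<in> L ==> s < top ==> State X s V ~= None ==> G s V = H s (Shift X s V)"
  and \<Psi>: "(\<lambda>(s, y). \<Psi> s y) \<in> BM (borel \<Otimes>\<^sub>M borel_cpt)"
  and H\<Psi>: "\<And>s y. s < top ==> (LI V. H s V wrt Pu (Some y)) = \<Psi> s (Some y)"
 shows "(LI V. (LI s. G s V wrt dA V) wrt Pu x) =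
  (LI V. (LI s. \<Psi> s (State X s V) wrt dA V) wrt Pu x)"
proof -
 have "(LI V. ind {..<top} (\<tau> u V) * G (\<tau> u V) V wrt Pu x) =
   (LI V. ind {..<top} (\<tau> u V) * \<Psi> (\<tau> u V) (State X (\<tau> u V) V) wrt Pu x)" for u
 proof -
  have "(LI V. ind {..<top} (\<tau> u V) * G (\<tau> u V) V wrt Pu x) =
    (LI V. ind {..<top} (\<tau> u V) * H (\<tau> u V) (Shift X (\<tau> u V) V) wrt Pu x)"
  proof (rule nn_integral_cong_AE)
   show "AE V in Pu x. ind {..<top} (\<tau> u V) * G (\<tau> u V) V =
     ind {..<top} (\<tau> u V) * H (\<tau> u V) (Shift X (\<tau> u V) V)"
    using L AE_space
    by eventually_elim (use GH hit_alive in \<open>auto simp: indicator_def\<close>)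
  qed
  also have "... = (LI V. ind {..<top} (\<tau> u V) * (LI V'. H (\<tau> u V) V' wrt Pu (State X (\<tau> u V) V)) wrt Pu x)"
   by (rule strong_markov_hit[OF H])
  also have "... = (LI V. ind {..<top} (\<tau> u V) * \<Psi> (\<tau> u V) (State X (\<tau> u V) V) wrt Pu x)"
  proof (intro nn_integral_cong)
   fix V assume "V \<in> space (Pu x)"
   then have w: "V \<in> \<Omega>" by simp
   show "ind {..<top} (\<tau> u V) * (LI V'. H (\<tau> u V) V' wrt Pu (State X (\<tau> u V) V)) =
     ind {..<top} (\<tau> u V) * \<Psi> (\<tau> u V) (State X (\<tau> u V) V)"
   proof (cases "\<tau> u V < top")
    case True
    then obtain y where "State X (\<tau> u V) V = Some y" using hit_alive[OF w True] by auto
    then show ?thesis using True H\<Psi>[OF True, of y] by simp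
   qed simp
  qed
  finally show ?thesis .
 qed
 then show ?thesis
  unfolding nn_integral_AA_swap[OF G] nn_integral_AA_swap[OF State_section_joint[OF \<Psi>]] by simp
qed

end

section \<open>Potentials of an additive functional\<close>

text \<open>A positive functional with the additivity and continuity of an integral is an integral.\<close>

lemma functional_is_integral:
 fixes L :: "('a => ennreal) => ennreal" and M :: "'a measure"
 assumes sp: "space M = UNIV"
  and add: "\<And>f g. f \<in> BM M ==> g \<in> BM M ==> L (\<lambda>x. f x + g x) = L f + L g"
  and cmult: "\<And>f c. f \<in> BM M ==> L (\<lambda>x. c * f x) = c * L f"
  and SUP: "\<And>F. (\<And>i::nat. F i \<in> BM M) ==> incseq F ==> L (\<lambda>x. SUP i. F i x) = (SUP i. L (F i))"
 shows "\<exists>N. sets N = sets M \<and> (\<forall>f\<in>BM M. (LI x. f x wrt N) = L f)"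
proof -
 have zero: "L (\<lambda>_. 0) = 0" using cmult[of "\<lambda>_. 0" 0] by simp
 define N where "N = measure_of UNIV (sets M) (\<lambda>S. L (ind S))"
 have sN: "sets N = sets M" unfolding N_def using sp by (metis sets.sets_measure_of_eq)
 have eN: "emeasure N S = L (ind S)" if S: "S \<in> sets M" for S
  unfolding N_def
 proof (rule emeasure_measure_of_sigma[OF _ _ _ S])
  show "sigma_algebra UNIV (sets M)" using sets.sigma_algebra_axioms[of M] sp by simp
  show "positive (sets M) (\<lambda>S. L (ind S))"
  proof -
   have "ind {} = (\<lambda>_ :: 'a. 0 :: ennreal)" by auto
   then show ?thesis using zero by (simp add: positive_def)
  qed
  show "countably_additive (sets M) (\<lambda>S. L (ind S))"
  proof (rule countably_additiveI)
   fix B :: "nat => 'a set" assume B: "range B \<subseteq> sets M" "disjoint_family B" "(\<Union>i. B i) \<in> sets M"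
   have [measurable]: "B i \<in> sets M" for i using B by auto
   have s: "(\<Sum>i<n. L (ind (B i))) = L (\<lambda>x. \<Sum>i<n. ind (B i) x)" for n
   proof (induction n)
    case (Suc n)
    have "L (\<lambda>x. (\<Sum>i<n. ind (B i) x) + ind (B n) x) = L (\<lambda>x. \<Sum>i<n. ind (B i) x) + L (ind (B n))"
     by (rule add) measurable
    then show ?case using Suc by simp
   qed (simp add: zero)
   have ind: "ind (\<Union>i. B i) = (\<lambda>x. SUP n. \<Sum>i<n. ind (B i) x :: ennreal)"
    using suminf_indicator[OF B(2)] by (auto simp: suminf_eq_SUP[symmetric])
   have "L (ind (\<Union>i. B i)) = (SUP n. L (\<lambda>x. \<Sum>i<n. ind (B i) x))"
    unfolding ind by (rule SUP) (auto simp: incseq_def le_fun_def intro!: sum_mono2)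
   then show "(\<Sum>i. L (ind (B i))) = L (ind (\<Union>i. B i))"
    by (simp add: suminf_eq_SUP s)
  qed
 qed
 have "(LI x. f x wrt N) = L f" if "f \<in> BM M" for f
  using that
 proof (induction rule: borel_measurable_induct)
  case (cong f g)
  then have "f = g" using sp by auto
  then show ?case using cong by simp
 next
  case (set S) then show ?case using sN eN by simp
 next
  case (mult u c)
  then show ?case using sN by (simp add: nn_integral_cmult cmult cong: measurable_cong_sets)
 next
  case (add u v)
  then show ?case using sN by (simp add: nn_integral_add assms(2) cong: measurable_cong_sets)
 next
  case (seq U)
  have "(LI x. (SUP i. U i x) wrt N) = (SUP i. LI x. U i x wrt N)"
   using seq sN by (intro nn_integral_monotone_convergence_SUP) (auto cong: measurable_cong_sets)
  then show ?case using seq SUP[of U] by (simp add: SUP_apply[abs_def])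
 qed
 then show ?thesis using sN by blast
qed

lemma nn_integral_exp:
 assumes "0 < c"
 shows "(LI r. ind {0..} r * ennreal (c * exp (- (c * r))) wrt lborel) = 1"
proof -
 interpret prob_space "density lborel (exponential_density c)"
  by (rule prob_space_exponential_density[OF assms])
 have "(LI r. ennreal (exponential_density c r) wrt lborel) = 1"
  using emeasure_space_1 by (subst (asm) emeasure_density) auto
 moreover have "ennreal (exponential_density c r) = ind {0..} r * ennreal (c * exp (- (c * r)))" for r
  by (auto simp: exponential_density_def indicator_def mult.commute)
 ultimately show ?thesis by simp
qed

definition eexp :: "real => ennreal => ennreal"
 where "eexp c s = (if s = top then 0 else ennreal (exp (- (c * enn2real s))))"

lemma eexp_measurable [measurable]: "eexp c \<in> BM borel"
 unfolding eexp_def[abs_def] by measurable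

lemma eexp_real: "0 <= r ==> eexp c (ennreal r) = ennreal (exp (- (c * r)))"
 by (simp add: eexp_def)

locale pcaf_setting = hunt_setting X m p + pcaf X A
 for X :: "('w, 's::{metric_space, second_countable_topology}) process" and m p A
begin

abbreviation TB :: "(ennreal \<times> 's option) measure" where "TB \<equiv> borel \<Otimes>\<^sub>M borel_cpt"

definition NN :: "(ennreal \<times> 's option => ennreal) => 's option => ennreal"
 where "NN \<phi> x = (LI V. (LI s. \<phi> (s, State X s V) wrt dA V) wrt Pu x)"

lemma path_measurable:
 assumes "\<phi> \<in> BM TB" "V \<in> \<Omega>"
 shows "(\<lambda>s. \<phi> (s, State X s V)) \<in> BM borel"
proof -
 have "(\<lambda>s. (s, State X s V)) \<in> borel \<rightarrow>\<^sub>M TB"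
  using assms(2) by (auto intro!: measurable_Pair State_joint_Fu)
 from measurable_compose[OF this assms(1)] show ?thesis .
qed

lemma path_joint:
 assumes "\<phi> \<in> BM TB"
 shows "(\<lambda>(s, V). \<phi> (s, State X s V)) \<in> BM (TF)"
 using State_section_joint[of "\<lambda>s y. \<phi> (s, y)"] assms by simp

lemma path_integral_Fu:
 assumes "\<phi> \<in> BM TB"
 shows "(\<lambda>V. LI s. \<phi> (s, State X s V) wrt dA V) \<in> BM Fu"
 using nn_integral_AA_measurable[OF path_joint[OF assms], of "\<lambda>V. V"] by simp

lemma NN_UB: "\<phi> \<in> BM TB ==> NN \<phi> \<in> BM UB"
 unfolding NN_def
 by (rule measurable_compose[OF Pu_kernel_sub nn_integral_measurable_subprob_algebra[OF path_integral_Fu]])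

lemma NN_add:
 assumes "\<phi> \<in> BM TB" "\<psi> \<in> BM TB"
 shows "NN (\<lambda>z. \<phi> z + \<psi> z) x = NN \<phi> x + NN \<psi> x"
proof -
 have "NN (\<lambda>z. \<phi> z + \<psi> z) x = (LI V. (LI s. \<phi> (s, State X s V) wrt dA V) + (LI s. \<psi> (s, State X s V) wrt dA V) wrt Pu x)"
  unfolding NN_def using path_measurable[OF assms(1)] path_measurable[OF assms(2)]
  by (intro nn_integral_cong nn_integral_add) (auto cong: measurable_cong_sets)
 also have "... = NN \<phi> x + NN \<psi> x"
  unfolding NN_def using path_integral_Fu[OF assms(1)] path_integral_Fu[OF assms(2)]
  by (intro nn_integral_add) (auto cong: measurable_cong_sets)
 finally show ?thesis .
qed

lemma NN_cmult:
 assumes "\<phi> \<in> BM TB"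
 shows "NN (\<lambda>z. c * \<phi> z) x = c * NN \<phi> x"
proof -
 have "NN (\<lambda>z. c * \<phi> z) x = (LI V. c * (LI s. \<phi> (s, State X s V) wrt dA V) wrt Pu x)"
  unfolding NN_def using path_measurable[OF assms]
  by (intro nn_integral_cong nn_integral_cmult) (auto cong: measurable_cong_sets)
 also have "... = c * NN \<phi> x"
  unfolding NN_def using path_integral_Fu[OF assms] by (intro nn_integral_cmult) (auto cong: measurable_cong_sets)
 finally show ?thesis .
qed

lemma NN_SUP:
 assumes "\<And>i::nat. F i \<in> BM TB" "incseq F"
 shows "NN (\<lambda>z. SUP i. F i z) x = (SUP i. NN (F i) x)"
proof -
 have inc: "F i z <= F j z" if "i <= j" for i j z using assms(2) that by (cases z) (auto simp: incseq_def le_fun_def)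
 have "NN (\<lambda>z. SUP i. F i z) x = (LI V. (SUP i. LI s. F i (s, State X s V) wrt dA V) wrt Pu x)"
  unfolding NN_def using path_measurable[OF assms(1)] inc
  by (intro nn_integral_cong nn_integral_monotone_convergence_SUP) (auto simp: incseq_def le_fun_def cong: measurable_cong_sets)
 also have "... = (SUP i. NN (F i) x)"
  unfolding NN_def using path_integral_Fu[OF assms(1)] inc
  by (intro nn_integral_monotone_convergence_SUP) (auto simp: incseq_def le_fun_def intro!: nn_integral_mono cong: measurable_cong_sets)
 finally show ?thesis .
qed

lemma NN_mono: "(\<And>z. \<phi> z <= \<psi> z) ==> NN \<phi> x <= NN \<psi> x"
 unfolding NN_def by (intro nn_integral_mono) auto

lemma NN_cong:
 assumes "\<And>s y. 0 < s ==> s < top ==> \<phi> (s, Some y) = \<psi> (s, Some y)"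
 shows "NN \<phi> x = NN \<psi> x"
 unfolding NN_def
proof (rule nn_integral_cong, rule nn_integral_cong_AE)
 fix V assume "V \<in> space (Pu x)"
 then have w: "V \<in> \<Omega>" by simp
 show "AE s in dA V. \<phi> (s, State X s V) = \<psi> (s, State X s V)"
  using AE_dclock_alive[OF w] AE_dclock_less_top[OF clock_AA[OF w]] AE_dclock_neq[OF clock_AA[OF w], of 0]
  by eventually_elim (use assms in \<open>auto simp: zero_less_iff_neq_zero\<close>)
qed

lemma NN_None: "NN \<phi> None = 0"
proof -
 have "AE V in Pu None. (LI s. \<phi> (s, State X s V) wrt dA V) = 0"
  using AE_Pu_None AE_space
 proof eventually_elim
  case (elim V)
  then have "AE s in dA V. False" using AE_dclock_alive[of V] by simp
  then have "(LI s. \<phi> (s, State X s V) wrt dA V) = (LI s. 0 wrt dA V)"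
   by (intro nn_integral_cong_AE) auto
  then show ?case by simp
 qed
 then have "NN \<phi> None = (LI V. 0 wrt Pu None)" unfolding NN_def by (rule nn_integral_cong_AE)
 then show ?thesis by simp
qed

text \<open>The same with initial law \<open>g \<cdot> m\<close>, as a measure on time and space.\<close>

definition NG :: "('s option => ennreal) => (ennreal \<times> 's option) measure"
 where "NG g = (SOME N. sets N = sets TB \<and>
  (\<forall>\<phi>\<in>BM TB. (LI z. \<phi> z wrt N) = (LI x. g (Some x) * NN \<phi> (Some x) wrt M)))"

lemma NG_props:
 assumes g: "g \<in> BM UB"
 shows "sets (NG g) = sets TB"
  and "\<phi> \<in> BM TB ==> (LI z. \<phi> z wrt NG g) = (LI x. g (Some x) * NN \<phi> (Some x) wrt M)"
proof -
 have gm[measurable]: "(\<lambda>x. g (Some x)) \<in> BM M" by (rule UB_Some_measurable[OF g])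
 have Nm: "(\<lambda>x. NN \<phi> (Some x)) \<in> BM M" if "\<phi> \<in> BM TB" for \<phi>
  by (rule UB_Some_measurable[OF NN_UB[OF that]])
 have "\<exists>N. sets N = sets TB \<and> (\<forall>\<phi>\<in>BM TB. (LI z. \<phi> z wrt N) = (LI x. g (Some x) * NN \<phi> (Some x) wrt M))"
 proof (rule functional_is_integral)
  show "space TB = UNIV" by (simp add: space_pair_measure)
  fix \<phi> \<psi> :: "ennreal \<times> 's option => ennreal" and c assume *: "\<phi> \<in> BM TB"
  note [measurable] = Nm[OF *]
  show "(LI x. g (Some x) * NN (\<lambda>z. c * \<phi> z) (Some x) wrt M) = c * (LI x. g (Some x) * NN \<phi> (Some x) wrt M)"
   unfolding NN_cmult[OF *] by (subst nn_integral_cmult[symmetric]) (auto simp: mult.left_commute)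
  assume **: "\<psi> \<in> BM TB"
  note [measurable] = Nm[OF **]
  show "(LI x. g (Some x) * NN (\<lambda>z. \<phi> z + \<psi> z) (Some x) wrt M) =
    (LI x. g (Some x) * NN \<phi> (Some x) wrt M) + (LI x. g (Some x) * NN \<psi> (Some x) wrt M)"
   unfolding NN_add[OF * **] distrib_left by (rule nn_integral_add) measurable
 next
  fix F :: "nat => ennreal \<times> 's option => ennreal"
  assume F: "\<And>i. F i \<in> BM TB" "incseq F"
  note [measurable] = Nm[OF F(1)]
  have inc: "incseq (\<lambda>i x. g (Some x) * NN (F i) (Some x))"
   using F(2) by (auto simp: incseq_def le_fun_def intro!: mult_left_mono NN_mono)
  show "(LI x. g (Some x) * NN (\<lambda>z. SUP i. F i z) (Some x) wrt M) = (SUP i. LI x. g (Some x) * NN (F i) (Some x) wrt M)"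
   unfolding NN_SUP[OF F]
   by (subst nn_integral_monotone_convergence_SUP[symmetric, OF inc]) (auto simp: SUP_mult_left_ennreal)
 qed
 from someI_ex[OF this, folded NG_def]
 show "sets (NG g) = sets TB"
  and "\<phi> \<in> BM TB ==> (LI z. \<phi> z wrt NG g) = (LI x. g (Some x) * NN \<phi> (Some x) wrt M)"
  by auto
qed

lemmas nn_integral_NG = NG_props(2)

lemma NN_shift:
 assumes a: "a < top" and \<phi>: "\<phi> \<in> BM TB"
 shows "NN (\<lambda>(s, y). ind {a..} s * \<phi> (s - a, y)) x = TT a (NN \<phi>) x"
proof -
 have \<phi>': "(\<lambda>z. \<phi> (fst z - a, snd z)) \<in> BM TB"
 proof -
  have "(\<lambda>z. (fst z - a, snd z)) \<in> TB \<rightarrow>\<^sub>M TB" by measurable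
  from measurable_compose[OF this \<phi>] show ?thesis .
 qed
 have "NN (\<lambda>(s, y). ind {a..} s * \<phi> (s - a, y)) x =
   (LI V. (LI s. \<phi> (s, State X s (Shift X a V)) wrt dclock (AA (Shift X a V))) wrt Pu x)"
  unfolding NN_def
 proof (rule nn_integral_cong_AE)
  show "AE V in Pu x. (LI s. (case (s, State X s V) of (s, y) => ind {a..} s * \<phi> (s - a, y)) wrt dA V) =
    (LI s. \<phi> (s, State X s (Shift X a V)) wrt dclock (AA (Shift X a V)))"
   using AE_Lam
  proof eventually_elim
   case (elim V)
   then have w: "V \<in> \<Omega>" using Lam_Omega by auto
   have "(LI s. ind {a..} s * \<phi> (s - a, State X s V) wrt dA V) =
     (LI s. \<phi> (a + s - a, State X (a + s) V) wrt dclock (AA (Shift X a V)))"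
    using path_measurable[OF \<phi>' w] by (intro dclock_AA_shift[OF elim a]) simp
   then show ?case using a by (simp add: State_Shift[OF w] add.commute)
  qed
 qed
 also have "... = TT a (NN \<phi>) x"
  unfolding NN_def using nn_integral_Shift[OF path_integral_Fu[OF \<phi>]] .
 finally show ?thesis .
qed

text \<open>Starting from \<open>g \<cdot> m\<close> and discarding the time up to \<open>a\<close> amounts to starting from the law at time \<open>a\<close>,
 whose density is \<open>TT a g\<close> by symmetry.\<close>

lemma NG_shift:
 assumes a: "a < top" and \<phi>: "\<phi> \<in> BM TB" and g: "g \<in> BM UB" "g None = 0"
 shows "(LI (s, y). ind {a..} s * \<phi> (s - a, y) wrt NG g) = (LI z. \<phi> z wrt NG (TT a g))"
proof -
 have "(\<lambda>z. ind {a..} (fst z) * \<phi> (fst z - a, snd z)) \<in> BM TB"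
 proof -
  have "(\<lambda>z. (fst z - a, snd z)) \<in> TB \<rightarrow>\<^sub>M TB" by measurable
  from measurable_compose[OF this \<phi>] have [measurable]: "(\<lambda>z. \<phi> (fst z - a, snd z)) \<in> BM TB" .
  show ?thesis by measurable
 qed
 then have "(LI (s, y). ind {a..} s * \<phi> (s - a, y) wrt NG g) =
   (LI x. g (Some x) * NN (\<lambda>(s, y). ind {a..} s * \<phi> (s - a, y)) (Some x) wrt M)"
  by (intro nn_integral_NG[OF g(1)]) (simp add: split_beta')
 also have "... = (LI x. TT a g (Some x) * NN \<phi> (Some x) wrt M)"
  unfolding NN_shift[OF a \<phi>] by (rule TT_symmetric[OF a g NN_UB[OF \<phi>] NN_None])
 also have "... = (LI z. \<phi> z wrt NG (TT a g))"
  by (rule nn_integral_NG[symmetric, OF TT_UB[OF g(1)] \<phi>])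
 finally show ?thesis .
qed

subsection \<open>A nest of sets on which the functional has bounded potential\<close>

text \<open>Nests are built from functions that are only universally measurable at first. Smoothing by the
 semigroup makes such a function Borel, because the transition law has a Borel density.\<close>

lemma TT_density_borel:
 assumes t: "0 < t" "t < top" and h: "h \<in> BM UB" "h None = 0"
 shows "(\<lambda>y. TT t h (Some y)) \<in> BM borel"
proof -
 obtain h' where h': "h' \<in> BM borel_cpt" "AE y in m. h (Some y) = h' (Some y)"
  using UB_representative[OF h(1)] by blast
 interpret sigma_finite_measure m by (rule sigma_finite_m)
 have [measurable]: "(\<lambda>y. h' (Some y)) \<in> BM borel"
  by (rule measurable_compose[OF measurable_Some h'(1)])
 have "TT t h (Some y) = (LI z. pd t y z * h' (Some z) wrt m)" for y
  unfolding TT_density[OF t h] nn_integral_completion using h'(2) by (intro nn_integral_cong_AE) auto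
 moreover have "(\<lambda>y. LI z. pd t y z * h' (Some z) wrt m) \<in> BM borel" by measurable
 ultimately show ?thesis by simp
qed

text \<open>\<open>gE y\<close> is $E_y[\int_0^\infty e^{-r} (1 - A_r)^+\,dr]$. It is positive on \<open>S\<close> because \<open>A\<close> starts
 continuously at zero, and it weights \<open>dA\<close> so that the potential is bounded.\<close>

definition YY :: "'w => ennreal"
 where "YY V = alive (State X 0 V) * (LI r. ind {0..} r * ennreal (exp (- r)) * (1 - AA V (ennreal r)) wrt lborel)"

definition gE :: "'s option => ennreal" where "gE y = (LI V. YY V wrt Pu y)"

lemma YY_measurable: "YY \<in> BM Fu"
proof -
 have [measurable]: "(\<lambda>V. alive (State X 0 V)) \<in> BM Fu"
  by (rule measurable_compose[OF State_Fil alive_borel]) simp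
 show ?thesis unfolding YY_def[abs_def] by measurable
qed

lemma YY_integrand_le: "(LI r. ind {0..} r * ennreal (exp (- r)) * (1 - a r) wrt lborel) <= 1"
proof -
 have "(LI r. ind {0..} r * ennreal (exp (- r)) * (1 - a r) wrt lborel) <= (LI r. ind {0..} r * ennreal (1 * exp (- (1 * r))) wrt lborel)"
  by (intro nn_integral_mono) (auto simp: indicator_def intro!: mult_left_le diff_le_self_ennreal)
 also have "... = 1" by (rule nn_integral_exp) simp
 finally show ?thesis .
qed

lemma YY_le: "YY V <= 1"
 unfolding YY_def using YY_integrand_le[of "\<lambda>r. AA V (ennreal r)"] by (auto simp: indicator_def)

lemma gE_UB: "gE \<in> BM UB"
 unfolding gE_def by (rule measurable_compose[OF Pu_kernel_sub nn_integral_measurable_subprob_algebra[OF YY_measurable]])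

lemma gE_None: "gE None = 0"
proof -
 have "gE None = (LI V. 0 wrt Pu None)"
  unfolding gE_def using AE_Pu_start[of None] by (intro nn_integral_cong_AE) (auto simp: YY_def)
 then show ?thesis by simp
qed

text \<open>As $t \downarrow 0$, the functional of the shifted path, $A_{t+r} - A_t$, tends to $A_r$.\<close>

lemma gE_limit: "(\<lambda>n. TT (ennreal (1 / real (Suc n))) gE (Some y)) \<longlonglongrightarrow> gE (Some y)"
proof -
 define e where "e n = ennreal (1 / real (Suc n))" for n
 have e0: "e \<longlonglongrightarrow> 0"
  using tendsto_ennrealI[OF LIMSEQ_inverse_real_of_nat] by (simp add: e_def[abs_def] inverse_eq_divide)
 have et: "e n < top" for n by (simp add: e_def)
 interpret prob_space "Pu (Some y)" by (rule prob_Pu)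
 have S[measurable]: "(\<lambda>V. YY (Shift X (e n) V)) \<in> BM (Pu (Some y))" for n
  using measurable_compose[OF measurable_Shift_Fu[OF stopping_time_const] YY_measurable] by (simp cong: measurable_cong_sets)
 have [measurable]: "YY \<in> BM (Pu (Some y))" using YY_measurable by (simp cong: measurable_cong_sets)
 have "(\<lambda>n. LI V. YY (Shift X (e n) V) wrt Pu (Some y)) \<longlonglongrightarrow> (LI V. YY V wrt Pu (Some y))"
 proof (rule nn_integral_dominated_convergence[where w="\<lambda>_. 1"])
  show "AE V in Pu (Some y). (\<lambda>n. YY (Shift X (e n) V)) \<longlonglongrightarrow> YY V"
   using AE_Lam AE_Pu_start[of "Some y"]
  proof eventually_elim
   case (elim V)
   then have w: "V \<in> \<Omega>" using Lam_Omega by auto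
   note c = clock_AA[OF w]
   have "0 < life_time X V" using State_None_iff[OF w, of 0] elim(2) by (simp add: zero_less_iff_neq_zero)
   from order_tendstoD(2)[OF e0 this]
   have ev: "\<forall>\<^sub>F n in sequentially. State X (e n) V ~= None"
    by eventually_elim (simp add: State_None_iff[OF w] not_le)
   have cont: "isCont (AA V) t" for t using c by (simp add: clock_def continuous_on_eq_continuous_at)
   have A0: "(\<lambda>n. AA V (e n)) \<longlonglongrightarrow> 0"
    using isCont_tendsto_compose[OF cont e0] c by (simp add: clock_def)
   have ev2: "\<forall>\<^sub>F n in sequentially. AA V (e n) < top"
    using order_tendstoD(2)[OF A0, of top] by simp
   have lim: "(\<lambda>n. LI r. ind {0..} r * ennreal (exp (- r)) * (1 - AA (Shift X (e n) V) (ennreal r)) wrt lborel)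
     \<longlonglongrightarrow> (LI r. ind {0..} r * ennreal (exp (- r)) * (1 - AA V (ennreal r)) wrt lborel)"
   proof (rule nn_integral_dominated_convergence[where w="\<lambda>r. ind {0..} r * ennreal (1 * exp (- (1 * r)))"])
    have AAm: "AA V' \<in> BM borel" if "V' \<in> \<Omega>" for V'
     using clock_AA[OF that] by (auto simp: clock_def intro: borel_measurable_continuous_onI)
    note [measurable] = AAm[OF w] AAm[OF Shift_in[OF w]]
    show "(\<lambda>r. ind {0..} r * ennreal (exp (- r)) * (1 - AA (Shift X (e n) V) (ennreal r))) \<in> BM lborel" for n
     by measurable
    show "(\<lambda>r. ind {0..} r * ennreal (exp (- r)) * (1 - AA V (ennreal r))) \<in> BM lborel" by measurable
    show "(\<lambda>r. ind {0..} r * ennreal (1 * exp (- (1 * r)))) \<in> BM lborel" by measurable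
    show "AE r in lborel. ind {0..} r * ennreal (exp (- r)) * (1 - AA (Shift X (e n) V) (ennreal r))
      <= ind {0..} r * ennreal (1 * exp (- (1 * r)))" for n
     by (intro AE_I2) (auto simp: indicator_def intro!: mult_left_le diff_le_self_ennreal)
    show "(LI r. ind {0..} r * ennreal (1 * exp (- (1 * r))) wrt lborel) < \<infinity>"
     by (subst nn_integral_exp) auto
    show "AE r in lborel. (\<lambda>n. ind {0..} r * ennreal (exp (- r)) * (1 - AA (Shift X (e n) V) (ennreal r)))
      \<longlonglongrightarrow> ind {0..} r * ennreal (exp (- r)) * (1 - AA V (ennreal r))"
    proof (intro AE_I2)
     fix r :: real
     have "(\<lambda>n. e n + ennreal r) \<longlonglongrightarrow> 0 + ennreal r" by (intro tendsto_add e0 tendsto_const)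
     then have "(\<lambda>n. AA V (e n + ennreal r)) \<longlonglongrightarrow> AA V (ennreal r)"
      using isCont_tendsto_compose[OF cont] by simp
     then have "(\<lambda>n. AA V (e n + ennreal r) - AA V (e n)) \<longlonglongrightarrow> AA V (ennreal r) - 0"
      by (intro tendsto_diff_ennreal_general A0) auto
     moreover have "\<forall>\<^sub>F n in sequentially. AA V (e n + ennreal r) - AA V (e n) = AA (Shift X (e n) V) (ennreal r)"
      using ev2 by eventually_elim (simp add: AA_add[OF elim(1) et] )
     ultimately have "(\<lambda>n. AA (Shift X (e n) V) (ennreal r)) \<longlonglongrightarrow> AA V (ennreal r)"
      using Lim_transform_eventually by fastforce
     then have "(\<lambda>n. 1 - AA (Shift X (e n) V) (ennreal r)) \<longlonglongrightarrow> 1 - AA V (ennreal r)"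
      by (intro tendsto_diff_ennreal_general tendsto_const) auto
     then show "(\<lambda>n. ind {0..} r * ennreal (exp (- r)) * (1 - AA (Shift X (e n) V) (ennreal r)))
       \<longlonglongrightarrow> ind {0..} r * ennreal (exp (- r)) * (1 - AA V (ennreal r))"
      by (intro ennreal_tendsto_cmult) (auto simp: indicator_def less_top[symmetric])
    qed
   qed
   have "\<forall>\<^sub>F n in sequentially. (LI r. ind {0..} r * ennreal (exp (- r)) * (1 - AA (Shift X (e n) V) (ennreal r)) wrt lborel) = YY (Shift X (e n) V)"
    using ev by eventually_elim (auto simp: YY_def State_Shift[OF w] indicator_def)
   moreover have "YY V = (LI r. ind {0..} r * ennreal (exp (- r)) * (1 - AA V (ennreal r)) wrt lborel)"
    by (simp add: YY_def elim(2))
   ultimately show ?case using Lim_transform_eventually[OF lim] by simp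
  qed
 qed (use emeasure_space_1 in \<open>auto simp: YY_le\<close>)
 moreover have "(LI V. YY (Shift X (e n) V) wrt Pu (Some y)) = TT (e n) gE (Some y)" for n
  using nn_integral_Shift[OF YY_measurable] by (simp add: gE_def[abs_def])
 ultimately show ?thesis by (simp add: gE_def[symmetric] e_def)
qed

lemma gE_borel: "gE \<in> BM borel_cpt"
proof (rule measurable_from_borel_cpt)
 have "(\<lambda>y. liminf (\<lambda>n. TT (ennreal (1 / real (Suc n))) gE (Some y))) \<in> BM borel"
  by (intro borel_measurable_liminf TT_density_borel gE_UB gE_None) auto
 moreover have "liminf (\<lambda>n. TT (ennreal (1 / real (Suc n))) gE (Some y)) = gE (Some y)" for y
  using gE_limit by (intro lim_imp_Liminf) auto
 ultimately show "(\<lambda>y. gE (Some y)) \<in> BM borel" by simp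
qed simp

lemma gE_pos: "0 < gE (Some y)"
proof (rule ccontr)
 assume "\<not> 0 < gE (Some y)"
 then have "(LI V. YY V wrt Pu (Some y)) = 0" by (simp add: gE_def)
 then have "AE V in Pu (Some y). YY V = 0"
  using YY_measurable by (subst (asm) nn_integral_0_iff_AE) (auto cong: measurable_cong_sets)
 then have "AE V in Pu (Some y). False"
  using AE_Pu_start[of "Some y"] AE_space
 proof eventually_elim
  case (elim V)
  then have w: "V \<in> \<Omega>" by simp
  note c = clock_AA[OF w]
  have [measurable]: "AA V \<in> BM borel"
   using c by (auto simp: clock_def intro: borel_measurable_continuous_onI)
  have "(LI r. ind {0..} r * ennreal (exp (- r)) * (1 - AA V (ennreal r)) wrt lborel) = 0"
   using elim(1,2) by (simp add: YY_def)
  then have ae: "AE r in lborel. ind {0..} r * ennreal (exp (- r)) * (1 - AA V (ennreal r)) = 0"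
   by (subst (asm) nn_integral_0_iff_AE) auto
  have "0 \<in> {s. AA V s < 1}" using c by (simp add: clock_def)
  from open_right[OF clock_open_greater[OF c] this, of 1]
  obtain b where b: "b > 0" "{0..<b} \<subseteq> {s. AA V s < 1}" by auto
  define d where "d = (if b = top then 1 else enn2real b)"
  have d0: "d > 0" using b(1) by (cases b) (auto simp: d_def)
  from ae have "AE r in lborel. r \<notin> {0..<d}"
  proof eventually_elim
   case (elim r)
   show ?case
   proof
    assume r: "r \<in> {0..<d}"
    then have "ennreal r < b" using b(1) by (cases b) (auto simp: d_def ennreal_less_iff split: if_splits)
    then have "AA V (ennreal r) < 1" using b(2) by auto
    then have "1 - AA V (ennreal r) ~= 0" by (simp add: diff_eq_0_iff_ennreal)
    with elim r show False by (auto simp: indicator_def)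
   qed
  qed
  then have "{0..<d} \<in> null_sets lborel" by (rule AE_iff_null_sets[THEN iffD2, rotated]) simp
  then have "emeasure lborel {0..<d} = 0" by (rule null_setsD1)
  with d0 show False by simp
 qed
 then show False using prob_space.AE_False[OF prob_Pu] by blast
qed

text \<open>By the strong Markov property the potential is the expectation of
 $\int_0^\infty e^{-r} \int_0^r (1 - (A_r - A_s))^+\, dA_s\, dr$. The inner integral is at most
 the length of the range of levels $A_s$ within distance 1 below $A_r$, that is, at most 1.\<close>

lemma NN_gE_le: "NN (\<lambda>(s, y). eexp 1 s * gE y) x <= 1"
proof -
 define G where "G s V = alive (State X s V) *
   (LI r. ind {0..} r * (if s <= ennreal r then 1 else 0) * ennreal (exp (- r)) * (1 - inc (AA V) s (ennreal r)) wrt lborel)" for s V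
 define H where "H s V = eexp 1 s * YY V" for s V
 have Gm: "(\<lambda>(s, V). G s V) \<in> BM (TF)"
 proof -
  have [measurable]: "(\<lambda>z. alive (State X (fst z) (snd z))) \<in> BM (TF)"
   by (rule measurable_compose[OF State_joint_Fu alive_borel]) measurable
  show ?thesis unfolding G_def split_beta' by measurable
 qed
 have Hm: "(\<lambda>(s, V). H s V) \<in> BM (TF)"
  using YY_measurable unfolding H_def split_beta' by measurable
 have GH: "G s V = H s (Shift X s V)" if w: "V \<in> Lam" and s: "s < top" and al: "State X s V ~= None" for s V
 proof -
  have wO: "V \<in> \<Omega>" using w Lam_Omega by auto
  obtain s' where s': "s = ennreal s'" "0 <= s'" using s by (cases s) auto
  have [measurable]: "(\<lambda>r. inc (AA V) s (ennreal r)) \<in> BM borel"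
   by (rule inc_joint) (use wO in auto)
  have "G s V = (LI r. ind {0..} r * (if s <= ennreal r then 1 else 0) * ennreal (exp (- r)) * (1 - inc (AA V) s (ennreal r)) wrt lborel)"
   using al by (auto simp: G_def indicator_def)
  also have "... = (LI r. ind {0..} (s' + r) * (if s <= ennreal (s' + r) then 1 else 0) * ennreal (exp (- (s' + r))) * (1 - inc (AA V) s (ennreal (s' + r))) wrt lborel)"
   using nn_integral_real_affine[of "\<lambda>r. ind {0..} r * (if s <= ennreal r then 1 else 0) * ennreal (exp (- r)) * (1 - inc (AA V) s (ennreal r))" 1 s']
   by simp
  also have "... = (LI r. eexp 1 s * (ind {0..} r * ennreal (exp (- r)) * (1 - AA (Shift X s V) (ennreal r))) wrt lborel)"
  proof (rule nn_integral_cong_AE, rule AE_mp[OF AE_lborel_singleton[of "- s'"]], intro AE_I2 impI)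
   fix r :: real assume ne: "r ~= - s'"
   show "ind {0..} (s' + r) * (if s <= ennreal (s' + r) then 1 else 0) * ennreal (exp (- (s' + r))) * (1 - inc (AA V) s (ennreal (s' + r))) =
     eexp 1 s * (ind {0..} r * ennreal (exp (- r)) * (1 - AA (Shift X s V) (ennreal r)))"
   proof (cases "0 <= r")
    case True
    have "inc (AA V) s (ennreal (s' + r)) = AA (Shift X s V) (ennreal (s' + r) - s)"
     using s' True by (intro inc_shift[OF w s]) (auto intro: ennreal_leI)
    also have "ennreal (s' + r) - s = ennreal r" using s' True by (simp add: ennreal_minus)
    finally have i: "inc (AA V) s (ennreal (s' + r)) = AA (Shift X s V) (ennreal r)" .
    have e: "ennreal (exp (- (s' + r))) = ennreal (exp (- s')) * ennreal (exp (- r))"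
     by (simp add: ennreal_mult[symmetric] exp_add[symmetric])
    have es: "eexp 1 s = ennreal (exp (- s'))" using s' by (simp add: eexp_real)
    have "s <= ennreal (s' + r)" using s' True by (auto intro: ennreal_leI)
    then show ?thesis unfolding e es i using s' True by (simp add: mult_ac)
   next
    case False
    then show ?thesis using s' ne by (auto simp: indicator_def)
   qed
  qed
  also have "... = H s (Shift X s V)"
  proof -
   have "AA (Shift X s V) \<in> BM borel"
    using clock_AA[OF Shift_in[OF wO]] by (auto simp: clock_def intro: borel_measurable_continuous_onI)
   then show ?thesis
    using al by (subst nn_integral_cmult) (auto simp: H_def YY_def State_Shift[OF wO] indicator_def)
  qed
  finally show ?thesis .
 qed
 have \<Psi>m: "(\<lambda>(s, y). eexp 1 s * gE y) \<in> BM (borel \<Otimes>\<^sub>M borel_cpt)"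
  using gE_borel by (simp add: split_beta') measurable
 have "NN (\<lambda>(s, y). eexp 1 s * gE y) x = (LI V. (LI s. G s V wrt dA V) wrt Pu x)"
  unfolding NN_def prod.case
 proof (rule strong_markov_AA[OF AE_Lam Gm Hm GH \<Psi>m, symmetric])
  show "(LI V. H s V wrt Pu (Some y)) = eexp 1 s * gE (Some y)" for s y
   unfolding H_def gE_def using YY_measurable by (intro nn_integral_cmult) (simp cong: measurable_cong_sets)
 qed
 also have "... <= (LI V. 1 wrt Pu x)"
 proof (rule nn_integral_mono)
  fix V assume "V \<in> space (Pu x)"
  then have w: "V \<in> \<Omega>" by simp
  note c = clock_AA[OF w]
  interpret pair_sigma_finite "dA V" lborel
   by (rule pair_sigma_finite.intro[OF sigma_finite_dclock[OF c] lborel.sigma_finite_measure_axioms])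
  have [measurable]: "(\<lambda>z. inc (AA V) (fst z) (ennreal (snd z))) \<in> BM (borel \<Otimes>\<^sub>M borel)"
   using w by (intro inc_joint) (auto intro!: measurable_compose[OF measurable_snd measurable_ennreal])
  have "(LI s. G s V wrt dA V) <= (LI s. (LI r. ind {0..} r * (if s <= ennreal r then 1 else 0) * ennreal (exp (- r)) * (1 - inc (AA V) s (ennreal r)) wrt lborel) wrt dA V)"
   by (intro nn_integral_mono) (auto simp: G_def indicator_def)
  also have "... = (LI r. (LI s. ind {0..} r * (if s <= ennreal r then 1 else 0) * ennreal (exp (- r)) * (1 - inc (AA V) s (ennreal r)) wrt dA V) wrt lborel)"
   by (rule Fubini'[symmetric]) (simp add: split_beta', measurable)
  also have "... <= (LI r. ind {0..} r * ennreal (1 * exp (- (1 * r))) wrt lborel)"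
  proof (rule nn_integral_mono)
   fix r :: real
   have [measurable]: "(\<lambda>s. inc (AA V) s (ennreal r)) \<in> BM borel" by (rule inc_measurable[OF c])
   have "(LI s. (if s <= ennreal r then 1 else 0) * (1 - inc (AA V) s (ennreal r)) wrt dA V) <=
     (LI u. ind {enn2real (AA V (ennreal r)) - 1 .. enn2real (AA V (ennreal r))} u wrt lborel)"
   proof (subst nn_integral_AA[OF w], measurable, rule nn_integral_mono)
    fix u :: real
    show "ind {0..} u * ind {..<top} (\<tau> u V) * ((if \<tau> u V <= ennreal r then 1 else 0) * (1 - inc (AA V) (\<tau> u V) (ennreal r)))
     <= ind {enn2real (AA V (ennreal r)) - 1 .. enn2real (AA V (ennreal r))} u"
    proof (cases "0 <= u \<and> \<tau> u V < top \<and> \<tau> u V <= ennreal r \<and> inc (AA V) (\<tau> u V) (ennreal r) < 1")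
     case True
     have "AA V (ennreal r) = ennreal u + inc (AA V) (\<tau> u V) (ennreal r)"
      using inc_add[OF c, of 0 "\<tau> u V" "ennreal r"] True clock_hit[OF c, of u] by (simp add: inc_0[OF c])
     moreover obtain i where "inc (AA V) (\<tau> u V) (ennreal r) = ennreal i" "0 <= i" "i < 1"
      using True by (cases "inc (AA V) (\<tau> u V) (ennreal r)") (auto simp: ennreal_less_iff ennreal_1[symmetric] simp del: ennreal_1)
     ultimately have "enn2real (AA V (ennreal r)) = u + i" using True by (simp add: ennreal_plus[symmetric] del: ennreal_plus)
     then have "u \<in> {enn2real (AA V (ennreal r)) - 1 .. enn2real (AA V (ennreal r))}"
      using \<open>0 <= i\<close> \<open>i < 1\<close> by auto
     then show ?thesis using diff_le_self_ennreal[of 1] by (auto simp: indicator_def)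
    next
     case False
     then have "ind {0..} u * ind {..<top} (\<tau> u V) * ((if \<tau> u V <= ennreal r then 1 else 0) * (1 - inc (AA V) (\<tau> u V) (ennreal r))) = 0"
      by (auto simp: indicator_def not_less diff_eq_0_iff_ennreal)
     then show ?thesis by (simp only: zero_le)
    qed
   qed
   also have "... = 1" by simp
   finally have le1: "(LI s. (if s <= ennreal r then 1 else 0) * (1 - inc (AA V) s (ennreal r)) wrt dA V) <= 1" .
   have "(LI s. ind {0..} r * (if s <= ennreal r then 1 else 0) * ennreal (exp (- r)) * (1 - inc (AA V) s (ennreal r)) wrt dA V) =
     ind {0..} r * ennreal (exp (- r)) * (LI s. (if s <= ennreal r then 1 else 0) * (1 - inc (AA V) s (ennreal r)) wrt dA V)"
    by (subst nn_integral_cmult[symmetric]) (auto simp: mult_ac)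
   also have "... <= ind {0..} r * ennreal (exp (- r)) * 1"
    by (rule mult_left_mono[OF le1]) simp
   finally show "(LI s. ind {0..} r * (if s <= ennreal r then 1 else 0) * ennreal (exp (- r)) * (1 - inc (AA V) s (ennreal r)) wrt dA V) <=
     ind {0..} r * ennreal (1 * exp (- (1 * r)))" by simp
  qed
  also have "... = 1" by (rule nn_integral_exp) simp
  finally show "(LI s. G s V wrt dA V) <= 1" .
 qed
 also have "... = 1" using prob_space.emeasure_space_1[OF prob_Pu[of x]] by simp
 finally show ?thesis .
qed

definition nest :: "nat => 's set" where "nest n = {y. 1 / of_nat (Suc n) < gE (Some y)}"

lemma nest_sets [measurable]: "nest n \<in> sets borel"
proof -
 have [measurable]: "(\<lambda>y. gE (Some y)) \<in> BM borel" by (rule measurable_compose[OF measurable_Some gE_borel])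
 have "{y \<in> space borel. 1 / of_nat (Suc n) < gE (Some y)} \<in> sets borel" by measurable
 then show ?thesis by (simp add: nest_def)
qed

lemma nest_mono: "mono nest"
proof (rule monoI)
 fix i j :: nat assume "i <= j"
 then have "1 / of_nat (Suc j) <= (1 / of_nat (Suc i) :: ennreal)"
  by (simp add: ennreal_of_nat_eq_real_of_nat divide_ennreal ennreal_1[symmetric] frac_le del: ennreal_1 of_nat_Suc)
 then show "nest i <= nest j" unfolding nest_def by (auto intro: le_less_trans)
qed

lemma nest_UN: "(\<Union>n. nest n) = UNIV"
proof -
 have "\<exists>n. y \<in> nest n" for y
 proof -
  have "(\<lambda>n. ennreal (1 / real (Suc n))) \<longlonglongrightarrow> 0"
   using tendsto_ennrealI[OF LIMSEQ_inverse_real_of_nat] by (simp add: inverse_eq_divide)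
  from order_tendstoD(2)[OF this gE_pos[of y]] obtain n where "ennreal (1 / real (Suc n)) < gE (Some y)"
   unfolding eventually_sequentially by blast
  then have "y \<in> nest n"
   by (simp add: nest_def ennreal_of_nat_eq_real_of_nat divide_ennreal ennreal_1[symmetric] del: ennreal_1 of_nat_Suc)
  then show ?thesis ..
 qed
 then show ?thesis by auto
qed

lemma nest_potential: "NN (\<lambda>(s, y). eexp 1 s * ind (Some ` nest n) y) x <= of_nat (Suc n)"
proof -
 have "NN (\<lambda>(s, y). eexp 1 s * ind (Some ` nest n) y) x <= NN (\<lambda>z. of_nat (Suc n) * (case z of (s, y) => eexp 1 s * gE y)) x"
 proof (rule NN_mono, clarify)
  fix s y
  have "ind (Some ` nest n) y <= of_nat (Suc n) * gE y"
  proof (cases "y \<in> Some ` nest n")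
   case True
   then have "1 / of_nat (Suc n) <= gE y" by (auto simp: nest_def)
   then have "of_nat (Suc n) * (1 / of_nat (Suc n)) <= of_nat (Suc n) * gE y" by (rule mult_left_mono) simp
   moreover have "of_nat (Suc n) * (1 / of_nat (Suc n)) = (1::ennreal)"
    by (simp add: ennreal_of_nat_eq_real_of_nat divide_ennreal ennreal_1[symmetric] ennreal_mult[symmetric] del: ennreal_1 of_nat_Suc)
   ultimately show ?thesis using True by simp
  qed simp
  then have "eexp 1 s * ind (Some ` nest n) y <= eexp 1 s * (of_nat (Suc n) * gE y)" by (rule mult_left_mono) simp
  then show "eexp 1 s * ind (Some ` nest n) y <= of_nat (Suc n) * (eexp 1 s * gE y)" by (simp add: mult_ac)
 qed
 also have "... = of_nat (Suc n) * NN (\<lambda>(s, y). eexp 1 s * gE y) x"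
  by (rule NN_cmult) (use gE_borel in \<open>simp add: split_beta'\<close>, measurable)
 also have "... <= of_nat (Suc n) * 1" by (rule mult_left_mono[OF NN_gE_le]) simp
 finally show ?thesis by simp
qed

end

section \<open>Symmetry of an additive functional under time reversal\<close>

locale weighted_pcaf = pcaf_setting X m p A
 for X :: "('w, 's::{metric_space, second_countable_topology}) process" and m p A +
 fixes w :: "'s option => ennreal" and C :: ennreal
 assumes w_borel [measurable]: "w \<in> BM borel_cpt" and w_None: "w None = 0" and w_le: "w y <= 1"
  and C: "C < top" and bound: "NN (\<lambda>(s, y). eexp 1 s * w y) x <= C"
begin

definition BB :: "ennreal => ennreal => 'w => ennreal"
 where "BB a b V = (LI s. ind {a..<b} s * w (State X s V) wrt dA V)"

lemma w_path [measurable]: "V \<in> \<Omega> ==> (\<lambda>s. w (State X s V)) \<in> BM borel"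
 using path_measurable[of "\<lambda>z. w (snd z)" V] by simp

text \<open>Written over the levels, the integral up to \<open>b\<close> only involves the minimum of \<open>\<tau> u\<close> and \<open>b\<close> and the state at that
 time.\<close>

lemma BB_Fil: "BB a b \<in> BM (Fil b)"
proof -
 note hit_min_measurable[of b, measurable]
 have "(\<lambda>z. State X (min (\<tau> (fst z) (snd z)) b) (snd z)) \<in> borel \<Otimes>\<^sub>M Fil b \<rightarrow>\<^sub>M borel_cpt"
  by (rule measurable_at_random_time[OF lc, where c=b and Z="\<lambda>q z. State X q (snd z)"])
   (auto intro!: measurable_compose[OF measurable_snd State_Fil] right_cont hit_min_measurable simp: space_pair_measure)
 from measurable_compose[OF this w_borel]
 have [measurable]: "(\<lambda>z. w (State X (min (\<tau> (fst z) (snd z)) b) (snd z))) \<in> BM (borel \<Otimes>\<^sub>M Fil b)" .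
 have sp: "(\<lambda>V. LI u. ind {0..} u * ind {a..<b} (min (\<tau> u V) b) * w (State X (min (\<tau> u V) b) V) wrt lborel)
   \<in> BM (Fil b)"
 proof (rule lborel.borel_measurable_nn_integral)
  have 1: "(\<lambda>z. ind {0..} (fst z) * ind {a..<b} (min (\<tau> (fst z) (snd z)) b) * w (State X (min (\<tau> (fst z) (snd z)) b) (snd z)))
    \<in> BM (borel \<Otimes>\<^sub>M Fil b)" by measurable
  have 2: "(\<lambda>z. (snd z, fst z)) \<in> Fil b \<Otimes>\<^sub>M lborel \<rightarrow>\<^sub>M borel \<Otimes>\<^sub>M Fil b" by measurable
  have "(\<lambda>z. ind {0..} (snd z) * ind {a..<b} (min (\<tau> (snd z) (fst z)) b) * w (State X (min (\<tau> (snd z) (fst z)) b) (fst z)))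
    \<in> BM (Fil b \<Otimes>\<^sub>M lborel)"
   using measurable_compose[OF 2 1] by simp
  then show "(\<lambda>(V, u). ind {0..} u * ind {a..<b} (min (\<tau> u V) b) * w (State X (min (\<tau> u V) b) V))
    \<in> BM (Fil b \<Otimes>\<^sub>M lborel)" by (simp add: split_beta')
 qed
 show ?thesis
 proof (rule measurable_cong[THEN iffD1, OF _ sp])
  fix V assume "V \<in> space (Fil b)"
  then have o: "V \<in> \<Omega>" by simp
  have "BB a b V = (LI u. ind {0..} u * ind {..<top} (\<tau> u V) * (ind {a..<b} (\<tau> u V) * w (State X (\<tau> u V) V)) wrt lborel)"
   unfolding BB_def using o by (intro nn_integral_AA) measurable
  also have "... = (LI u. ind {0..} u * ind {a..<b} (min (\<tau> u V) b) * w (State X (min (\<tau> u V) b) V) wrt lborel)"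
   by (intro nn_integral_cong) (auto simp: indicator_def min_def less_top[symmetric] top_unique)
  finally show "(LI u. ind {0..} u * ind {a..<b} (min (\<tau> u V) b) * w (State X (min (\<tau> u V) b) V) wrt lborel) = BB a b V" by simp
 qed
qed

lemma BB_Fu [measurable]: "BB a b \<in> BM Fu"
 by (rule measurable_Fil_mono[OF _ BB_Fil]) simp

lemma BB_joint: "(\<lambda>(s, V). BB s t V) \<in> BM (TF)"
proof -
 have "(\<lambda>z. LI s. ind {fst z..<t} s * w (State X s (snd z)) wrt dclock (AA (snd z))) \<in> BM (TF)"
 proof (rule nn_integral_AA_measurable)
  have "(\<lambda>v. (if fst (snd v) <= fst v \<and> fst v < t then 1 else 0 :: ennreal) * w (State X (fst v) (snd (snd v)))) \<in> BM (borel \<Otimes>\<^sub>M TF)"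
   by measurable
  then show "(\<lambda>(s :: ennreal, z). ind {fst z..<t} s * w (State X s (snd z))) \<in> BM (borel \<Otimes>\<^sub>M TF)"
   by (simp add: split_beta' indicator_def of_bool_def)
 qed measurable
 then show ?thesis by (simp add: BB_def split_beta')
qed

lemma BB_shift:
 assumes o: "V \<in> Lam" and a: "a < top"
 shows "BB a (a + s) V = BB 0 s (Shift X a V)"
proof -
 have oO: "V \<in> \<Omega>" using o Lam_Omega by auto
 have "BB a (a + s) V = (LI r. ind {a..} r * (ind {..<a + s} r * w (State X r V)) wrt dA V)"
  unfolding BB_def by (intro nn_integral_cong) (auto simp: indicator_def)
 also have "... = (LI r. ind {..<a + s} (a + r) * w (State X (a + r) V) wrt dclock (AA (Shift X a V)))"
  using oO by (intro dclock_AA_shift[OF o a]) measurable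
 also have "... = BB 0 s (Shift X a V)"
  unfolding BB_def using a
  by (intro nn_integral_cong) (auto simp: indicator_def State_Shift[OF oO] add.commute ennreal_add_left_cancel_less)
 finally show ?thesis .
qed

lemma BB_mono: "a' <= a ==> b <= b' ==> BB a b V <= BB a' b' V"
 unfolding BB_def by (intro nn_integral_mono mult_right_mono) (auto simp: indicator_def)

lemma sum_cells:
 assumes "\<And>i j. i <= j ==> c i <= (c j :: ennreal)" and o: "V \<in> \<Omega>" and f: "f \<in> BM borel"
 shows "(\<Sum>j<n. LI s. ind {c j..<c (Suc j)} s * f s wrt dA V) =
  (LI s. ind {c 0..<c n} s * f s wrt dA V)"
proof (induction n)
 case (Suc n)
 have "(LI s. ind {c 0..<c (Suc n)} s * f s wrt dA V) =
   (LI s. ind {c 0..<c n} s * f s + ind {c n..<c (Suc n)} s * f s wrt dA V)"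
  using assms(1)[of 0 n] assms(1)[of n "Suc n"]
  by (intro nn_integral_cong) (auto simp: indicator_def)
 also have "... = (LI s. ind {c 0..<c n} s * f s wrt dA V) + (LI s. ind {c n..<c (Suc n)} s * f s wrt dA V)"
  using f by (intro nn_integral_add) (simp_all add: borel_measurable_indicator)
 finally show ?case using Suc by simp
qed simp

definition CT :: "ennreal => ennreal" where "CT t = ennreal (exp (enn2real t)) * C"

lemma CT_top: "CT t < top" using C by (auto simp: CT_def ennreal_mult_less_top)

definition K :: "ennreal => 's option => ennreal" where "K t y = (LI V. BB 0 t V wrt Pu y)"

lemma K_NN: "K t y = NN (\<lambda>(s, y). ind {..<t} s * w y) y"
 unfolding K_def NN_def BB_def by (auto intro!: nn_integral_cong simp: indicator_def)

lemma K_UB: "K t \<in> BM UB"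
proof -
 have "NN (\<lambda>(s, y). ind {..<t} s * w y) \<in> BM UB"
  by (rule NN_UB) (simp add: split_beta')
 then show ?thesis by (simp add: K_NN[abs_def])
qed

lemma K_None: "K t None = 0" unfolding K_NN by (rule NN_None)

lemma K_le: "t < top ==> K t y <= CT t"
proof -
 assume t: "t < top"
 have "K t y <= NN (\<lambda>z. ennreal (exp (enn2real t)) * (case z of (s, y) => eexp 1 s * w y)) y"
  unfolding K_NN
 proof (rule NN_mono, clarify)
  fix s y
  have "ind {..<t} s <= ennreal (exp (enn2real t)) * eexp 1 s"
  proof (cases "s < t")
   case True
   then obtain s' t' where "s = ennreal s'" "t = ennreal t'" "0 <= s'" "0 <= t'" "s' < t'"
    using t by (cases s; cases t) (auto simp: ennreal_less_iff)
   then show ?thesis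
    by (auto simp: eexp_real ennreal_mult[symmetric] exp_add[symmetric] indicator_def ennreal_1[symmetric]
      simp del: ennreal_1 intro!: ennreal_leI)
  qed simp
  then have "ind {..<t} s * w y <= ennreal (exp (enn2real t)) * eexp 1 s * w y" by (rule mult_right_mono) simp
  then show "ind {..<t} s * w y <= ennreal (exp (enn2real t)) * (eexp 1 s * w y)" by (simp add: mult.assoc)
 qed
 also have "... = ennreal (exp (enn2real t)) * NN (\<lambda>(s, y). eexp 1 s * w y) y"
  by (rule NN_cmult) (simp add: split_beta')
 also have "... <= CT t" unfolding CT_def by (rule mult_left_mono[OF bound]) simp
 finally show ?thesis .
qed

text \<open>The square is a double integral over pairs of times, which is at most twice the part where the first
 time comes first.\<close>

lemma BB_square:
 assumes o: "V \<in> \<Omega>"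
 shows "BB 0 t V * BB 0 t V <= 2 * (LI s. ind {..<t} s * w (State X s V) * BB s t V wrt dA V)"
proof -
 let ?D = "dA V"
 define f where "f s = ind {0..<t} s * w (State X s V)" for s
 have [measurable]: "f \<in> BM borel" unfolding f_def[abs_def] using o by measurable
 interpret pair_sigma_finite ?D ?D
  by (rule pair_sigma_finite.intro) (intro sigma_finite_dclock clock_AA o)+
 have I: "(LI r. (if s <= r then f s * f r else 0) wrt ?D) = ind {..<t} s * w (State X s V) * BB s t V" for s
 proof -
  have "(LI r. (if s <= r then f s * f r else 0) wrt ?D) = (LI r. (ind {..<t} s * w (State X s V)) * (ind {s..<t} r * w (State X r V)) wrt ?D)"
   by (intro nn_integral_cong) (auto simp: f_def indicator_def)
  also have "... = ind {..<t} s * w (State X s V) * BB s t V"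
   unfolding BB_def using o by (intro nn_integral_cmult) measurable
  finally show ?thesis .
 qed
 have Bf: "BB 0 t V = (LI s. f s wrt ?D)" by (simp add: BB_def f_def)
 have "BB 0 t V * BB 0 t V = (LI s. f s * (LI r. f r wrt ?D) wrt ?D)"
  unfolding Bf by (rule nn_integral_multc[symmetric]) simp
 also have "... = (LI s. (LI r. f s * f r wrt ?D) wrt ?D)"
  by (intro nn_integral_cong nn_integral_cmult[symmetric]) measurable
 also have "... <= (LI s. (LI r. (if s <= r then f s * f r else 0) + (if r <= s then f s * f r else 0) wrt ?D) wrt ?D)"
  by (intro nn_integral_mono) auto
 also have "... = (LI s. (LI r. (if s <= r then f s * f r else 0) wrt ?D) + (LI r. (if r <= s then f s * f r else 0) wrt ?D) wrt ?D)"
  by (intro nn_integral_cong nn_integral_add) measurable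
 also have "... = (LI s. (LI r. (if s <= r then f s * f r else 0) wrt ?D) wrt ?D) + (LI s. (LI r. (if r <= s then f s * f r else 0) wrt ?D) wrt ?D)"
  by (intro nn_integral_add M1.borel_measurable_nn_integral) measurable
 also have "(LI s. (LI r. (if r <= s then f s * f r else 0) wrt ?D) wrt ?D) = (LI r. (LI s. (if r <= s then f s * f r else 0) wrt ?D) wrt ?D)"
  by (intro Fubini'[symmetric]) measurable
 also have "... = (LI s. (LI r. (if s <= r then f s * f r else 0) wrt ?D) wrt ?D)"
  by (intro nn_integral_cong) (simp add: mult.commute)
 finally show ?thesis unfolding I by (simp add: mult_2)
qed

text \<open>By the strong Markov property a functional with bounded potential has bounded second
 moments: after the first of two points of increase, the rest of the functional is again bounded
 in mean.\<close>

lemma BB_second_moment: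
 assumes t: "t < top"
 shows "(LI V. BB 0 t V * BB 0 t V wrt Pu x) <= 2 * (CT t * CT t)"
proof -
 have Gm: "(\<lambda>(s :: ennreal, V). ind {..<t} s * w (State X s V) * BB s t V) \<in> BM (TF)"
  using BB_joint unfolding split_beta' by measurable
 have Hm: "(\<lambda>(s :: ennreal, V). ind {..<t} s * (w (State X 0 V) * BB 0 t V)) \<in> BM (TF)"
  unfolding split_beta' by measurable
 have "(LI V. BB 0 t V * BB 0 t V wrt Pu x) <= (LI V. 2 * (LI s. ind {..<t} s * w (State X s V) * BB s t V wrt dA V) wrt Pu x)"
  by (intro nn_integral_mono BB_square) simp
 also have "... = 2 * (LI V. (LI s. ind {..<t} s * w (State X s V) * BB s t V wrt dA V) wrt Pu x)"
  using nn_integral_AA_measurable[OF Gm, of "\<lambda>V. V"] by (intro nn_integral_cmult) (simp cong: measurable_cong_sets)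
 also have "... <= 2 * (LI V. (LI s. ind {..<t} s * (w (State X s V) * CT t) wrt dA V) wrt Pu x)"
 proof (intro mult_left_mono strong_markov_AA_le[OF Gm Hm])
  fix s :: ennreal and V assume o: "V \<in> Lam" "s < top"
  then have oO: "V \<in> \<Omega>" using Lam_Omega by auto
  have "BB s t V <= BB s (s + t) V" by (rule BB_mono) (simp_all add: add_increasing)
  also have "... = BB 0 t (Shift X s V)" by (rule BB_shift[OF o])
  finally have "ind {..<t} s * w (State X s V) * BB s t V <= ind {..<t} s * w (State X s V) * BB 0 t (Shift X s V)"
   by (rule mult_left_mono) simp
  then show "ind {..<t} s * w (State X s V) * BB s t V <= ind {..<t} s * (w (State X 0 (Shift X s V)) * BB 0 t (Shift X s V))"
   by (simp add: State_Shift[OF oO] mult.assoc)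
 next
  show "(\<lambda>(s :: ennreal, y). ind {..<t} s * (w y * CT t)) \<in> BM (borel \<Otimes>\<^sub>M borel_cpt)"
   unfolding split_beta' by measurable
 next
  fix s y
  have "(LI V. ind {..<t} s * (w (State X 0 V) * BB 0 t V) wrt Pu (Some y)) = (LI V. ind {..<t} s * w (Some y) * BB 0 t V wrt Pu (Some y))"
   using AE_Pu_start[of "Some y"] by (intro nn_integral_cong_AE) (auto simp: mult.assoc)
  also have "... = ind {..<t} s * w (Some y) * K t (Some y)"
   unfolding K_def by (intro nn_integral_cmult) measurable
  also have "... <= ind {..<t} s * w (Some y) * CT t" by (rule mult_left_mono[OF K_le[OF t]]) simp
  finally show "(LI V. ind {..<t} s * (w (State X 0 V) * BB 0 t V) wrt Pu (Some y)) <= ind {..<t} s * (w (Some y) * CT t)"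
   by (simp add: mult.assoc)
 qed simp
 also have "(LI V. (LI s. ind {..<t} s * (w (State X s V) * CT t) wrt dA V) wrt Pu x) = CT t * K t x"
 proof -
  have "(LI V. (LI s. ind {..<t} s * (w (State X s V) * CT t) wrt dA V) wrt Pu x) = NN (\<lambda>z. CT t * (case z of (s, y) => ind {..<t} s * w y)) x"
   unfolding NN_def by (simp add: mult_ac)
  also have "... = CT t * NN (\<lambda>(s, y). ind {..<t} s * w y) x" by (rule NN_cmult) (simp add: split_beta')
  finally show ?thesis by (simp add: K_NN)
 qed
 also have "2 * (CT t * K t x) <= 2 * (CT t * CT t)" by (intro mult_left_mono K_le t) simp_all
 finally show ?thesis .
qed

subsection \<open>Discretisation\<close>

context
 fixes T :: real
 assumes T: "0 < T"
begin

definition tj :: "nat => nat => ennreal" where "tj n j = ennreal (real j * T / real n)"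

lemma tj_0 [simp]: "tj n 0 = 0" by (simp add: tj_def)

lemma tj_top [simp]: "tj n j < top" by (simp add: tj_def)

lemma tj_n: "0 < n ==> tj n n = ennreal T" by (simp add: tj_def)

lemma tj_add: "tj n i + tj n j = tj n (i + j)"
 using T by (simp add: tj_def ennreal_plus[symmetric] add_divide_distrib distrib_right del: ennreal_plus)

lemma tj_mono: "i <= j ==> tj n i <= tj n j"
 using T by (auto simp: tj_def intro!: ennreal_leI divide_right_mono mult_right_mono)

lemma tj_lim: "(\<lambda>n. tj (Suc n) 1) \<longlonglongrightarrow> 0"
proof -
 have "(\<lambda>n. T * inverse (real (Suc n))) \<longlonglongrightarrow> T * 0" by (intro tendsto_mult tendsto_const LIMSEQ_inverse_real_of_nat)
 then have "(\<lambda>n. ennreal (T * inverse (real (Suc n)))) \<longlonglongrightarrow> ennreal 0" by (intro tendsto_ennrealI) simp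
 then show ?thesis by (simp add: tj_def inverse_eq_divide)
qed

abbreviation BJ :: "nat => nat => 'w => ennreal" where "BJ n j \<equiv> BB (tj n j) (tj n (Suc j))"

lemma AE_BB_finite: "AE V in Pu x. BB 0 (ennreal T) V < top"
proof -
 have "(LI V. BB 0 (ennreal T) V wrt Pu x) ~= \<infinity>"
  using K_le[of "ennreal T" x] CT_top[of "ennreal T"] by (auto simp: K_def top_unique)
 then have "AE V in Pu x. BB 0 (ennreal T) V ~= \<infinity>" by (intro nn_integral_PInf_AE) auto
 then show ?thesis by (simp add: less_top)
qed

lemma BB_small: "(\<lambda>n. LI V. BB 0 (tj (Suc n) 1) V wrt Pu x) \<longlonglongrightarrow> 0"
proof -
 have "(\<lambda>n. LI V. BB 0 (tj (Suc n) 1) V wrt Pu x) \<longlonglongrightarrow> (LI V. 0 wrt Pu x)"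
 proof (rule nn_integral_dominated_convergence[where w="BB 0 (ennreal T)"])
  have le: "tj (Suc n) 1 <= ennreal T" for n
   using tj_mono[of 1 "Suc n" "Suc n"] tj_n[of "Suc n"] by simp
  show "AE V in Pu x. BB 0 (tj (Suc n) 1) V <= BB 0 (ennreal T) V" for n
   by (intro AE_I2 BB_mono le) simp
  show "(LI V. BB 0 (ennreal T) V wrt Pu x) < \<infinity>"
   using K_le[of "ennreal T" x] CT_top[of "ennreal T"] by (simp add: K_def le_less_trans)
  show "AE V in Pu x. (\<lambda>n. BB 0 (tj (Suc n) 1) V) \<longlonglongrightarrow> 0"
   using AE_BB_finite AE_space
  proof eventually_elim
   case (elim V)
   then have o: "V \<in> \<Omega>" by simp
   have "(\<lambda>n. BB 0 (tj (Suc n) 1) V) \<longlonglongrightarrow> (LI s. 0 wrt dA V)"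
    unfolding BB_def
   proof (rule nn_integral_dominated_convergence[where w="\<lambda>s. ind {0..<ennreal T} s * w (State X s V)"])
    show "(LI s. ind {0..<ennreal T} s * w (State X s V) wrt dA V) < \<infinity>"
     using elim by (simp add: BB_def)
    show "AE s in dA V. ind {0..<tj (Suc n) 1} s * w (State X s V) <= ind {0..<ennreal T} s * w (State X s V)" for n
     using le by (intro AE_I2 mult_right_mono) (auto simp: indicator_def dest: less_le_trans)
    show "AE s in dA V. (\<lambda>n. ind {0..<tj (Suc n) 1} s * w (State X s V)) \<longlonglongrightarrow> 0"
     using AE_dclock_neq[OF clock_AA[OF o], of 0]
    proof eventually_elim
     case (elim s)
     then have "0 < s" by (simp add: zero_less_iff_neq_zero)
     from order_tendstoD(2)[OF tj_lim this]
     have "\<forall>\<^sub>F n in sequentially. 0 = ind {0..<tj (Suc n) 1} s * w (State X s V)"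
      by eventually_elim (auto simp: indicator_def)
     then show ?case by (rule Lim_transform_eventually[OF tendsto_const])
    qed
   qed (use o in measurable)
   then show ?case by simp
  qed
 qed measurable
 then show ?thesis by simp
qed

text \<open>The mean quadratic variation of a continuous additive functional along a partition tends
 to zero.\<close>

lemma quadratic_variation:
 shows "(LI V. (\<Sum>j<Suc n. BJ (Suc n) j V * BJ (Suc n) j V) wrt Pu x) <= 2 * (CT (ennreal T) * CT (ennreal T))"
  and "(\<lambda>n. LI V. (\<Sum>j<Suc n. BJ (Suc n) j V * BJ (Suc n) j V) wrt Pu x) \<longlonglongrightarrow> 0"
proof -
 let ?t = "ennreal T"
 define f where "f V s = ind {0..<?t} s * w (State X s V)" for V s
 \<comment> \<open>Two times in the same cell are at distance less than the cell length.\<close>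
 define near where "near n s r = (if r < s + tj (Suc n) 1 \<and> s < r + tj (Suc n) 1 then 1 else 0 :: ennreal)" for n s r
 define W where "W n V s = (LI r. near n s r * f V r wrt dA V)" for n V s
 have fm[measurable]: "f V \<in> BM borel" if "V \<in> \<Omega>" for V
  unfolding f_def[abs_def] using that by measurable
 have nm[measurable]: "(\<lambda>r. near n s r) \<in> BM borel" for n s unfolding near_def by measurable
 have Wm: "(\<lambda>s. W n V s) \<in> BM borel" if "V \<in> \<Omega>" for n V
 proof -
  interpret sigma_finite_measure "dA V" by (rule sigma_finite_dclock[OF clock_AA[OF that]])
  note fm[OF that, measurable]
  show ?thesis unfolding W_def near_def by measurable
 qed
 have fB: "(LI r. f V r wrt dA V) = BB 0 ?t V" for V by (simp add: BB_def f_def)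
 have WB: "W n V s <= BB 0 ?t V" for n V s
  unfolding W_def fB[symmetric] by (intro nn_integral_mono) (auto simp: near_def)
 have D_le: "(\<Sum>j<Suc n. BJ (Suc n) j V * BJ (Suc n) j V) <= (LI s. f V s * W n V s wrt dA V)" if o: "V \<in> \<Omega>" for n V
 proof -
  note [measurable] = fm[OF o] Wm[OF o] w_path[OF o]
  have "BJ (Suc n) j V * BJ (Suc n) j V <= (LI s. ind {tj (Suc n) j..<tj (Suc n) (Suc j)} s * (w (State X s V) * W n V s) wrt dA V)"
   if j: "j < Suc n" for j
  proof -
   have "BJ (Suc n) j V * BJ (Suc n) j V = (LI s. ind {tj (Suc n) j..<tj (Suc n) (Suc j)} s * w (State X s V) * BJ (Suc n) j V wrt dA V)"
    by (subst nn_integral_multc) (auto simp: BB_def)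
   also have "... <= (LI s. ind {tj (Suc n) j..<tj (Suc n) (Suc j)} s * (w (State X s V) * W n V s) wrt dA V)"
   proof (rule nn_integral_mono)
    fix s
    have "BJ (Suc n) j V <= W n V s" if s: "s \<in> {tj (Suc n) j..<tj (Suc n) (Suc j)}"
     unfolding BB_def W_def
    proof (rule nn_integral_mono)
     fix r
     have up: "v < u + tj (Suc n) 1" if "v < tj (Suc n) (Suc j)" "tj (Suc n) j <= u" for u v
     proof -
      have "v < tj (Suc n) j + tj (Suc n) 1" using that(1) tj_add[of "Suc n" j 1] by simp
      also have "... <= u + tj (Suc n) 1" using that(2) by (rule add_right_mono)
      finally show ?thesis .
     qed
     have "r < ?t" if "r < tj (Suc n) (Suc j)"
      using that tj_mono[of "Suc j" "Suc n" "Suc n"] tj_n[of "Suc n"] j by (auto intro: less_le_trans)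
     then show "ind {tj (Suc n) j..<tj (Suc n) (Suc j)} r * w (State X r V) <= near n s r * f V r"
      using s up by (auto simp: indicator_def near_def f_def)
    qed
    then show "ind {tj (Suc n) j..<tj (Suc n) (Suc j)} s * w (State X s V) * BJ (Suc n) j V <=
      ind {tj (Suc n) j..<tj (Suc n) (Suc j)} s * (w (State X s V) * W n V s)"
     by (auto simp: indicator_def intro: mult_left_mono)
   qed
   finally show ?thesis .
  qed
  then have "(\<Sum>j<Suc n. BJ (Suc n) j V * BJ (Suc n) j V) <=
    (\<Sum>j<Suc n. LI s. ind {tj (Suc n) j..<tj (Suc n) (Suc j)} s * (w (State X s V) * W n V s) wrt dA V)"
   by (intro sum_mono) auto
  also have "... = (LI s. ind {tj (Suc n) 0..<tj (Suc n) (Suc n)} s * (w (State X s V) * W n V s) wrt dA V)"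
   by (rule sum_cells[OF tj_mono o]) measurable
  finally show ?thesis by (simp add: f_def tj_n mult.assoc)
 qed
 have fW: "(LI s. f V s * W n V s wrt dA V) <= BB 0 ?t V * BB 0 ?t V" if o: "V \<in> \<Omega>" for n V
 proof -
  have "(LI s. f V s * W n V s wrt dA V) <= (LI s. f V s * BB 0 ?t V wrt dA V)"
   by (intro nn_integral_mono mult_left_mono WB) simp
  also have "... = BB 0 ?t V * BB 0 ?t V"
   using fm[OF o] by (subst nn_integral_multc) (auto simp: fB)
  finally show ?thesis .
 qed
 have D_BB: "(\<Sum>j<Suc n. BJ (Suc n) j V * BJ (Suc n) j V) <= BB 0 ?t V * BB 0 ?t V" if o: "V \<in> \<Omega>" for n V
  using D_le[OF o] fW[OF o] by (rule order_trans)
 show "(LI V. (\<Sum>j<Suc n. BJ (Suc n) j V * BJ (Suc n) j V) wrt Pu x) <= 2 * (CT ?t * CT ?t)"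
  using D_BB by (intro order_trans[OF nn_integral_mono BB_second_moment]) auto
 have "(\<lambda>n. LI V. (\<Sum>j<Suc n. BJ (Suc n) j V * BJ (Suc n) j V) wrt Pu x) \<longlonglongrightarrow> (LI V. 0 wrt Pu x)"
 proof (rule nn_integral_dominated_convergence[where w="\<lambda>V. BB 0 ?t V * BB 0 ?t V"])
  show "(LI V. BB 0 ?t V * BB 0 ?t V wrt Pu x) < \<infinity>"
   using BB_second_moment[of ?t x] CT_top[of ?t] by (auto simp: ennreal_mult_less_top intro: le_less_trans)
  show "AE V in Pu x. (\<Sum>j<Suc n. BJ (Suc n) j V * BJ (Suc n) j V) <= BB 0 ?t V * BB 0 ?t V" for n
   by (rule AE_I2, rule D_BB) simp
  show "AE V in Pu x. (\<lambda>n. \<Sum>j<Suc n. BJ (Suc n) j V * BJ (Suc n) j V) \<longlonglongrightarrow> 0"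
   using AE_BB_finite AE_space
  proof eventually_elim
   case (elim V)
   then have o: "V \<in> \<Omega>" by simp
   note [measurable] = fm[OF o] Wm[OF o]
   have "(\<lambda>n. W n V s) \<longlonglongrightarrow> 0" for s
   proof -
    have "(\<lambda>n. W n V s) \<longlonglongrightarrow> (LI r. 0 wrt dA V)"
     unfolding W_def
    proof (rule nn_integral_dominated_convergence[where w="f V"])
     show "AE r in dA V. near n s r * f V r <= f V r" for n
      by (intro AE_I2) (simp add: near_def)
     show "(LI r. f V r wrt dA V) < \<infinity>" using elim by (simp add: fB)
     show "AE r in dA V. (\<lambda>n. near n s r * f V r) \<longlonglongrightarrow> 0"
      using AE_dclock_neq[OF clock_AA[OF o], of s]
     proof eventually_elim
      case (elim r)
      have "\<forall>\<^sub>F n in sequentially. near n s r = 0"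
      proof -
       have l: "(\<lambda>n. u + tj (Suc n) 1) \<longlonglongrightarrow> u" for u
        using tendsto_add[OF tendsto_const[of u] tj_lim] by simp
       consider "r < s" | "s < r" using elim by fastforce
       then show ?thesis
       proof cases
        case 1
        from order_tendstoD(2)[OF l this] show ?thesis by eventually_elim (auto simp: near_def)
       next
        case 2
        from order_tendstoD(2)[OF l this] show ?thesis by eventually_elim (auto simp: near_def)
       qed
      qed
      then have "\<forall>\<^sub>F n in sequentially. 0 = near n s r * f V r" by eventually_elim simp
      then show ?case by (rule Lim_transform_eventually[OF tendsto_const])
     qed
    qed measurable
    then show ?thesis by simp
   qed
   then have "(\<lambda>n. LI s. f V s * W n V s wrt dA V) \<longlonglongrightarrow> (LI s. f V s * 0 wrt dA V)"
   proof (intro nn_integral_dominated_convergence[where w="\<lambda>s. f V s * BB 0 ?t V"])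
    show "(LI s. f V s * BB 0 ?t V wrt dA V) < \<infinity>"
     using elim by (subst nn_integral_multc) (auto simp: fB ennreal_mult_less_top)
    show "AE s in dA V. f V s * W n V s <= f V s * BB 0 ?t V" for n
     by (intro AE_I2 mult_left_mono WB) simp
    assume *: "\<And>s. (\<lambda>n. W n V s) \<longlonglongrightarrow> 0"
    show "AE s in dA V. (\<lambda>n. f V s * W n V s) \<longlonglongrightarrow> f V s * 0"
    proof (rule AE_I2, rule ennreal_tendsto_cmult[OF _ *])
     fix s
     have "f V s <= 1" using w_le by (auto simp: f_def indicator_def)
     then show "f V s < top" by (rule le_less_trans) simp
    qed
   qed measurable
   then have fWlim: "(\<lambda>n. LI s. f V s * W n V s wrt dA V) \<longlonglongrightarrow> 0" by simp
   show ?case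
    by (rule tendsto_sandwich[OF always_eventually always_eventually tendsto_const fWlim]) (use D_le[OF o] in auto)
  qed
 qed measurable
 then show "(\<lambda>n. LI V. (\<Sum>j<Suc n. BJ (Suc n) j V * BJ (Suc n) j V) wrt Pu x) \<longlonglongrightarrow> 0" by simp
qed

end

end

lemma ennreal_weighted_am_gm:
 fixes d y :: ennreal
 assumes "0 < e"
 shows "d * y <= ennreal e * (d * d) + ennreal (1 / e) * (y * y)"
proof (cases d)
 case (real a)
 show ?thesis
 proof (cases y)
  case (real b)
  have "0 <= (e * a - b)\<^sup>2" by simp
  then have "2 * (e * (a * b)) <= e * (e * (a * a)) + b * b" by (simp add: power2_eq_square algebra_simps)
  moreover have "0 <= e * (a * b)" using assms \<open>0 <= a\<close> \<open>0 <= b\<close> by simp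
  ultimately have "e * (a * b) <= e * (e * (a * a)) + b * b" by linarith
  then have "a * b <= e * (a * a) + (1 / e) * (b * b)" using assms by (simp add: field_simps)
  then show ?thesis using real \<open>d = ennreal a\<close> \<open>0 <= a\<close> assms
   by (simp add: ennreal_mult[symmetric] ennreal_plus[symmetric] del: ennreal_plus)
 next
  case top
  then show ?thesis using assms by (simp add: ennreal_mult_top)
 qed
next
 case top
 then show ?thesis using assms by (simp add: ennreal_mult_top)
qed

abbreviation dist_e :: "ennreal => ennreal => ennreal" where "dist_e a b \<equiv> (a - b) + (b - a)"

lemma dist_e_triangle: "(a :: ennreal) <= b + dist_e a b" "b <= a + dist_e a b"
 by (metis add.commute add.left_commute ennreal_diff_le_mono_left le_iff_add linear order_refl diff_add_cancel_ennreal add_increasing2 zero_le)+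

lemma dist_e_square:
 assumes "a <= 1" "b <= (1 :: ennreal)"
 shows "dist_e a b * dist_e a b + 2 * (a * b) = a * a + b * b"
proof -
 obtain a' where a: "a = ennreal a'" "0 <= a'" using assms by (cases a) (auto simp: top_unique)
 obtain b' where b: "b = ennreal b'" "0 <= b'" using assms by (cases b) (auto simp: top_unique)
 have "dist_e a b = ennreal \<bar>a' - b'\<bar>"
  using a b by (cases "a' <= b'") (auto simp: ennreal_minus ennreal_neg)
 then have "dist_e a b * dist_e a b + 2 * (a * b) = ennreal (\<bar>a' - b'\<bar> * \<bar>a' - b'\<bar> + 2 * (a' * b'))"
  using a b by (simp only: ennreal_mult ennreal_plus abs_ge_zero mult_nonneg_nonneg zero_le_numeral ennreal_numeral)
 also have "\<bar>a' - b'\<bar> * \<bar>a' - b'\<bar> + 2 * (a' * b') = a' * a' + b' * b'"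
  by (simp add: abs_mult[symmetric] algebra_simps)
 also have "ennreal (a' * a' + b' * b') = a * a + b * b"
  using a b by (simp only: ennreal_mult ennreal_plus mult_nonneg_nonneg)
 finally show ?thesis .
qed

context pcaf_setting
begin

definition is_test :: "('s option => ennreal) => bool"
 where "is_test h \<longleftrightarrow> h \<in> BM borel_cpt \<and> (\<forall>y. h y <= 1) \<and> h None = 0"

end

context weighted_pcaf
begin

definition UU ::  "real => ('s option => ennreal) => 's option => ennreal"
 where "UU T h y = (LI V. h (State X (ennreal T) V) * BB 0 (ennreal T) V wrt Pu y)"

context
 fixes T :: real
 assumes T: "0 < T"
begin

text \<open>The martingale \<open>TT (T - t) h (X\<^sub>t)\<close> replaces \<open>h (X\<^sub>T)\<close> in each cell of a partition of
 \<open>[0, T]\<close>. Moving its time from the right to the left end of the cell costs at most a weighted sum of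
 two quadratic variations: that of the martingale, which is at most 1 and gets the small weight \<open>e\<close>,
 and that of the functional, which vanishes in the limit.\<close>

lemma riemann_sum_error:
 fixes n x h e
 assumes h: "is_test h" and e: "0 < e"
 defines "N \<equiv> Suc n"
 defines "u \<equiv> (LI V. h (State X (ennreal T) V) * BB 0 (ennreal T) V wrt Pu x)"
 defines "S \<equiv> (\<Sum>j<N. TT (tj T N j) (\<lambda>y. TT (tj T N (N - j)) h y * K (tj T N 1) y) x)"
 defines "q \<equiv> (LI V. (\<Sum>j<N. BJ T N j V * BJ T N j V) wrt Pu x)"
 shows "u <= S + (ennreal e + ennreal (1 / e) * q)" and "S <= u + (ennreal e + ennreal (1 / e) * q)"
proof -
 have hb[measurable]: "h \<in> BM borel_cpt" and h1: "\<And>y. h y <= 1" using h by (auto simp: is_test_def)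
 interpret prob_space "Pu x" by (rule prob_Pu)
 define t where "t j = tj T N j" for j
 have tadd: "t i + t j = t (i + j)" for i j unfolding t_def by (rule tj_add[OF T])
 have tN: "t N = ennreal T" unfolding t_def N_def by (rule tj_n) (use T in auto)
 have ttop: "t j < top" for j unfolding t_def by (simp add: tj_top[OF T])
 define H where "H j = TT (t (N - j)) h" for j
 have Hb[measurable]: "H j \<in> BM borel_cpt" for j unfolding H_def by (rule TT_borel) simp
 have H1: "H j y <= 1" for j y unfolding H_def by (rule TT_le) (rule h1)
 define MM where "MM j V = H j (State X (t j) V)" for j V
 have MF: "MM j \<in> BM (Fil (t j))" for j
  unfolding MM_def[abs_def] by (rule measurable_compose[OF State_Fil Hb]) simp
 have Mm[measurable]: "MM j \<in> BM (Pu x)" for j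
  using measurable_Fil_mono[OF _ MF, of j top] by (simp cong: measurable_cong_sets)
 have M1: "MM j V <= 1" for j V unfolding MM_def by (rule H1)
 define B where "B j = BJ T N j" for j
 have Bm[measurable]: "B j \<in> BM (Pu x)" for j unfolding B_def by measurable
 have BF: "B j \<in> BM (Fil (t (Suc j)))" for j unfolding B_def t_def by (rule BB_Fil)
 have q: "q = (LI V. (\<Sum>j<N. B j V * B j V) wrt Pu x)" unfolding q_def B_def ..
 have uB: "u = (\<Sum>j<N. LI V. h (State X (ennreal T) V) * B j V wrt Pu x)"
 proof -
  have [measurable]: "(\<lambda>V. h (State X (ennreal T) V)) \<in> BM (Pu x)"
   using measurable_compose[OF State_Fil hb, of "ennreal T" top] by (simp cong: measurable_cong_sets)
  have "BB 0 (ennreal T) V = (\<Sum>j<N. B j V)" if o: "V \<in> \<Omega>" for V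
   using sum_cells[where c="t" and V=V and f="\<lambda>s. w (State X s V)" and n=N, OF _ o w_path[OF o]] tj_mono[OF T] tN
   by (simp add: BB_def B_def t_def tj_0[OF T])
  then have "u = (LI V. (\<Sum>j<N. h (State X (ennreal T) V) * B j V) wrt Pu x)"
   unfolding u_def by (intro nn_integral_cong) (simp add: sum_distrib_left)
  also have "... = (\<Sum>j<N. LI V. h (State X (ennreal T) V) * B j V wrt Pu x)"
   by (intro nn_integral_sum) measurable
  finally show ?thesis .
 qed
 have L1: "(LI V. h (State X (ennreal T) V) * B j V wrt Pu x) = (LI V. MM (Suc j) V * B j V wrt Pu x)" if j: "j < N" for j
 proof -
  have Y: "(\<lambda>V. h (State X (t (N - Suc j)) V)) \<in> BM Fu"
   by (rule measurable_compose[OF State_Fil hb]) simp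
  have "(LI V. h (State X (ennreal T) V) * B j V wrt Pu x) = (LI V. B j V * h (State X (t (N - Suc j)) (Shift X (t (Suc j)) V)) wrt Pu x)"
   using j by (intro nn_integral_cong) (simp add: State_Shift tadd tN mult.commute)
  also have "... = (LI V. B j V * (LI V'. h (State X (t (N - Suc j)) V') wrt Pu (State X (t (Suc j)) V)) wrt Pu x)"
   by (rule markov[OF BF Y])
  finally show ?thesis by (simp add: MM_def H_def TT_def mult.commute)
 qed
 have L2: "(LI V. MM j V * B j V wrt Pu x) = TT (tj T N j) (\<lambda>y. TT (tj T N (N - j)) h y * K (tj T N 1) y) x" for j
 proof -
  have "(LI V. MM j V * B j V wrt Pu x) = (LI V. MM j V * BB 0 (t 1) (Shift X (t j) V) wrt Pu x)"
  proof (rule nn_integral_cong_AE)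
   show "AE V in Pu x. MM j V * B j V = MM j V * BB 0 (t 1) (Shift X (t j) V)"
    using AE_Lam
   proof eventually_elim
    case (elim V)
    have "BB (t j) (t j + t 1) V = BB 0 (t 1) (Shift X (t j) V)" by (rule BB_shift[OF elim ttop])
    moreover have "t j + t 1 = t (Suc j)" using tadd[of j 1] by simp
    ultimately show ?case unfolding B_def t_def by simp
   qed
  qed
  also have "... = (LI V. MM j V * (LI V'. BB 0 (t 1) V' wrt Pu (State X (t j) V)) wrt Pu x)"
   by (rule markov[OF MF BB_Fu])
  finally show ?thesis by (simp add: MM_def H_def TT_def[of "tj T N j"] K_def t_def)
 qed
 have S: "S = (\<Sum>j<N. LI V. MM j V * B j V wrt Pu x)" unfolding S_def L2 ..
 have uM: "u = (\<Sum>j<N. LI V. MM (Suc j) V * B j V wrt Pu x)"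
  unfolding uB by (intro sum.cong refl L1) simp
 define dd where "dd j V = dist_e (MM (Suc j) V) (MM j V)" for j V
 have ddm[measurable]: "dd j \<in> BM (Pu x)" for j unfolding dd_def by measurable
 have fin: "(LI V. MM j V * MM j V wrt Pu x) <= 1" for j
 proof -
  have "(LI V. MM j V * MM j V wrt Pu x) <= (LI V. 1 wrt Pu x)"
   by (intro nn_integral_mono) (use mult_mono[OF M1 M1] in simp)
  then show ?thesis using emeasure_space_1 by simp
 qed
 have L3: "(LI V. MM (Suc j) V * MM j V wrt Pu x) = (LI V. MM j V * MM j V wrt Pu x)" if j: "j < N" for j
 proof -
  have Y: "(\<lambda>V. H (Suc j) (State X (t 1) V)) \<in> BM Fu"
   by (rule measurable_compose[OF State_Fil Hb]) simp
  have "(LI V. MM (Suc j) V * MM j V wrt Pu x) = (LI V. MM j V * H (Suc j) (State X (t 1) (Shift X (t j) V)) wrt Pu x)"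
   by (intro nn_integral_cong) (simp add: State_Shift tadd MM_def mult.commute)
  also have "... = (LI V. MM j V * (LI V'. H (Suc j) (State X (t 1) V') wrt Pu (State X (t j) V)) wrt Pu x)"
   by (rule markov[OF MF Y])
  also have "... = (LI V. MM j V * TT (t 1) (TT (t (N - Suc j)) h) (State X (t j) V) wrt Pu x)"
   by (simp add: H_def TT_def[of "t 1"] del: One_nat_def)
  also have "... = (LI V. MM j V * MM j V wrt Pu x)"
   using j by (simp add: TT_add[OF measurable_UB_borel[OF hb]] tadd MM_def H_def Suc_diff_Suc)
  finally show ?thesis .
 qed
 have L4: "(LI V. dd j V * dd j V wrt Pu x) + (LI V. MM j V * MM j V wrt Pu x) = (LI V. MM (Suc j) V * MM (Suc j) V wrt Pu x)"
  if j: "j < N" for j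
 proof -
  let ?m = "LI V. MM j V * MM j V wrt Pu x"
  have "(LI V. dd j V * dd j V wrt Pu x) + 2 * (LI V. MM (Suc j) V * MM j V wrt Pu x) =
    (LI V. dd j V * dd j V + 2 * (MM (Suc j) V * MM j V) wrt Pu x)"
   by (subst nn_integral_add) (auto simp: nn_integral_cmult)
  also have "... = (LI V. MM (Suc j) V * MM (Suc j) V + MM j V * MM j V wrt Pu x)"
   unfolding dd_def by (intro nn_integral_cong dist_e_square M1)
  also have "... = (LI V. MM (Suc j) V * MM (Suc j) V wrt Pu x) + ?m"
   by (intro nn_integral_add) measurable
  finally have "?m + ((LI V. dd j V * dd j V wrt Pu x) + ?m) = ?m + (LI V. MM (Suc j) V * MM (Suc j) V wrt Pu x)"
   unfolding L3[OF j] by (simp add: mult_2 add_ac)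
  then show ?thesis using fin[of j] by (auto simp: ennreal_add_left_cancel top_unique)
 qed
 have "(\<Sum>j<k. LI V. dd j V * dd j V wrt Pu x) + (LI V. MM 0 V * MM 0 V wrt Pu x) = (LI V. MM k V * MM k V wrt Pu x)"
  if "k <= N" for k using that
 proof (induction k)
  case (Suc k)
  then have "(\<Sum>j<Suc k. LI V. dd j V * dd j V wrt Pu x) + (LI V. MM 0 V * MM 0 V wrt Pu x) =
    (LI V. dd k V * dd k V wrt Pu x) + (LI V. MM k V * MM k V wrt Pu x)" by (simp add: add_ac)
  also have "... = (LI V. MM (Suc k) V * MM (Suc k) V wrt Pu x)" using Suc.prems by (intro L4) simp
  finally show ?case .
 qed simp
 note tele = this[OF order_refl]
 have "(\<Sum>j<N. LI V. dd j V * dd j V wrt Pu x) <= (\<Sum>j<N. LI V. dd j V * dd j V wrt Pu x) + (LI V. MM 0 V * MM 0 V wrt Pu x)"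
  by (rule add_increasing2) simp_all
 also have "... <= 1" unfolding tele by (rule fin)
 finally have dsum: "(\<Sum>j<N. LI V. dd j V * dd j V wrt Pu x) <= 1" .
 have err: "(\<Sum>j<N. LI V. dd j V * B j V wrt Pu x) <= ennreal e + ennreal (1 / e) * q"
 proof -
  have "(\<Sum>j<N. LI V. dd j V * B j V wrt Pu x) <=
    (\<Sum>j<N. LI V. ennreal e * (dd j V * dd j V) + ennreal (1 / e) * (B j V * B j V) wrt Pu x)"
   by (intro sum_mono nn_integral_mono ennreal_weighted_am_gm e)
  also have "... = (\<Sum>j<N. ennreal e * (LI V. dd j V * dd j V wrt Pu x) + ennreal (1 / e) * (LI V. B j V * B j V wrt Pu x))"
   by (intro sum.cong refl) (subst nn_integral_add, auto simp: nn_integral_cmult)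
  also have "... = ennreal e * (\<Sum>j<N. LI V. dd j V * dd j V wrt Pu x) + ennreal (1 / e) * (\<Sum>j<N. LI V. B j V * B j V wrt Pu x)"
   by (simp add: sum.distrib sum_distrib_left)
  also have "(\<Sum>j<N. LI V. B j V * B j V wrt Pu x) = q"
   unfolding q by (intro nn_integral_sum[symmetric]) measurable
  also have "ennreal e * (\<Sum>j<N. LI V. dd j V * dd j V wrt Pu x) <= ennreal e * 1"
   by (rule mult_left_mono[OF dsum]) simp
  finally show ?thesis by (simp add: add_right_mono)
 qed
 have add: "(LI V. a V * B j V wrt Pu x) <= (LI V. b V * B j V wrt Pu x) + (LI V. dd j V * B j V wrt Pu x)"
  if [measurable]: "b \<in> BM (Pu x)" and le: "\<And>V. a V <= b V + dd j V" for a b j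
 proof -
  have "(LI V. a V * B j V wrt Pu x) <= (LI V. b V * B j V + dd j V * B j V wrt Pu x)"
   using le by (intro nn_integral_mono) (simp add: distrib_right[symmetric] mult_right_mono)
  also have "... = (LI V. b V * B j V wrt Pu x) + (LI V. dd j V * B j V wrt Pu x)"
   by (intro nn_integral_add) measurable
  finally show ?thesis .
 qed
 have "u <= (\<Sum>j<N. (LI V. MM j V * B j V wrt Pu x) + (LI V. dd j V * B j V wrt Pu x))"
  unfolding uM by (intro sum_mono add) (simp_all add: dd_def dist_e_triangle)
 also have "... <= S + (ennreal e + ennreal (1 / e) * q)"
  unfolding S sum.distrib by (rule add_left_mono[OF err])
 finally show "u <= S + (ennreal e + ennreal (1 / e) * q)" .
 have "S <= (\<Sum>j<N. (LI V. MM (Suc j) V * B j V wrt Pu x) + (LI V. dd j V * B j V wrt Pu x))"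
  unfolding S by (intro sum_mono add) (simp_all add: dd_def dist_e_triangle)
 also have "... <= u + (ennreal e + ennreal (1 / e) * q)"
  unfolding uM sum.distrib by (rule add_left_mono[OF err])
 finally show "S <= u + (ennreal e + ennreal (1 / e) * q)" .
qed

abbreviation cell :: "nat => ('s option => ennreal) => nat => 's option => ennreal"
 where "cell n k j \<equiv> TT (tj T (Suc n) j) (\<lambda>y. TT (tj T (Suc n) (Suc n - j)) k y * K (tj T (Suc n) 1) y)"

text \<open>By symmetry of the semigroup, the \<open>j\<close>-th term of the sum for \<open>g, h\<close> is
 $\int T_{j\delta} g \cdot T_{T-j\delta} h \cdot E_\cdot[B_\delta]\,dm$, which, with
 $N$ cells, is the term of index $N - j$ for \<open>h, g\<close>. The sums over $j < N$ differ from each other by boundary terms, and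
 the term with \<open>j = 0\<close> tends to zero.\<close>

lemma reversal_le:
 assumes g: "is_test g" and h: "is_test h" and gi: "(LI x. g (Some x) wrt M) < top" and hi: "(LI x. h (Some x) wrt M) < top"
 shows "(LI x. g (Some x) * UU T h (Some x) wrt M) <= (LI x. h (Some x) * UU T g (Some x) wrt M)"
proof -
 define q where "q n x = (LI V. (\<Sum>j<Suc n. BJ T (Suc n) j V * BJ T (Suc n) j V) wrt Pu x)" for n x
 define s where "s n f k j = (LI x. f (Some x) * cell n k j (Some x) wrt M)"
  for n f k j
 define r where "r n = (LI x. g (Some x) * K (tj T (Suc n) 1) (Some x) wrt M)" for n
 define D where "D = 2 * (CT (ennreal T) * CT (ennreal T))"
 have D: "D < top" unfolding D_def using CT_top by (simp add: ennreal_mult_less_top)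
 note KUB[measurable] = UB_Some_measurable[OF K_UB]
 have qUB: "q n \<in> BM UB" for n
  unfolding q_def[abs_def]
  by (rule measurable_compose[OF Pu_kernel_sub nn_integral_measurable_subprob_algebra]) measurable
 note qm[measurable] = UB_Some_measurable[OF qUB]
 have UUB: "UU T f \<in> BM UB" if "is_test f" for f
 proof -
  have "f \<in> BM borel_cpt" using that by (simp add: is_test_def)
  note [measurable] = measurable_compose[OF State_Fil[OF top_greatest] this]
  show ?thesis unfolding UU_def[abs_def]
   by (rule measurable_compose[OF Pu_kernel_sub nn_integral_measurable_subprob_algebra]) measurable
 qed
 have test_UB: "f \<in> BM UB" if "is_test f" for f
  using that by (auto simp: is_test_def intro: measurable_UB_borel)
 have inner_UB: "(\<lambda>y. TT (tj T (Suc n) (Suc n - j)) k y * K (tj T (Suc n) 1) y) \<in> BM UB" if "is_test k" for n k j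
  using TT_UB[OF test_UB[OF that]] K_UB by (intro borel_measurable_times_ennreal) auto
 have q_lim: "(\<lambda>n. LI x. f (Some x) * q n (Some x) wrt M) \<longlonglongrightarrow> 0" if f: "is_test f" and fi: "(LI x. f (Some x) wrt M) < top" for f
 proof -
  note [measurable] = UB_Some_measurable[OF test_UB[OF f]]
  have "(\<lambda>n. LI x. f (Some x) * q n (Some x) wrt M) \<longlonglongrightarrow> (LI x. f (Some x) * 0 wrt M)"
  proof (rule nn_integral_dominated_convergence[where w="\<lambda>x. f (Some x) * D"])
   show "(LI x. f (Some x) * D wrt M) < \<infinity>" using fi D by (subst nn_integral_multc) (auto simp: ennreal_mult_less_top)
   show "AE x in M. f (Some x) * q n (Some x) <= f (Some x) * D" for n
    unfolding q_def D_def by (intro AE_I2 mult_left_mono quadratic_variation(1)[OF T]) simp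
   show "AE x in M. (\<lambda>n. f (Some x) * q n (Some x)) \<longlonglongrightarrow> f (Some x) * 0"
   proof (rule AE_I2, rule ennreal_tendsto_cmult)
    fix x
    have "f (Some x) <= 1" using f by (simp add: is_test_def)
    then show "f (Some x) < top" by (rule le_less_trans) simp
    show "(\<lambda>n. q n (Some x)) \<longlonglongrightarrow> 0" unfolding q_def by (rule quadratic_variation(2)[OF T])
   qed
  qed measurable
  then show ?thesis by simp
 qed
 have r_lim: "r \<longlonglongrightarrow> 0"
 proof -
  note [measurable] = UB_Some_measurable[OF test_UB[OF g]]
  have "r \<longlonglongrightarrow> (LI x. g (Some x) * 0 wrt M)"
   unfolding r_def[abs_def]
  proof (rule nn_integral_dominated_convergence[where w="\<lambda>x. g (Some x) * CT (ennreal T)"])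
   show "(LI x. g (Some x) * CT (ennreal T) wrt M) < \<infinity>"
    using gi CT_top by (subst nn_integral_multc) (auto simp: ennreal_mult_less_top)
   show "AE x in M. g (Some x) * K (tj T (Suc n) 1) (Some x) <= g (Some x) * CT (ennreal T)" for n
   proof (intro AE_I2 mult_left_mono)
    fix x
    have "tj T (Suc n) 1 <= ennreal T" using tj_mono[OF T, of 1 "Suc n" "Suc n"] tj_n[OF T, of "Suc n"] by simp
    then have "K (tj T (Suc n) 1) (Some x) <= K (ennreal T) (Some x)"
     unfolding K_def by (intro nn_integral_mono BB_mono) simp_all
    also have "... <= CT (ennreal T)" by (rule K_le) simp
    finally show "K (tj T (Suc n) 1) (Some x) <= CT (ennreal T)" .
   qed simp
   show "AE x in M. (\<lambda>n. g (Some x) * K (tj T (Suc n) 1) (Some x)) \<longlonglongrightarrow> g (Some x) * 0"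
   proof (rule AE_I2, rule ennreal_tendsto_cmult)
    fix x
    have "g (Some x) <= 1" using g by (simp add: is_test_def)
    then show "g (Some x) < top" by (rule le_less_trans) simp
    show "(\<lambda>n. K (tj T (Suc n) 1) (Some x)) \<longlonglongrightarrow> 0" unfolding K_def by (rule BB_small[OF T])
   qed
  qed measurable
  then show ?thesis by simp
 qed
 have s_refl: "s n f k j = s n k f (Suc n - j)" if f: "is_test f" and k: "is_test k" and j: "j <= Suc n" for n f k j
 proof -
  have sym: "s n f k j = (LI x. TT (tj T (Suc n) j) f (Some x) * (TT (tj T (Suc n) (Suc n - j)) k (Some x) * K (tj T (Suc n) 1) (Some x)) wrt M)"
   if f: "is_test f" and k: "is_test k" for f k j
   unfolding s_def
   using f by (intro TT_symmetric tj_top[OF T] test_UB inner_UB k) (auto simp: is_test_def K_None)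
  show ?thesis unfolding sym[OF f k] sym[OF k f] using j by (intro nn_integral_cong) (simp add: mult_ac)
 qed
 have s_shift: "(\<Sum>j<Suc n. s n g h j) <= r n + (\<Sum>j<Suc n. s n h g j)" for n
 proof -
  have "(\<Sum>j<n. s n g h (Suc j)) = (\<Sum>j<n. s n h g (Suc (n - Suc j)))"
   by (intro sum.cong refl) (simp add: s_refl[OF g h] Suc_diff_Suc)
  also have "... = (\<Sum>j<n. s n h g (Suc j))" by (rule sum.nat_diff_reindex)
  also have "... <= (\<Sum>j<Suc n. s n h g j)" unfolding sum.lessThan_Suc_shift by simp
  finally have 1: "(\<Sum>j<n. s n g h (Suc j)) <= (\<Sum>j<Suc n. s n h g j)" .
  have 2: "s n g h 0 <= r n"
   unfolding s_def r_def
  proof (intro nn_integral_mono mult_left_mono)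
   fix x
   have "TT (tj T (Suc n) (Suc n - 0)) h (Some x) <= 1" using h by (intro TT_le) (simp add: is_test_def)
   from mult_right_mono[OF this, of "K (tj T (Suc n) 1) (Some x)"]
   show "TT (tj T (Suc n) 0) (\<lambda>y. TT (tj T (Suc n) (Suc n - 0)) h y * K (tj T (Suc n) 1) y) (Some x) <= K (tj T (Suc n) 1) (Some x)"
    by (simp add: tj_0[OF T] TT_0)
  qed simp
  show ?thesis unfolding sum.lessThan_Suc_shift[of "s n g h"] using add_mono[OF 2 1] .
 qed
 have bound: "(LI x. g (Some x) * UU T h (Some x) wrt M) <= (LI x. h (Some x) * UU T g (Some x) wrt M) +
   ennreal e * ((LI x. g (Some x) wrt M) + (LI x. h (Some x) wrt M))" (is "?a <= ?b + ?c") if e: "0 < e" for e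
 proof -
  have split: "(LI x. f (Some x) * (v (Some x) + (ennreal e + ennreal (1 / e) * q n (Some x))) wrt M) =
    (LI x. f (Some x) * v (Some x) wrt M) + (ennreal e * (LI x. f (Some x) wrt M) + ennreal (1 / e) * (LI x. f (Some x) * q n (Some x) wrt M))"
   if f: "is_test f" and v: "v \<in> BM UB" for f v n
  proof -
   note [measurable] = UB_Some_measurable[OF test_UB[OF f]] UB_Some_measurable[OF v]
   have "(LI x. f (Some x) * (v (Some x) + (ennreal e + ennreal (1 / e) * q n (Some x))) wrt M) =
     (LI x. f (Some x) * v (Some x) + (ennreal e * f (Some x) + ennreal (1 / e) * (f (Some x) * q n (Some x))) wrt M)"
    by (intro nn_integral_cong) (simp add: distrib_left mult_ac)
   also have "... = (LI x. f (Some x) * v (Some x) wrt M) + ((LI x. ennreal e * f (Some x) wrt M) + (LI x. ennreal (1 / e) * (f (Some x) * q n (Some x)) wrt M))"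
    by (simp add: nn_integral_add)
   also have "... = (LI x. f (Some x) * v (Some x) wrt M) + (ennreal e * (LI x. f (Some x) wrt M) + ennreal (1 / e) * (LI x. f (Some x) * q n (Some x) wrt M))"
    by (simp add: nn_integral_cmult)
   finally show ?thesis .
  qed
  have sums: "(LI x. f (Some x) * (\<Sum>j<Suc n. cell n k j (Some x)) wrt M)
    = (\<Sum>j<Suc n. s n f k j)" if f: "is_test f" and k: "is_test k" for f k n
  proof -
   note [measurable] = UB_Some_measurable[OF test_UB[OF f]] UB_Some_measurable[OF TT_UB[OF inner_UB[OF k]]]
   show ?thesis unfolding s_def sum_distrib_left by (intro nn_integral_sum) measurable
  qed
  have S_UB: "(\<lambda>x. \<Sum>j<Suc n. cell n k j x) \<in> BM UB"
   if k: "is_test k" for k n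
   by (intro borel_measurable_sum TT_UB inner_UB k)
  have "?a <= ?b + (r n + (?c + ennreal (1 / e) * ((LI x. g (Some x) * q n (Some x) wrt M) + (LI x. h (Some x) * q n (Some x) wrt M))))" for n
  proof -
   have "?a <= (LI x. g (Some x) * ((\<Sum>j<Suc n. cell n h j (Some x)) + (ennreal e + ennreal (1 / e) * q n (Some x))) wrt M)"
    unfolding UU_def q_def by (intro nn_integral_mono mult_left_mono riemann_sum_error(1)[OF h e]) simp
   also note split[OF g S_UB[OF h]]
   also note sums[OF g h]
   finally have up: "?a <= (\<Sum>j<Suc n. s n g h j) + (ennreal e * (LI x. g (Some x) wrt M) + ennreal (1 / e) * (LI x. g (Some x) * q n (Some x) wrt M))" .
   have "(\<Sum>j<Suc n. s n h g j) <= (LI x. h (Some x) * (UU T g (Some x) + (ennreal e + ennreal (1 / e) * q n (Some x))) wrt M)"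
    unfolding sums[OF h g, symmetric] UU_def q_def by (intro nn_integral_mono mult_left_mono riemann_sum_error(2)[OF g e]) simp
   also note split[OF h UUB[OF g]]
   finally have "(\<Sum>j<Suc n. s n h g j) <= ?b + (ennreal e * (LI x. h (Some x) wrt M) + ennreal (1 / e) * (LI x. h (Some x) * q n (Some x) wrt M))" .
   then have "(\<Sum>j<Suc n. s n g h j) <= r n + (?b + (ennreal e * (LI x. h (Some x) wrt M) + ennreal (1 / e) * (LI x. h (Some x) * q n (Some x) wrt M)))"
    by (intro order_trans[OF s_shift] add_left_mono)
   from order_trans[OF up add_right_mono[OF this]]
   have "?a <= (r n + (?b + (ennreal e * (LI x. h (Some x) wrt M) + ennreal (1 / e) * (LI x. h (Some x) * q n (Some x) wrt M)))) +
     (ennreal e * (LI x. g (Some x) wrt M) + ennreal (1 / e) * (LI x. g (Some x) * q n (Some x) wrt M))"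
    .
   then show ?thesis by (simp add: distrib_left add_ac)
  qed
  moreover have "(\<lambda>n. ?b + (r n + (?c + ennreal (1 / e) * ((LI x. g (Some x) * q n (Some x) wrt M) + (LI x. h (Some x) * q n (Some x) wrt M)))))
    \<longlonglongrightarrow> ?b + (0 + (?c + ennreal (1 / e) * (0 + 0)))"
   by (intro tendsto_add tendsto_const r_lim ennreal_tendsto_cmult q_lim g h gi hi) simp
  ultimately show ?thesis using LIMSEQ_le_const by fastforce
 qed
 let ?I = "(LI x. g (Some x) wrt M) + (LI x. h (Some x) wrt M)"
 obtain c where c: "?I = ennreal c" "0 <= c" using gi hi by (cases ?I) auto
 show ?thesis
 proof (rule ennreal_le_epsilon)
  fix e :: real assume e: "0 < e"
  have "ennreal (e / (c + 1)) * ?I <= ennreal e"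
   unfolding c(1) using c(2) e by (simp add: ennreal_mult[symmetric] field_simps)
  then show "(LI x. g (Some x) * UU T h (Some x) wrt M) <= (LI x. h (Some x) * UU T g (Some x) wrt M) + ennreal e"
   using bound[of "e / (c + 1)"] e c(2) by (simp add: order_trans[OF _ add_left_mono])
 qed
qed

end

end

context weighted_pcaf
begin

text \<open>Condition on the path up to a point of increase \<open>s\<close>.\<close>

lemma UU_NN:
 assumes h: "h \<in> BM borel_cpt"
 shows "UU T h x = NN (\<lambda>(s, y). ind {..<ennreal T} s * (w y * TT (ennreal T - s) h y)) x"
proof -
 let ?T = "ennreal T"
 note [measurable] = h
 have "UU T h x = (LI V. (LI s. ind {..<?T} s * (w (State X s V) * h (State X ?T V)) wrt dA V) wrt Pu x)"
  unfolding UU_def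
 proof (rule nn_integral_cong)
  fix V assume "V \<in> space (Pu x)"
  then have "V \<in> \<Omega>" by simp
  note [measurable] = w_path[OF this]
  have "(\<lambda>s. ind {0..<?T} s * w (State X s V)) \<in> BM (dA V)" by measurable
  note * = nn_integral_multc[OF this, of "h (State X ?T V)"]
  show "h (State X ?T V) * BB 0 ?T V = (LI s. ind {..<?T} s * (w (State X s V) * h (State X ?T V)) wrt dA V)"
  proof -
   have "{0..<?T} = {..<?T}" by auto
   then show ?thesis using * unfolding BB_def by (simp add: mult_ac)
  qed
 qed
 also have "... = (LI V. (LI s. ind {..<?T} s * (w (State X s V) * TT (?T - s) h (State X s V)) wrt dA V) wrt Pu x)"
 proof (rule strong_markov_AA[OF AE_Lam, where H="\<lambda>s V. ind {..<?T} s * (w (State X 0 V) * h (State X (?T - s) V))"])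
  show "(\<lambda>(s :: ennreal, V). ind {..<?T} s * (w (State X s V) * h (State X ?T V))) \<in> BM (TF)"
   unfolding split_beta' by measurable
  show "(\<lambda>(s :: ennreal, V). ind {..<?T} s * (w (State X 0 V) * h (State X (?T - s) V))) \<in> BM (TF)"
   unfolding split_beta' by measurable
  show "(\<lambda>(s :: ennreal, y). ind {..<?T} s * (w y * TT (?T - s) h y)) \<in> BM (borel \<Otimes>\<^sub>M borel_cpt)"
   unfolding split_beta' by measurable
 next
  fix s :: ennreal and V assume "V \<in> Lam" and s: "s < top"
  then have o: "V \<in> \<Omega>" using Lam_Omega by auto
  show "ind {..<?T} s * (w (State X s V) * h (State X ?T V)) =
    ind {..<?T} s * (w (State X 0 (Shift X s V)) * h (State X (?T - s) (Shift X s V)))"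
   by (auto simp: indicator_def State_Shift[OF o] diff_add_cancel_ennreal)
 next
  fix s :: ennreal and y
  have [measurable]: "(\<lambda>V. h (State X (?T - s) V)) \<in> BM (Pu (Some y))"
   by (rule State_fun_Pu[OF h])
  have "(LI V. ind {..<?T} s * (w (State X 0 V) * h (State X (?T - s) V)) wrt Pu (Some y)) =
    (LI V. (ind {..<?T} s * w (Some y)) * h (State X (?T - s) V) wrt Pu (Some y))"
   using AE_Pu_start[of "Some y"] by (intro nn_integral_cong_AE) (auto simp: mult.assoc)
  also have "... = (ind {..<?T} s * w (Some y)) * TT (?T - s) h (Some y)"
   unfolding TT_def by (intro nn_integral_cmult) measurable
  finally show "(LI V. ind {..<?T} s * (w (State X 0 V) * h (State X (?T - s) V)) wrt Pu (Some y)) =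
    ind {..<?T} s * (w (Some y) * TT (?T - s) h (Some y))" by (simp add: mult.assoc)
 qed
 also have "... = NN (\<lambda>(s, y). ind {..<?T} s * (w y * TT (?T - s) h y)) x" by (simp add: NN_def)
 finally show ?thesis .
qed

lemma time_reversal_integrable:
 assumes T: "0 < T" and g: "is_test g" and h: "is_test h"
  and gi: "(LI x. g (Some x) wrt M) < top" and hi: "(LI x. h (Some x) wrt M) < top"
 shows "(LI (s, y). ind {..<ennreal T} s * (w y * TT (ennreal T - s) h y) wrt NG g) =
  (LI (s, y). ind {..<ennreal T} s * (w y * TT (ennreal T - s) g y) wrt NG h)"
proof -
 have "(LI (s, y). ind {..<ennreal T} s * (w y * TT (ennreal T - s) h y) wrt NG g) = (LI x. g (Some x) * UU T h (Some x) wrt M)"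
  if g: "is_test g" and h: "is_test h" for g h
 proof -
  have gb: "g \<in> BM UB" and hb: "h \<in> BM borel_cpt"
   using g h by (auto simp: is_test_def intro: measurable_UB_borel)
  note [measurable] = hb
  have "(\<lambda>(s, y). ind {..<ennreal T} s * (w y * TT (ennreal T - s) h y)) \<in> BM TB"
   unfolding split_beta' by measurable
  from nn_integral_NG[OF gb this] show ?thesis unfolding UU_NN[OF hb] by simp
 qed
 note * = this
 show ?thesis unfolding *[OF g h] *[OF h g]
  using reversal_le[OF T g h gi hi] reversal_le[OF T h g hi gi] by (rule antisym)
qed

end

context pcaf_setting
begin

lemma NG_mono: "g \<in> BM UB ==> g' \<in> BM UB ==> (\<And>x. g (Some x) <= g' (Some x)) ==> \<phi> \<in> BM TB ==>
  (LI z. \<phi> z wrt NG g) <= (LI z. \<phi> z wrt NG g')"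
 by (simp add: nn_integral_NG nn_integral_mono mult_right_mono)

lemma NG_SUP:
 assumes g: "\<And>i::nat. g i \<in> BM borel_cpt" "\<And>y. incseq (\<lambda>i. g i y)" and \<phi>: "\<phi> \<in> BM TB"
 shows "(LI z. \<phi> z wrt NG (\<lambda>y. SUP i. g i y)) = (SUP i. LI z. \<phi> z wrt NG (g i))"
proof -
 note [measurable] = g(1) UB_Some_measurable[OF NN_UB[OF \<phi>]] UB_Some_measurable[OF measurable_UB_borel[OF g(1)]]
 have "(LI z. \<phi> z wrt NG (\<lambda>y. SUP i. g i y)) = (LI x. (SUP i. g i (Some x) * NN \<phi> (Some x)) wrt M)"
  by (subst nn_integral_NG[OF measurable_UB_borel \<phi>]) (auto simp: SUP_mult_right_ennreal)
 also have "... = (SUP i. LI z. \<phi> z wrt NG (g i))"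
  using g(2) by (subst nn_integral_monotone_convergence_SUP)
   (auto simp: nn_integral_NG[OF measurable_UB_borel[OF g(1)] \<phi>] incseq_def le_fun_def intro!: mult_right_mono)
 finally show ?thesis .
qed

lemma NG_None: "AE z in NG g. snd z ~= None \<and> 0 < fst z \<and> fst z < top" if g: "g \<in> BM UB"
proof -
 define N where "N = {z :: ennreal \<times> 's option. snd z = None \<or> fst z \<in> {0, top}}"
 have N[measurable]: "N \<in> sets TB"
 proof -
  have "(\<lambda>z. snd z) -` {None} \<inter> space TB \<in> sets TB" by (rule measurable_sets[OF measurable_snd sets_borel_cpt_None])
  moreover have "fst -` {0, top} \<inter> space TB \<in> sets TB" by (rule measurable_sets[OF measurable_fst]) simp
  ultimately have "((\<lambda>z. snd z) -` {None} \<inter> space TB) \<union> (fst -` {0, top} \<inter> space TB) \<in> sets TB" by (rule sets.Un)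
  moreover have "((\<lambda>z. snd z) -` {None} \<inter> space TB) \<union> (fst -` {0, top} \<inter> space TB) = N"
   by (auto simp: N_def space_pair_measure)
  ultimately show ?thesis by simp
 qed
 have eN: "emeasure (NG g) N = (LI z. ind N z wrt NG g)" using N NG_props(1)[OF g] by (intro nn_integral_indicator[symmetric]) auto
 have iN: "(LI z. ind N z wrt NG g) = (LI x. g (Some x) * NN (ind N) (Some x) wrt M)" by (rule nn_integral_NG[OF g]) measurable
 have "NN (ind N) x = 0" for x
 proof -
  have "NN (ind N) x = NN (\<lambda>z. 0 * ind N z) x" by (rule NN_cong) (auto simp: N_def indicator_def)
  also have "... = 0" by (subst NN_cmult) auto
  finally show ?thesis .
 qed
 then have "N \<in> null_sets (NG g)" using N NG_props(1)[OF g] eN iN by auto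
 then show ?thesis by (rule AE_I') (auto simp: N_def top.not_eq_extremum zero_less_iff_neq_zero)
qed

lemma occupation_NN:
 assumes E: "E \<in> sets borel" and t: "t < top"
 shows "(LI V. occupation_integral X A E t V wrt law_at X (Some x)) = NN (\<lambda>(s, y). ind {..<t} s * ind (Some ` E) y) (Some x)"
proof -
 note [measurable] = sets_borel_cpt_image[OF E]
 have m: "(\<lambda>(s :: ennreal, y). ind {..<t} s * ind (Some ` E) y :: ennreal) \<in> BM TB"
  unfolding split_beta' by measurable
 have "(LI V. occupation_integral X A E t V wrt law_at X (Some x)) =
   (LI V. (LI s. (case (s, State X s V) of (s, y) => ind {..<t} s * ind (Some ` E) y) wrt dA V) wrt law_at X (Some x))"
 proof (rule nn_integral_cong)
  fix V assume "V \<in> space (law_at X (Some x))"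
  then have o: "V \<in> \<Omega>" by simp
  have im: "(\<lambda>z. ind (Some ` E) (snd z) :: ennreal) \<in> BM TB" by measurable
  have gm: "(\<lambda>s. ind (Some ` E) (State X s V) :: ennreal) \<in> BM borel"
   using path_measurable[OF im o] by simp
  show "occupation_integral X A E t V = (LI s. (case (s, State X s V) of (s, y) => ind {..<t} s * ind (Some ` E) y) wrt dA V)"
   unfolding occupation_integral_def prod.case
   by (rule occupation_dclock[OF clock_AA[OF o] AA_finite[OF o] _ gm _ t]) (auto simp: AA_less_top State_None_iff[OF o, symmetric])
 qed
 also have "... = NN (\<lambda>(s, y). ind {..<t} s * ind (Some ` E) y) (Some x)"
  unfolding NN_def by (rule nn_integral_Pu[OF path_integral_Fu[OF m]])
 finally show ?thesis .
qed

section \<open>The Revuz measure\<close>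

text \<open>The mean occupation up to time \<open>t\<close>, started from \<open>m\<close>, is subadditive in \<open>t\<close> because \<open>m\<close> is
 excessive. Hence its ratio to \<open>t\<close> increases as \<open>t\<close> is halved, and dyadic times determine the
 Revuz measure.\<close>

definition OI :: "('s option => ennreal) => ennreal => ennreal"
 where "OI \<phi> t = (LI (s, y). ind {..<t} s * \<phi> y wrt NG alive)"

lemma alive_UB: "alive \<in> BM UB" by (rule measurable_UB_borel) measurable

lemma OI_mono: "t <= t' ==> OI \<phi> t <= OI \<phi> t'"
 unfolding OI_def by (intro nn_integral_mono) (auto simp: indicator_def)

lemma OI_add:
 assumes [measurable]: "\<phi> \<in> BM borel_cpt" and a: "a < top"
 shows "OI \<phi> (a + b) <= OI \<phi> a + OI \<phi> b"
proof -
 have m[measurable]: "(\<lambda>z. ind {..<c} (fst z) * \<phi> (snd z)) \<in> BM TB" for c :: ennreal by measurable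
 have [measurable]: "(\<lambda>z. ind {..<c} (fst z - a) * \<phi> (snd z)) \<in> BM TB" for c :: ennreal by measurable
 note [measurable_cong] = NG_props(1)[OF alive_UB]
 have "OI \<phi> (a + b) <= (LI z. ind {..<a} (fst z) * \<phi> (snd z) + ind {a..} (fst z) * (ind {..<b} (fst z - a) * \<phi> (snd z)) wrt NG alive)"
  unfolding OI_def
 proof (rule nn_integral_mono, clarify)
  fix s y
  have "s - a < b" if "a <= s" "s < a + b"
   using that by (metis a diff_add_cancel_ennreal add.commute ennreal_add_left_cancel_less infinity_ennreal_def order_less_irrefl)
  then show "ind {..<a + b} s * \<phi> y <= ind {..<a} (fst (s, y)) * \<phi> (snd (s, y)) + ind {a..} (fst (s, y)) * (ind {..<b} (fst (s, y) - a) * \<phi> (snd (s, y)))"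
   by (auto simp: indicator_def)
 qed
 also have "... = OI \<phi> a + (LI z. ind {a..} (fst z) * (ind {..<b} (fst z - a) * \<phi> (snd z)) wrt NG alive)"
  unfolding OI_def by (subst nn_integral_add) (auto simp: split_beta')
 also have "(LI z. ind {a..} (fst z) * (ind {..<b} (fst z - a) * \<phi> (snd z)) wrt NG alive) = (LI z. ind {..<b} (fst z) * \<phi> (snd z) wrt NG (TT a alive))"
  using NG_shift[OF a m[of b] alive_UB] by (simp add: split_beta')
 also have "... <= OI \<phi> b"
  unfolding OI_def split_beta' by (intro NG_mono TT_UB alive_UB m) (auto intro!: TT_le simp: indicator_def)
 finally show ?thesis by (simp add: add_left_mono)
qed

definition dy :: "nat => ennreal" where "dy k = ennreal (1 / 2 ^ k)"

lemma dy_props: "dy k < top" "0 < dy k" "dy (Suc k) + dy (Suc k) = dy k" "2 ^ k * dy k = 1" "decseq dy" "dy \<longlonglongrightarrow> 0"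
proof -
 show "dy k < top" "0 < dy k" by (simp_all add: dy_def)
 show "dy (Suc k) + dy (Suc k) = dy k" by (simp add: dy_def ennreal_plus[symmetric] field_simps del: ennreal_plus)
 have "(2::ennreal) ^ k = ennreal (2 ^ k)" by (simp add: ennreal_power[symmetric])
 then show "2 ^ k * dy k = 1" by (simp add: dy_def ennreal_mult[symmetric])
 show "decseq dy" unfolding dy_def decseq_def by (auto intro!: ennreal_leI divide_left_mono power_increasing)
 have "(\<lambda>k. (1 / 2 :: real) ^ k) \<longlonglongrightarrow> 0" by (rule LIMSEQ_realpow_zero) auto
 then have "(\<lambda>k. ennreal ((1 / 2) ^ k)) \<longlonglongrightarrow> ennreal 0" by (rule tendsto_ennrealI)
 then show "dy \<longlonglongrightarrow> 0" by (simp add: dy_def[abs_def] power_one_over)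
qed

definition DK :: "('s option => ennreal) => nat => ennreal" where "DK \<phi> k = 2 ^ k * OI \<phi> (dy k)"

lemma DK_mono: "\<phi> \<in> BM borel_cpt ==> incseq (DK \<phi>)"
proof (rule incseq_SucI)
 fix k assume \<phi>: "\<phi> \<in> BM borel_cpt"
 have "OI \<phi> (dy k) <= 2 * OI \<phi> (dy (Suc k))"
  using OI_add[OF \<phi> dy_props(1), of "Suc k" "dy (Suc k)"] by (simp add: dy_props(3) mult_2)
 from mult_left_mono[OF this, of "2 ^ k"] show "DK \<phi> k <= DK \<phi> (Suc k)"
  by (simp add: DK_def mult_ac)
qed

text \<open>Cover $[0,t]$ by $n \le t 2^k + 1$ dyadic intervals of length $2^{-k}$ and let \<open>k\<close> tend to infinity.\<close>

lemma OI_le_DK: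
 assumes \<phi>: "\<phi> \<in> BM borel_cpt" and t: "0 < t" "t < top"
 shows "OI \<phi> t / t <= (SUP k. DK \<phi> k)" (is "_ <= ?S")
proof -
 obtain r where r: "t = ennreal r" "0 < r" using t by (cases t) auto
 have n: "OI \<phi> (of_nat n * dy k) <= of_nat n * OI \<phi> (dy k)" for n k
 proof (induction n)
  case 0
  then show ?case by (simp add: OI_def split_beta')
 next
  case (Suc n)
  have "OI \<phi> (of_nat (Suc n) * dy k) <= OI \<phi> (dy k) + OI \<phi> (of_nat n * dy k)"
   using OI_add[OF \<phi> dy_props(1), of k "of_nat n * dy k"] by (simp add: distrib_right)
  also have "... <= OI \<phi> (dy k) + of_nat n * OI \<phi> (dy k)" by (rule add_left_mono[OF Suc])
  finally show ?case by (simp add: distrib_right)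
 qed
 have "OI \<phi> t <= t * ?S + dy k * ?S" for k
 proof -
  define n where "n = nat \<lceil>r * 2 ^ k\<rceil>"
  have "0 <= r * 2 ^ k" using r by simp
  then have n1: "r * 2 ^ k <= real n" "real n <= r * 2 ^ k + 1"
   unfolding n_def by (simp_all add: real_nat_ceiling_ge of_int_ceiling_le_add_one)
  have nk: "of_nat n * dy k = ennreal (real n / 2 ^ k)"
   by (simp add: dy_def ennreal_of_nat_eq_real_of_nat ennreal_mult[symmetric])
  have "t <= of_nat n * dy k" unfolding nk r by (rule ennreal_leI) (use n1 in \<open>simp add: field_simps\<close>)
  then have "OI \<phi> t <= of_nat n * OI \<phi> (dy k)" using OI_mono n order_trans by blast
  also have "... = of_nat n * dy k * DK \<phi> k"
   using dy_props(4)[of k] by (simp add: DK_def mult_ac) (metis mult.commute mult.left_commute mult_1)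
  also have "... <= (t + dy k) * ?S"
  proof (rule mult_mono)
   show "of_nat n * dy k <= t + dy k"
    unfolding nk unfolding r dy_def using n1 r(2)
    by (simp add: ennreal_plus[symmetric] field_simps del: ennreal_plus)
   show "DK \<phi> k <= ?S" by (rule SUP_upper) simp
  qed simp_all
  finally show ?thesis by (simp add: distrib_right)
 qed
 note le = this
 have lim: "(\<lambda>k. t * ?S + dy k * ?S) \<longlonglongrightarrow> t * ?S + 0 * ?S" if "?S < top"
 proof (intro tendsto_add tendsto_const tendsto_mult_ennreal dy_props(6))
  have "?S ~= top" using that by (rule less_imp_neq)
  then show "\<not> (0 = (0 :: ennreal) \<and> ?S = \<infinity> \<or> (0 :: ennreal) = \<infinity> \<and> ?S = 0)" by simp
 qed
 have "OI \<phi> t <= t * ?S"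
 proof (cases "?S < top")
  case True
  show ?thesis using LIMSEQ_le_const[OF lim[OF True]] le by auto
 next
  case False
  then have "?S = top" using top.not_eq_extremum by blast
  then have "t * ?S = top" using t by (simp only: ennreal_mult_top zero_less_iff_neq_zero if_False)
  then show ?thesis by (simp only: top_greatest)
 qed
 then show ?thesis using t by (simp add: divide_le_posI_ennreal)
qed

end

locale pcaf_revuz = pcaf_setting X m p A
 for X :: "('w, 's::{metric_space, second_countable_topology}) process" and m p A +
 fixes \<mu> :: "'s measure"
 assumes revuz: "revuz_measure m X A \<mu>"
begin

lemma sets_\<mu> [measurable_cong, simp]: "sets \<mu> = sets borel"
 using revuz by (simp add: revuz_measure_def)

text \<open>The supremum in the definition of the Revuz measure is an increasing limit along dyadic times; an increasing limit of integrals passes from sets to functions.\<close>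

lemma nn_integral_\<mu>:
 assumes "\<phi> \<in> BM borel_cpt"
 shows "(LI y. \<phi> (Some y) wrt \<mu>) = (SUP k. DK \<phi> k)"
 using assms
proof (induction rule: borel_measurable_induct)
 case (cong f g)
 then have "f = g" by auto
 then show ?case using cong by simp
next
 case (set B)
 define E where "E = Some -` B"
 have E: "E \<in> sets borel" using set by (simp add: E_def sets_borel_cpt_iff)
 note [measurable] = sets_borel_cpt_image[OF E] set
 have ae: "AE z in NG alive. ((case z of (s, y) => ind {..<t} s * ind (Some ` E) y) :: ennreal) = (case z of (s, y) => (ind {..<t} s * ind B y :: ennreal))" for t
  using NG_None[OF alive_UB] by eventually_elim (auto simp: indicator_def E_def)
 have OI: "(LI x. (LI V. occupation_integral X A E t V wrt law_at X (Some x)) wrt M) = OI (ind B) t" if "t < top" for t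
 proof -
  have m: "(\<lambda>(s :: ennreal, y). ind {..<t} s * ind (Some ` E) y :: ennreal) \<in> BM TB"
   unfolding split_beta' by measurable
  have "(LI x. (LI V. occupation_integral X A E t V wrt law_at X (Some x)) wrt M) = (LI (s, y). ind {..<t} s * ind (Some ` E) y wrt NG alive)"
   unfolding nn_integral_NG[OF alive_UB m] occupation_NN[OF E that] by simp
  also have "... = OI (ind B) t" unfolding OI_def by (rule nn_integral_cong_AE[OF ae])
  finally show ?thesis .
 qed
 have "(LI y. ind B (Some y) wrt \<mu>) = emeasure \<mu> E"
 proof -
  have "(\<lambda>y. ind B (Some y)) = (ind E :: 's => ennreal)" by (auto simp: E_def indicator_def fun_eq_iff)
  then show ?thesis using E by simp
 qed
 also have "... = (SUP t\<in>{0<..<top}. OI (ind B) t / t)"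
  using revuz E OI by (simp add: revuz_measure_def)
 also have "... = (SUP k. DK (ind B) k)"
 proof (rule antisym)
  show "(SUP t\<in>{0<..<top}. OI (ind B) t / t) <= (SUP k. DK (ind B) k)"
   by (rule SUP_least) (use OI_le_DK in simp)
  show "(SUP k. DK (ind B) k) <= (SUP t\<in>{0<..<top}. OI (ind B) t / t)"
  proof (rule SUP_least)
   fix k
   have "DK (ind B) k = OI (ind B) (dy k) / dy k"
    by (simp add: DK_def dy_def divide_ennreal_def inverse_ennreal ennreal_power[symmetric] mult.commute)
   also have "... <= (SUP t\<in>{0<..<top}. OI (ind B) t / t)" by (rule SUP_upper) (simp add: dy_props)
   finally show "DK (ind B) k <= (SUP t\<in>{0<..<top}. OI (ind B) t / t)" .
  qed
 qed
 finally show ?case .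
next
 case (mult u c)
 note [measurable] = measurable_compose[OF measurable_Some mult(2)] mult(2)
 note [measurable_cong] = NG_props(1)[OF alive_UB]
 have "DK (\<lambda>x. c * u x) k = c * DK u k" for k
 proof -
  have "OI (\<lambda>x. c * u x) t = c * OI u t" for t
   unfolding OI_def split_beta' by (subst nn_integral_cmult[symmetric]) (auto simp: mult.left_commute)
  then show ?thesis by (simp add: DK_def mult.left_commute)
 qed
 then show ?case using mult by (simp add: nn_integral_cmult SUP_mult_left_ennreal)
next
 case (add u v)
 note [measurable] = measurable_compose[OF measurable_Some add(1)] measurable_compose[OF measurable_Some add(3)] add(1,3)
 note [measurable_cong] = NG_props(1)[OF alive_UB]
 have "DK (\<lambda>x. v x + u x) k = DK v k + DK u k" for k
 proof -
  have "OI (\<lambda>x. v x + u x) t = OI v t + OI u t" for t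
   unfolding OI_def split_beta' distrib_left by (rule nn_integral_add) measurable
  then show ?thesis by (simp add: DK_def distrib_left)
 qed
 then show ?case using add by (simp add: nn_integral_add ennreal_SUP_add DK_mono)
next
 case (seq U)
 note [measurable] = measurable_compose[OF measurable_Some seq(1)] seq(1)
 note [measurable_cong] = NG_props(1)[OF alive_UB]
 have incU: "incseq U" by fact
 have inc: "incseq (\<lambda>i y. U i (Some y))" using incU by (auto simp: incseq_def le_fun_def)
 have "DK (SUP i. U i) k = (SUP i. DK (U i) k)" for k
 proof -
  have "OI (SUP i. U i) t = (SUP i. OI (U i) t)" for t
   unfolding OI_def split_beta' using incU
   by (subst nn_integral_monotone_convergence_SUP[symmetric])
    (auto simp: SUP_mult_left_ennreal incseq_def le_fun_def image_comp intro!: mult_left_mono)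
  then show ?thesis by (simp add: DK_def SUP_mult_left_ennreal)
 qed
 then have "(SUP k. DK (SUP i. U i) k) = (SUP i. SUP k. DK (U i) k)" by (subst SUP_commute) simp
 moreover have "(LI y. (SUP i. U i) (Some y) wrt \<mu>) = (SUP i. LI y. U i (Some y) wrt \<mu>)"
  by (subst nn_integral_monotone_convergence_SUP[OF inc, symmetric]) (auto simp: image_comp)
 ultimately show ?case using seq by (simp only: SUP_apply[symmetric])
qed

end

section \<open>The law of the points of increase\<close>

context hunt_setting
begin

lemma TT_SUP:
 assumes h: "\<And>i::nat. h i \<in> BM borel_cpt" and inc: "\<And>y. incseq (\<lambda>i. h i y)"
 shows "TT s (\<lambda>y. SUP i. h i y) x = (SUP i. TT s (h i) x)"
proof -
 have [measurable]: "(\<lambda>V. h i (State X s V)) \<in> BM (Pu x)" for i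
  by (rule State_fun_Pu[OF h])
 have "incseq (\<lambda>i V. h i (State X s V))" using inc by (auto simp: incseq_def le_fun_def)
 then show ?thesis unfolding TT_def by (intro nn_integral_monotone_convergence_SUP) measurable
qed

lemma TT_cmult:
 assumes h: "h \<in> BM borel_cpt"
 shows "TT s (\<lambda>y. c * h y) x = c * TT s h x"
proof -
 have [measurable]: "(\<lambda>V. h (State X s V)) \<in> BM (Pu x)"
  by (rule State_fun_Pu[OF h])
 show ?thesis unfolding TT_def by (rule nn_integral_cmult) measurable
qed

lemma TT_alive_antimono:
 assumes "a <= b"
 shows "TT b alive y <= TT a alive y"
proof -
 have "a + (b - a) = b" using diff_add_cancel_ennreal[OF assms] by (simp only: add.commute)
 then have "TT b alive y = TT a (TT (b - a) alive) y"
  by (simp only: TT_add[OF measurable_UB_borel[OF alive_borel]])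
 also have "... <= TT a alive y"
 proof (rule TT_mono)
  fix y show "TT (b - a) alive y <= alive y"
   by (cases y) (auto simp: TT_None indicator_def intro!: TT_le)
 qed
 finally show ?thesis .
qed

definition cover :: "nat => 's set"
 where "cover = (SOME A. (\<forall>i. A i \<in> sets borel \<and> emeasure m (A i) < top) \<and> incseq A \<and> (\<Union>i. A i) = UNIV)"

lemma cover: "cover i \<in> sets borel" "emeasure m (cover i) < top" "incseq cover" "(\<Union>i. cover i) = UNIV"
proof -
 obtain A :: "nat => 's set" where "range A \<subseteq> sets m" "(\<Union>i. A i) = space m" "\<And>i. emeasure m (A i) ~= \<infinity>" "incseq A"
  using sigma_finite_measure.sigma_finite_incseq[OF sigma_finite_m] by blast
 then have "\<exists>A :: nat => 's set. (\<forall>i. A i \<in> sets borel \<and> emeasure m (A i) < top) \<and> incseq A \<and> (\<Union>i. A i) = UNIV"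
  by (intro exI[of _ A]) (auto simp: less_top)
 from someI_ex[OF this, folded cover_def]
 show "cover i \<in> sets borel" "emeasure m (cover i) < top" "incseq cover" "(\<Union>i. cover i) = UNIV" by auto
qed

abbreviation cut :: "nat => 's option => ennreal" where "cut i \<equiv> ind (Some ` cover i)"

lemma cut_borel [measurable]: "cut i \<in> BM borel_cpt"
 by (intro borel_measurable_indicator sets_borel_cpt_image cover)

lemma cut_mono: "incseq (\<lambda>i. cut i y)"
 using cover(3) by (auto simp: incseq_def indicator_def)

lemma cut_SUP: "(SUP i. cut i y) = alive y"
proof (rule antisym)
 show "(SUP i. cut i y) <= alive y" by (rule SUP_least) (auto simp: indicator_def)
 show "alive y <= (SUP i. cut i y)"
 proof (cases y)
  case (Some z)
  then obtain i where "z \<in> cover i" using cover(4) by blast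
  then have "alive y <= cut i y" using Some by (simp add: indicator_def)
  then show ?thesis by (rule order_trans) (rule SUP_upper, simp)
 qed (simp add: indicator_def)
qed

lemma cut_integral: "(LI x. cut i (Some x) wrt M) < top"
proof -
 have "(LI x. cut i (Some x) wrt M) = (LI x. ind (cover i) x wrt m)"
  unfolding nn_integral_completion by (intro nn_integral_cong) (auto simp: indicator_def)
 then show ?thesis using cover(1,2) by simp
qed

end

context pcaf_setting
begin

text \<open>The life time is positive when the process starts in \<open>S\<close>.\<close>

lemma TT_alive_SUP: "(SUP k. TT (dy k) alive (Some y)) = 1"
proof -
 interpret prob_space "Pu (Some y)" by (rule prob_Pu)
 have [measurable]: "(\<lambda>V. alive (State X s V)) \<in> BM (Pu (Some y))" for s
  by (rule State_fun_Pu[OF alive_borel])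
 have al: "alive (State X s V) = (if s < life_time X V then 1 else 0)" if "V \<in> \<Omega>" for s V
  using State_None_iff[OF that, of s] by (cases "State X s V") (auto simp: indicator_def not_less)
 have "(SUP k. TT (dy k) alive (Some y)) = (LI V. (SUP k. alive (State X (dy k) V)) wrt Pu (Some y))"
  unfolding TT_def
 proof (rule nn_integral_monotone_convergence_SUP_AE[symmetric])
  fix k
  have "dy (Suc k) <= dy k" using dy_props(5) by (simp add: decseq_Suc_iff)
  then show "AE V in Pu (Some y). alive (State X (dy k) V) <= alive (State X (dy (Suc k)) V)"
   by (intro AE_I2) (auto simp: al intro: le_less_trans)
 qed measurable
 also have "... = (LI V. 1 wrt Pu (Some y))"
 proof (rule nn_integral_cong_AE)
  show "AE V in Pu (Some y). (SUP k. alive (State X (dy k) V)) = 1"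
   using AE_Pu_start[of "Some y"] AE_space
  proof eventually_elim
   case (elim V)
   then have o: "V \<in> \<Omega>" by simp
   have "0 < life_time X V" using State_None_iff[OF o, of 0] elim(1) by (simp add: zero_less_iff_neq_zero)
   from order_tendstoD(2)[OF dy_props(6) this] obtain k where "dy k < life_time X V" by (auto simp: eventually_sequentially)
   then have "1 <= (SUP k. alive (State X (dy k) V))" by (intro SUP_upper2[of k]) (simp_all add: al[OF o])
   moreover have "(SUP k. alive (State X (dy k) V)) <= 1" by (rule SUP_least) (simp add: indicator_def)
   ultimately show ?case by (rule antisym[rotated])
  qed
 qed
 finally show ?thesis using emeasure_space_1 by simp
qed

lemma is_test_alive: "is_test alive" by (simp add: is_test_def indicator_def)

lemma is_test_cut: "is_test g ==> is_test (\<lambda>y. cut i y * g y)"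
 using borel_measurable_times_ennreal[OF cut_borel] unfolding is_test_def by (auto simp: indicator_def)

lemma cut_integral': "is_test g ==> (LI x. cut i (Some x) * g (Some x) wrt M) < top"
proof -
 assume "is_test g"
 then have "(LI x. cut i (Some x) * g (Some x) wrt M) <= (LI x. cut i (Some x) wrt M)"
  by (intro nn_integral_mono) (auto simp: is_test_def indicator_def)
 then show ?thesis using cut_integral by (rule le_less_trans)
qed

lemma is_test_UB: "is_test g ==> g \<in> BM UB"
 by (auto simp: is_test_def intro: measurable_UB_borel)

lemma is_test_TT: "is_test g ==> is_test (TT a g)"
 by (auto simp: is_test_def TT_None intro: TT_borel TT_le)

lemma weighted_indicator:
 assumes E: "E \<in> sets borel" "E \<subseteq> nest n"
 shows "weighted_pcaf X m p A (ind (Some ` E)) (of_nat (Suc n))"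
proof unfold_locales
 show "(ind (Some ` E) :: _ => ennreal) \<in> BM borel_cpt"
  by (intro borel_measurable_indicator sets_borel_cpt_image E)
 fix x
 have "NN (\<lambda>(s, y). eexp 1 s * ind (Some ` E) y) x <= NN (\<lambda>(s, y). eexp 1 s * ind (Some ` nest n) y) x"
  using subsetD[OF E(2)] by (intro NN_mono) (auto simp: indicator_def)
 also have "... <= of_nat (Suc n)" by (rule nest_potential)
 finally show "NN (\<lambda>(s, y). eexp 1 s * ind (Some ` E) y) x <= of_nat (Suc n)" .
qed (auto simp: indicator_def of_nat_less_top simp del: of_nat_Suc)

text \<open>\<open>h = 1\<close> is reached as the increasing limit of the indicators of sets of finite measure.\<close>

lemma time_reversal:
 assumes E: "E \<in> sets borel" "E \<subseteq> nest n" and T: "0 < T" and g: "is_test g" and gi: "(LI x. g (Some x) wrt M) < top"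
 shows "(LI z. ind {..<ennreal T} (fst z) * (ind (Some ` E) (snd z) * TT (ennreal T - fst z) alive (snd z)) wrt NG g) =
  (LI z. ind {..<ennreal T} (fst z) * (ind (Some ` E) (snd z) * TT (ennreal T - fst z) g (snd z)) wrt NG alive)"
proof -
 interpret weighted_pcaf X m p A "ind (Some ` E)" "of_nat (Suc n)" by (rule weighted_indicator[OF E])
 have gb[measurable]: "g \<in> BM borel_cpt" using g by (simp add: is_test_def)
 note [measurable] = sets_borel_cpt_image[OF E(1)]
 note [measurable_cong] = NG_props(1)[OF is_test_UB[OF g]]
 have alive: "(\<lambda>y. SUP i. cut i y) = alive" by (rule ext) (rule cut_SUP)
 have cut1: "is_test (cut i)" for i by (simp add: is_test_def indicator_def)
 have inc: "incseq (\<lambda>i. TT s (cut i) y)" for s y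
  using cut_mono by (auto simp: incseq_def intro: TT_mono)
 have "(LI z. ind {..<ennreal T} (fst z) * (ind (Some ` E) (snd z) * TT (ennreal T - fst z) alive (snd z)) wrt NG g) =
   (LI z. (SUP i. ind {..<ennreal T} (fst z) * (ind (Some ` E) (snd z) * TT (ennreal T - fst z) (cut i) (snd z))) wrt NG g)"
  unfolding alive[symmetric] TT_SUP[OF cut_borel cut_mono] by (simp add: SUP_mult_left_ennreal)
 also have "... = (SUP i. LI z. ind {..<ennreal T} (fst z) * (ind (Some ` E) (snd z) * TT (ennreal T - fst z) (cut i) (snd z)) wrt NG g)"
  using inc by (intro nn_integral_monotone_convergence_SUP) (auto simp: incseq_def le_fun_def intro!: mult_left_mono)
 also have "... = (SUP i. LI z. ind {..<ennreal T} (fst z) * (ind (Some ` E) (snd z) * TT (ennreal T - fst z) g (snd z)) wrt NG (cut i))"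
  using time_reversal_integrable[OF T g cut1 gi cut_integral] by (simp add: split_beta')
 also have "... = (LI z. ind {..<ennreal T} (fst z) * (ind (Some ` E) (snd z) * TT (ennreal T - fst z) g (snd z)) wrt NG (\<lambda>y. SUP i. cut i y))"
  by (rule NG_SUP[symmetric]) (measurable, rule cut_mono, measurable)
 finally show ?thesis by (simp add: alive)
qed

lemma NG_nest_finite:
 assumes g: "is_test g" and gi: "(LI x. g (Some x) wrt M) < top" and t: "t < top"
 shows "emeasure (NG g) ({..<t} \<times> Some ` nest n) < top"
proof -
 interpret weighted_pcaf X m p A "ind (Some ` nest n)" "of_nat (Suc n)" by (rule weighted_indicator) auto
 note gU = is_test_UB[OF g]
 note [measurable] = sets_borel_cpt_image[OF nest_sets] UB_Some_measurable[OF gU]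
 have m: "(\<lambda>(s :: ennreal, y). ind {..<t} s * ind (Some ` nest n) y :: ennreal) \<in> BM TB"
  unfolding split_beta' by measurable
 have "emeasure (NG g) ({..<t} \<times> Some ` nest n) = (LI z. ind ({..<t} \<times> Some ` nest n) z wrt NG g)"
  by (subst nn_integral_indicator) (auto simp: NG_props(1)[OF gU])
 also have "... = (LI (s, y). ind {..<t} s * ind (Some ` nest n) y wrt NG g)"
  by (intro nn_integral_cong) (auto simp: indicator_def)
 also have "... = (LI x. g (Some x) * K t (Some x) wrt M)" unfolding nn_integral_NG[OF gU m] K_NN ..
 also have "... <= (LI x. g (Some x) * CT t wrt M)" by (intro nn_integral_mono mult_left_mono K_le t) simp
 also have "... = (LI x. g (Some x) wrt M) * CT t" by (rule nn_integral_multc) measurable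
 also have "... < top" using gi CT_top by (simp add: ennreal_mult_less_top)
 finally show ?thesis .
qed

text \<open>The nest and the bounded time intervals carry finite mass; infinite time and the cemetery are not
 charged.\<close>

lemma sigma_finite_NG:
 assumes g: "is_test g" and gi: "(LI x. g (Some x) wrt M) < top"
 shows "sigma_finite_measure (NG g)"
proof
 note gU = is_test_UB[OF g]
 define C where "C i = {..<of_nat i :: ennreal} \<times> Some ` nest i" for i
 obtain N where N: "{z \<in> space (NG g). \<not> (snd z ~= None \<and> 0 < fst z \<and> fst z < top)} \<subseteq> N" "N \<in> null_sets (NG g)"
  using AE_E[OF NG_None[OF gU]] by (metis (no_types, lifting) null_setsI)
 note [measurable] = sets_borel_cpt_image[OF nest_sets]
 have "C i \<in> sets (NG g)" "emeasure (NG g) (C i) < top" for i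
  unfolding C_def NG_props(1)[OF gU] by (auto intro!: NG_nest_finite g gi simp: of_nat_less_top)
 moreover have "\<Union>(insert N (range C)) = space (NG g)"
 proof
  have sp: "space (NG g) = UNIV" using sets_eq_imp_space_eq[OF NG_props(1)[OF gU]] by (simp add: space_pair_measure)
  show "\<Union>(insert N (range C)) \<subseteq> space (NG g)" by (simp add: sp)
  show "space (NG g) \<subseteq> \<Union>(insert N (range C))"
  proof
   fix z assume z: "z \<in> space (NG g)"
   show "z \<in> \<Union>(insert N (range C))"
   proof (cases "snd z ~= None \<and> 0 < fst z \<and> fst z < top")
    case True
    then obtain y where y: "snd z = Some y" by auto
    obtain i where i: "fst z < of_nat i" using ennreal_Ex_less_of_nat[of "fst z"] True by auto
    obtain j where j: "y \<in> nest j" using nest_UN by blast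
    have "y \<in> nest (max i j)" using j monoD[OF nest_mono, of j "max i j"] by auto
    moreover have "fst z < of_nat (max i j)" using i by (rule less_le_trans) simp
    ultimately have "z \<in> C (max i j)" using y by (cases z) (auto simp: C_def)
    then show ?thesis by blast
   qed (use N z in auto)
  qed
 qed
 ultimately show "\<exists>A. countable A \<and> A \<subseteq> sets (NG g) \<and> \<Union>A = space (NG g) \<and> (\<forall>a\<in>A. emeasure (NG g) a ~= \<infinity>)"
  using N(2) by (intro exI[of _ "insert N (range C)"]) (auto simp: less_top)
qed

lemma NG_Fubini:
 assumes g: "is_test g" and \<phi>[measurable]: "(\<lambda>(a, z). \<phi> a z) \<in> BM (lborel \<Otimes>\<^sub>M TB)"
 shows "(LI a. LI z. \<phi> a z wrt NG g wrt lborel) = (LI z. LI a. \<phi> a z wrt lborel wrt NG g)"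
proof -
 have sec[measurable]: "(\<lambda>z. \<phi> a z) \<in> BM TB" for a
  using measurable_compose[OF _ \<phi>, of "Pair a" TB] by simp
 have int[measurable]: "(\<lambda>z. LI a. \<phi> a z wrt lborel) \<in> BM TB"
 proof (rule lborel.borel_measurable_nn_integral)
  have 1: "(\<lambda>z. (snd z, fst z)) \<in> TB \<Otimes>\<^sub>M lborel \<rightarrow>\<^sub>M lborel \<Otimes>\<^sub>M TB" by measurable
  show "(\<lambda>(z, a). \<phi> a z) \<in> BM (TB \<Otimes>\<^sub>M lborel)"
   using measurable_compose[OF 1 \<phi>] by (simp add: split_beta')
 qed
 have gb[measurable]: "g \<in> BM borel_cpt" using g by (simp add: is_test_def)
 define h where "h i y = cut i y * g y" for i y
 have h: "is_test (h i)" "(LI x. h i (Some x) wrt M) < top" for i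
  unfolding h_def by (rule is_test_cut[OF g], rule cut_integral'[OF g])
 have hb[measurable]: "h i \<in> BM borel_cpt" for i using h(1) by (simp add: is_test_def)
 have inc: "incseq (\<lambda>i. h i y)" for y using cut_mono[of y] by (auto simp: h_def incseq_def intro: mult_right_mono)
 have gh: "(\<lambda>y. SUP i. h i y) = g"
 proof
  fix y
  have "(SUP i. h i y) = alive y * g y" unfolding h_def by (simp add: SUP_mult_right_ennreal[symmetric] cut_SUP)
  also have "... = g y" using g by (cases y) (auto simp: is_test_def)
  finally show "(SUP i. h i y) = g y" .
 qed
 have F: "(LI a. LI z. \<phi> a z wrt NG (h i) wrt lborel) = (LI z. LI a. \<phi> a z wrt lborel wrt NG (h i))"
  and Fm: "(\<lambda>a. LI z. \<phi> a z wrt NG (h i)) \<in> BM lborel" for i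
 proof -
  interpret N: sigma_finite_measure "NG (h i)" by (rule sigma_finite_NG[OF h])
  interpret pair_sigma_finite lborel "NG (h i)" ..
  note [measurable_cong] = NG_props(1)[OF is_test_UB[OF h(1)]]
  show "(LI a. LI z. \<phi> a z wrt NG (h i) wrt lborel) = (LI z. LI a. \<phi> a z wrt lborel wrt NG (h i))"
   by (rule Fubini'[symmetric]) measurable
  show "(\<lambda>a. LI z. \<phi> a z wrt NG (h i)) \<in> BM lborel" by measurable
 qed
 have mono: "(LI z. \<psi> z wrt NG (h i)) <= (LI z. \<psi> z wrt NG (h j))" if "i <= j" "\<psi> \<in> BM TB" for i j \<psi>
  using inc that by (intro NG_mono is_test_UB h) (auto simp: incseq_def)
 have "(LI a. LI z. \<phi> a z wrt NG g wrt lborel) = (LI a. (SUP i. LI z. \<phi> a z wrt NG (h i)) wrt lborel)"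
  unfolding NG_SUP[OF hb inc sec, symmetric] gh ..
 also have "... = (SUP i. LI a. LI z. \<phi> a z wrt NG (h i) wrt lborel)"
  by (rule nn_integral_monotone_convergence_SUP[OF _ Fm]) (auto simp: incseq_def le_fun_def intro!: mono)
 also have "... = (LI z. LI a. \<phi> a z wrt lborel wrt NG g)"
  unfolding F NG_SUP[OF hb inc int, symmetric] gh ..
 finally show ?thesis .
qed

end

lemma nn_integral_lborel_translate:
 fixes f :: "real => ennreal"
 assumes "f \<in> BM borel"
 shows "(LI a. f (c + a) wrt lborel) = (LI a. f a wrt lborel)"
 using nn_integral_real_affine[OF assms, of 1 c] by simp

context pcaf_revuz
begin

definition GI :: "('s option => ennreal) => real => real => 's option => ennreal"
 where "GI g u v y = (LI a. ind {u..v} a * TT (ennreal a) g y wrt lborel)"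

lemma GI_borel:
 assumes [measurable]: "g \<in> BM borel_cpt"
 shows "GI g u v \<in> BM borel_cpt"
proof -
 have "(\<lambda>(y, a). ind {u..v} a * TT (ennreal a) g y) \<in> BM (borel_cpt \<Otimes>\<^sub>M lborel)"
  unfolding split_beta' by measurable
 from lborel.borel_measurable_nn_integral[OF this] show ?thesis by (simp add: GI_def[abs_def])
qed

context
 fixes g E n
 assumes g: "is_test g" and gi: "(LI x. g (Some x) wrt M) < top" and E: "E \<in> sets borel" "E \<subseteq> nest n"
begin

private lemma gb [measurable]: "g \<in> BM borel_cpt" using g by (simp add: is_test_def)

private lemma Em [measurable]: "Some ` E \<in> sets borel_cpt" by (rule sets_borel_cpt_image[OF E(1)])

abbreviation ind_E :: "'s option => ennreal" where "ind_E \<equiv> ind (Some ` E)"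

private lemma GIm [measurable]: "GI g u v \<in> BM borel_cpt" by (rule GI_borel) measurable

abbreviation late :: "ennreal => real => ennreal \<times> 's option => ennreal"
 where "late \<delta> a z \<equiv> ind {ennreal a..} (fst z) * (ind {..<\<delta>} (fst z - ennreal a) *
  (ind_E (snd z) * TT (\<delta> - (fst z - ennreal a)) alive (snd z)))"

abbreviation early :: "ennreal => real => ennreal \<times> 's option => ennreal"
 where "early \<delta> a z \<equiv> ind {..<\<delta>} (fst z) * (ind_E (snd z) * TT (\<delta> - fst z + ennreal a) g (snd z))"

text \<open>The two sides of the duality for the set $[0,t) \times E$ are \<open>FF t\<close> and \<open>JJ 0 t\<close>. They are compared by
 inequalities with a small shift of \<open>t\<close>, which suffices because both are left-continuous in \<open>t\<close>.\<close>

definition JJ :: "real => real => ennreal"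
 where "JJ u v = (LI y. ind_E (Some y) * GI g u v (Some y) wrt \<mu>)"

definition FF :: "real => ennreal"
 where "FF t = (LI z. ind {..<ennreal t} (fst z) * ind_E (snd z) wrt NG g)"

text \<open>Shift the time-reversal identity over a short interval by \<open>a\<close> and integrate over \<open>a\<close>: on the
 left the time of increase of the functional is picked out, on the right the mean over the short
 interval started from \<open>m\<close> appears, which tends to the Revuz measure.\<close>

lemma smeared_reversal:
 assumes d: "0 < d"
 defines "\<delta> \<equiv> ennreal d"
 shows "(LI z. (LI a. ind {0..t} a * late \<delta> a z wrt lborel) wrt NG g) =
  (LI z. (LI a. ind {0..t} a * early \<delta> a z wrt lborel) wrt NG alive)"
proof -
 have inner: "(LI z. late \<delta> a z wrt NG g) =
   (LI z. early \<delta> a z wrt NG alive)" for a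
 proof -
  have "(\<lambda>z. ind {..<\<delta>} (fst z) * (ind_E (snd z) * TT (\<delta> - fst z) alive (snd z))) \<in> BM TB"
   by measurable
  from NG_shift[OF _ this is_test_UB[OF g], of "ennreal a"] g
  have "(LI z. late \<delta> a z wrt NG g) =
    (LI z. ind {..<\<delta>} (fst z) * (ind_E (snd z) * TT (\<delta> - fst z) alive (snd z)) wrt NG (TT (ennreal a) g))"
   by (simp add: split_beta' is_test_def)
  also have "... = (LI z. ind {..<\<delta>} (fst z) * (ind_E (snd z) * TT (\<delta> - fst z) (TT (ennreal a) g) (snd z)) wrt NG alive)"
   unfolding \<delta>_def
  proof (rule time_reversal[OF E d is_test_TT[OF g]])
   have "(LI x. TT (ennreal a) g (Some x) wrt M) <= (LI x. g (Some x) wrt M)"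
    using g by (intro TT_integral_le is_test_UB) (auto simp: is_test_def)
   then show "(LI x. TT (ennreal a) g (Some x) wrt M) < top" using gi by (rule le_less_trans)
  qed
  finally show ?thesis by (simp add: TT_add[OF is_test_UB[OF g]])
 qed
 have ind: "(\<lambda>v. ind {ennreal (fst v)..} (fst (snd v)) :: ennreal) \<in> BM (lborel \<Otimes>\<^sub>M TB)"
 proof -
  have "(\<lambda>v. if ennreal (fst v) <= fst (snd v) then 1 else 0 :: ennreal) \<in> BM (lborel \<Otimes>\<^sub>M TB)" by measurable
  then show ?thesis by (simp add: indicator_def of_bool_def)
 qed
 note [measurable] = ind
 have [measurable]: "(\<lambda>v. ind {..<\<delta>} (fst (snd v) - ennreal (fst v)) :: ennreal) \<in> BM (lborel \<Otimes>\<^sub>M TB)"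
  by measurable
 have nm1: "(\<lambda>z. late \<delta> a z) \<in> BM TB" for a
  by measurable
 have nm2: "(\<lambda>z. early \<delta> a z) \<in> BM TB" for a
  by measurable
 have "(LI z. (LI a. ind {0..t} a * late \<delta> a z wrt lborel) wrt NG g) =
   (LI a. (LI z. ind {0..t} a * late \<delta> a z wrt NG g) wrt lborel)"
  by (rule NG_Fubini[symmetric, OF g]) (unfold split_beta', measurable)
 also have "... = (LI a. (LI z. ind {0..t} a * early \<delta> a z wrt NG alive) wrt lborel)"
  using nm1 nm2 NG_props(1)[OF is_test_UB[OF g]] NG_props(1)[OF alive_UB]
  by (intro nn_integral_cong) (simp add: nn_integral_cmult inner cong: measurable_cong_sets)
 also have "... = (LI z. (LI a. ind {0..t} a * early \<delta> a z wrt lborel) wrt NG alive)"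
  by (rule NG_Fubini[OF is_test_alive]) (unfold split_beta', measurable)
 finally show ?thesis .
qed

definition dr :: "nat => real" where "dr k = 1 / 2 ^ k"

lemma dr: "0 < dr k" "ennreal (dr k) = dy k" "2 ^ k * ennreal (dr k) = 1" "decseq dr" "dr \<longlonglongrightarrow> 0"
proof -
 show "0 < dr k" "ennreal (dr k) = dy k" by (simp_all add: dr_def dy_def)
 then show "2 ^ k * ennreal (dr k) = 1" using dy_props(4)[of k] by simp
 show "decseq dr" unfolding dr_def decseq_def by (auto intro!: divide_left_mono power_increasing)
 have "(\<lambda>k. (1 / 2 :: real) ^ k) \<longlonglongrightarrow> 0" by (rule LIMSEQ_realpow_zero) auto
 then show "dr \<longlonglongrightarrow> 0" by (simp add: dr_def[abs_def] power_one_over)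
qed

lemma window:
 fixes d s :: real
 assumes "0 < d"
 shows "(LI a. ind {s - d<..s} a * c wrt lborel) = ennreal d * c"
 using assms by (simp add: nn_integral_multc)

text \<open>A time of increase \<open>s\<close> between \<open>\<delta>\<close> and \<open>t\<close> lies in the interval from \<open>a\<close> to \<open>a + \<delta>\<close> for a set of shifts \<open>a\<close> of measure
 exactly \<open>\<delta>\<close>.\<close>

lemma reversal_bound_upper:
 "(LI z. ind {dy k..ennreal t} (fst z) * (ind_E (snd z) * TT (dy k) alive (snd z)) wrt NG g) <= JJ 0 (t + dr k)"
proof -
 let ?d = "dr k" let ?\<delta> = "ennreal (dr k)"
 note [measurable_cong] = NG_props(1)[OF is_test_UB[OF g]] NG_props(1)[OF alive_UB]
 have "ennreal ?d * (ind {dy k..ennreal t} (fst z) * (ind_E (snd z) * TT (dy k) alive (snd z))) <=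
   (LI a. ind {0..t} a * late ?\<delta> a z wrt lborel)" for z :: "ennreal \<times> 's option"
 proof (cases "dy k <= fst z \<and> fst z <= ennreal t")
  case True
  then have "fst z < top" by (auto intro: le_less_trans)
  then obtain s where s: "fst z = ennreal s" "0 <= s" by (cases "fst z") auto
  have sd: "?d <= s" "s <= t"
   using True s dr(1)[of k] by (auto simp: dr(2)[symmetric] ennreal_le_iff2 dest: order_trans)
  have "ennreal ?d * (ind {dy k..ennreal t} (fst z) * (ind_E (snd z) * TT (dy k) alive (snd z))) =
    (LI a. ind {s - ?d<..s} a * (ind_E (snd z) * TT (dy k) alive (snd z)) wrt lborel)"
   using True by (simp add: window[OF dr(1)])
  also have "... <= (LI a. ind {0..t} a * late ?\<delta> a z wrt lborel)"
  proof (rule nn_integral_mono)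
   fix a :: real
   show "ind {s - ?d<..s} a * (ind_E (snd z) * TT (dy k) alive (snd z)) <= ind {0..t} a * late ?\<delta> a z"
   proof (cases "s - ?d < a \<and> a <= s")
    case True
    then have a: "0 <= a" "a <= t" using sd by auto
    have "ennreal s - ennreal a < ?\<delta>" using True a by (simp add: ennreal_minus ennreal_less_iff)
    moreover have "ennreal a <= ennreal s" using True by (simp add: ennreal_leI)
    moreover have "TT (dy k) alive (snd z) <= TT (?\<delta> - (ennreal s - ennreal a)) alive (snd z)"
     unfolding dr(2) by (rule TT_alive_antimono) (rule diff_le_self_ennreal)
    ultimately show ?thesis using True a s by (auto intro: mult_left_mono)
   qed simp
  qed
  finally show ?thesis .
 qed auto
 then have "ennreal ?d * (LI z. ind {dy k..ennreal t} (fst z) * (ind_E (snd z) * TT (dy k) alive (snd z)) wrt NG g) <=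
   (LI z. (LI a. ind {0..t} a * late ?\<delta> a z wrt lborel) wrt NG g)"
  by (subst nn_integral_cmult[symmetric]) (measurable, rule nn_integral_mono)
 also note smeared_reversal[OF dr(1)]
 also have "(LI z. (LI a. ind {0..t} a * early ?\<delta> a z wrt lborel) wrt NG alive)
   <= (LI z. ind {..<?\<delta>} (fst z) * (ind_E (snd z) * GI g 0 (t + ?d) (snd z)) wrt NG alive)"
 proof (rule nn_integral_mono)
  fix z :: "ennreal \<times> 's option"
  show "(LI a. ind {0..t} a * early ?\<delta> a z wrt lborel)
   <= ind {..<?\<delta>} (fst z) * (ind_E (snd z) * GI g 0 (t + ?d) (snd z))"
  proof (cases "fst z < ?\<delta> \<and> snd z \<in> Some ` E")
   case True
   then have "fst z < top" by (auto intro: less_trans)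
   then obtain s where s: "fst z = ennreal s" "0 <= s" by (cases "fst z") auto
   have sd: "s < ?d" using True s by (simp add: ennreal_less_iff)
   have "(LI a. ind {0..t} a * TT (?\<delta> - fst z + ennreal a) g (snd z) wrt lborel) <=
     (LI a. ind {0..t + ?d} ((?d - s) + a) * TT (ennreal ((?d - s) + a)) g (snd z) wrt lborel)"
    using s sd by (intro nn_integral_mono) (auto simp: indicator_def ennreal_minus ennreal_plus[symmetric] simp del: ennreal_plus)
   also have "... = GI g 0 (t + ?d) (snd z)"
    unfolding GI_def by (rule nn_integral_lborel_translate) measurable
   finally show ?thesis using True by simp
  qed (auto simp: indicator_def)
 qed
 also have "... = OI (\<lambda>y. ind_E y * GI g 0 (t + ?d) y) (dy k)" unfolding OI_def dr(2) by (simp add: split_beta')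
 finally have "2 ^ k * (ennreal ?d * (LI z. ind {dy k..ennreal t} (fst z) * (ind_E (snd z) * TT (dy k) alive (snd z)) wrt NG g)) <=
   2 ^ k * OI (\<lambda>y. ind_E y * GI g 0 (t + ?d) y) (dy k)" by (rule mult_left_mono) simp
 also have "... <= (SUP k'. DK (\<lambda>y. ind_E y * GI g 0 (t + ?d) y) k')"
  unfolding DK_def[symmetric] by (rule SUP_upper) simp
 also have "... = JJ 0 (t + ?d)" unfolding JJ_def by (rule nn_integral_\<mu>[symmetric]) measurable
 finally show ?thesis by (simp add: mult.assoc[symmetric] dr(3))
qed

lemma reversal_bound_lower: "DK (\<lambda>y. ind_E y * GI g (dr k) t y) k <= FF (t + dr k)"
proof -
 let ?d = "dr k" let ?\<delta> = "ennreal (dr k)"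
 note [measurable_cong] = NG_props(1)[OF is_test_UB[OF g]] NG_props(1)[OF alive_UB]
 have "OI (\<lambda>y. ind_E y * GI g ?d t y) (dy k) = (LI z. ind {..<?\<delta>} (fst z) * (ind_E (snd z) * GI g ?d t (snd z)) wrt NG alive)"
  unfolding OI_def dr(2) by (simp add: split_beta')
 also have "... <= (LI z. (LI a. ind {0..t} a * early ?\<delta> a z wrt lborel) wrt NG alive)"
 proof (rule nn_integral_mono)
  fix z :: "ennreal \<times> 's option"
  show "ind {..<?\<delta>} (fst z) * (ind_E (snd z) * GI g ?d t (snd z)) <=
   (LI a. ind {0..t} a * early ?\<delta> a z wrt lborel)"
  proof (cases "fst z < ?\<delta> \<and> snd z \<in> Some ` E")
   case True
   then have "fst z < top" by (auto intro: less_trans)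
   then obtain s where s: "fst z = ennreal s" "0 <= s" by (cases "fst z") auto
   have sd: "s < ?d" using True s by (simp add: ennreal_less_iff)
   have "GI g ?d t (snd z) = (LI a. ind {?d..t} ((?d - s) + a) * TT (ennreal ((?d - s) + a)) g (snd z) wrt lborel)"
    unfolding GI_def by (rule nn_integral_lborel_translate[symmetric]) measurable
   also have "... <= (LI a. ind {0..t} a * TT (?\<delta> - fst z + ennreal a) g (snd z) wrt lborel)"
    using s sd by (intro nn_integral_mono) (auto simp: indicator_def ennreal_minus ennreal_plus[symmetric] simp del: ennreal_plus)
   finally show ?thesis using True by simp
  qed (auto simp: indicator_def)
 qed
 also note smeared_reversal[OF dr(1), symmetric]
 also have "(LI z. (LI a. ind {0..t} a * late ?\<delta> a z wrt lborel) wrt NG g)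
   <= (LI z. ennreal ?d * (ind {..<ennreal (t + ?d)} (fst z) * ind_E (snd z)) wrt NG g)"
 proof (rule nn_integral_mono)
  fix z :: "ennreal \<times> 's option"
  show "(LI a. ind {0..t} a * late ?\<delta> a z wrt lborel)
   <= ennreal ?d * (ind {..<ennreal (t + ?d)} (fst z) * ind_E (snd z))"
  proof (cases "fst z < top")
   case True
   then obtain s where s: "fst z = ennreal s" "0 <= s" by (cases "fst z") auto
   have "(LI a. ind {0..t} a * late ?\<delta> a z wrt lborel)
    <= (LI a. ind {s - ?d<..s} a * (ind {..<ennreal (t + ?d)} (fst z) * ind_E (snd z)) wrt lborel)"
   proof (rule nn_integral_mono)
    fix a :: real
    show "ind {0..t} a * late ?\<delta> a z
     <= ind {s - ?d<..s} a * (ind {..<ennreal (t + ?d)} (fst z) * ind_E (snd z))"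
    proof (cases "0 <= a \<and> a <= t \<and> ennreal a <= fst z \<and> fst z - ennreal a < ?\<delta>")
     case True
     then have *: "a <= s" "s - a < ?d" using s dr(1)[of k] by (auto simp: ennreal_le_iff ennreal_minus ennreal_less_iff)
     then have "s < t + ?d" using True by linarith
     then have "fst z < ennreal (t + ?d)" unfolding s(1) using s(2) by (intro ennreal_lessI) linarith+
     moreover have "TT (?\<delta> - (fst z - ennreal a)) alive (snd z) <= 1" by (rule TT_le) (simp add: indicator_def)
     ultimately show ?thesis using * by (auto simp: indicator_def)
    qed (auto simp: indicator_def)
   qed
   then show ?thesis by (simp add: window[OF dr(1)])
  next
   case False
   then have "fst z - ennreal a = top" for a by (simp add: top_unique not_less ennreal_top_minus)
   then show ?thesis by simp
  qed
 qed
 also have "... = ennreal ?d * FF (t + ?d)" unfolding FF_def by (rule nn_integral_cmult) measurable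
 finally have "2 ^ k * OI (\<lambda>y. ind_E y * GI g ?d t y) (dy k) <= 2 ^ k * (ennreal ?d * FF (t + ?d))"
  by (rule mult_left_mono) simp
 then show ?thesis unfolding DK_def by (simp add: mult.assoc[symmetric] dr(3))
qed

lemma FF_le: "FF t <= JJ 0 (t + dr i)"
proof -
 define F where "F k z = ind {dy k..ennreal t} (fst z) * (ind_E (snd z) * TT (dy k) alive (snd z))" for k and z :: "ennreal \<times> 's option"
 have Fm[measurable]: "F k \<in> BM TB" for k unfolding F_def[abs_def] by measurable
 note [measurable_cong] = NG_props(1)[OF is_test_UB[OF g]]
 have dyk: "dy k' <= dy k" if "k <= k'" for k k' using dy_props(5) that by (simp add: decseq_def)
 have inc: "incseq F"
  unfolding incseq_def le_fun_def F_def
 proof (intro allI impI)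
  fix k k' :: nat and z :: "ennreal \<times> 's option" assume k: "k <= k'"
  show "ind {dy k..ennreal t} (fst z) * (ind_E (snd z) * TT (dy k) alive (snd z)) <=
    ind {dy k'..ennreal t} (fst z) * (ind_E (snd z) * TT (dy k') alive (snd z))"
   using dyk[OF k] TT_alive_antimono[OF dyk[OF k]] by (auto simp: indicator_def dest: order_trans)
 qed
 have "FF t <= (LI z. (SUP k. F k z) wrt NG g)"
  unfolding FF_def
 proof (rule nn_integral_mono_AE)
  show "AE z in NG g. ind {..<ennreal t} (fst z) * ind_E (snd z) <= (SUP k. F k z)"
   using NG_None[OF is_test_UB[OF g]]
  proof eventually_elim
   case (elim z)
   show ?case
   proof (cases "fst z < ennreal t \<and> snd z \<in> Some ` E")
    case True
    then obtain y where y: "snd z = Some y" "y \<in> E" by blast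
    from order_tendstoD(2)[OF dy_props(6)] elim obtain k0 where k0: "dy k0 < fst z"
     by (auto simp: eventually_sequentially)
    have "(SUP k. TT (dy k) alive (snd z)) <= (SUP k. F k z)"
    proof (rule SUP_least)
     fix k
     have "TT (dy k) alive (snd z) <= TT (dy (max k k0)) alive (snd z)"
      by (rule TT_alive_antimono[OF dyk]) simp
     also have "... <= F (max k k0) z"
      using True k0 dyk[of k0 "max k k0"] by (auto simp: F_def indicator_def dest: order_trans)
     also have "... <= (SUP k. F k z)" by (rule SUP_upper) simp
     finally show "TT (dy k) alive (snd z) <= (SUP k. F k z)" .
    qed
    then show ?thesis using True by (simp add: y TT_alive_SUP)
   qed (auto simp: indicator_def)
  qed
 qed
 also have "... = (SUP k. LI z. F k z wrt NG g)"
  by (intro nn_integral_monotone_convergence_SUP inc) measurable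
 also have "... <= JJ 0 (t + dr i)"
 proof (rule SUP_least)
  fix k
  have "(LI z. F k z wrt NG g) <= (LI z. F (max k i) z wrt NG g)"
   by (intro nn_integral_mono le_funD[OF incseqD[OF inc]]) simp
  also have "... <= JJ 0 (t + dr (max k i))" unfolding F_def by (rule reversal_bound_upper)
  also have "... <= JJ 0 (t + dr i)"
  proof -
   have "dr (max k i) <= dr i" using dr(4) by (simp add: decseq_def)
   then show ?thesis unfolding JJ_def GI_def by (intro nn_integral_mono mult_left_mono mult_right_mono) (auto simp: indicator_def)
  qed
  finally show "(LI z. F k z wrt NG g) <= JJ 0 (t + dr i)" .
 qed
 finally show ?thesis .
qed

lemma JJ_SUP:
 assumes m: "\<And>u u' a. u <= (u' :: nat) ==> l u' <= (l u :: real) \<and> r u <= (r u' :: real)"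
  and lim: "\<And>a. 0 < a ==> a < t ==> \<exists>u. l u <= a \<and> a <= r u"
 shows "JJ 0 t <= (SUP u. JJ (l u) (r u))"
proof -
 have "GI g 0 t y <= (SUP u. GI g (l u) (r u) y)" for y
 proof -
  have "GI g 0 t y <= (LI a. (SUP u. ind {l u..r u} a * TT (ennreal a) g y) wrt lborel)"
   unfolding GI_def
  proof (rule nn_integral_mono_AE)
   show "AE a in lborel. ind {0..t} a * TT (ennreal a) g y <= (SUP u. ind {l u..r u} a * TT (ennreal a) g y)"
    using AE_lborel_singleton[of 0] AE_lborel_singleton[of t]
   proof eventually_elim
    case (elim a)
    show ?case
    proof (cases "0 <= a \<and> a <= t")
     case True
     then obtain u where "l u <= a" "a <= r u" using elim lim[of a] by force
     then have "ind {0..t} a * TT (ennreal a) g y <= ind {l u..r u} a * TT (ennreal a) g y"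
      by (auto simp: indicator_def)
     then show ?thesis by (rule order_trans) (rule SUP_upper, simp)
    qed auto
   qed
  qed
  also have "... = (SUP u. GI g (l u) (r u) y)"
   unfolding GI_def
  proof (rule nn_integral_monotone_convergence_SUP)
   show "incseq (\<lambda>u a. ind {l u..r u} a * TT (ennreal a) g y)"
    unfolding incseq_def le_fun_def
   proof (intro allI impI mult_right_mono)
    fix u u' :: nat and a assume "u <= u'"
    from m[OF this] show "ind {l u..r u} a <= (ind {l u'..r u'} a :: ennreal)"
     by (auto simp: indicator_def)
   qed simp
  qed measurable
  finally show ?thesis .
 qed
 then have "JJ 0 t <= (LI y. (SUP u. ind_E (Some y) * GI g (l u) (r u) (Some y)) wrt \<mu>)"
  unfolding JJ_def by (intro nn_integral_mono) (auto simp: SUP_mult_left_ennreal[symmetric] intro: mult_left_mono)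
 also have "... = (SUP u. JJ (l u) (r u))"
  unfolding JJ_def
 proof (rule nn_integral_monotone_convergence_SUP)
  show "incseq (\<lambda>u y. ind_E (Some y) * GI g (l u) (r u) (Some y))"
   unfolding incseq_def le_fun_def GI_def
  proof (intro allI impI mult_left_mono nn_integral_mono mult_right_mono)
   fix u u' :: nat and a assume "u <= u'"
   from m[OF this] show "ind {l u..r u} a <= (ind {l u'..r u'} a :: ennreal)"
    by (auto simp: indicator_def)
  qed simp_all
  have "(\<lambda>y. ind_E y * GI g (l u) (r u) y) \<in> BM borel_cpt" for u by measurable
  from measurable_compose[OF measurable_Some this]
  show "(\<lambda>y. ind_E (Some y) * GI g (l u) (r u) (Some y)) \<in> BM \<mu>" for u by simp
 qed
 finally show ?thesis .
qed

lemma JJ_le: "JJ 0 t <= FF (t + dr i)"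
proof -
 have drm: "dr k' <= dr k" if "k <= k'" for k k' using dr(4) that by (simp add: decseq_def)
 have "JJ 0 t <= (SUP j. JJ (dr j) t)"
 proof (rule JJ_SUP)
  fix a :: real assume "0 < a" "a < t"
  from order_tendstoD(2)[OF dr(5) this(1)] obtain u where "dr u < a" by (auto simp: eventually_sequentially)
  then show "\<exists>u. dr u <= a \<and> a <= t" using \<open>a < t\<close> by (intro exI[of _ u]) simp
 qed (use drm in simp)
 also have "... <= FF (t + dr i)"
 proof (rule SUP_least)
  fix j
  have "JJ (dr j) t = (SUP k. DK (\<lambda>y. ind_E y * GI g (dr j) t y) k)"
   unfolding JJ_def by (rule nn_integral_\<mu>) measurable
  also have "... <= FF (t + dr i)"
  proof (rule SUP_least)
   fix k
   let ?k = "max k (max j i)"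
   have "DK (\<lambda>y. ind_E y * GI g (dr j) t y) k <= DK (\<lambda>y. ind_E y * GI g (dr j) t y) ?k"
    by (rule incseqD[OF DK_mono]) simp_all
   also have "... <= DK (\<lambda>y. ind_E y * GI g (dr ?k) t y) ?k"
   proof -
    have "dr ?k <= dr j" by (rule drm) simp
    then show ?thesis unfolding DK_def OI_def GI_def
    by (intro mult_left_mono nn_integral_mono) (auto simp: split_beta' indicator_def intro!: nn_integral_mono)
   qed
   also have "... <= FF (t + dr ?k)" by (rule reversal_bound_lower)
   also have "... <= FF (t + dr i)"
   proof -
    have "ennreal (t + dr ?k) <= ennreal (t + dr i)" using drm[of i ?k] by (intro ennreal_leI) simp
    then show ?thesis unfolding FF_def by (intro nn_integral_mono mult_right_mono) (auto simp: indicator_def)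
   qed
   finally show "DK (\<lambda>y. ind_E y * GI g (dr j) t y) k <= FF (t + dr i)" .
  qed
  finally show "JJ (dr j) t <= FF (t + dr i)" .
 qed
 finally show ?thesis .
qed

lemma FF_eq_JJ: "FF t = JJ 0 t"
proof (rule antisym)
 have drm: "dr k' <= dr k" if "k <= k'" for k k' using dr(4) that by (simp add: decseq_def)
 note [measurable_cong] = NG_props(1)[OF is_test_UB[OF g]]
 have le: "ennreal (t - dr i) <= ennreal (t - dr j)" if "i <= j" for i j
  using drm[OF that] by (intro ennreal_leI) simp
 have "FF t = (LI z. (SUP i. ind {..<ennreal (t - dr i)} (fst z) * ind_E (snd z)) wrt NG g)"
  unfolding FF_def
 proof (rule nn_integral_cong)
  fix z :: "ennreal \<times> 's option"
  show "ind {..<ennreal t} (fst z) * ind_E (snd z) = (SUP i. ind {..<ennreal (t - dr i)} (fst z) * ind_E (snd z))"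
  proof (rule antisym)
   show "(SUP i. ind {..<ennreal (t - dr i)} (fst z) * ind_E (snd z)) <= ind {..<ennreal t} (fst z) * ind_E (snd z)"
   proof (rule SUP_least, rule mult_right_mono)
    fix i
    have "ennreal (t - dr i) <= ennreal t" using dr(1)[of i] by (intro ennreal_leI) simp
    then show "ind {..<ennreal (t - dr i)} (fst z) <= (ind {..<ennreal t} (fst z) :: ennreal)"
     by (auto simp: indicator_def)
   qed simp
   show "ind {..<ennreal t} (fst z) * ind_E (snd z) <= (SUP i. ind {..<ennreal (t - dr i)} (fst z) * ind_E (snd z))"
   proof (cases "fst z < ennreal t")
    case True
    then have "fst z < top" by (auto intro: less_trans)
    then obtain s where s: "fst z = ennreal s" "0 <= s" by (cases "fst z") auto
    then have "0 < t - s" using True by (simp add: ennreal_less_iff)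
    from order_tendstoD(2)[OF dr(5) this] obtain i where "dr i < t - s" by (auto simp: eventually_sequentially)
    then have "fst z < ennreal (t - dr i)" unfolding s(1) using s(2) by (intro ennreal_lessI) linarith+
    then have "ind {..<ennreal t} (fst z) * ind_E (snd z) <= ind {..<ennreal (t - dr i)} (fst z) * ind_E (snd z)"
     by (simp add: indicator_def)
    then show ?thesis by (rule order_trans) (rule SUP_upper, simp)
   qed (simp add: indicator_def)
  qed
 qed
 also have "... = (SUP i. FF (t - dr i))"
  unfolding FF_def
 proof (rule nn_integral_monotone_convergence_SUP)
  show "incseq (\<lambda>i z. ind {..<ennreal (t - dr i)} (fst z) * ind_E (snd z))"
   unfolding incseq_def le_fun_def
  proof (intro allI impI mult_right_mono)
   fix i j :: nat and z :: "ennreal \<times> 's option" assume "i <= j"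
   from le[OF this] show "ind {..<ennreal (t - dr i)} (fst z) <= (ind {..<ennreal (t - dr j)} (fst z) :: ennreal)"
    by (auto simp: indicator_def)
  qed simp
 qed measurable
 also have "... <= JJ 0 t"
 proof (rule SUP_least)
  fix i show "FF (t - dr i) <= JJ 0 t" using FF_le[of "t - dr i" i] by simp
 qed
 finally show "FF t <= JJ 0 t" .
 have "JJ 0 t <= (SUP i. JJ 0 (t - dr i))"
 proof (rule JJ_SUP)
  fix a :: real assume "0 < a" "a < t"
  then have "0 < t - a" by simp
  from order_tendstoD(2)[OF dr(5) this] obtain i where "dr i < t - a" by (auto simp: eventually_sequentially)
  then show "\<exists>i. 0 <= a \<and> a <= t - dr i" using \<open>0 < a\<close> by (intro exI[of _ i]) simp
 qed (use drm in simp)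
 also have "... <= FF t"
 proof (rule SUP_least)
  fix i show "JJ 0 (t - dr i) <= FF t" using JJ_le[of "t - dr i" i] by simp
 qed
 finally show "JJ 0 t <= FF t" .
qed

lemma duality_rectangle:
 "(LI z. ind {..<ennreal t} (fst z) * ind_E (snd z) wrt NG g) = (LI y. ind_E (Some y) * GI g 0 t (Some y) wrt \<mu>)"
 using FF_eq_JJ unfolding FF_def JJ_def .

end

end

lemma SUP_min_of_nat: "(SUP i. min a (of_nat (Suc i))) = (a :: ennreal)"
proof (rule antisym)
 show "(SUP i. min a (of_nat (Suc i))) <= a" by (rule SUP_least) simp
 show "a <= (SUP i. min a (of_nat (Suc i)))"
 proof (cases "a < top")
  case True
  then obtain n where "a < of_nat n" using ennreal_Ex_less_of_nat by blast
  also have "of_nat n <= (of_nat (Suc n) :: ennreal)" by (rule of_nat_mono) simp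
  finally have "a = min a (of_nat (Suc n))" by (simp only: min_absorb1 less_imp_le)
  also have "... <= (SUP i. min a (of_nat (Suc i)))" by (rule SUP_upper) simp
  finally show ?thesis .
 next
  case False
  then have "a = top" using top.not_eq_extremum by blast
  have "(SUP i. of_nat i :: ennreal) <= (SUP i. min a (of_nat (Suc i)))"
  proof (rule SUP_mono)
   fix n :: nat
   have "(of_nat n :: ennreal) <= min a (of_nat (Suc n))" using \<open>a = top\<close> by (simp only: min_top of_nat_mono le_SucI order_refl)
   then show "\<exists>k\<in>UNIV. (of_nat n :: ennreal) <= min a (of_nat (Suc k))" by blast
  qed
  then show ?thesis by (simp add: ennreal_SUP_of_nat_eq_top top_unique \<open>a = top\<close>)
 qed
qed

lemma SUP_indicator_mult:
 assumes "z \<in> S i"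
 shows "(SUP i. ind (S i) z * c) = (c :: ennreal)"
proof (rule antisym)
 show "(SUP i. ind (S i) z * c) <= c" by (rule SUP_least) (simp add: indicator_def)
 have "c <= ind (S i) z * c" using assms by simp
 also have "... <= (SUP i. ind (S i) z * c)" by (rule SUP_upper) simp
 finally show "c <= (SUP i. ind (S i) z * c)" .
qed

lemma ennreal_inverse_of_nat_less:
 assumes "0 < (c :: ennreal)"
 shows "\<exists>j. 1 / of_nat (Suc j) < c"
proof (cases "c = top")
 case True
 then show ?thesis by (auto intro!: exI[of _ 0])
next
 case False
 then obtain r where r: "c = ennreal r" "0 < r" using assms by (cases c) auto
 obtain j where j: "1 / real (Suc j) < r" using nat_approx_posE[OF r(2)] by blast
 have "1 / of_nat (Suc j) = ennreal (1 / real (Suc j))"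
  by (simp add: ennreal_of_nat_eq_real_of_nat divide_ennreal[symmetric] del: of_nat_Suc)
 then show ?thesis using j r by (intro exI[of _ j]) (simp add: ennreal_lessI)
qed

context pcaf_revuz
begin

lemma is_test_borel: "is_test g ==> g \<in> BM borel_cpt"
 unfolding is_test_def by blast

text \<open>The process stays alive for a short time with positive probability, and \<open>g\<close> is positive there.\<close>

lemma GI_pos:
 assumes g: "is_test g" and pos: "\<And>z. 0 < g (Some z)"
 shows "0 < GI g 0 1 (Some y)"
proof (rule ccontr)
 have [measurable]: "g \<in> BM borel_cpt" by (rule is_test_borel[OF g])
 have Tpos: "TT s g (Some y) ~= 0" if "TT s alive (Some y) ~= 0" for s
 proof
  note [measurable] = State_fun_Pu[OF \<open>g \<in> BM borel_cpt\<close>] State_fun_Pu[OF alive_borel]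
  assume "TT s g (Some y) = 0"
  then have "AE V in Pu (Some y). g (State X s V) = 0" unfolding TT_def by (subst (asm) nn_integral_0_iff_AE) auto
  then have "AE V in Pu (Some y). alive (State X s V) = 0"
  proof eventually_elim
   case (elim V)
   then show ?case using pos by (cases "State X s V") (auto simp: less_le)
  qed
  then have "TT s alive (Some y) = 0" unfolding TT_def by (subst nn_integral_0_iff_AE) auto
  then show False using that by simp
 qed
 obtain k where k: "TT (dy k) alive (Some y) ~= 0"
 proof -
  have "\<exists>k. TT (dy k) alive (Some y) ~= 0"
  proof (rule ccontr)
   assume "\<nexists>k. TT (dy k) alive (Some y) ~= 0"
   then have "(SUP k. TT (dy k) alive (Some y)) = 0" by simp
   then show False using TT_alive_SUP[of y] by simp
  qed
  then show ?thesis using that by blast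
 qed
 assume "\<not> 0 < GI g 0 1 (Some y)"
 then have "(LI a. ind {0..1} a * TT (ennreal a) g (Some y) wrt lborel) = 0" by (simp add: GI_def not_less)
 then have "AE a in lborel. ind {0..1} a * TT (ennreal a) g (Some y) = 0"
  by (subst (asm) nn_integral_0_iff_AE) auto
 then have "AE a in lborel. a \<notin> {0..1 / 2 ^ k :: real}"
 proof eventually_elim
  case (elim a)
  show ?case
  proof
   assume a: "a \<in> {0..1 / 2 ^ k}"
   have "1 / 2 ^ k <= (1 :: real)" by simp
   moreover have "0 <= a" "a <= 1 / 2 ^ k" using a by simp_all
   ultimately have "a \<in> {0..1}" unfolding atLeastAtMost_iff by linarith
   have "TT (dy k) alive (Some y) <= TT (ennreal a) alive (Some y)"
    using a by (intro TT_alive_antimono) (simp add: dy_def ennreal_leI)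
   then have "TT (ennreal a) alive (Some y) ~= 0" using k by (metis le_zero_eq)
   from Tpos[OF this] show False using elim \<open>a \<in> {0..1}\<close> by simp
  qed
 qed
 from emeasure_eq_0_AE[OF this] have "emeasure lborel {0..1 / 2 ^ k :: real} = 0"
  by (simp only: space_lborel space_borel UNIV_I simp_thms Collect_mem_eq)
 then show False by simp
qed

text \<open>Since \<open>A\<close> has finite expectation on each set of the nest, the identity for rectangles with a
 strictly positive integrable \<open>g\<close> shows that the Revuz measure is \<open>\<sigma>\<close>-finite.\<close>

lemma sigma_finite_\<mu>: "sigma_finite_measure \<mu>"
proof
 obtain h where h: "h \<in> BM borel" "\<And>x. 0 < h x" "\<And>x. h x <= 1" "(LI x. h x wrt m) < \<infinity>"
  "(LI x. h x wrt m) > 0" using positive_integrable by blast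
 define g where "g y = (case y of None => 0 | Some z => h z)" for y :: "'s option"
 have gb: "g \<in> BM borel_cpt"
  by (rule measurable_from_borel_cpt) (use h(1) in \<open>simp_all add: g_def\<close>)
 have g: "is_test g" unfolding is_test_def using gb h(3) by (auto simp: g_def split: option.split)
 have gi: "(LI x. g (Some x) wrt M) < top" using h(4) unfolding nn_integral_completion by (simp add: g_def)
 note [measurable] = measurable_compose[OF measurable_Some GI_borel[OF gb]]
 define B where "B n j = {y \<in> nest n. 1 / of_nat (Suc j) < GI g 0 1 (Some y)}" for n j :: nat
 have Bs[measurable]: "B n j \<in> sets borel" for n j unfolding B_def by measurable
 have "emeasure \<mu> (B n j) < top" for n j
 proof -
  let ?E = "nest n"
  have "emeasure \<mu> (B n j) = (LI y. ind (B n j) y wrt \<mu>)" by simp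
  also have "... <= (LI y. of_nat (Suc j) * (ind (Some ` ?E) (Some y) * GI g 0 1 (Some y)) wrt \<mu>)"
  proof (rule nn_integral_mono)
   fix y
   show "ind (B n j) y <= of_nat (Suc j) * (ind (Some ` ?E) (Some y) * GI g 0 1 (Some y))"
   proof (cases "y \<in> B n j")
    case True
    have "1 = of_nat (Suc j) * (1 / of_nat (Suc j) :: ennreal)"
     by (simp only: ennreal_times_divide mult_1_right) (simp add: ennreal_divide_self of_nat_less_top del: of_nat_Suc)
    also have "... <= of_nat (Suc j) * GI g 0 1 (Some y)" using True by (intro mult_left_mono) (auto simp: B_def)
    finally show ?thesis using True by (auto simp: B_def)
   qed simp
  qed
  also have "... = of_nat (Suc j) * (LI y. ind (Some ` ?E) (Some y) * GI g 0 1 (Some y) wrt \<mu>)"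
  proof (rule nn_integral_cmult)
   note [measurable] = measurable_compose[OF measurable_Some borel_measurable_indicator[OF sets_borel_cpt_image[OF nest_sets]]]
   show "(\<lambda>y. ind (Some ` ?E) (Some y) * GI g 0 1 (Some y)) \<in> BM \<mu>" by measurable
  qed
  also have "(LI y. ind (Some ` ?E) (Some y) * GI g 0 1 (Some y) wrt \<mu>) = emeasure (NG g) ({..<ennreal 1} \<times> Some ` ?E)"
  proof -
   note [measurable] = sets_borel_cpt_image[OF nest_sets]
   have "emeasure (NG g) ({..<ennreal 1} \<times> Some ` ?E) = (LI z. ind ({..<ennreal 1} \<times> Some ` ?E) z wrt NG g)"
    by (subst nn_integral_indicator) (auto simp: NG_props(1)[OF is_test_UB[OF g]])
   also have "... = (LI z. ind {..<ennreal 1} (fst z) * ind (Some ` ?E) (snd z) wrt NG g)"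
    by (intro nn_integral_cong) (auto simp: indicator_def)
   finally show ?thesis using duality_rectangle[OF g gi nest_sets order_refl, of 1 n] by simp
  qed
  also have "of_nat (Suc j) * emeasure (NG g) ({..<ennreal 1} \<times> Some ` ?E) < top"
   using NG_nest_finite[OF g gi, of "ennreal 1" n] by (simp add: ennreal_mult_less_top of_nat_less_top del: of_nat_Suc)
  finally show ?thesis .
 qed
 moreover have "(\<Union>n. \<Union>j. B n j) = UNIV"
 proof (intro set_eqI iffI UNIV_I)
  fix y
  obtain n where n: "y \<in> nest n" using nest_UN by blast
  have "0 < GI g 0 1 (Some y)" by (rule GI_pos[OF g]) (simp add: g_def h(2))
  then obtain j where "1 / of_nat (Suc j) < GI g 0 1 (Some y)" using ennreal_inverse_of_nat_less by blast
  then show "y \<in> (\<Union>n. \<Union>j. B n j)" using n by (auto simp: B_def)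
 qed
 moreover have "space \<mu> = UNIV" using sets_eq_imp_space_eq[OF sets_\<mu>] by simp
 ultimately show "\<exists>A. countable A \<and> A \<subseteq> sets \<mu> \<and> \<Union>A = space \<mu> \<and> (\<forall>a\<in>A. emeasure \<mu> a ~= \<infinity>)"
 proof (intro exI[of _ "range (\<lambda>(n, j). B n j)"] conjI)
  assume fin: "\<And>n j. emeasure \<mu> (B n j) < top" and un: "(\<Union>n. \<Union>j. B n j) = UNIV" and sp: "space \<mu> = UNIV"
  show "\<Union>(range (\<lambda>(n, j). B n j)) = space \<mu>"
  proof (rule set_eqI)
   fix y
   have "y \<in> (\<Union>n. \<Union>j. B n j)" unfolding un by simp
   then obtain n j where "y \<in> B n j" by blast
   then show "y \<in> \<Union>(range (\<lambda>(n, j). B n j)) \<longleftrightarrow> y \<in> space \<mu>" unfolding sp by auto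
  qed
  show "\<forall>a\<in>range (\<lambda>(n, j). B n j). emeasure \<mu> a ~= \<infinity>" using fin by (auto simp: less_top)
 qed auto
qed

sublocale \<mu>: sigma_finite_measure \<mu> by (rule sigma_finite_\<mu>)

text \<open>The integral of \<open>\<phi>\<close> against the measure $T_s g(y)\,ds\,\mu(dy)$.\<close>

definition RM :: "('s option => ennreal) => (ennreal \<times> 's option => ennreal) => ennreal"
 where "RM g \<phi> = (LI s. ind {0..} s * (LI y. TT (ennreal s) g (Some y) * \<phi> (ennreal s, Some y) wrt \<mu>) wrt lborel)"

lemma TB_real_measurable:
 assumes "\<phi> \<in> BM TB"
 shows "(\<lambda>z. \<phi> (ennreal (fst z), Some (snd z))) \<in> BM (borel \<Otimes>\<^sub>M borel)"
proof -
 note [measurable] = measurable_Some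
 have "(\<lambda>z. (ennreal (fst z), Some (snd z))) \<in> borel \<Otimes>\<^sub>M borel \<rightarrow>\<^sub>M TB" by measurable
 from measurable_compose[OF this assms] show ?thesis .
qed

lemma RM_measurable:
 assumes "g \<in> BM borel_cpt" "\<phi> \<in> BM TB"
 shows "(\<lambda>z. TT (ennreal (fst z)) g (Some (snd z)) * \<phi> (ennreal (fst z), Some (snd z))) \<in> BM (lborel \<Otimes>\<^sub>M \<mu>)"
  and "(\<lambda>s. LI y. TT (ennreal s) g (Some y) * \<phi> (ennreal s, Some y) wrt \<mu>) \<in> BM lborel"
proof -
 note [measurable] = measurable_Some TB_real_measurable[OF assms(2)] assms(1)
 show 1: "(\<lambda>z. TT (ennreal (fst z)) g (Some (snd z)) * \<phi> (ennreal (fst z), Some (snd z))) \<in> BM (lborel \<Otimes>\<^sub>M \<mu>)"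
  by measurable
 from \<mu>.borel_measurable_nn_integral[of "\<lambda>s y. TT (ennreal s) g (Some y) * \<phi> (ennreal s, Some y)" lborel] 1
 show "(\<lambda>s. LI y. TT (ennreal s) g (Some y) * \<phi> (ennreal s, Some y) wrt \<mu>) \<in> BM lborel"
  by (simp add: split_beta')
qed

lemma RM_rectangle:
 assumes gb: "g \<in> BM borel_cpt" and E: "E \<in> sets borel"
 shows "RM g (\<lambda>z. ind {..<ennreal t} (fst z) * ind (Some ` E) (snd z)) =
  (LI y. ind (Some ` E) (Some y) * GI g 0 t (Some y) wrt \<mu>)"
proof -
 note [measurable] = sets_borel_cpt_image[OF E] measurable_Some gb
 interpret pair_sigma_finite lborel \<mu> ..
 let ?\<phi> = "\<lambda>z. ind {..<ennreal t} (fst z) * ind (Some ` E) (snd z) :: ennreal"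
 have \<phi>: "?\<phi> \<in> BM TB" by measurable
 note [measurable] = RM_measurable(1)[OF gb \<phi>, simplified]
 have sec: "(\<lambda>y. TT (ennreal s) g (Some y) * ?\<phi> (ennreal s, Some y)) \<in> BM \<mu>" for s
  by measurable
 have "RM g ?\<phi> = (LI s. LI y. ind {0..} s * (TT (ennreal s) g (Some y) * ?\<phi> (ennreal s, Some y)) wrt \<mu> wrt lborel)"
  unfolding RM_def using sec by (intro nn_integral_cong nn_integral_cmult[symmetric]) simp
 also have "... = (LI y. LI s. ind {0..} s * (TT (ennreal s) g (Some y) * ?\<phi> (ennreal s, Some y)) wrt lborel wrt \<mu>)"
  by (rule Fubini'[symmetric]) (unfold split_beta' fst_conv snd_conv, measurable)
 also have "... = (LI y. ind (Some ` E) (Some y) * GI g 0 t (Some y) wrt \<mu>)"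
 proof (rule nn_integral_cong)
  fix y
  have "(LI s. ind {0..} s * (TT (ennreal s) g (Some y) * ?\<phi> (ennreal s, Some y)) wrt lborel) =
    (LI s. ind (Some ` E) (Some y) * (ind {0..t} s * TT (ennreal s) g (Some y)) wrt lborel)"
  proof (rule nn_integral_cong_AE)
   show "AE s in lborel. ind {0..} s * (TT (ennreal s) g (Some y) * ?\<phi> (ennreal s, Some y)) =
     ind (Some ` E) (Some y) * (ind {0..t} s * TT (ennreal s) g (Some y))"
    using AE_lborel_singleton[of t] by eventually_elim (auto simp: indicator_def ennreal_less_iff)
  qed
  also have "... = ind (Some ` E) (Some y) * GI g 0 t (Some y)"
   unfolding GI_def by (rule nn_integral_cmult) measurable
  finally show "(LI s. ind {0..} s * (TT (ennreal s) g (Some y) * ?\<phi> (ennreal s, Some y)) wrt lborel) =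
    ind (Some ` E) (Some y) * GI g 0 t (Some y)" .
 qed
 finally show ?thesis .
qed

lemma sets_TB_generator:
 "sets TB = sigma_sets UNIV {S \<times> B | S B. S \<in> insert UNIV (range lessThan) \<and> B \<in> sets borel_cpt}"
proof -
 \<comment> \<open>The whole space is added because none of the other sets contains the time \<open>\<infinity>\<close>.\<close>
 let ?S = "insert UNIV (range lessThan) :: ennreal set set"
 have b: "sets (borel :: ennreal measure) = sigma_sets UNIV ?S"
 proof (rule antisym)
  have "sets (borel :: ennreal measure) = sigma_sets UNIV (range lessThan)" by (subst borel_Iio) simp
  also have "... \<subseteq> sigma_sets UNIV ?S" by (rule sigma_sets_mono') auto
  finally show "sets (borel :: ennreal measure) \<subseteq> sigma_sets UNIV ?S" .
  have "?S \<subseteq> sets (borel :: ennreal measure)" by auto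
  from sets.sigma_sets_subset[OF this] show "sigma_sets UNIV ?S \<subseteq> sets (borel :: ennreal measure)" by simp
 qed
 have "sets TB = sets (sigma (space (borel :: ennreal measure) \<times> space borel_cpt) {S \<times> B | S B. S \<in> ?S \<and> B \<in> sets borel_cpt})"
  by (rule sets_pair_eq[where Ca="{UNIV}" and Cb="{UNIV}"]) (use b sets.sigma_sets_eq[of borel_cpt] sets.top[of borel_cpt] in auto)
 also have "... = sigma_sets UNIV {S \<times> B | S B. S \<in> ?S \<and> B \<in> sets borel_cpt}" by (subst sets_measure_of) auto
 finally show ?thesis .
qed

text \<open>On each product of a bounded time interval and a member of the nest, two finite measures agree on
 rectangles, which are stable under intersection.\<close>

lemma duality_test:
 assumes g: "is_test g" and gi: "(LI x. g (Some x) wrt M) < top" and \<phi>: "\<phi> \<in> BM TB"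
 shows "(LI z. \<phi> z wrt NG g) = RM g \<phi>"
proof -
 have gb[measurable]: "g \<in> BM borel_cpt" by (rule is_test_borel[OF g])
 note [measurable] = measurable_Some
 define N2 where "N2 = distr (density (lborel \<Otimes>\<^sub>M \<mu>) (\<lambda>z. ind {0..} (fst z) * TT (ennreal (fst z)) g (Some (snd z)))) TB
  (\<lambda>z. (ennreal (fst z), Some (snd z)))"
 have sN2[measurable_cong]: "sets N2 = sets TB" by (simp add: N2_def)
 note sNG[measurable_cong] = NG_props(1)[OF is_test_UB[OF g]]
 have N2: "(LI z. \<psi> z wrt N2) = RM g \<psi>" if \<psi>[measurable]: "\<psi> \<in> BM TB" for \<psi>
 proof -
  note [measurable] = TB_real_measurable[OF \<psi>] RM_measurable(1)[OF gb \<psi>]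
  have sec: "(\<lambda>y. TT (ennreal s) g (Some y) * \<psi> (ennreal s, Some y)) \<in> BM \<mu>" for s
   using measurable_compose[OF _ RM_measurable(1)[OF gb \<psi>], of "Pair s" \<mu>] by simp
  have "(LI z. \<psi> z wrt N2) = (LI z. ind {0..} (fst z) * TT (ennreal (fst z)) g (Some (snd z)) * \<psi> (ennreal (fst z), Some (snd z)) wrt (lborel \<Otimes>\<^sub>M \<mu>))"
   unfolding N2_def by (subst nn_integral_distr) (measurable, subst nn_integral_density, measurable)
  also have "... = (LI s. LI y. ind {0..} s * (TT (ennreal s) g (Some y) * \<psi> (ennreal s, Some y)) wrt \<mu> wrt lborel)"
   by (subst \<mu>.nn_integral_fst[symmetric]) (measurable, simp add: mult.assoc)
  also have "... = RM g \<psi>"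
   unfolding RM_def using sec by (intro nn_integral_cong nn_integral_cmult) simp
  finally show ?thesis .
 qed
 define C where "C i = {..<of_nat i :: ennreal} \<times> Some ` nest i" for i
 note [measurable] = sets_borel_cpt_image[OF nest_sets]
 have Cm[measurable]: "C i \<in> sets TB" for i unfolding C_def by measurable
 have rect: "emeasure (NG g) ({..<c} \<times> Some ` E) = emeasure N2 ({..<c} \<times> Some ` E)"
  if E: "E \<in> sets borel" "E \<subseteq> nest n" and c: "c < top" for E n c
 proof -
  obtain t where t: "c = ennreal t" using c by (cases c) auto
  note [measurable] = sets_borel_cpt_image[OF E(1)]
  let ?\<psi> = "\<lambda>z. ind {..<ennreal t} (fst z) * ind (Some ` E) (snd z) :: ennreal"
  have i: "ind ({..<ennreal t} \<times> Some ` E) = ?\<psi>" by (auto simp: fun_eq_iff indicator_def)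
  have "emeasure (NG g) ({..<c} \<times> Some ` E) = (LI z. ?\<psi> z wrt NG g)"
   unfolding t i[symmetric] by (rule nn_integral_indicator[symmetric]) measurable
  also have "... = (LI z. ?\<psi> z wrt N2)"
   by (subst N2) (measurable, simp only: RM_rectangle[OF gb E(1)] duality_rectangle[OF g gi E])
  also have "... = emeasure N2 ({..<c} \<times> Some ` E)"
   unfolding t i[symmetric] by (rule nn_integral_indicator) measurable
  finally show ?thesis .
 qed
 have eq: "density (NG g) (ind (C i)) = density N2 (ind (C i))" for i
 proof (rule measure_eqI_generator_eq)
  let ?G = "{S \<times> B | S B. S \<in> insert UNIV (range lessThan) \<and> B \<in> sets borel_cpt} :: (ennreal \<times> 's option) set set"
  show "Int_stable ?G"
  proof (rule Int_stableI)
   fix P Q assume "P \<in> ?G" "Q \<in> ?G"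
   then obtain S B S' B' where *: "P = S \<times> B" "Q = S' \<times> B'" "S \<in> insert UNIV (range lessThan)" "S' \<in> insert UNIV (range lessThan)"
    "B \<in> sets borel_cpt" "B' \<in> sets borel_cpt" by blast
   have "S \<inter> S' \<in> insert UNIV (range lessThan)"
   proof (cases "S = UNIV \<or> S' = UNIV")
    case False
    then obtain d d' where d: "S = {..<d}" "S' = {..<d'}" using *(3,4) by blast
    have "S \<inter> S' = {..<min d d'}" unfolding d by auto
    then show ?thesis by (simp only: rangeI insertI2)
   qed (use *(3,4) in auto)
   moreover have "B \<inter> B' \<in> sets borel_cpt" using *(5,6) by (rule sets.Int)
   moreover have "P \<inter> Q = (S \<inter> S') \<times> (B \<inter> B')" using *(1,2) by auto
   ultimately show "P \<inter> Q \<in> ?G" by blast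
  qed
  show "sets (density (NG g) (ind (C i))) = sigma_sets UNIV ?G" "sets (density N2 (ind (C i))) = sigma_sets UNIV ?G"
   using sets_TB_generator by (simp_all add: sNG sN2)
  have UG: "UNIV \<in> ?G"
  proof -
   have "UNIV \<in> sets (borel_cpt :: 's option measure)" using sets.top[of "borel_cpt :: 's option measure"] by simp
   moreover have "(UNIV :: (ennreal \<times> 's option) set) = UNIV \<times> UNIV" by simp
   ultimately show ?thesis by (intro CollectI exI[of _ UNIV] conjI insertI1)
  qed
  then show "range (\<lambda>_ :: nat. UNIV) \<subseteq> ?G" by blast
  show "emeasure (density (NG g) (ind (C i))) UNIV ~= \<infinity>"
  proof -
   have "emeasure (density (NG g) (ind (C i))) UNIV = (LI z. ind (C i) z * ind UNIV z wrt NG g)"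
    using sNG by (intro emeasure_density) (auto simp: sNG simp del: space_pair_measure intro: sets_TB_generator[THEN equalityD2, THEN subsetD] sigma_sets.Basic[OF UG])
   also have "... = emeasure (NG g) (C i)" using sNG by simp
   also have "... < top" unfolding C_def by (rule NG_nest_finite[OF g gi]) (simp add: of_nat_less_top)
   finally show ?thesis by simp
  qed
  fix P assume P: "P \<in> ?G"
  then obtain S B where SB: "P = S \<times> B" "S \<in> insert UNIV (range lessThan)" "B \<in> sets borel_cpt" by blast
  have PT[measurable]: "P \<in> sets TB" unfolding sets_TB_generator using P by (rule sigma_sets.Basic)
  define E where "E = nest i \<inter> Some -` B"
  have E: "E \<in> sets borel" "E \<subseteq> nest i" using SB(3) by (auto simp: E_def sets_borel_cpt_iff)
  obtain c where c: "{..<of_nat i} \<inter> S = {..<c}" "c < (top :: ennreal)"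
  proof (cases "S = UNIV")
   case True
   then show ?thesis using that[of "of_nat i"] by (simp add: of_nat_less_top)
  next
   case False
   then obtain d where "S = {..<d}" using SB(2) by blast
   then have "{..<of_nat i} \<inter> S = {..<min (of_nat i) d}" by auto
   then show ?thesis using that[of "min (of_nat i) d"] by (simp add: of_nat_less_top min_less_iff_disj)
  qed
  have CP: "C i \<inter> P = {..<c} \<times> Some ` E"
   unfolding c(1)[symmetric] by (auto simp: C_def SB(1) E_def)
  have ed: "emeasure (density N (ind (C i))) P = emeasure N (C i \<inter> P)" if sN: "sets N = sets TB" for N
  proof -
   note [measurable_cong] = sN
   have "emeasure (density N (ind (C i))) P = (LI z. ind (C i) z * ind P z wrt N)"
   proof (rule emeasure_density)
    show "ind (C i) \<in> BM N"
     unfolding measurable_cong_sets[OF sN refl] by (rule borel_measurable_indicator[OF Cm])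
   qed (simp add: sN)
   also have "... = (LI z. ind (C i \<inter> P) z wrt N)" by (intro nn_integral_cong) (auto simp: indicator_def)
   also have "... = emeasure N (C i \<inter> P)" by (rule nn_integral_indicator) (simp add: sN)
   finally show ?thesis .
  qed
  show "emeasure (density (NG g) (ind (C i))) P = emeasure (density N2 (ind (C i))) P"
   unfolding ed[OF sNG] ed[OF sN2] CP by (rule rect[OF E c(2)])
 qed auto
 have Cmono: "i <= j ==> C i \<subseteq> C j" for i j
  using monoD[OF nest_mono, of i j] unfolding C_def
  by (auto dest: less_le_trans[OF _ of_nat_mono])
 have Cin: "\<exists>i. z \<in> C i" if z: "snd z ~= None" "fst z < top" for z
 proof -
  obtain y where y: "snd z = Some y" using z by auto
  obtain i where i: "fst z < of_nat i" using ennreal_Ex_less_of_nat z by blast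
  obtain j where j: "y \<in> nest j" using nest_UN by blast
  have "y \<in> nest (max i j)" using j monoD[OF nest_mono, of j "max i j"] by auto
  moreover have "fst z < of_nat (max i j)" using i by (rule less_le_trans) simp
  ultimately have "z \<in> C (max i j)" using y by (cases z) (auto simp: C_def)
  then show ?thesis by blast
 qed
 have sup: "(SUP i. ind (C i) z * \<phi> z) = \<phi> z" if z: "snd z ~= None" "fst z < top" for z
 proof (rule antisym)
  show "(SUP i. ind (C i) z * \<phi> z) <= \<phi> z" by (rule SUP_least) (simp add: indicator_def)
  obtain i where "z \<in> C i" using Cin z by blast
  then have "\<phi> z <= ind (C i) z * \<phi> z" by simp
  also have "... <= (SUP i. ind (C i) z * \<phi> z)" by (rule SUP_upper) simp
  finally show "\<phi> z <= (SUP i. ind (C i) z * \<phi> z)" .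
 qed
 have inc: "incseq (\<lambda>i z. ind (C i) z * \<phi> z)"
  using Cmono by (force simp: incseq_def le_fun_def indicator_def)
 have "(LI z. \<phi> z wrt NG g) = (LI z. (SUP i. ind (C i) z * \<phi> z) wrt NG g)"
 proof (rule nn_integral_cong_AE)
  show "AE z in NG g. \<phi> z = (SUP i. ind (C i) z * \<phi> z)"
   using NG_None[OF is_test_UB[OF g]] by eventually_elim (rule sup[symmetric], blast+)
 qed
 also have "... = (SUP i. LI z. ind (C i) z * \<phi> z wrt NG g)"
  using \<phi> by (intro nn_integral_monotone_convergence_SUP inc) measurable
 also have "... = (SUP i. LI z. \<phi> z wrt density (NG g) (ind (C i)))"
  using \<phi> by (intro SUP_cong refl nn_integral_density[symmetric]) measurable
 also have "... = (SUP i. LI z. \<phi> z wrt density N2 (ind (C i)))" unfolding eq ..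
 also have "... = (SUP i. LI z. ind (C i) z * \<phi> z wrt N2)"
  using \<phi> by (intro SUP_cong refl nn_integral_density) measurable
 also have "... = (LI z. (SUP i. ind (C i) z * \<phi> z) wrt N2)"
  using \<phi> by (intro nn_integral_monotone_convergence_SUP[symmetric] inc) measurable
 also have "... = RM g (\<lambda>z. SUP i. ind (C i) z * \<phi> z)" using \<phi> by (intro N2) measurable
 also have "... = RM g \<phi>" unfolding RM_def by (intro nn_integral_cong) (simp add: sup)
 finally show ?thesis .
qed

lemma RM_cmult:
 assumes g: "g \<in> BM borel_cpt" and \<phi>: "\<phi> \<in> BM TB"
 shows "RM (\<lambda>y. c * g y) \<phi> = c * RM g \<phi>"
proof -
 note [measurable] = RM_measurable(2)[OF g \<phi>]
 have sec: "(\<lambda>y. TT (ennreal s) g (Some y) * \<phi> (ennreal s, Some y)) \<in> BM \<mu>" for s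
  using measurable_compose[OF _ RM_measurable(1)[OF g \<phi>], of "Pair s" \<mu>] by simp
 have "RM (\<lambda>y. c * g y) \<phi> = (LI s. c * (ind {0..} s * (LI y. TT (ennreal s) g (Some y) * \<phi> (ennreal s, Some y) wrt \<mu>)) wrt lborel)"
  unfolding RM_def TT_cmult[OF g] mult.assoc nn_integral_cmult[OF sec] by (simp add: mult.left_commute)
 also have "... = c * RM g \<phi>" unfolding RM_def by (rule nn_integral_cmult) measurable
 finally show ?thesis .
qed

lemma RM_SUP:
 assumes g: "\<And>i::nat. g i \<in> BM borel_cpt" "\<And>y. incseq (\<lambda>i. g i y)" and \<phi>: "\<phi> \<in> BM TB"
 shows "RM (\<lambda>y. SUP i. g i y) \<phi> = (SUP i. RM (g i) \<phi>)"
proof -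
 note [measurable] = RM_measurable(2)[OF g(1) \<phi>]
 have sec: "(\<lambda>y. TT (ennreal s) (g i) (Some y) * \<phi> (ennreal s, Some y)) \<in> BM \<mu>" for s i
  using measurable_compose[OF _ RM_measurable(1)[OF g(1) \<phi>], of "Pair s" \<mu>] by simp
 have TTm: "TT s (g i) y <= TT s (g j) y" if "i <= j" for s i j y
  using g(2) that by (intro TT_mono) (simp add: incseq_def)
 have "RM (\<lambda>y. SUP i. g i y) \<phi> = (LI s. (SUP i. ind {0..} s * (LI y. TT (ennreal s) (g i) (Some y) * \<phi> (ennreal s, Some y) wrt \<mu>)) wrt lborel)"
  unfolding RM_def
 proof (rule nn_integral_cong)
  fix s :: real
  have "(LI y. TT (ennreal s) (\<lambda>y. SUP i. g i y) (Some y) * \<phi> (ennreal s, Some y) wrt \<mu>) =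
    (LI y. (SUP i. TT (ennreal s) (g i) (Some y) * \<phi> (ennreal s, Some y)) wrt \<mu>)"
   unfolding TT_SUP[OF g] by (simp add: SUP_mult_right_ennreal)
  also have "... = (SUP i. LI y. TT (ennreal s) (g i) (Some y) * \<phi> (ennreal s, Some y) wrt \<mu>)"
   using TTm by (intro nn_integral_monotone_convergence_SUP sec) (auto simp: incseq_def le_fun_def intro!: mult_right_mono)
  finally show "ind {0..} s * (LI y. TT (ennreal s) (\<lambda>y. SUP i. g i y) (Some y) * \<phi> (ennreal s, Some y) wrt \<mu>) =
    (SUP i. ind {0..} s * (LI y. TT (ennreal s) (g i) (Some y) * \<phi> (ennreal s, Some y) wrt \<mu>))"
   by (simp add: SUP_mult_left_ennreal)
 qed
 also have "... = (SUP i. RM (g i) \<phi>)"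
  unfolding RM_def
 proof (rule nn_integral_monotone_convergence_SUP)
  show "incseq (\<lambda>i s. ind {0..} s * (LI y. TT (ennreal s) (g i) (Some y) * \<phi> (ennreal s, Some y) wrt \<mu>))"
   unfolding incseq_def le_fun_def by (intro allI impI mult_left_mono nn_integral_mono mult_right_mono TTm) simp_all
 qed measurable
 finally show ?thesis .
qed

text \<open>Every \<open>g\<close> is an increasing limit of multiples of bounded integrable functions.\<close>

theorem duality:
 assumes g: "g \<in> BM borel_cpt" "g None = 0" and \<phi>: "\<phi> \<in> BM TB"
 shows "(LI z. \<phi> z wrt NG g) = RM g \<phi>"
proof -
 note [measurable] = g(1)
 define h where "h i y = cut i y * min (g y) (of_nat (Suc i))" for i y
 define k where "k i y = (1 / of_nat (Suc i)) * h i y" for i y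
 have c1: "of_nat (Suc i) * (1 / of_nat (Suc i)) = (1::ennreal)" for i
  by (simp only: ennreal_times_divide mult_1_right) (simp add: ennreal_divide_self of_nat_less_top del: of_nat_Suc)
 have hb[measurable]: "h i \<in> BM borel_cpt" for i unfolding h_def by measurable
 have kb[measurable]: "k i \<in> BM borel_cpt" for i unfolding k_def by measurable
 have kle: "k i y <= cut i y" for i y
 proof -
  have "k i y <= (1 / of_nat (Suc i)) * (cut i y * of_nat (Suc i))"
   unfolding k_def h_def by (intro mult_left_mono) simp_all
  also have "... = cut i y" using c1[of i] by (metis mult.assoc mult.commute mult_1)
  finally show ?thesis .
 qed
 have kt: "is_test (k i)" for i
 proof -
  have "k i y <= 1" for y using kle[of i y] by (rule order_trans) (simp add: indicator_def)
  moreover have "k i None = 0" by (simp add: k_def h_def)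
  ultimately show ?thesis using kb unfolding is_test_def by blast
 qed
 have ki: "(LI x. k i (Some x) wrt M) < top" for i
  by (rule le_less_trans[OF nn_integral_mono[OF kle] cut_integral])
 have hk: "h i = (\<lambda>y. of_nat (Suc i) * k i y)" for i
  unfolding k_def by (simp only: mult.assoc[symmetric] c1 mult_1)
 have H: "(LI z. \<phi> z wrt NG (h i)) = RM (h i) \<phi>" for i
 proof -
  note [measurable] = UB_Some_measurable[OF NN_UB[OF \<phi>]] UB_Some_measurable[OF is_test_UB[OF kt]]
  have "(LI z. \<phi> z wrt NG (h i)) = (LI x. h i (Some x) * NN \<phi> (Some x) wrt M)"
   by (rule nn_integral_NG[OF measurable_UB_borel[OF hb] \<phi>])
  also have "... = (LI x. of_nat (Suc i) * (k i (Some x) * NN \<phi> (Some x)) wrt M)"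
   by (simp only: hk mult.assoc)
  also have "... = of_nat (Suc i) * (LI z. \<phi> z wrt NG (k i))"
   unfolding nn_integral_NG[OF measurable_UB_borel[OF kb] \<phi>] by (rule nn_integral_cmult) measurable
  also have "... = RM (h i) \<phi>" unfolding duality_test[OF kt ki \<phi>] hk by (rule RM_cmult[symmetric, OF kb \<phi>])
  finally show ?thesis .
 qed
 have inc: "incseq (\<lambda>i. h i y)" for y
  unfolding h_def using cut_mono[of y]
  by (auto simp: incseq_def simp del: of_nat_Suc intro!: mult_mono min.mono of_nat_mono)
 have sup: "(\<lambda>y. SUP i. h i y) = g"
 proof
  fix y
  show "(SUP i. h i y) = g y"
  proof (cases y)
   case None
   then show ?thesis using g(2) by (simp add: h_def)
  next
   case (Some z)
   then obtain j where j: "z \<in> cover j" using cover(4) by blast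
   show ?thesis
   proof (rule antisym)
    show "(SUP i. h i y) <= g y"
     by (rule SUP_least) (auto simp: h_def indicator_def)
    have "(SUP i. min (g y) (of_nat (Suc i))) <= (SUP i. h i y)"
    proof (rule SUP_least)
     fix i
     have "z \<in> cover (max i j)" using j incseqD[OF cover(3), of j "max i j"] by auto
     then have "h (max i j) y = min (g y) (of_nat (Suc (max i j)))" using Some by (simp add: h_def del: of_nat_Suc)
     moreover have "min (g y) (of_nat (Suc i)) <= min (g y) (of_nat (Suc (max i j)))"
      by (intro min.mono of_nat_mono) simp_all
     ultimately have "min (g y) (of_nat (Suc i)) <= h (max i j) y" by simp
     also have "... <= (SUP i. h i y)" by (rule SUP_upper) simp
     finally show "min (g y) (of_nat (Suc i)) <= (SUP i. h i y)" .
    qed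
    then show "g y <= (SUP i. h i y)" unfolding SUP_min_of_nat .
   qed
  qed
 qed
 have "(LI z. \<phi> z wrt NG g) = (SUP i. LI z. \<phi> z wrt NG (h i))"
  unfolding sup[symmetric] by (rule NG_SUP[OF hb inc \<phi>])
 also have "... = RM g \<phi>" unfolding H sup[symmetric] by (rule RM_SUP[symmetric, OF hb inc \<phi>])
 finally show ?thesis .
qed

subsection \<open>Starting from a point\<close>

text \<open>Starting at a point instead of an absolutely continuous law: run the process for a short time
 \<open>a\<close>, after which its law has density \<open>p\<^sub>a(x, \<cdot>)\<close>, apply the duality, and let \<open>a\<close> tend to \<open>0\<close>.\<close>

lemma density_measurable:
 assumes "\<psi> \<in> BM TB"
 shows "(\<lambda>z. pd (ennreal (fst z)) x (snd z) * \<psi> (ennreal (fst z), Some (snd z))) \<in> BM (lborel \<Otimes>\<^sub>M \<mu>)"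
  and "(\<lambda>r. LI y. pd (ennreal r) x y * \<psi> (ennreal r, Some y) wrt \<mu>) \<in> BM lborel"
proof -
 note [measurable] = TB_real_measurable[OF assms]
 show 1: "(\<lambda>z. pd (ennreal (fst z)) x (snd z) * \<psi> (ennreal (fst z), Some (snd z))) \<in> BM (lborel \<Otimes>\<^sub>M \<mu>)"
  by measurable
 from \<mu>.borel_measurable_nn_integral[of "\<lambda>r y. pd (ennreal r) x y * \<psi> (ennreal r, Some y)" lborel] 1
 show "(\<lambda>r. LI y. pd (ennreal r) x y * \<psi> (ennreal r, Some y) wrt \<mu>) \<in> BM lborel"
  by (simp add: split_beta')
qed

lemma NN_density_late:
 assumes a: "0 < a" and \<psi>: "\<psi> \<in> BM TB"
 shows "NN (\<lambda>(s, y). ind {ennreal a..} s * \<psi> (s, y)) (Some x) =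
  (LI r. ind {a..} r * (LI y. pd (ennreal r) x y * \<psi> (ennreal r, Some y) wrt \<mu>) wrt lborel)"
proof -
 define \<phi> where "\<phi> z = \<psi> (fst z + ennreal a, snd z)" for z
 have \<phi>: "\<phi> \<in> BM TB"
 proof -
  have "(\<lambda>z. (fst z + ennreal a, snd z)) \<in> TB \<rightarrow>\<^sub>M TB" by measurable
  from measurable_compose[OF this \<psi>] show ?thesis by (simp add: \<phi>_def[abs_def])
 qed
 define g where "g y = (case y of None => 0 | Some z => pd (ennreal a) x z)" for y
 have g: "g \<in> BM borel_cpt" "g None = 0"
 proof -
  show "g \<in> BM borel_cpt"
   by (rule measurable_from_borel_cpt) (simp_all add: g_def)
 qed (simp add: g_def)
 have at: "0 < ennreal a" "ennreal a < top" using a by simp_all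
 note [measurable] = density_measurable(2)[OF \<psi>, of x]
 have "NN (\<lambda>(s, y). ind {ennreal a..} s * \<psi> (s, y)) (Some x) = NN (\<lambda>(s, y). ind {ennreal a..} s * \<phi> (s - ennreal a, y)) (Some x)"
  by (rule NN_cong) (auto simp: \<phi>_def indicator_def diff_add_cancel_ennreal)
 also have "... = TT (ennreal a) (NN \<phi>) (Some x)" by (rule NN_shift[OF at(2) \<phi>])
 also have "... = (LI y. g (Some y) * NN \<phi> (Some y) wrt M)"
  unfolding TT_density[OF at NN_UB[OF \<phi>] NN_None] by (simp add: g_def)
 also have "... = RM g \<phi>"
  unfolding nn_integral_NG[OF measurable_UB_borel[OF g(1)] \<phi>, symmetric] by (rule duality[OF g \<phi>])
 also have "... = (LI s. ind {a..} (a + s) * (LI y. pd (ennreal (a + s)) x y * \<psi> (ennreal (a + s), Some y) wrt \<mu>) wrt lborel)"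
  unfolding RM_def
 proof (rule nn_integral_cong_AE)
  show "AE s in lborel. ind {0..} s * (LI y. TT (ennreal s) g (Some y) * \<phi> (ennreal s, Some y) wrt \<mu>) =
    ind {a..} (a + s) * (LI y. pd (ennreal (a + s)) x y * \<psi> (ennreal (a + s), Some y) wrt \<mu>)"
   using AE_lborel_singleton[of 0]
  proof eventually_elim
   case (elim s)
   show ?case
   proof (cases "0 < s")
    case True
    then have st: "0 < ennreal s" "ennreal s < top" by simp_all
    have e: "ennreal (a + s) = ennreal s + ennreal a" using a True by (simp add: add.commute)
    have "TT (ennreal s) g (Some y) = pd (ennreal (a + s)) x y" for y
    proof -
     have "TT (ennreal s) g (Some y) = (LI z. pd (ennreal s) y z * pd (ennreal a) x z wrt m)"
      unfolding TT_density[OF st measurable_UB_borel[OF g(1)] g(2)] nn_integral_completion by (simp add: g_def)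
     also have "... = (LI z. pd (ennreal s) y z * pd (ennreal a) z x wrt m)" by (simp add: pd_sym[of "ennreal a" x])
     also have "... = pd (ennreal (a + s)) x y"
      unfolding e pd_add[OF st at, symmetric] by (rule pd_sym)
     finally show ?thesis .
    qed
    then show ?thesis using True a by (simp add: \<phi>_def e del: ennreal_plus)
   qed (use elim in simp)
  qed
 qed
 also have "... = (LI r. ind {a..} r * (LI y. pd (ennreal r) x y * \<psi> (ennreal r, Some y) wrt \<mu>) wrt lborel)"
  by (rule nn_integral_lborel_translate) measurable
 finally show ?thesis .
qed

theorem NN_density:
 assumes \<psi>: "\<psi> \<in> BM TB"
 shows "NN \<psi> (Some x) =
  (LI r. ind {0<..} r * (LI y. pd (ennreal r) x y * \<psi> (ennreal r, Some y) wrt \<mu>) wrt lborel)"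
proof -
 define d :: "nat => real" where "d i = 1 / 2 ^ i" for i
 have d: "0 < d i" "ennreal (d i) = dy i" for i by (simp_all add: d_def dy_def)
 have dm: "d j <= d i" "dy j <= dy i" if "i <= j" for i j
  using dy_props(5) that by (auto simp: d_def decseq_def intro!: divide_left_mono power_increasing)
 have ex: "\<exists>i. dy i <= s" if "0 < s" for s
 proof -
  from order_tendstoD(2)[OF dy_props(6) that] obtain i where "dy i < s" by (auto simp: eventually_sequentially)
  then show ?thesis by (auto intro: less_imp_le)
 qed
 note [measurable] = \<psi> density_measurable(2)[OF \<psi>, of x]
 have "NN \<psi> (Some x) = NN (\<lambda>z. SUP i. ind {dy i..} (fst z) * \<psi> z) (Some x)"
 proof (rule NN_cong)
  fix s :: ennreal and y assume "0 < s"
  then obtain i where "s \<in> {dy i..}" using ex by auto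
  from SUP_indicator_mult[where S="\<lambda>i. {dy i..}", OF this] show "\<psi> (s, Some y) = (SUP i. ind {dy i..} (fst (s, Some y)) * \<psi> (s, Some y))" by simp
 qed
 also have "... = (SUP i. NN (\<lambda>z. ind {dy i..} (fst z) * \<psi> z) (Some x))"
 proof (rule NN_SUP)
  show "incseq (\<lambda>i z. ind {dy i..} (fst z) * \<psi> z)"
   unfolding incseq_def le_fun_def using dm(2) by (intro allI impI mult_right_mono) (auto simp: indicator_def intro: order_trans)
 qed measurable
 also have "... = (SUP i. LI r. ind {d i..} r * (LI y. pd (ennreal r) x y * \<psi> (ennreal r, Some y) wrt \<mu>) wrt lborel)"
  using NN_density_late[OF d(1) \<psi>] by (simp add: d(2) split_beta')
 also have "... = (LI r. (SUP i. ind {d i..} r * (LI y. pd (ennreal r) x y * \<psi> (ennreal r, Some y) wrt \<mu>)) wrt lborel)"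
 proof (rule nn_integral_monotone_convergence_SUP[symmetric])
  show "incseq (\<lambda>i r. ind {d i..} r * (LI y. pd (ennreal r) x y * \<psi> (ennreal r, Some y) wrt \<mu>))"
   unfolding incseq_def le_fun_def using dm(1) by (intro allI impI mult_right_mono) (auto simp: indicator_def intro: order_trans)
 qed measurable
 also have "... = (LI r. ind {0<..} r * (LI y. pd (ennreal r) x y * \<psi> (ennreal r, Some y) wrt \<mu>) wrt lborel)"
 proof (rule nn_integral_cong)
  fix r :: real
  show "(SUP i. ind {d i..} r * (LI y. pd (ennreal r) x y * \<psi> (ennreal r, Some y) wrt \<mu>)) =
    ind {0<..} r * (LI y. pd (ennreal r) x y * \<psi> (ennreal r, Some y) wrt \<mu>)"
  proof (cases "0 < r")
   case True
   then obtain i where "dy i <= ennreal r" using ex[of "ennreal r"] by auto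
   then have "r \<in> {d i..}" using True by (simp add: d(2)[symmetric] ennreal_le_iff)
   from SUP_indicator_mult[where S="\<lambda>i. {d i..}", OF this] show ?thesis using True by simp
  next
   case False
   have "r < d i" for i using False d(1)[of i] by linarith
   then show ?thesis using False by (simp add: not_le)
  qed
 qed
 finally show ?thesis .
qed

end

context pcaf_revuz
begin

text \<open>One step of the recursion: condition on the path at a point of increase \<open>s\<close> of \<open>A\<close>, and use the
 duality for the joint law of \<open>(s, X\<^sub>s)\<close>.\<close>

lemma clock_integral_density:
 assumes L: "AE V in Pu (Some x). V \<in> L"
  and G: "(\<lambda>(s, V). G s V) \<in> BM (TF)"
  and H: "(\<lambda>(s, V). H s V) \<in> BM (TF)"
  and GH: "\<And>s V. V \<in> L ==> s < top ==> State X s V ~= None ==> G s V = H s (Shift X s V)"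
  and \<Psi>: "(\<lambda>(s, y). \<Psi> s y) \<in> BM (borel \<Otimes>\<^sub>M borel)"
  and H\<Psi>: "\<And>s y. s < top ==> (LI V. H s V wrt Pu (Some y)) = \<Psi> s y"
 shows "(LI V. (LI s. G s V wrt dA V) wrt Pu (Some x)) =
  (LI r. ind {0<..} r * (LI y. pd (ennreal r) x y * \<Psi> (ennreal r) y wrt \<mu>) wrt lborel)"
proof -
 define \<Psi>' where "\<Psi>' s y = (case y of None => 0 | Some z => \<Psi> s z)" for s y
 have \<Psi>'m: "(\<lambda>z. \<Psi>' (fst z) (snd z)) \<in> BM TB"
 proof -
  obtain z0 :: 's where True by simp
  define pr where "pr y = (case y of None => z0 | Some z => z)" for y
  have [measurable]: "pr \<in> borel_cpt \<rightarrow>\<^sub>M borel" by (rule measurable_from_borel_cpt) (simp_all add: pr_def)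
  have "(\<lambda>z. (fst z, pr (snd z))) \<in> TB \<rightarrow>\<^sub>M borel \<Otimes>\<^sub>M borel" by measurable
  from measurable_compose[OF this \<Psi>] have [measurable]: "(\<lambda>z. \<Psi> (fst z) (pr (snd z))) \<in> BM TB" by simp
  have "(\<lambda>z. alive (snd z) * \<Psi> (fst z) (pr (snd z))) \<in> BM TB" by measurable
  moreover have "\<Psi>' s y = alive y * \<Psi> s (pr y)" for s y by (cases y) (auto simp: \<Psi>'_def pr_def indicator_def)
  ultimately show ?thesis by simp
 qed
 have "(LI V. (LI s. G s V wrt dA V) wrt Pu (Some x)) = (LI V. (LI s. \<Psi>' s (State X s V) wrt dA V) wrt Pu (Some x))"
  by (rule strong_markov_AA[OF L G H GH]) (use \<Psi>'m H\<Psi> in \<open>simp_all add: split_beta' \<Psi>'_def\<close>)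
 also have "... = NN (\<lambda>z. \<Psi>' (fst z) (snd z)) (Some x)" by (simp add: NN_def)
 also have "... = (LI r. ind {0<..} r * (LI y. pd (ennreal r) x y * \<Psi> (ennreal r) y wrt \<mu>) wrt lborel)"
  unfolding NN_density[OF \<Psi>'m] by (simp add: \<Psi>'_def)
 finally show ?thesis .
qed

end

section \<open>Iteration\<close>

lemma sum_permutations_of_set:
 assumes "finite I" "I ~= {}"
 shows "(\<Sum>L\<in>permutations_of_set I. F L) = (\<Sum>i\<in>I. \<Sum>L\<in>permutations_of_set (I - {i}). F (i # L))"
proof -
 have "(\<Sum>L\<in>permutations_of_set I. F L) = (\<Sum>L\<in>(\<Union>i\<in>I. (#) i ` permutations_of_set (I - {i})). F L)"
  by (simp add: permutations_of_set_nonempty[OF assms(2)])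
 also have "... = (\<Sum>i\<in>I. \<Sum>L\<in>(#) i ` permutations_of_set (I - {i}). F L)"
  by (rule sum.UNION_disjoint) (use assms in auto)
 also have "... = (\<Sum>i\<in>I. \<Sum>L\<in>permutations_of_set (I - {i}). F (i # L))"
  by (intro sum.cong refl sum.reindex_cong[of "(#) _"]) auto
 finally show ?thesis .
qed

lemma path_density_Cons:
 "path_density Q (a # s # ts) (y # y' # ys) t z = Q (s - a) y (Some y') * path_density Q (s # ts) (y' # ys) t z"
 by (simp add: path_density_def prod.lessThan_Suc_shift mult.assoc del: prod.lessThan_Suc)

locale pcaf_family = hunt_setting X m p
 for X :: "('w, 's::{metric_space, second_countable_topology}) process" and m p +
 fixes A :: "nat => ennreal => 'w => ennreal" and \<mu> :: "nat => 's measure" and f :: "'s option => ennreal" and I0 :: "nat set"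
 assumes pcafs: "\<And>i. i \<in> I0 ==> PCAF_strict X (A i)" and revuzs: "\<And>i. i \<in> I0 ==> revuz_measure m X (A i) (\<mu> i)"
  and f: "f \<in> BM borel_cpt"
begin

lemma pcaf_i: "i \<in> I0 ==> pcaf_revuz X m p (A i) (\<mu> i)"
 by unfold_locales (use pcafs revuzs in auto)

abbreviation aa :: "nat => 'w => ennreal => ennreal" where "aa i V t \<equiv> extend_to_infinity (A i) t V"

lemma AA_aa:
 assumes "i \<in> I0"
 shows "pcaf.AA (A i) V = aa i V"
proof -
 interpret pcaf_revuz X m p "A i" "\<mu> i" by (rule pcaf_i[OF assms])
 show ?thesis by (rule ext) (rule AA_def)
qed

text \<open>The iterated integral for the factors in the order \<open>L\<close>, in the form in which the recursion
 produces it: \<open>t\<close> is the time that remains, and each increment \<open>r\<close> is subtracted from it.\<close>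

primrec J :: "nat list => ennreal => 's => ennreal"
 where
  "J [] t x = TT t f (Some x)"
 | "J (i # L) t x = (LI r. ind {0<..} r * (LI y. pd (ennreal r) x y *
   (ind {..<t} (ennreal r) * J L (t - ennreal r) y) wrt \<mu> i) wrt lborel)"

lemma sigma_finite_\<mu>i: "i \<in> I0 ==> sigma_finite_measure (\<mu> i)" and sets_\<mu>i: "i \<in> I0 ==> sets (\<mu> i) = sets borel"
 by (rule pcaf_revuz.sigma_finite_\<mu>[OF pcaf_i], assumption) (rule pcaf_revuz.sets_\<mu>[OF pcaf_i])

lemma J_measurable: "set L \<subseteq> I0 ==> (\<lambda>z. J L (fst z) (snd z)) \<in> BM (borel \<Otimes>\<^sub>M borel)"
proof (induction L)
 case Nil
 note [measurable] = f measurable_Some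
 show ?case by simp
next
 case (Cons i L)
 then have i: "i \<in> I0" and IH: "(\<lambda>z. J L (fst z) (snd z)) \<in> BM (borel \<Otimes>\<^sub>M borel)" by auto
 interpret N: sigma_finite_measure "\<mu> i" by (rule sigma_finite_\<mu>i[OF i])
 note [measurable_cong] = sets_\<mu>i[OF i]
 have J': "(\<lambda>v. J L (g v) (h v)) \<in> BM N" if "g \<in> BM N" "h \<in> N \<rightarrow>\<^sub>M borel" for g h and N :: "'q measure"
  using measurable_compose[OF measurable_Pair[OF that] IH] by simp
 have ind: "(\<lambda>v. ind {..<a v} (b v) :: ennreal) \<in> BM N"
  if [measurable]: "a \<in> BM N" "b \<in> BM N" for a b :: "'q => ennreal" and N :: "'q measure"
 proof -
  have "(\<lambda>v. if b v < a v then 1 else 0 :: ennreal) \<in> BM N" by measurable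
  then show ?thesis by (simp add: indicator_def of_bool_def)
 qed
 have m: "(\<lambda>v. pd (ennreal (snd (fst v))) (snd (fst (fst v))) (snd v) * (ind {..<fst (fst (fst v))} (ennreal (snd (fst v))) *
   J L (fst (fst (fst v)) - ennreal (snd (fst v))) (snd v))) \<in> BM (((borel \<Otimes>\<^sub>M borel) \<Otimes>\<^sub>M lborel) \<Otimes>\<^sub>M \<mu> i)"
  by (intro borel_measurable_times_ennreal ind J' pd_measurable') measurable
 have "(\<lambda>v. LI y. pd (ennreal (snd v)) (snd (fst v)) y * (ind {..<fst (fst v)} (ennreal (snd v)) *
   J L (fst (fst v) - ennreal (snd v)) y) wrt \<mu> i) \<in> BM ((borel \<Otimes>\<^sub>M borel) \<Otimes>\<^sub>M lborel)"
  by (rule N.borel_measurable_nn_integral) (use m in \<open>simp add: split_beta'\<close>)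
 then have "(\<lambda>(z, r). ind {0<..} r * (LI y. pd (ennreal r) (snd z) y * (ind {..<fst z} (ennreal r) *
   J L (fst z - ennreal r) y) wrt \<mu> i)) \<in> BM ((borel \<Otimes>\<^sub>M borel) \<Otimes>\<^sub>M lborel)"
  unfolding split_beta' by measurable
 from lborel.borel_measurable_nn_integral[OF this] show ?case by simp
qed

definition \<Phi> :: "nat set => ennreal => 's option => ennreal"
 where "\<Phi> I t x = (LI V. f (State X t V) * (\<Prod>i\<in>I. aa i V t) wrt Pu x)"

lemma aa_props:
 assumes i: "i \<in> I0"
 shows "V \<in> \<Omega> ==> clock (aa i V)" "AE V in Pu x. V \<in> pcaf.Lam X (A i)"
  "g \<in> BM N ==> h \<in> N \<rightarrow>\<^sub>M Fu ==> (\<lambda>z. aa i (h z) (g z)) \<in> BM N"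
  "g \<in> BM N ==> g' \<in> BM N ==> h \<in> N \<rightarrow>\<^sub>M Fu ==> (\<lambda>z. inc (aa i (h z)) (g z) (g' z)) \<in> BM N"
  "V \<in> pcaf.Lam X (A i) ==> s < top ==> s <= t ==> inc (aa i V) s t = aa i (Shift X s V) (t - s)"
  "V \<in> pcaf.Lam X (A i) ==> V \<in> \<Omega>"
proof -
 interpret pcaf_revuz X m p "A i" "\<mu> i" by (rule pcaf_i[OF i])
 show "V \<in> \<Omega> ==> clock (aa i V)" using clock_AA[of V] by (simp add: AA_aa[OF i])
 show "AE V in Pu x. V \<in> Lam" by (rule AE_Lam)
 show "g \<in> BM N ==> h \<in> N \<rightarrow>\<^sub>M Fu ==> (\<lambda>z. aa i (h z) (g z)) \<in> BM N"
  using AA_joint'[of g N h] by (simp add: AA_aa[OF i])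
 show "g \<in> BM N ==> g' \<in> BM N ==> h \<in> N \<rightarrow>\<^sub>M Fu ==> (\<lambda>z. inc (aa i (h z)) (g z) (g' z)) \<in> BM N"
  using inc_joint[of g N g' h] by (simp add: AA_aa[OF i])
 show "V \<in> Lam ==> s < top ==> s <= t ==> inc (aa i V) s t = aa i (Shift X s V) (t - s)"
  using inc_shift[of V s t] by (simp add: AA_aa[OF i])
 show "V \<in> Lam ==> V \<in> \<Omega>" using Lam_Omega by blast
qed

text \<open>The product rule singles out the index whose clock ticks first; the remaining factors refer to
 the path after that time.\<close>

lemma moment_recursion:
 assumes I: "I \<subseteq> I0" "finite I" "I ~= {}"
  and IH: "\<And>i t y. i \<in> I ==> \<Phi> (I - {i}) t (Some y) = (\<Sum>L\<in>permutations_of_set (I - {i}). J L t y)"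
 shows "\<Phi> I t (Some x) = (\<Sum>L\<in>permutations_of_set I. J L t x)"
proof -
 have fS[measurable]: "(\<lambda>V. f (State X s V)) \<in> BM Fu" for s
  using measurable_compose[OF State_Fil[OF top_greatest] f] by simp
 define G where "G i s V = ind {0..<t} s * (f (State X t V) * (\<Prod>l\<in>I - {i}. inc (aa l V) s t))" for i s V
 have Gm: "(\<lambda>(s, V). G i s V) \<in> BM (TF)" for i
 proof -
  have "(\<lambda>z. inc (aa l (snd z)) (fst z) t) \<in> BM (TF)" if "l \<in> I - {i}" for l
   by (rule aa_props(4)) (use I that in auto)
  then show ?thesis unfolding G_def split_beta' by (intro borel_measurable_times_ennreal borel_measurable_prod_ennreal) measurable
 qed
 have "\<Phi> I t (Some x) = (LI V. (\<Sum>i\<in>I. LI s. G i s V wrt dclock (aa i V)) wrt Pu (Some x))"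
  unfolding \<Phi>_def
 proof (rule nn_integral_cong)
  fix V assume "V \<in> space (Pu (Some x))"
  then have o: "V \<in> \<Omega>" by simp
  have c: "clock (aa i V)" if "i \<in> I" for i using that I o by (intro aa_props(1)) auto
  have "(\<Prod>i\<in>I. aa i V t) = (\<Prod>i\<in>I. inc (aa i V) 0 t)" by (intro prod.cong refl) (simp add: inc_0 c)
  also have "... = (\<Sum>i\<in>I. LI s. ind {0..<t} s * (\<Prod>l\<in>I - {i}. inc (aa l V) s t) wrt dclock (aa i V))"
   by (rule prod_inc[OF I(2,3) c])
  also have "f (State X t V) * ... = (\<Sum>i\<in>I. LI s. G i s V wrt dclock (aa i V))"
   unfolding sum_distrib_left
  proof (rule sum.cong[OF refl])
   fix i assume i: "i \<in> I"
   have "(\<lambda>s. inc (aa l V) s t) \<in> BM borel" if "l \<in> I - {i}" for l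
    by (rule inc_measurable[OF c]) (use that in auto)
   then have "(\<lambda>s. ind {0..<t} s * (\<Prod>l\<in>I - {i}. inc (aa l V) s t)) \<in> BM (dclock (aa i V))"
    by (auto intro!: borel_measurable_times_ennreal borel_measurable_prod_ennreal)
   from nn_integral_cmult[OF this, of "f (State X t V)"]
   show "f (State X t V) * (LI s. ind {0..<t} s * (\<Prod>l\<in>I - {i}. inc (aa l V) s t) wrt dclock (aa i V)) =
     (LI s. G i s V wrt dclock (aa i V))" unfolding G_def by (simp only: mult.left_commute)
  qed
  finally show "f (State X t V) * (\<Prod>i\<in>I. aa i V t) = (\<Sum>i\<in>I. LI s. G i s V wrt dclock (aa i V))" .
 qed
 also have "... = (\<Sum>i\<in>I. LI V. (LI s. G i s V wrt dclock (aa i V)) wrt Pu (Some x))"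
 proof (rule nn_integral_sum)
  fix i assume "i \<in> I"
  then have i: "i \<in> I0" using I by auto
  interpret pcaf_revuz X m p "A i" "\<mu> i" by (rule pcaf_i[OF i])
  show "(\<lambda>V. LI s. G i s V wrt dclock (aa i V)) \<in> BM (Pu (Some x))"
   using nn_integral_AA_measurable[OF Gm, of "\<lambda>V. V"] by (simp add: AA_aa[OF i] cong: measurable_cong_sets)
 qed
 also have "... = (\<Sum>i\<in>I. \<Sum>L\<in>permutations_of_set (I - {i}). J (i # L) t x)"
 proof (rule sum.cong[OF refl])
  fix i assume iI: "i \<in> I"
  then have i: "i \<in> I0" using I by auto
  interpret pcaf_revuz X m p "A i" "\<mu> i" by (rule pcaf_i[OF i])
  let ?P = "permutations_of_set (I - {i})"
  have P: "set L \<subseteq> I0" if "L \<in> ?P" for L using that I by (auto simp: permutations_of_set_def)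
  define H where "H s V = ind {0..<t} s * (f (State X (t - s) V) * (\<Prod>l\<in>I - {i}. aa l V (t - s)))" for s V
  define \<Psi> where "\<Psi> s y = ind {..<t} s * (\<Sum>L\<in>?P. J L (t - s) y)" for s y
  define L where "L = (\<Inter>l\<in>I. pcaf.Lam X (A l))"
  have LAE: "AE V in Pu (Some x). V \<in> L"
   unfolding L_def INT_iff
  proof (rule AE_finite_allI[OF I(2)])
   fix l assume "l \<in> I"
   then show "AE V in Pu (Some x). V \<in> pcaf.Lam X (A l)" using I by (intro aa_props(2)) auto
  qed
  have fS': "(\<lambda>z. f (State X (t - fst z) (snd z))) \<in> BM (TF)"
   using f by measurable
  have Hm: "(\<lambda>(s, V). H s V) \<in> BM (TF)"
  proof -
   have "(\<lambda>z. aa l (snd z) (t - fst z)) \<in> BM (TF)" if "l \<in> I - {i}" for l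
   proof (rule aa_props(3))
    show "l \<in> I0" using I that by auto
   qed measurable
   then show ?thesis unfolding H_def split_beta'
    by (intro borel_measurable_times_ennreal borel_measurable_prod_ennreal fS') measurable
  qed
  have Jm: "(\<lambda>z. J L (t - fst z) (snd z)) \<in> BM (borel \<Otimes>\<^sub>M borel)" if "L \<in> ?P" for L
  proof -
   have "(\<lambda>z. (t - fst z, snd z)) \<in> (borel \<Otimes>\<^sub>M borel :: (ennreal \<times> 's) measure) \<rightarrow>\<^sub>M borel \<Otimes>\<^sub>M borel" by measurable
   from measurable_compose[OF this J_measurable[OF P[OF that]]] show ?thesis by simp
  qed
  have \<Psi>m: "(\<lambda>(s, y). \<Psi> s y) \<in> BM (borel \<Otimes>\<^sub>M borel)"
   unfolding \<Psi>_def split_beta' by (intro borel_measurable_times_ennreal borel_measurable_sum Jm) measurable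
  have "(LI V. (LI s. G i s V wrt dA V) wrt Pu (Some x)) =
    (LI r. ind {0<..} r * (LI y. pd (ennreal r) x y * \<Psi> (ennreal r) y wrt \<mu> i) wrt lborel)"
  proof (rule clock_integral_density[OF LAE Gm Hm _ \<Psi>m])
   fix s :: ennreal and V assume o: "V \<in> L" and s: "s < top"
   have oO: "V \<in> \<Omega>" using o iI aa_props(6)[OF i] by (auto simp: L_def)
   show "G i s V = H s (Shift X s V)"
   proof (cases "s < t")
    case True
    have "inc (aa l V) s t = aa l (Shift X s V) (t - s)" if "l \<in> I - {i}" for l
     using o that I True s by (intro aa_props(5)) (auto simp: L_def less_imp_le)
    then have "(\<Prod>l\<in>I - {i}. inc (aa l V) s t) = (\<Prod>l\<in>I - {i}. aa l (Shift X s V) (t - s))" by (intro prod.cong refl)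
    moreover have "State X (t - s) (Shift X s V) = State X t V"
     using True by (simp add: State_Shift[OF oO] diff_add_cancel_ennreal)
    ultimately show ?thesis by (simp add: G_def H_def)
   qed (simp add: G_def H_def)
  next
   fix s :: ennreal and y
   have "(\<lambda>V. aa l V (t - s)) \<in> BM Fu" if "l \<in> I - {i}" for l
    using I that by (intro aa_props(3)) auto
   then have "(\<lambda>V. f (State X (t - s) V) * (\<Prod>l\<in>I - {i}. aa l V (t - s))) \<in> BM Fu"
    by (intro borel_measurable_times_ennreal borel_measurable_prod_ennreal fS) auto
   then have "(LI V. H s V wrt Pu (Some y)) = ind {0..<t} s * \<Phi> (I - {i}) (t - s) (Some y)"
    unfolding H_def \<Phi>_def by (intro nn_integral_cmult) (simp cong: measurable_cong_sets)
   then show "(LI V. H s V wrt Pu (Some y)) = \<Psi> s y"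
    unfolding IH[OF iI] \<Psi>_def by (simp add: indicator_def)
  qed
  also have "... = (LI r. (\<Sum>L\<in>?P. ind {0<..} r * (LI y. pd (ennreal r) x y * (ind {..<t} (ennreal r) * J L (t - ennreal r) y) wrt \<mu> i)) wrt lborel)"
  proof (rule nn_integral_cong)
   fix r :: real
   have m: "(\<lambda>y. pd (ennreal r) x y * (ind {..<t} (ennreal r) * J L (t - ennreal r) y)) \<in> BM (\<mu> i)" if "L \<in> ?P" for L
   proof -
    have "(\<lambda>y. (ennreal r, y)) \<in> \<mu> i \<rightarrow>\<^sub>M borel \<Otimes>\<^sub>M borel" by measurable
    from measurable_compose[OF this Jm[OF that]] have [measurable]: "(\<lambda>y. J L (t - ennreal r) y) \<in> BM (\<mu> i)" by simp
    show ?thesis by measurable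
   qed
   have "(LI y. pd (ennreal r) x y * \<Psi> (ennreal r) y wrt \<mu> i) =
     (LI y. (\<Sum>L\<in>?P. pd (ennreal r) x y * (ind {..<t} (ennreal r) * J L (t - ennreal r) y)) wrt \<mu> i)"
    unfolding \<Psi>_def sum_distrib_left ..
   also have "... = (\<Sum>L\<in>?P. LI y. pd (ennreal r) x y * (ind {..<t} (ennreal r) * J L (t - ennreal r) y) wrt \<mu> i)"
    by (rule nn_integral_sum[OF m])
   finally show "ind {0<..} r * (LI y. pd (ennreal r) x y * \<Psi> (ennreal r) y wrt \<mu> i) =
     (\<Sum>L\<in>?P. ind {0<..} r * (LI y. pd (ennreal r) x y * (ind {..<t} (ennreal r) * J L (t - ennreal r) y) wrt \<mu> i))"
    by (simp add: sum_distrib_left)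
  qed
  also have "... = (\<Sum>L\<in>?P. J (i # L) t x)"
   unfolding J.simps
  proof (rule nn_integral_sum)
   fix L assume L: "L \<in> ?P"
   have "(\<lambda>v. (ennreal (fst v), snd v)) \<in> lborel \<Otimes>\<^sub>M \<mu> i \<rightarrow>\<^sub>M borel \<Otimes>\<^sub>M borel" by measurable
   from measurable_compose[OF this Jm[OF L]]
   have [measurable]: "(\<lambda>v. J L (t - ennreal (fst v)) (snd v)) \<in> BM (lborel \<Otimes>\<^sub>M \<mu> i)" by simp
   have "(\<lambda>(r, y). pd (ennreal r) x y * (ind {..<t} (ennreal r) * J L (t - ennreal r) y)) \<in> BM (lborel \<Otimes>\<^sub>M \<mu> i)"
    unfolding split_beta' by measurable
   from \<mu>.borel_measurable_nn_integral[OF this]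
   show "(\<lambda>r. ind {0<..} r * (LI y. pd (ennreal r) x y * (ind {..<t} (ennreal r) * J L (t - ennreal r) y) wrt \<mu> i)) \<in> BM lborel"
    by measurable
  qed
  finally show "(LI V. (LI s. G i s V wrt dclock (aa i V)) wrt Pu (Some x)) = (\<Sum>L\<in>?P. J (i # L) t x)"
   by (simp add: AA_aa[OF i])
 qed
 also have "... = (\<Sum>L\<in>permutations_of_set I. J L t x)" by (rule sum_permutations_of_set[symmetric, OF I(2,3)])
 finally show ?thesis .
qed

theorem moment_formula:
 assumes "finite I" "I \<subseteq> I0"
 shows "\<Phi> I t (Some x) = (\<Sum>L\<in>permutations_of_set I. J L t x)"
 using assms
proof (induction "card I" arbitrary: I t x)
 case 0
 then show ?case by (simp add: \<Phi>_def TT_def)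
next
 case (Suc n)
 show ?case
 proof (rule moment_recursion)
  show "I ~= {}" using Suc.hyps(2) by auto
  fix i t y assume "i \<in> I"
  then have "card (I - {i}) = n" using Suc.hyps(2) Suc.prems by simp
  then show "\<Phi> (I - {i}) t (Some y) = (\<Sum>L\<in>permutations_of_set (I - {i}). J L t y)"
   using Suc.prems by (intro Suc.hyps(1)) auto
 qed (use Suc.prems in auto)
qed

lemma J_section [measurable (raw)]:
 assumes "set L \<subseteq> I0" "g \<in> BM N" "h \<in> N \<rightarrow>\<^sub>M borel"
 shows "(\<lambda>v. J L (g v) (h v)) \<in> BM N"
 using measurable_compose[OF measurable_Pair[OF assms(2,3)] J_measurable[OF assms(1)]] by simp

subsection \<open>Comparison with iterated integrals of path densities\<close>

text \<open>The functional on the right is additive and continuous, so it is integration against a measure, and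
 that measure agrees with \<open>extended_measure m\<close> on sets.\<close>

lemma nn_integral_extended:
 assumes "\<phi> \<in> BM borel_cpt"
 shows "(LI z. \<phi> z wrt extended_measure m) = (LI y. \<phi> (Some y) wrt m) + \<phi> None"
proof -
 have S: "(\<lambda>y. g (Some y)) \<in> BM m" if "g \<in> BM borel_cpt" for g :: "'s option => ennreal"
  using measurable_compose[OF measurable_Some that] by simp
 have "\<exists>N. sets N = sets (borel_cpt :: 's option measure) \<and>
   (\<forall>f\<in>BM borel_cpt. (LI z. f z wrt N) = (LI y. f (Some y) wrt m) + f None)"
 proof (rule functional_is_integral)
  fix F :: "nat => 's option => ennreal" assume F: "\<And>i. F i \<in> BM borel_cpt" "incseq F"
  have "(LI y. (SUP i. F i (Some y)) wrt m) = (SUP i. LI y. F i (Some y) wrt m)"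
   using F by (intro nn_integral_monotone_convergence_SUP S) (auto simp: incseq_def le_fun_def)
  then show "(LI y. (SUP i. F i (Some y)) wrt m) + (SUP i. F i None) = (SUP i. (LI y. F i (Some y) wrt m) + F i None)"
   using F(2) by (subst ennreal_SUP_add) (auto simp: incseq_def le_fun_def intro!: nn_integral_mono)
 qed (simp_all add: S nn_integral_add nn_integral_cmult distrib_left add_ac)
 then obtain N where sN: "sets N = sets (borel_cpt :: 's option measure)"
  and N: "\<And>f. f \<in> BM borel_cpt ==> (LI z. f z wrt N) = (LI y. f (Some y) wrt m) + f None" by blast
 have sp: "space N = UNIV" using sets_eq_imp_space_eq[OF sN] by simp
 have "extended_measure m = measure_of UNIV (sets borel_cpt) (emeasure N)"
  unfolding extended_measure_def
 proof (rule measure_of_eq)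
  show "sets (borel_cpt :: 's option measure) \<subseteq> Pow UNIV" by simp
  fix B :: "'s option set" assume "B \<in> sigma_sets UNIV (sets borel_cpt)"
  then have B: "B \<in> sets borel_cpt" using sets.sigma_sets_eq[of "borel_cpt :: 's option measure"] by simp
  have "emeasure N B = (LI z. ind B z wrt N)" using B sN by simp
  also have "... = (LI y. ind (Some -` B) y wrt m) + ind B None"
  proof -
   have "(\<lambda>y. ind B (Some y)) = (ind (Some -` B) :: 's => ennreal)" by (auto simp: fun_eq_iff indicator_def)
   then show ?thesis using B by (subst N) simp_all
  qed
  also have "(LI y. ind (Some -` B) y wrt m) = emeasure m (Some -` B)"
   using B by (intro nn_integral_indicator) (simp add: sets_borel_cpt_iff)
  finally show "emeasure m (Some -` B) + ind B None = emeasure N B" by simp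
 qed
 also have "... = N" using measure_of_of_measure[of N] by (simp add: sp sN)
 finally show ?thesis using N[OF assms] by simp
qed

abbreviation q where "q \<equiv> extended_density m p"

lemma q_Some: "0 < s ==> s < top ==> q s y (Some z) = pd s y z"
 by (simp add: extended_density_def pd_def)

lemma q_measurable: "0 < s ==> q s y \<in> BM borel_cpt"
proof (rule measurable_from_borel_cpt)
 assume s: "0 < s"
 show "(\<lambda>z. q s y (Some z)) \<in> BM borel"
 proof (cases "s = top")
  case True
  then show ?thesis by (simp add: extended_density_def indicator_def)
 next
  case False
  then have "s < top" by (simp add: less_top)
  then show ?thesis by (simp add: q_Some[OF s])
 qed
qed simp

text \<open>The extended density also gives the mass at the cemetery, so it represents $E_y[f(X_s)]$ for all
 \<open>f\<close>; at time $\infty$ the process sits at the cemetery.\<close>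

lemma q_last:
 assumes s: "0 < s"
 shows "(LI z. q s y z * f z wrt extended_measure m) = TT s f (Some y)"
proof -
 have "(LI z. q s y z * f z wrt extended_measure m) = (LI z. q s y (Some z) * f (Some z) wrt m) + q s y None * f None"
  by (rule nn_integral_extended) (intro borel_measurable_times_ennreal q_measurable s f)
 also have "... = TT s f (Some y)"
 proof (cases "s = top")
  case True
  interpret prob_space "Pu (Some y)" by (rule prob_Pu)
  have "TT s f (Some y) = (LI V. f None wrt Pu (Some y))"
   unfolding TT_def by (intro nn_integral_cong) (simp add: True State_top)
  then show ?thesis using emeasure_space_1 by (simp add: True extended_density_def)
 next
  case False
  then have "s < top" by (simp add: less_top)
  then have "pd s y = p s y" using s by (auto simp: pd_def)
  then show ?thesis unfolding transition_borel[OF s \<open>s < top\<close> f] using False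
   by (simp add: extended_density_def)
 qed
 finally show ?thesis .
qed

text \<open>The iterated spatial integral for fixed times, evaluated from the last factor backwards.\<close>

primrec S :: "ennreal => nat list => ennreal => ennreal list => 's => ennreal"
 where
  "S t [] a ts y = TT (t - a) f (Some y)"
 | "S t (i # L) a ts y = (LI y'. pd (hd ts - a) y y' * S t L (hd ts) (tl ts) y' wrt \<mu> i)"

lemma S_measurable: "set L \<subseteq> I0 ==> S t L a ts \<in> BM borel"
proof (induction L arbitrary: a ts)
 case Nil
 note [measurable] = f measurable_Some
 show ?case by simp
next
 case (Cons i L)
 then have i: "i \<in> I0" and [measurable]: "S t L (hd ts) (tl ts) \<in> BM borel" by auto
 interpret N: sigma_finite_measure "\<mu> i" by (rule sigma_finite_\<mu>i[OF i])
 note [measurable_cong] = sets_\<mu>i[OF i]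
 have "(\<lambda>(y, y'). pd (hd ts - a) y y' * S t L (hd ts) (tl ts) y') \<in> BM (borel \<Otimes>\<^sub>M \<mu> i)"
  unfolding split_beta' by measurable
 from N.borel_measurable_nn_integral[OF this] show ?case by simp
qed

lemma path_density_measurable:
 assumes "last ts < t"
 shows "(\<lambda>z. path_density q ts ys t z) \<in> BM borel_cpt"
proof -
 have [measurable]: "q (t - last ts) (last ys) \<in> BM borel_cpt"
  by (rule q_measurable) (use assms in \<open>simp add: diff_gr0_ennreal\<close>)
 show ?thesis unfolding path_density_def by measurable
qed

text \<open>The constant \<open>c\<close> collects the densities that have been pulled out of the inner integrals.\<close>

lemma space_integral_path_density:
 assumes "set L \<subseteq> I0" "length ts = length L" "sorted_wrt (<) (a # ts)" "\<forall>s\<in>set (a # ts). s < t"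
 shows "space_integral (map \<mu> L) (\<lambda>ys. c * (LI z. path_density q (a # ts) (y # ys) t z * f z wrt extended_measure m)) = c * S t L a ts y"
 using assms
proof (induction L arbitrary: a ts y c)
 case Nil
 then have "0 < t - a" by (simp add: diff_gr0_ennreal)
 then show ?case using Nil by (simp add: path_density_def q_last)
next
 case (Cons i L)
 then obtain s ts' where ts: "ts = s # ts'" by (cases ts) auto
 have i: "i \<in> I0" using Cons by simp
 have as: "a < s" "s < t" using Cons.prems ts by auto
 then have sa: "0 < s - a" "s - a < top"
  by (auto simp: diff_gr0_ennreal intro: le_less_trans[OF diff_le_self_ennreal] less_le_trans)
 note [measurable] = S_measurable[of L t s ts']
 have Sm: "(\<lambda>y'. pd (s - a) y y' * S t L s ts' y') \<in> BM (\<mu> i)"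
 proof -
  note [measurable_cong] = sets_\<mu>i[OF i]
  have [measurable]: "S t L s ts' \<in> BM borel" by (rule S_measurable) (use Cons.prems in simp)
  show ?thesis by measurable
 qed
 have lt: "last (s # ts') < t" using Cons.prems ts by (auto dest: last_in_set split: if_splits)
 have "space_integral (map \<mu> (i # L)) (\<lambda>ys. c * (LI z. path_density q (a # ts) (y # ys) t z * f z wrt extended_measure m)) =
   (LI y'. space_integral (map \<mu> L) (\<lambda>ys. (c * pd (s - a) y y') * (LI z. path_density q (s # ts') (y' # ys) t z * f z wrt extended_measure m)) wrt \<mu> i)"
 proof -
  have "(LI z. path_density q (a # ts) (y # y' # ys) t z * f z wrt extended_measure m) =
    pd (s - a) y y' * (LI z. path_density q (s # ts') (y' # ys) t z * f z wrt extended_measure m)" for y' ys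
  proof -
   have "(\<lambda>z. path_density q (s # ts') (y' # ys) t z * f z) \<in> BM (extended_measure m)"
   proof -
    have "sets (extended_measure m) = sets (borel_cpt :: 's option measure)"
     using sets.sigma_sets_eq[of "borel_cpt :: 's option measure"] by (simp add: extended_measure_def)
    note c = measurable_cong_sets[OF this refl]
    show ?thesis unfolding c
     by (intro borel_measurable_times_ennreal path_density_measurable lt f)
   qed
   from nn_integral_cmult[OF this] show ?thesis
    unfolding ts path_density_Cons q_Some[OF sa] by (simp add: mult.assoc)
  qed
  then show ?thesis by (simp add: mult.assoc)
 qed
 also have "... = (LI y'. (c * pd (s - a) y y') * S t L s ts' y' wrt \<mu> i)"
  using Cons.prems ts by (intro nn_integral_cong Cons.IH) auto
 also have "... = c * S t (i # L) a ts y"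
  using nn_integral_cmult[OF Sm] by (simp add: ts mult.assoc)
 finally show ?case .
qed

lemma time_integral_cong:
 assumes "\<And>ts. length ts = k ==> sorted_wrt (<) (a # ts) ==> \<forall>s\<in>set ts. s < t ==> G ts = G' ts"
 shows "time_integral k a t G = time_integral k a t G'"
 using assms
proof (induction k arbitrary: a G G')
 case (Suc k)
 have "time_integral k (ennreal s) t (\<lambda>ts. G (ennreal s # ts)) = time_integral k (ennreal s) t (\<lambda>ts. G' (ennreal s # ts))"
  if s: "a < ennreal s" "ennreal s < t" for s
 proof (rule Suc.IH)
  fix ts assume ts: "length ts = k" "sorted_wrt (<) (ennreal s # ts)" "\<forall>s\<in>set ts. s < t"
  have "\<forall>u\<in>set ts. a < u" using ts(2) s(1) by (auto intro: less_trans)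
  then show "G (ennreal s # ts) = G' (ennreal s # ts)" using ts s by (intro Suc.prems) auto
 qed
 then show ?case by (auto intro!: nn_integral_cong simp: indicator_def)
qed simp

lemma nn_integral_kernel_swap:
 assumes "sigma_finite_measure N" "sigma_finite_measure N'" "sets N = sets borel" "sets N' = sets borel"
  and [measurable]: "c \<in> BM borel" "h \<in> BM borel"
   "(\<lambda>z. g (fst z) (snd z)) \<in> BM (borel \<Otimes>\<^sub>M borel)"
 shows "(LI y. c y * (LI y'. g y y' * h y' wrt N') wrt N) = (LI y'. (LI y. c y * g y y' wrt N) * (h y' :: ennreal) wrt (N' :: 's measure))"
proof -
 interpret pair_sigma_finite N N' by (rule pair_sigma_finite.intro) fact+
 note [measurable_cong] = assms(3,4)
 have gm: "(\<lambda>y'. g y y') \<in> BM N'" "(\<lambda>y. g y y') \<in> BM N" for y y'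
 proof -
  have "(\<lambda>y'. (y, y')) \<in> N' \<rightarrow>\<^sub>M borel \<Otimes>\<^sub>M borel" "(\<lambda>y. (y, y')) \<in> N \<rightarrow>\<^sub>M borel \<Otimes>\<^sub>M borel" by measurable
  from this[THEN measurable_compose, OF assms(7)] show "(\<lambda>y'. g y y') \<in> BM N'" "(\<lambda>y. g y y') \<in> BM N"
   by simp_all
 qed
 note [measurable] = gm
 have "(LI y. c y * (LI y'. g y y' * h y' wrt N') wrt N) = (LI y. LI y'. c y * (g y y' * h y') wrt N' wrt N)"
  by (intro nn_integral_cong nn_integral_cmult[symmetric]) measurable
 also have "... = (LI y'. LI y. c y * (g y y' * h y') wrt N wrt N')"
  by (rule Fubini'[symmetric]) (unfold split_beta', measurable)
 also have "... = (LI y'. (LI y. c y * g y y' wrt N) * h y' wrt N')"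
  by (intro nn_integral_cong) (simp add: mult.assoc[symmetric] nn_integral_multc)
 finally show ?thesis .
qed

text \<open>Integrating against a weight \<open>c\<close> and a measure \<open>N\<close> in the starting point lets the induction
 absorb the first transition density.\<close>

lemma time_integral_S:
 assumes "set L \<subseteq> I0" "sigma_finite_measure N" "sets N = sets borel" "c \<in> BM borel" "a < t"
 shows "time_integral (length L) a t (\<lambda>ts. LI y. c y * S t L a ts y wrt N) = (LI y. c y * J L (t - a) y wrt N)"
 using assms
proof (induction L arbitrary: N c a)
 case (Cons i L)
 then have i: "i \<in> I0" and L: "set L \<subseteq> I0" by auto
 note sf = sigma_finite_\<mu>i[OF i] and si = sets_\<mu>i[OF i]
 interpret N: sigma_finite_measure N by fact
 interpret \<mu>i: sigma_finite_measure "\<mu> i" by (rule sf)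
 interpret LN: pair_sigma_finite lborel N ..
 note [measurable_cong] = Cons.prems(3) si
 note [measurable] = Cons.prems(4)
 note [measurable] = J_section[OF L]
 obtain a' where a': "a = ennreal a'" "0 <= a'" using Cons.prems(5) by (cases a) auto
 define Q where "Q r y = (LI y'. pd (ennreal r) y y' * (ind {..<t - a} (ennreal r) * J L (t - a - ennreal r) y') wrt \<mu> i)" for r y
 have Qm: "(\<lambda>z. Q (fst z) (snd z)) \<in> BM (borel \<Otimes>\<^sub>M borel)"
 proof -
  have "(\<lambda>(z, y'). pd (ennreal (fst z)) (snd z) y' * (ind {..<t - a} (ennreal (fst z)) * J L (t - a - ennreal (fst z)) y'))
    \<in> BM ((borel \<Otimes>\<^sub>M borel) \<Otimes>\<^sub>M \<mu> i)" unfolding split_beta' by measurable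
  from \<mu>i.borel_measurable_nn_integral[OF this] show ?thesis by (simp add: Q_def)
 qed
 have step: "time_integral (length L) (ennreal s) t (\<lambda>ts. LI y. c y * S t (i # L) a (ennreal s # ts) y wrt N) =
   (LI y. c y * Q (s - a') y wrt N)" if s: "a < ennreal s" "ennreal s < t" for s
 proof -
  have s': "a' < s" "0 < s" using s(1) a' by (auto simp: ennreal_less_iff intro: le_less_trans)
  define c' where "c' y' = (LI y. c y * pd (ennreal s - a) y y' wrt N)" for y'
  have c': "c' \<in> BM borel"
  proof -
   have "(\<lambda>(y', y). c y * pd (ennreal s - a) y y') \<in> BM (borel \<Otimes>\<^sub>M N)" unfolding split_beta' by measurable
   from N.borel_measurable_nn_integral[OF this] show ?thesis by (simp add: c'_def[abs_def])
  qed
  have swap: "(LI y. c y * (LI y'. pd (ennreal s - a) y y' * h y' wrt \<mu> i) wrt N) = (LI y'. c' y' * h y' wrt \<mu> i)"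
   if "h \<in> BM borel" for h
   unfolding c'_def by (rule nn_integral_kernel_swap) (use Cons.prems sf si that in measurable)
  have Jm: "(\<lambda>y'. J L (t - ennreal s) y') \<in> BM borel" by measurable
  have "time_integral (length L) (ennreal s) t (\<lambda>ts. LI y. c y * S t (i # L) a (ennreal s # ts) y wrt N) =
    time_integral (length L) (ennreal s) t (\<lambda>ts. LI y'. c' y' * S t L (ennreal s) ts y' wrt \<mu> i)"
   by (simp add: swap[OF S_measurable[OF L]])
  also have "... = (LI y'. c' y' * J L (t - ennreal s) y' wrt \<mu> i)" by (rule Cons.IH[OF L sf si c' s(2)])
  also have "... = (LI y. c y * (LI y'. pd (ennreal s - a) y y' * J L (t - ennreal s) y' wrt \<mu> i) wrt N)"
   by (rule swap[OF Jm, symmetric])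
  also have "... = (LI y. c y * Q (s - a') y wrt N)"
  proof -
   have 1: "ennreal s - a = ennreal (s - a')" using a' by (simp add: ennreal_minus)
   have 2: "t - ennreal s = t - a - ennreal (s - a')"
   proof (cases t)
    case (real t')
    then show ?thesis using a' s' s by (simp add: ennreal_minus ennreal_less_iff)
   qed (simp add: a')
   have 3: "ennreal (s - a') < t - a"
   proof (cases t)
    case (real t')
    then show ?thesis using a' s' s by (simp add: ennreal_minus ennreal_less_iff)
   qed (simp add: a')
   show ?thesis unfolding Q_def 1 2 using 3 by simp
  qed
  finally show ?thesis .
 qed
 have Qc: "(\<lambda>z. c (snd z) * Q (fst z) (snd z)) \<in> BM (borel \<Otimes>\<^sub>M borel)"
  using Qm by measurable
 have Qc1: "(\<lambda>r. LI y. c y * Q r y wrt N) \<in> BM borel"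
 proof -
  have "(\<lambda>(r, y). c y * Q r y) \<in> BM (borel \<Otimes>\<^sub>M N)" using Qc by (simp add: split_beta' cong: measurable_cong_sets)
  from N.borel_measurable_nn_integral[OF this] show ?thesis by simp
 qed
 have Qr: "(\<lambda>y. Q r y) \<in> BM N" "(\<lambda>r. Q r y) \<in> BM lborel" for r y
 proof -
  have "(\<lambda>y. (r, y)) \<in> N \<rightarrow>\<^sub>M borel \<Otimes>\<^sub>M borel" "(\<lambda>r. (r, y)) \<in> lborel \<rightarrow>\<^sub>M borel \<Otimes>\<^sub>M borel" by measurable
  from this[THEN measurable_compose, OF Qm] show "(\<lambda>y. Q r y) \<in> BM N" "(\<lambda>r. Q r y) \<in> BM lborel" by simp_all
 qed
 note [measurable] = Qc1 Qr
 have "time_integral (length (i # L)) a t (\<lambda>ts. LI y. c y * S t (i # L) a ts y wrt N) =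
   (LI s. ind {0<..} (- a' + s) * (LI y. c y * Q (- a' + s) y wrt N) wrt lborel)"
  unfolding length_Cons time_integral.simps
 proof (rule nn_integral_cong)
  fix s :: real
  show "time_integral (length L) (ennreal s) t (\<lambda>ts. LI y. c y * S t (i # L) a (ennreal s # ts) y wrt N) * ind {s. a < ennreal s \<and> ennreal s < t} s =
    ind {0<..} (- a' + s) * (LI y. c y * Q (- a' + s) y wrt N)"
  proof (cases "a' < s")
   case True
   then have as: "a < ennreal s" using a' by (simp add: ennreal_less_iff)
   show ?thesis
   proof (cases "ennreal s < t")
    case True
    then show ?thesis using step[OF as True] as \<open>a' < s\<close> by simp
   next
    case False
    have "\<not> ennreal (s - a') < t - a"
    proof (cases t)
     case (real t')
     then show ?thesis using a' \<open>a' < s\<close> False by (simp add: ennreal_minus ennreal_less_iff not_less)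
    qed (use False in simp)
    then have "Q (s - a') y = 0" for y by (simp add: Q_def)
    then show ?thesis using False by simp
   qed
  next
   case False
   then have "\<not> a < ennreal s" using a' by (simp add: ennreal_leI not_less)
   then show ?thesis using False by simp
  qed
 qed
 also have "... = (LI r. ind {0<..} r * (LI y. c y * Q r y wrt N) wrt lborel)"
  by (rule nn_integral_lborel_translate) measurable
 also have "... = (LI r. LI y. c y * (ind {0<..} r * Q r y) wrt N wrt lborel)"
  by (intro nn_integral_cong) (simp add: nn_integral_cmult[symmetric] mult.left_commute)
 also have "... = (LI y. LI r. c y * (ind {0<..} r * Q r y) wrt lborel wrt N)"
  by (rule LN.Fubini'[symmetric]) (use Qm in \<open>unfold split_beta', measurable\<close>)
 also have "... = (LI y. c y * J (i # L) (t - a) y wrt N)"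
  by (intro nn_integral_cong) (simp add: nn_integral_cmult Q_def[symmetric])
 finally show ?case .
qed simp

lemma J_eq_iterated:
 assumes L: "set L \<subseteq> I0" and t: "0 < t"
 shows "time_integral (length L) 0 t (\<lambda>ts. space_integral (map \<mu> L) (\<lambda>ys.
   LI z. path_density q (0 # ts) (x # ys) t z * f z wrt extended_measure m)) = J L t x"
proof -
 have ret: "(LI y. h y wrt return borel x) = h x" for h :: "'s => ennreal" by (rule nn_integral_return_any) auto
 have "time_integral (length L) 0 t (\<lambda>ts. space_integral (map \<mu> L) (\<lambda>ys.
   LI z. path_density q (0 # ts) (x # ys) t z * f z wrt extended_measure m)) =
   time_integral (length L) 0 t (\<lambda>ts. LI y. 1 * S t L 0 ts y wrt return borel x)"
  using t space_integral_path_density[OF L, of _ 0 t 1 x] by (intro time_integral_cong) (simp add: ret)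
 also have "... = (LI y. 1 * J L (t - 0) y wrt return borel x)"
  by (rule time_integral_S[OF L]) (simp_all add: t prob_space_imp_sigma_finite prob_space_return)
 finally show ?thesis by (simp add: ret)
qed

end

lemma bij_betw_permutes_lists:
 "bij_betw (\<lambda>\<pi>. map \<pi> [1..<Suc k]) {\<pi>. \<pi> permutes {1..k}} (permutations_of_set {1..k})"
 unfolding bij_betw_def
proof
 let ?F = "\<lambda>\<pi>. map \<pi> [1..<Suc k]"
 show inj: "inj_on ?F {\<pi>. \<pi> permutes {1..k}}"
 proof (rule inj_onI)
  fix \<pi> \<pi>' assume *: "\<pi> \<in> {\<pi>. \<pi> permutes {1..k}}" "\<pi>' \<in> {\<pi>. \<pi> permutes {1..k}}" "?F \<pi> = ?F \<pi>'"
  show "\<pi> = \<pi>'"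
  proof
   fix j show "\<pi> j = \<pi>' j"
   proof (cases "j \<in> {1..k}")
    case True
    then have "j \<in> set [1..<Suc k]" by (simp del: upt_Suc)
    then show ?thesis using *(3) by (metis map_eq_conv)
   qed (use * in \<open>simp add: permutes_not_in\<close>)
  qed
 qed
 have "?F ` {\<pi>. \<pi> permutes {1..k}} \<subseteq> permutations_of_set {1..k}"
 proof
  fix xs assume "xs \<in> ?F ` {\<pi>. \<pi> permutes {1..k}}"
  then obtain \<pi> where \<pi>: "\<pi> permutes {1..k}" "xs = ?F \<pi>" by blast
  have s: "set [1..<Suc k] = {1..k}" by (simp add: atLeastLessThanSuc_atLeastAtMost del: upt_Suc)
  have "set xs = {1..k}" unfolding \<pi>(2) set_map s by (rule permutes_image[OF \<pi>(1)])
  moreover have "distinct xs"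
   unfolding \<pi>(2) distinct_map by (simp add: permutes_inj_on[OF \<pi>(1)] del: upt_Suc)
  ultimately show "xs \<in> permutations_of_set {1..k}" by (simp add: permutations_of_set_def)
 qed
 then show "?F ` {\<pi>. \<pi> permutes {1..k}} = permutations_of_set {1..k}"
 proof (rule card_subset_eq[rotated])
  have "card {\<pi>. \<pi> permutes {1..k}} = fact k" by (rule card_permutations) simp_all
  then show "card (?F ` {\<pi>. \<pi> permutes {1..k}}) = card (permutations_of_set {1..k})"
   unfolding card_image[OF inj] by simp
 qed simp
qed



theorem theorem2p9:
  fixes m :: "'s::{metric_space, second_countable_topology} measure"
    and \<E> :: "('s \<Rightarrow> real) \<Rightarrow> ('s \<Rightarrow> real) \<Rightarrow> real"
    and \<F> :: "('s \<Rightarrow> real) set"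
    and X :: "('w, 's) process"
    and p :: "ennreal \<Rightarrow> 's \<Rightarrow> 's \<Rightarrow> ennreal"
    and k :: nat
    and A :: "nat \<Rightarrow> ennreal \<Rightarrow> 'w \<Rightarrow> ennreal"
    and \<mu> :: "nat \<Rightarrow> 's measure"
    and t :: ennreal
    and x :: 's
    and f :: "'s option \<Rightarrow> ennreal"
  assumes "locally_compact_space (euclidean :: 's topology)"
    and "radon_full_support m"
    and "symmetric_dirichlet_form m \<E> \<F>"
    and "regular_form m \<E> \<F>"
    and "hunt_process X"
    and "symmetric_process m X"
    and "dirichlet_form_of m X \<E> \<F>"
    and "absolute_continuity m X"
    and "transition_density m X p"
    and "k \<ge> 1"
    and "\<And>i. i \<in> {1..k} \<Longrightarrow> PCAF_strict X (A i)"
    and "\<And>i. i \<in> {1..k} \<Longrightarrow> revuz_measure m X (A i) (\<mu> i)"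
    and "t > 0"
    and "f \<in> borel_measurable borel_cpt"
  shows "(\<integral>\<^sup>+\<omega>. f (State X t \<omega>) * (\<Prod>i\<in>{1..k}. extend_to_infinity (A i) t \<omega>) \<partial>law_at X (Some x)) =
    (\<Sum>\<pi> | \<pi> permutes {1..k}.
      time_integral k 0 t (\<lambda>ts.
        space_integral (map (\<lambda>i. \<mu> (\<pi> i)) [1..<Suc k]) (\<lambda>ys.
          \<integral>\<^sup>+z. path_density (extended_density m p) (0 # ts) (x # ys) t z * f z
            \<partial>extended_measure m)))"
proof -
 have t: "0 < t" by fact
 interpret pcaf_family X m p A \<mu> f "{1..k}"
  by unfold_locales (use assms in auto)
 have fS: "(\<lambda>V. f (State X t V)) \<in> BM Fu"
  using measurable_compose[OF State_Fil[OF top_greatest] assms(14)] by simp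
 have "(\<lambda>V. aa i V t) \<in> BM Fu" if "i \<in> {1..k}" for i
  by (rule aa_props(3)[OF that]) simp_all
 then have "(\<lambda>V. f (State X t V) * (\<Prod>i\<in>{1..k}. aa i V t)) \<in> BM Fu"
  by (intro borel_measurable_times_ennreal borel_measurable_prod_ennreal fS)
 from nn_integral_Pu[OF this]
 have "(LI V. f (State X t V) * (\<Prod>i\<in>{1..k}. aa i V t) wrt law_at X (Some x)) = \<Phi> {1..k} t (Some x)"
  by (simp add: \<Phi>_def)
 also have "... = (\<Sum>L\<in>permutations_of_set {1..k}. J L t x)" by (rule moment_formula) simp_all
 also have "... = (\<Sum>\<pi> | \<pi> permutes {1..k}. J (map \<pi> [1..<Suc k]) t x)"
  by (rule sum.reindex_bij_betw[OF bij_betw_permutes_lists, symmetric])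
 also have "... = (\<Sum>\<pi> | \<pi> permutes {1..k}.
   time_integral k 0 t (\<lambda>ts.
    space_integral (map (\<lambda>i. \<mu> (\<pi> i)) [1..<Suc k]) (\<lambda>ys.
     LI z. path_density q (0 # ts) (x # ys) t z * f z
      wrt extended_measure m)))"
 proof (rule sum.cong[OF refl])
  fix \<pi> assume "\<pi> \<in> {\<pi>. \<pi> permutes {1..k}}"
  then have "set (map \<pi> [1..<Suc k]) \<subseteq> {1..k}"
   unfolding set_map set_upt atLeastLessThanSuc_atLeastAtMost by (simp add: permutes_image)
  note iter = J_eq_iterated[OF this t, of x]
  have len: "length (map \<pi> [1..<Suc k]) = k" by simp
  have comp: "map \<mu> (map \<pi> [1..<Suc k]) = map (\<lambda>i. \<mu> (\<pi> i)) [1..<Suc k]" by (simp add: comp_def del: upt_Suc)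
  show "J (map \<pi> [1..<Suc k]) t x = time_integral k 0 t (\<lambda>ts.
    space_integral (map (\<lambda>i. \<mu> (\<pi> i)) [1..<Suc k]) (\<lambda>ys.
     LI z. path_density q (0 # ts) (x # ys) t z * f z wrt extended_measure m))"
   by (rule iter[unfolded len comp, symmetric])
 qed
 finally show ?thesis .
qed

end
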